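(* Let $I=\mathbb{R}/\mathbb{Z}$ and $T>0$. Suppose that the system $$(\vec x\cdot\vec e_1)\,|\vec x_\rho|^2\,\vec x_t-\big((\vec x\cdot\vec e_1)\,\vec x_\rho\big)_\rho+|\vec x_\rho|^2\,\vec e_1=\vec 0\qquad\text{in } I\times(0,T]$$ has a solution $\vec x: I\times[0,T]\to\mathbb{R}_{\ge 0}\times\mathbb{R}$ satisfying $$\vec x\in C([0,T];[W^{2,\infty}(I)]^2),\quad \vec x_t\in L^2(0,T;[H^2(I)]^2),\quad \vec x_{tt}\in L^2(0,T;[L^2(I)]^2),$$ as well as $$|\vec x_\rho|>0,\qquad \vec x\cdot\vec e_1>0\qquad\text{in } I\times[0,T].$$ Then there exist $h_0,\gamma\in\mathbb{R}_{>0}$ and a constant $C>0$, all independent of $h$ and $\Delta t$, such that the following holds for all $h=\frac1J$ ($J\in\mathbb{N}$, $J\ge 3$) and $\Delta t=\frac TM$ ($M\in\mathbb{N}$, $M\geq 1$). If $0<h\le h_0$ and $\Delta t\le\gamma\sqrt h$, then the fully discrete scheme $(\mathcal P^{h,\Delta t})$ (defined in the context, with initial value $\vec X^0=\pi^h\vec x(0)$) has a unique solution $(\vec X^m)_{m=0,\ldots,M}$, and the following error bounds hold: $$\max_{m=0,\ldots,M}|\vec x^m-\vec X^m|_0^2+\Delta t\sum_{m=0}^{M-1}|\vec x_t^{m+1}-D_t\vec X^{m+1}|_0^2\le C\left(h^4+(\Delta t)^2\right),$$ $$\max_{m=0,\ldots,M}|\vec x^m-\vec X^m|_1^2\le C\left(h^2+(\Delta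 t)^2\right).$$
   Context: Here $I=\mathbb{R}/\mathbb{Z}$ (periodic case, $\partial I=\emptyset$), $\vec e_1,\vec e_2$ are the standard basis vectors of $\mathbb{R}^2$, and subscripts $\rho\in I$ and $t$ denote partial derivatives. $(\cdot,\cdot)$ denotes the $L^2$-inner product on $I$: $(f,g)=\int_I fg\,d\rho$ for scalar functions and $(\vec f,\vec g)=\int_I\vec f\cdot\vec g\,d\rho$ for vector functions. $|\cdot|_0$ is the $L^2(I)$-norm and $|\cdot|_1$ is the $H^1(I)$-seminorm, i.e. $|\vec f|_1=|\vec f_\rho|_0$ (also for vector functions). Mesh and finite element space: for an integer $J\ge3$ let $h=\frac1J$, $q_j=jh$ ($j=0,\ldots,J$), $I_j=[q_{j-1},q_j]$, with $q_0=0$ and $q_J=1$ identified. Let $V^h=\{\chi\in C(I):\chi|_{I_j}\text{ is affine},\ j=1,\ldots,J\}$ and $\underline V^h=[V^h]^2$. $\pi^h:C(I)\to V^h$ is the standard nodal interpolation operator at the nodes $q_j$, applied componentwise to vector functions. Time discretization: $\Delta t=\frac TM$, $t_m=m\Delta t$ for $m=0,\ldots,M$; $f^m=f(t_m)$ for a function $f$ continuous in time with values in a Banach space (so $\vec x^m=\vec x(t_m)$ and $\vec x_t^{m+1}=\vec x_t(t_{m+1})$); for sequences, $D_t g^{m+1}=\frac{g^{m+1}-g^m}{\Delta t}$. Scheme $(\mathcal P^{h,\Delta t})$: Let $\vec X^0=\pi^h\vec x(0)\in\underline V^h$. For $m=0,\ldots,M-1$, find $\vec X^{m+1}\in\underline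 V^h$ such that $$\left((\vec X^m\cdot\vec e_1)\,D_t\vec X^{m+1},\vec\eta\,|\vec X^m_\rho|^2\right)+\left((\vec X^m\cdot\vec e_1)\,\vec X^{m+1}_\rho,\vec\eta_\rho\right)+\left(\vec\eta\cdot\vec e_1,|\vec X^m_\rho|^2\right)=0\qquad\forall\ \vec\eta\in\underline V^h.$$ *)

theory Defs
  imports "HOL-Analysis.Analysis" "HOL-Probability.Essential_Supremum"
begin

text \<open>
  Functions on \<open>I = \<real>/\<int>\<close> are represented by 1-periodic functions on the real line, and
  integrals over \<open>I\<close> by integrals over the period \<open>{0..1}\<close>. A function of space and time is
  written \<open>u t \<rho>\<close>, so that \<open>u t\<close> is a function on \<open>I\<close>. Elements of \<open>L\<^sup>p\<close> and Sobolev spaces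
  are represented by arbitrary (Lebesgue measurable) representatives. The function spaces are
  defined for values in a Euclidean space, which covers both scalar functions and the
  componentwise spaces \<open>[\<dots>]\<^sup>2\<close> (values in \<open>real^2\<close>).
\<close>

definition periodic :: "(real \<Rightarrow> 'a) \<Rightarrow> bool" where
  "periodic f \<longleftrightarrow> (\<forall>\<rho>. f (\<rho> + 1) = f \<rho>)"

abbreviation I_measure :: "real measure" where
  "I_measure \<equiv> lebesgue_on {0..1}"

abbreviation time_measure :: "real \<Rightarrow> real measure" where
  "time_measure T \<equiv> lebesgue_on {0<..<T}"

definition smooth :: "(real \<Rightarrow> real) \<Rightarrow> bool" where
  "smooth \<phi> \<longleftrightarrow> (\<forall>n s. (deriv ^^ n) \<phi> field_differentiable at s)"


subsection \<open>Lebesgue and Sobolev spaces on the circle\<close>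

definition L2_space :: "(real \<Rightarrow> 'a::euclidean_space) set" where
  "L2_space = {f. periodic f \<and> f \<in> borel_measurable I_measure \<and>
                  integrable I_measure (\<lambda>\<rho>. (norm (f \<rho>))\<^sup>2)}"

definition l2_inner :: "(real \<Rightarrow> 'a::euclidean_space) \<Rightarrow> (real \<Rightarrow> 'a) \<Rightarrow> real" where
  "l2_inner f g = (\<integral>\<rho>. f \<rho> \<bullet> g \<rho> \<partial>I_measure)"

definition l2_norm :: "(real \<Rightarrow> 'a::euclidean_space) \<Rightarrow> real" where
  "l2_norm f = sqrt (l2_inner f f)"

definition Linf_space :: "(real \<Rightarrow> 'a::euclidean_space) set" where
  "Linf_space = {f. periodic f \<and> f \<in> borel_measurable I_measure \<and>
                    esssup I_measure (\<lambda>\<rho>. ennreal (norm (f \<rho>))) < \<infinity>}"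

definition linf_norm :: "(real \<Rightarrow> 'a::euclidean_space) \<Rightarrow> real" where
  "linf_norm f = enn2real (esssup I_measure (\<lambda>\<rho>. ennreal (norm (f \<rho>))))"

definition has_weak_deriv ::
    "(real \<Rightarrow> 'a::euclidean_space) \<Rightarrow> (real \<Rightarrow> 'a) \<Rightarrow> bool" where
  "has_weak_deriv f g \<longleftrightarrow>
     periodic f \<and> periodic g \<and> integrable I_measure f \<and> integrable I_measure g \<and>
     (\<forall>\<phi>. smooth \<phi> \<and> periodic \<phi> \<longrightarrow>
        (\<integral>\<rho>. deriv \<phi> \<rho> *\<^sub>R f \<rho> \<partial>I_measure) = - (\<integral>\<rho>. \<phi> \<rho> *\<^sub>R g \<rho> \<partial>I_measure))"

text \<open>Weak derivatives are unique up to null sets; \<open>weak_deriv\<close> picks a representative and is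
  only used where the choice is immaterial (under integrals, essential suprema, or for almost
  every \<open>\<rho>\<close>).\<close>

definition weak_deriv :: "(real \<Rightarrow> 'a::euclidean_space) \<Rightarrow> real \<Rightarrow> 'a" where
  "weak_deriv f = (SOME g. has_weak_deriv f g)"

definition second_order_space ::
    "(real \<Rightarrow> 'a::euclidean_space) set \<Rightarrow> (real \<Rightarrow> 'a) set" where
  "second_order_space P =
     {f \<in> P. \<exists>g\<in>P. has_weak_deriv f g \<and> (\<exists>k\<in>P. has_weak_deriv g k)}"

definition H2_space :: "(real \<Rightarrow> 'a::euclidean_space) set" where
  "H2_space = second_order_space L2_space"

definition W2inf_space :: "(real \<Rightarrow> 'a::euclidean_space) set" where
  "W2inf_space = second_order_space Linf_space"

definition h2_norm :: "(real \<Rightarrow> 'a::euclidean_space) \<Rightarrow> real" where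
  "h2_norm f = sqrt ((l2_norm f)\<^sup>2 + (l2_norm (weak_deriv f))\<^sup>2
                     + (l2_norm (weak_deriv (weak_deriv f)))\<^sup>2)"

definition w2inf_norm :: "(real \<Rightarrow> 'a::euclidean_space) \<Rightarrow> real" where
  "w2inf_norm f = linf_norm f + linf_norm (weak_deriv f)
                  + linf_norm (weak_deriv (weak_deriv f))"

definition h1_seminorm :: "(real \<Rightarrow> 'a::euclidean_space) \<Rightarrow> real" where
  "h1_seminorm f = l2_norm (weak_deriv f)"


subsection \<open>Spaces of functions of time with values in a function space\<close>

text \<open>\<open>C_time T V N\<close> and \<open>L2_time T V N\<close> are the spaces \<open>C([0,T];V)\<close> and \<open>L\<^sup>2(0,T;V)\<close> for a
  space \<open>V\<close> of functions on \<open>I\<close> with norm \<open>N\<close>. Membership in \<open>L2_time\<close> is Bochner's definition: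
  strong measurability (almost everywhere limit of simple \<open>V\<close>-valued functions) and square
  integrability of the norm.\<close>

definition C_time ::
    "real \<Rightarrow> (real \<Rightarrow> 'a::euclidean_space) set \<Rightarrow> ((real \<Rightarrow> 'a) \<Rightarrow> real)
     \<Rightarrow> (real \<Rightarrow> real \<Rightarrow> 'a) set" where
  "C_time T V N =
     {u. \<forall>s\<in>{0..T}. u s \<in> V \<and>
           ((\<lambda>t. N (\<lambda>\<rho>. u t \<rho> - u s \<rho>)) \<longlongrightarrow> 0) (at s within {0..T})}"

definition strongly_measurable_time ::
    "real \<Rightarrow> (real \<Rightarrow> 'a::euclidean_space) set \<Rightarrow> ((real \<Rightarrow> 'a) \<Rightarrow> real)
     \<Rightarrow> (real \<Rightarrow> real \<Rightarrow> 'a) \<Rightarrow> bool" where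
  "strongly_measurable_time T V N u \<longleftrightarrow>
     (AE t in time_measure T. u t \<in> V) \<and>
     (\<exists>S. (\<forall>n. simple_function (time_measure T) (S n) \<and> (\<forall>t\<in>{0<..<T}. S n t \<in> V)) \<and>
          (AE t in time_measure T. (\<lambda>n. N (\<lambda>\<rho>. S n t \<rho> - u t \<rho>)) \<longlonglongrightarrow> 0))"

definition L2_time ::
    "real \<Rightarrow> (real \<Rightarrow> 'a::euclidean_space) set \<Rightarrow> ((real \<Rightarrow> 'a) \<Rightarrow> real)
     \<Rightarrow> (real \<Rightarrow> real \<Rightarrow> 'a) set" where
  "L2_time T V N =
     {u. strongly_measurable_time T V N u \<and>
         (\<integral>\<^sup>+ t. ennreal ((N (u t))\<^sup>2) \<partial>time_measure T) < \<infinity>}"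

text \<open>Weak time derivative: \<open>\<integral> \<phi>' u dt = - \<integral> \<phi> v dt\<close> for all \<open>\<phi>\<close> in \<open>C\<^sub>c\<^sup>\<infinity>(0,T)\<close>, an identity of
  Bochner integrals in \<open>L\<^sup>2(I)\<close>, which is expressed by pairing both sides with the elements \<open>\<psi>\<close>
  of \<open>L\<^sup>2(I)\<close> (the pairing commutes with the Bochner integral).\<close>

definition has_weak_time_deriv ::
    "real \<Rightarrow> (real \<Rightarrow> real \<Rightarrow> 'a::euclidean_space) \<Rightarrow> (real \<Rightarrow> real \<Rightarrow> 'a) \<Rightarrow> bool" where
  "has_weak_time_deriv T u v \<longleftrightarrow>
     (\<forall>\<phi>. smooth \<phi> \<and> (\<exists>a b. 0 < a \<and> b < T \<and> (\<forall>t. t \<notin> {a..b} \<longrightarrow> \<phi> t = 0)) \<longrightarrow>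
        (\<forall>\<psi>\<in>L2_space.
           (\<integral>t. deriv \<phi> t * l2_inner (u t) \<psi> \<partial>time_measure T) =
           - (\<integral>t. \<phi> t * l2_inner (v t) \<psi> \<partial>time_measure T)))"


subsection \<open>Finite elements and the fully discrete scheme\<close>

abbreviation e1 :: "real^2" where
  "e1 \<equiv> axis 1 1"

text \<open>The pointwise derivative in \<open>\<rho>\<close>. It is applied to continuously differentiable functions
  and to piecewise affine ones; for the latter its (unspecified) value at the finitely many mesh
  nodes does not affect any integral.\<close>

abbreviation d_rho :: "(real \<Rightarrow> 'a::real_normed_vector) \<Rightarrow> real \<Rightarrow> 'a" where
  "d_rho f \<rho> \<equiv> vector_derivative f (at \<rho>)"

definition node :: "nat \<Rightarrow> nat \<Rightarrow> real" where
  "node J j = real j / real J"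

definition Vh :: "nat \<Rightarrow> (real \<Rightarrow> real) set" where
  "Vh J = {\<xi>. periodic \<xi> \<and> continuous_on UNIV \<xi> \<and>
              (\<forall>j\<in>{1..J}. \<exists>a b. \<forall>\<rho>\<in>{node J (j - 1)..node J j}. \<xi> \<rho> = a + b * \<rho>)}"

definition Vh_vec :: "nat \<Rightarrow> (real \<Rightarrow> real^2) set" where
  "Vh_vec J = {\<xi>. \<forall>i. (\<lambda>\<rho>. \<xi> \<rho> $ i) \<in> Vh J}"

definition interp :: "nat \<Rightarrow> (real \<Rightarrow> real) \<Rightarrow> real \<Rightarrow> real" where
  "interp J f = (THE \<xi>. \<xi> \<in> Vh J \<and> (\<forall>j\<le>J. \<xi> (node J j) = f (node J j)))"

definition interp_vec :: "nat \<Rightarrow> (real \<Rightarrow> real^2) \<Rightarrow> real \<Rightarrow> real^2" where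
  "interp_vec J f \<rho> = (\<chi> i. interp J (\<lambda>\<sigma>. f \<sigma> $ i) \<rho>)"

definition D_t :: "real \<Rightarrow> (nat \<Rightarrow> real \<Rightarrow> real^2) \<Rightarrow> nat \<Rightarrow> real \<Rightarrow> real^2" where
  "D_t dt X m \<rho> = (X m \<rho> - X (m - 1) \<rho>) /\<^sub>R dt"

text \<open>\<open>X 0, \<dots>, X M\<close> solve the scheme with \<open>J\<close> elements, \<open>M\<close> time steps, final time \<open>T\<close> and
  initial datum \<open>x0\<close>; the values \<open>X m\<close> for \<open>m > M\<close> are irrelevant.\<close>

definition scheme_solution ::
    "nat \<Rightarrow> nat \<Rightarrow> real \<Rightarrow> (real \<Rightarrow> real^2) \<Rightarrow> (nat \<Rightarrow> real \<Rightarrow> real^2) \<Rightarrow> bool" where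
  "scheme_solution J M T x0 X \<longleftrightarrow>
     X 0 = interp_vec J x0 \<and>
     (\<forall>m\<le>M. X m \<in> Vh_vec J) \<and>
     (\<forall>m<M. \<forall>\<eta>\<in>Vh_vec J.
        l2_inner (\<lambda>\<rho>. (X m \<rho> \<bullet> e1) *\<^sub>R D_t (T / real M) X (m + 1) \<rho>)
                 (\<lambda>\<rho>. (norm (d_rho (X m) \<rho>))\<^sup>2 *\<^sub>R \<eta> \<rho>)
        + l2_inner (\<lambda>\<rho>. (X m \<rho> \<bullet> e1) *\<^sub>R d_rho (X (m + 1)) \<rho>) (d_rho \<eta>)
        + l2_inner (\<lambda>\<rho>. \<eta> \<rho> \<bullet> e1) (\<lambda>\<rho>. (norm (d_rho (X m) \<rho>))\<^sup>2) = 0)"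

end

theory Submission
  imports Defs
begin

text \<open>
  The nodal interpolant \<open>Y\<close> of \<open>x\<close> satisfies the scheme up to a consistency error that consists of
  an \<open>L\<^sup>2\<close> part of order \<open>h\<^sup>2 + \<Delta>t\<close> and of a flux \<open>g\<^sub>j = O(h\<^sup>2)\<close> paired with the increments
  of the test function over the elements. The error equation is tested with the difference quotient in
  time of the nodal error \<open>E = Y - U\<close>. The mass term then controls this difference quotient, the
  stiffness term controls \<open>E\<close> in \<open>H\<^sup>1\<close>, and the flux is summed by parts in time: only the time
  increments of \<open>g\<close>, which are again of order \<open>h\<^sup>2\<close>, meet the slopes of \<open>E\<close>. A discrete Gronwall
  argument gives \<open>|E|\<^sub>1\<^sup>2 \<le> C (h\<^sup>4 + \<Delta>t\<^sup>2)\<close>. The coefficients of the scheme depend on the discrete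
  solution; by the inverse inequality they stay close to those of \<open>Y\<close> as long as \<open>(h\<^sup>4 + \<Delta>t\<^sup>2) / h\<close> is
  small, which is where \<open>\<Delta>t \<le> \<gamma> \<surd>h\<close> enters, and then each time step is a coercive linear system.
  The regularity of \<open>x\<close> is only used through increments in space and time, which are obtained
  from the weak derivatives by testing with smooth plateaus.
\<close>

text \<open>The squared slopes of the interpolant and of \<open>x\<close> differ on each element by
  a term of first order. That term is linear in the derivative of the interpolation error, which
  vanishes at the nodes, so integrating by parts on the element gains a power of h. The part in
  which the derivative falls on the test function is the flux. As the test function is a difference
  quotient in time, nothing controls its slope, hence the summation by parts in time. The increments
  of the flux see \<open>x_t\<close> and \<open>x_tt\<close> only through integrals over single time
  steps; the squares of these sum to \<open>dt\<close> times a space-time norm, which pays for one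
  division by \<open>dt\<close>. A second obstacle is that the weight of the stiffness term is the
  discrete solution itself. Its change over a step contains the difference quotient of the error,
  which has no pointwise bound; estimating one slope of the error by 1 leaves a quadratic term,
  absorbed by a quarter of the mass term that is held in reserve. Finally, the pointwise Lipschitz
  bound of \<open>x\<close> in time rests on a bound for \<open>x_t\<close> that the equation itself
  provides.\<close>

lemmas HK_integral_add = Henstock_Kurzweil_Integration.integral_add
lemmas HK_integral_cmul = Henstock_Kurzweil_Integration.integral_cmul
lemmas HK_integral_combine = Henstock_Kurzweil_Integration.integral_combine
lemmas HK_integral_diff = Henstock_Kurzweil_Integration.integral_diff
lemmas HK_integral_mult_left = Henstock_Kurzweil_Integration.integral_mult_left
lemmas HK_integral_mult_right = Henstock_Kurzweil_Integration.integral_mult_right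
lemmas HK_integral_restrict_Int = Henstock_Kurzweil_Integration.integral_restrict_Int

subsection \<open>Smooth steps\<close>

text \<open>\<open>smooth\<close> is phrased with iterated \<open>deriv\<close>, so smoothness is
  best obtained by exhibiting a whole family in which each member has the next one as
  derivative.\<close>

lemma higher_deriv_family:
  fixes F :: "nat \<Rightarrow> real \<Rightarrow> real"
  assumes "\<And>n s. (F n has_real_derivative F (Suc n) s) (at s)"
  shows "(deriv ^^ n) (F 0) = F n"
proof (induction n)
  case (Suc n)
  have "deriv (F n) = F (Suc n)"
    using assms DERIV_imp_deriv by blast
  then show ?case
    using Suc by simp
qed simp

lemma smooth_family:
  assumes "\<And>n s. (F n has_real_derivative F (Suc n) s) (at s)"
  shows "smooth (F 0)"
  unfolding smooth_def higher_deriv_family[of F, OF assms]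
  using assms field_differentiable_def by blast

text \<open>The derivatives of exp(-1/(x(1-x))), extended by zero outside (0,1), all have this form:
  differentiation only changes the polynomial and the order of the pole.\<close>

definition bump_term :: "real poly \<Rightarrow> nat \<Rightarrow> real \<Rightarrow> real" where
  "bump_term p k x = (if 0 < x \<and> x < 1
     then poly p x / (x * (1 - x)) ^ k * exp (- inverse (x * (1 - x))) else 0)"

text \<open>One term of the exponential series at 1/q, the one of order k + 2, outweighs a pole of
  order k and leaves two powers of q for the decay.\<close>

lemma exp_neg_inverse_bound:
  fixes q :: real
  assumes "0 < q"
  shows "exp (- inverse q) / q ^ k \<le> fact (k + 2) * q^2"
proof -
  have "(inverse q) ^ (k + 2) / fact (k + 2) \<le> exp (inverse q)"
  proof -
    have "(\<Sum>n\<in>{k+2}. inverse q ^ n /\<^sub>R fact n) \<le> exp (inverse q)"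
      unfolding exp_def
      by (rule sum_le_suminf[OF summable_exp_generic]) (use assms in auto)
    then show ?thesis by (simp add: divide_inverse mult.commute)
  qed
  then have "(inverse q) ^ (k + 2) \<le> fact (k + 2) * exp (inverse q)"
    by (simp only: pos_divide_le_eq fact_gt_zero mult.commute)
  then have "exp (- inverse q) * (inverse q) ^ (k + 2)
      \<le> exp (- inverse q) * (fact (k + 2) * exp (inverse q))"
    by (rule mult_left_mono) simp
  then have "exp (- inverse q) * (inverse q) ^ (k + 2) \<le> fact (k + 2)"
    by (simp only: exp_minus) (simp only: mult.assoc mult.left_commute[of "inverse (exp _)"]
      left_inverse exp_not_eq_zero not_False_eq_True mult_1_right)
  then have "(exp (- inverse q) * (inverse q) ^ (k + 2)) * q^2 \<le> fact (k + 2) * q^2"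
    using assms by (intro mult_right_mono) auto
  moreover have "(exp (- inverse q) * (inverse q) ^ (k + 2)) * q^2 = exp (- inverse q) / q ^ k"
    using assms by (simp add: field_simps power_add power2_eq_square)
  ultimately show ?thesis by linarith
qed

lemma DERIV_zero_if_quadratic:
  fixes f :: "real \<Rightarrow> real"
  assumes "f a = 0" "\<And>x. \<bar>f x\<bar> \<le> C * (x - a)^2"
  shows "(f has_real_derivative 0) (at a)"
proof -
  have "((\<lambda>x. (f x - f a) / (x - a)) \<longlongrightarrow> 0) (at a)"
  proof (rule Lim_null_comparison[where g = "\<lambda>x. \<bar>C\<bar> * \<bar>x - a\<bar>"])
    show "\<forall>\<^sub>F x in at a. norm ((f x - f a) / (x - a)) \<le> \<bar>C\<bar> * \<bar>x - a\<bar>"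
    proof (rule eventually_at_filter[THEN iffD2], intro always_eventually allI impI)
      fix x assume "x \<noteq> a"
      have "\<bar>f x\<bar> \<le> \<bar>C\<bar> * \<bar>x - a\<bar> * \<bar>x - a\<bar>"
        using assms(2)[of x] mult_right_mono[OF abs_ge_self[of C], of "(x-a)^2"]
        by (simp add: power2_eq_square abs_mult_self_eq mult.assoc)
      then show "norm ((f x - f a) / (x - a)) \<le> \<bar>C\<bar> * \<bar>x - a\<bar>"
        using \<open>x \<noteq> a\<close> assms(1) by (simp add: divide_simps)
    qed
    show "((\<lambda>x. \<bar>C\<bar> * \<bar>x - a\<bar>) \<longlongrightarrow> 0) (at a)"
      by (auto intro!: tendsto_eq_intros)
  qed
  then show ?thesis
    by (simp add: has_field_derivative_iff)
qed

text \<open>Quadratic decay at 0 and at 1 is what makes the extension by zero differentiable there,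
  with derivative zero.\<close>

lemma bump_term_bound: "\<exists>C. \<forall>x. \<bar>bump_term p k x\<bar> \<le> C * x^2 \<and> \<bar>bump_term p k x\<bar> \<le> C * (x - 1)^2"
proof -
  have "bounded (poly p ` {0..1})"
    by (intro compact_imp_bounded compact_continuous_image continuous_intros) auto
  then obtain B where B: "\<And>x. 0 \<le> x \<Longrightarrow> x \<le> 1 \<Longrightarrow> \<bar>poly p x\<bar> \<le> B"
    by (auto simp: bounded_iff) (meson atLeastAtMost_iff)
  define C where "C = B * fact (k + 2)"
  have "B \<ge> 0" using B[of 0] by auto
  then have C0: "C \<ge> 0" by (auto simp: C_def)
  have b: "\<bar>bump_term p k x\<bar> \<le> C * (x * (1 - x))^2" for x
  proof (cases "0 < x \<and> x < 1")
    case True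
    then have q: "0 < x * (1 - x)" by simp
    have "\<bar>bump_term p k x\<bar>
        = \<bar>poly p x\<bar> * (exp (- inverse (x * (1 - x))) / (x * (1 - x)) ^ k)"
      using True q by (simp add: bump_term_def abs_mult)
    also have "\<dots> \<le> B * (fact (k + 2) * (x * (1 - x))^2)"
      using True exp_neg_inverse_bound[OF q, of k] q B[of x] by (intro mult_mono) auto
    finally show ?thesis by (simp add: C_def mult.assoc)
  next
    case False
    then have "bump_term p k x = 0" by (simp only: bump_term_def if_False)
    then show ?thesis using C0 by simp
  qed
  have z: "bump_term p k x = 0" if "\<not> (0 < x \<and> x < 1)" for x
    using that by (simp only: bump_term_def if_False)
  have sq: "(x * (1 - x))^2 \<le> x^2" "(x * (1 - x))^2 \<le> (x - 1)^2" if "0 < x" "x < 1" for x :: real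
    using that power_mono[of "x * (1 - x)" x 2] power_mono[of "x * (1 - x)" "1 - x" 2]
    by (auto simp: power2_commute[of x 1] mult_left_le mult_left_le_one_le)
  have "\<bar>bump_term p k x\<bar> \<le> C * x^2 \<and> \<bar>bump_term p k x\<bar> \<le> C * (x - 1)^2" for x
  proof (cases "0 < x \<and> x < 1")
    case True
    then show ?thesis
      using b[of x] mult_left_mono[OF sq(1)[of x] C0] mult_left_mono[OF sq(2)[of x] C0] by auto
  next
    case False
    then show ?thesis using z[of x] C0 by simp
  qed
  then show ?thesis by blast
qed

text \<open>The new polynomial collects the derivatives of p, of the pole and of the exponential
  over the common denominator of order k + 2. At 0 and 1 the quadratic decay replaces the
  computation.\<close>

lemma DERIV_bump_term:
  defines "q \<equiv> [:0, 1, -1:] :: real poly"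
  shows "(bump_term p k has_real_derivative
    bump_term (pderiv p * q^2 - of_nat k * p * pderiv q * q + p * pderiv q) (k + 2) x) (at x)"
    (is "(_ has_real_derivative bump_term ?p _ _) _")
proof -
  obtain C where C: "\<And>x. \<bar>bump_term p k x\<bar> \<le> C * (x - 0)^2"
    "\<And>x. \<bar>bump_term p k x\<bar> \<le> C * (x - 1)^2"
    using bump_term_bound[of p k] by auto
  consider "x < 0" | "x = 0" | "0 < x" "x < 1" | "x = 1" | "1 < x" by linarith
  then show ?thesis
  proof cases
    case 1
    have "((\<lambda>_. 0) has_real_derivative 0) (at x)" by simp
    moreover have "bump_term ?p (k+2) x = 0" using 1 by (simp add: bump_term_def)
    ultimately show ?thesis
      by (auto intro: has_field_derivative_transform_within_open[of "\<lambda>_. 0" _ _ "{..<0}"]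
          simp: 1 bump_term_def)
  next
    case 2
    then show ?thesis
      using DERIV_zero_if_quadratic[of "bump_term p k" 0, OF _ C(1)]
      by (simp add: bump_term_def)
  next
    case 3
    define Q where "Q y = y * (1 - y)" for y :: real
    have Qq: "poly q y = Q y" for y by (simp add: q_def Q_def algebra_simps)
    have Qd: "(Q has_real_derivative poly (pderiv q) y) (at y)" for y
      using poly_DERIV[of q y] by (simp add: Qq[abs_def] fun_eq_iff[of "poly q"])
    have Q0: "Q x > 0" using 3 by (simp add: Q_def)
    have "((\<lambda>y. poly p y * inverse (Q y) ^ k * exp (- inverse (Q y))) has_real_derivative
       ((poly (pderiv p) x * inverse (Q x) ^ k
         + poly p x * (of_nat k * inverse (Q x) ^ (k - 1) * (- (inverse (Q x) * poly (pderiv q) x * inverse (Q x)))))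
        * exp (- inverse (Q x))
       + poly p x * inverse (Q x) ^ k * (exp (- inverse (Q x)) * (inverse (Q x) * poly (pderiv q) x * inverse (Q x))))) (at x)"
      using Q0 by (auto intro!: derivative_eq_intros Qd poly_DERIV)
    also have "((poly (pderiv p) x * inverse (Q x) ^ k
         + poly p x * (of_nat k * inverse (Q x) ^ (k - 1) * (- (inverse (Q x) * poly (pderiv q) x * inverse (Q x)))))
        * exp (- inverse (Q x))
       + poly p x * inverse (Q x) ^ k * (exp (- inverse (Q x)) * (inverse (Q x) * poly (pderiv q) x * inverse (Q x))))
      = poly ?p x / Q x ^ (k + 2) * exp (- inverse (Q x))"
      using Q0 by (cases k) (simp_all add: Qq field_simps power2_eq_square)
    also have "\<dots> = bump_term ?p (k+2) x"
      using 3 by (simp add: bump_term_def Q_def)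
    finally show ?thesis
      by (rule has_field_derivative_transform_within_open[where S = "{0<..<1}"])
        (use 3 in \<open>auto simp: bump_term_def Q_def divide_inverse power_inverse power_mult_distrib\<close>)
  next
    case 4
    then show ?thesis
      using DERIV_zero_if_quadratic[of "bump_term p k" 1, OF _ C(2)]
      by (simp add: bump_term_def)
  next
    case 5
    have "((\<lambda>_. 0) has_real_derivative 0) (at x)" by simp
    moreover have "bump_term ?p (k+2) x = 0" using 5 by (simp add: bump_term_def)
    ultimately show ?thesis
      by (auto intro: has_field_derivative_transform_within_open[of "\<lambda>_. 0" _ _ "{1<..}"]
          simp: 5 bump_term_def)
  qed
qed

text \<open>As f vanishes to the left of 0, the base point can be moved to \<open>-R\<close>, which
  makes x an interior point of the interval of integration. For negative x the interval
  \<open>{0..x}\<close> is empty, which agrees with this.\<close>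

lemma DERIV_integral_from_0:
  fixes f :: "real \<Rightarrow> real"
  assumes cont: "continuous_on UNIV f" and zero: "\<And>x. x \<le> 0 \<Longrightarrow> f x = 0"
  shows "((\<lambda>x. integral {0..x} f) has_real_derivative f x) (at x)"
proof -
  define R where "R = \<bar>x\<bar> + 1"
  have eq: "integral {-R..y} f = integral {0..y} f" if "y \<in> {-R<..<R}" for y
  proof (cases "y \<ge> 0")
    case True
    have "integral {-R..0} f + integral {0..y} f = integral {-R..y} f"
      using True cont by (intro HK_integral_combine
          integrable_continuous_real continuous_on_subset[OF cont]) (auto simp: R_def)
    moreover have "integral {-R..0} f = 0"
      using integral_cong[of "{-R..0}" f "\<lambda>_. 0"] zero by simp
    ultimately show ?thesis by simp
  next
    case False
    then have "integral {-R..y} f = 0"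
      using integral_cong[of "{-R..y}" f "\<lambda>_. 0"] zero by simp
    then show ?thesis using False by simp
  qed
  have "((\<lambda>x. integral {-R..x} f) has_real_derivative f x) (at x within {-R..R})"
    by (rule integral_has_real_derivative) (auto simp: R_def intro: continuous_on_subset[OF cont])
  then have "((\<lambda>x. integral {-R..x} f) has_real_derivative f x) (at x)"
    by (subst (asm) at_within_Icc_at) (auto simp: R_def)
  then show ?thesis
    by (rule has_field_derivative_transform_within_open[of _ _ _ "{-R<..<R}"])
      (use eq in \<open>auto simp: R_def\<close>)
qed

text \<open>The family \<open>F\<close> consists of a step from 0 to 1, its derivative (a bump) and all further derivatives.\<close>

lemma smooth_step_exists:
  "\<exists>F :: nat \<Rightarrow> real \<Rightarrow> real. (\<forall>n s. (F n has_real_derivative F (Suc n) s) (at s)) \<and>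
     (\<forall>s. 0 \<le> F 0 s \<and> F 0 s \<le> 1 \<and> 0 \<le> F (Suc 0) s) \<and>
     (\<forall>s\<le>0. \<forall>n. F n s = 0) \<and> (\<forall>s\<ge>1. F 0 s = 1)"
proof -
  define q where "q = ([:0, 1, -1:] :: real poly)"
  define st where "st = (\<lambda>(p, k). (pderiv p * q^2 - of_nat k * p * pderiv q * q + p * pderiv q, k + 2 :: nat))"
  define G where "G n = bump_term (fst ((st ^^ n) (1, 0))) (snd ((st ^^ n) (1, 0)))" for n
  have Gd: "(G n has_real_derivative G (Suc n) s) (at s)" for n s
    using DERIV_bump_term[of "fst ((st ^^ n) (1, 0))" "snd ((st ^^ n) (1, 0))" s]
    by (simp add: G_def st_def q_def split_beta)
  have G0: "G n s = 0" if "s \<le> 0" for n s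
    using that by (simp add: G_def bump_term_def)
  have G1: "G 0 s = 0" if "s \<ge> 1" for s
    using that by (simp add: G_def bump_term_def)
  have Gnn: "G 0 s \<ge> 0" for s
    by (simp add: G_def bump_term_def)
  have cont: "continuous_on UNIV (G 0)"
    using Gd DERIV_continuous_on by blast
  define c where "c = integral {0..1} (G 0)"
  have int: "G 0 integrable_on {a..b}" for a b
    by (intro integrable_continuous_real continuous_on_subset[OF cont]) auto
  have "c \<ge> 0" unfolding c_def by (intro integral_nonneg int Gnn)
  moreover have "c \<noteq> 0"
  proof
    assume "c = 0"
    then have "(G 0 has_integral 0) (cbox 0 1)"
      using integrable_integral[OF int[of 0 1]] by (simp add: c_def)
    then have "G 0 (1/2) = 0"
      by (rule has_integral_0_cbox_imp_0[rotated 2]) (use Gnn cont in \<open>auto intro: continuous_on_subset\<close>)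
    then show False by (simp add: G_def bump_term_def)
  qed
  ultimately have c: "c > 0" by simp
  define B where "B x = integral {0..x} (G 0) / c" for x
  have Bd: "(B has_real_derivative G 0 s / c) (at s)" for s
    unfolding B_def by (intro DERIV_cdivide DERIV_integral_from_0 cont G0)
  have B0: "B s = 0" if "s \<le> 0" for s
    using that by (cases "s = 0") (auto simp: B_def)
  have B1: "B s = 1" if "s \<ge> 1" for s
  proof -
    have "integral {0..1} (G 0) + integral {1..s} (G 0) = integral {0..s} (G 0)"
      using that by (intro HK_integral_combine int) auto
    moreover have "integral {1..s} (G 0) = 0"
      using integral_cong[of "{1..s}" "G 0" "\<lambda>_. 0"] G1 by simp
    ultimately show ?thesis using c by (simp add: B_def c_def)
  qed
  have mono: "B s \<le> B t" if "s \<le> t" for s t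
    by (rule DERIV_nonneg_imp_nondecreasing[OF that]) (use Bd Gnn c in \<open>auto intro!: exI\<close>)
  have B01: "0 \<le> B s \<and> B s \<le> 1" for s
    using mono[of "min s 0" s] mono[of s "max s 1"] B0[of "min s 0"] B1[of "max s 1"] by auto
  define F where "F n = (case n of 0 \<Rightarrow> B | Suc n \<Rightarrow> \<lambda>s. G n s / c)" for n
  have "(F n has_real_derivative F (Suc n) s) (at s)" for n s
    using Bd DERIV_cdivide[OF Gd] by (auto simp: F_def split: nat.split)
  moreover have "0 \<le> F 0 s \<and> F 0 s \<le> 1 \<and> 0 \<le> F (Suc 0) s" for s
    using B01 Gnn c by (simp add: F_def)
  moreover have "F n s = 0" if "s \<le> 0" for n s
    using that B0 G0 by (auto simp: F_def split: nat.split)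
  moreover have "F 0 s = 1" if "s \<ge> 1" for s
    using that B1 by (auto simp: F_def)
  ultimately show ?thesis by (intro exI[of _ F]) blast
qed

section \<open>Smooth functions, periodicity and periodization\<close>

lemma smooth_const: "smooth (\<lambda>_. c)"
  using smooth_family[of "\<lambda>n _. if n = 0 then c else 0"] by simp

lemma smooth_DERIV: "smooth \<phi> \<Longrightarrow> (((deriv ^^ n) \<phi>) has_real_derivative (deriv ^^ Suc n) \<phi> s) (at s)"
  unfolding smooth_def by (simp add: field_differentiable_derivI)

lemma smooth_continuous: "smooth \<phi> \<Longrightarrow> continuous_on A ((deriv ^^ n) \<phi>)"
  using smooth_DERIV by (meson DERIV_continuous_on has_field_derivative_at_within)

lemma smooth_deriv: "smooth \<phi> \<Longrightarrow> smooth (deriv \<phi>)"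
  unfolding smooth_def
proof (intro allI)
  fix n s
  assume "\<forall>n s. (deriv ^^ n) \<phi> field_differentiable at s"
  then have "(deriv ^^ Suc n) \<phi> field_differentiable at s" by blast
  then show "(deriv ^^ n) (deriv \<phi>) field_differentiable at s"
    by (simp only: funpow_Suc_right o_apply)
qed

lemmas smooth_DERIV0 = smooth_DERIV[where n = 0, simplified]
lemmas smooth_continuous0 = smooth_continuous[where n = 0, simplified]
lemmas smooth_continuous1 = smooth_continuous[where n = 1, simplified]
lemma smooth_continuous2: "smooth \<phi> \<Longrightarrow> continuous_on A (deriv (deriv \<phi>))"
  using smooth_continuous[of \<phi> A 2] by (simp add: numeral_2_eq_2)

lemma periodic_deriv:
  assumes "periodic \<phi>" "\<And>s. (\<phi> has_real_derivative \<phi>' s) (at s)"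
  shows "periodic \<phi>'"
  unfolding periodic_def
proof
  fix s
  have "(\<phi> has_real_derivative \<phi>' (s + 1)) (at (s + 1))" by (rule assms)
  then have "((\<lambda>x. \<phi> (x + 1)) has_real_derivative \<phi>' (s + 1)) (at s)"
    by (simp add: DERIV_shift)
  moreover have "(\<lambda>x. \<phi> (x + 1)) = \<phi>" using assms(1) by (auto simp: periodic_def)
  ultimately show "\<phi>' (s + 1) = \<phi>' s" using assms(2) DERIV_unique by metis
qed

lemma periodic_deriv_smooth: "smooth \<phi> \<Longrightarrow> periodic \<phi> \<Longrightarrow> periodic (deriv \<phi>)"
  using periodic_deriv smooth_DERIV0 by blast

lemma periodic_of_int:
  assumes "periodic f" shows "f (x + of_int k) = f x"
proof -
  have nat: "f (x + real n) = f x" for x n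
    using assms by (induction n) (auto simp: periodic_def add.assoc[symmetric] add.commute[of 1])
  show ?thesis
    using nat[of x "nat k"] nat[of "x + of_int k" "nat (- k)"] by (cases "k \<ge> 0") auto
qed

lemma periodic_frac: "periodic f \<Longrightarrow> f (frac x) = f x"
  using periodic_of_int[of f x "- \<lfloor>x\<rfloor>"] by (simp add: frac_def)

lemma integral_periodic:
  fixes f :: "real \<Rightarrow> 'a::euclidean_space"
  assumes cont: "continuous_on UNIV f" and per: "periodic f"
  shows "integral {c..c+1} f = integral {0..1} f"
proof -
  have int: "f integrable_on {a..b}" for a b
    by (intro integrable_continuous_real continuous_on_subset[OF cont]) auto
  define d where "d = frac c"
  have d: "0 \<le> d" "d \<le> 1" by (auto simp: d_def frac_lt_1 less_imp_le)
  have shift: "integral {a + of_int k..b + of_int k} f = integral {a..b} f" for a b k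
  proof -
    have "integral {a..b} (f \<circ> (\<lambda>x. x + of_int k)) = integral {a + of_int k..b + of_int k} f"
      by (rule integral_shift) (rule continuous_on_subset[OF cont], simp)
    then show ?thesis by (simp add: o_def periodic_of_int[OF per])
  qed
  have "integral {c..c+1} f = integral {d..d+1} f"
    using shift[of d "\<lfloor>c\<rfloor>" "d + 1"] by (simp add: d_def frac_def)
  also have "\<dots> = integral {d..1} f + integral {1..d+1} f"
    using d by (intro HK_integral_combine[symmetric] int) auto
  also have "integral {1..d+1} f = integral {0..d} f"
    using shift[of 0 1 d] by (simp add: add.commute)
  also have "integral {d..1} f + integral {0..d} f = integral {0..1} f"
    using HK_integral_combine[OF d(1) d(2) int] by (simp add: add.commute)
  finally show ?thesis .
qed

lemma I_integral_continuous:
  fixes f :: "real \<Rightarrow> 'a::euclidean_space"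
  assumes "continuous_on {a..b} f"
  shows "integrable (lebesgue_on {a..b}) f"
    "(\<integral>x. f x \<partial>(lebesgue_on {a..b})) = integral {a..b} f"
proof -
  show 1: "integrable (lebesgue_on {a..b}) f"
    using assms by (rule continuous_imp_integrable_real)
  show "(\<integral>x. f x \<partial>(lebesgue_on {a..b})) = integral {a..b} f"
    by (rule lebesgue_integral_eq_integral[OF 1]) simp
qed

text \<open>The derivatives vanish on the open complement by locality and at the end points by
  continuity; the latter allows translates to be glued at the seam of a period.\<close>

lemma smooth_zero_outside:
  assumes "smooth \<phi>" "\<And>r. r \<notin> {c..d} \<Longrightarrow> \<phi> r = 0" "r \<notin> {c<..<d}"
  shows "(deriv ^^ n) \<phi> r = 0"
proof -
  have out: "(deriv ^^ n) \<phi> r = 0" if "r \<in> - {c..d}" for r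
    using that
  proof (induction n arbitrary: r)
    case 0
    then show ?case using assms(2) by simp
  next
    case (Suc n)
    have "((deriv ^^ n) \<phi> has_real_derivative 0) (at r)"
      by (rule has_field_derivative_transform_within_open[of "\<lambda>_. 0" _ _ "- {c..d}"])
        (use Suc in auto)
    then show ?case
      using smooth_DERIV[OF assms(1)] DERIV_unique by blast
  qed
  have "closed {r. (deriv ^^ n) \<phi> r = 0}"
    using smooth_continuous[OF assms(1), of UNIV]
    by (intro closed_Collect_eq) auto
  then have "closure (- {c..d}) \<subseteq> {r. (deriv ^^ n) \<phi> r = 0}"
    using out by (intro closure_minimal) auto
  moreover have "r \<in> closure (- {c..d})"
    using assms(3) by (simp add: closure_complement)
  ultimately show ?thesis by blast
qed

lemma smooth_periodization:
  assumes sm: "smooth \<phi>" and zero: "\<And>r. r \<notin> {c..c+1} \<Longrightarrow> \<phi> r = 0"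
  shows "\<exists>\<psi>. smooth \<psi> \<and> periodic \<psi> \<and> (\<forall>n. \<forall>r\<in>{c..c+1}. (deriv ^^ n) \<psi> r = (deriv ^^ n) \<phi> r)"
proof -
  define P where "P n r = (deriv ^^ n) \<phi> (c + frac (r - c))" for n r
  have z: "(deriv ^^ n) \<phi> r = 0" if "r \<notin> {c<..<c+1}" for n r
    using smooth_zero_outside[OF sm zero that] by auto
  have "(P n has_real_derivative P (Suc n) r) (at r)" for n r
  proof -
    define k where "k = real_of_int \<lfloor>r - c\<rfloor>"
    have r: "r \<in> {c + k - 1<..<c + k + 1}" "r - k \<ge> c"
      by (auto simp: k_def) linarith+
    \<comment> \<open>On this window around r the periodization is a sum of two translates, of which
      at most one is nonzero. The formula is also valid across the seam \<open>c + k\<close>, so it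
      can be differentiated termwise there.\<close>
    have eq: "P n \<sigma> = (deriv ^^ n) \<phi> (\<sigma> - k) + (deriv ^^ n) \<phi> (\<sigma> - k + 1)"
      if "\<sigma> \<in> {c + k - 1<..<c + k + 1}" for \<sigma> n
    proof (cases "\<sigma> \<ge> c + k")
      case True
      then have "frac (\<sigma> - c) = \<sigma> - c - k"
        using that by (auto simp: frac_unique_iff k_def)
      then show ?thesis using z[of "\<sigma> - k + 1" n] True by (simp add: P_def)
    next
      case False
      then have "frac (\<sigma> - c) = \<sigma> - c - k + 1"
        using that by (auto simp: frac_unique_iff k_def)
      then have "c + frac (\<sigma> - c) = \<sigma> - k + 1" by simp
      then show ?thesis using z[of "\<sigma> - k" n] False unfolding P_def by simp
    qed
    have "((\<lambda>\<sigma>. (deriv ^^ n) \<phi> (\<sigma> - k) + (deriv ^^ n) \<phi> (\<sigma> - k + 1)) has_real_derivative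
        (deriv ^^ Suc n) \<phi> (r - k) + (deriv ^^ Suc n) \<phi> (r - k + 1)) (at r)"
    proof (rule DERIV_add)
      show "((\<lambda>\<sigma>. (deriv ^^ n) \<phi> (\<sigma> - k)) has_real_derivative (deriv ^^ Suc n) \<phi> (r - k)) (at r)"
        using smooth_DERIV[OF sm, of n "r + - k"] unfolding DERIV_shift by simp
      show "((\<lambda>\<sigma>. (deriv ^^ n) \<phi> (\<sigma> - k + 1)) has_real_derivative (deriv ^^ Suc n) \<phi> (r - k + 1)) (at r)"
        using smooth_DERIV[OF sm, of n "r + (1 - k)"] unfolding DERIV_shift by (simp add: algebra_simps)
    qed
    then have "(P n has_real_derivative (deriv ^^ Suc n) \<phi> (r - k) + (deriv ^^ Suc n) \<phi> (r - k + 1)) (at r)"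
    proof (rule has_field_derivative_transform_within_open[OF _ open_greaterThanLessThan r(1)])
      show "(deriv ^^ n) \<phi> (\<sigma> - k) + (deriv ^^ n) \<phi> (\<sigma> - k + 1) = P n \<sigma>"
        if "\<sigma> \<in> {c + k - 1<..<c + k + 1}" for \<sigma>
        by (rule eq[OF that, symmetric])
    qed
    then show ?thesis using eq[OF r(1), of "Suc n"] by simp
  qed
  note * = this
  have "periodic (P 0)"
    unfolding periodic_def P_def
  proof
    fix r
    have "frac (r + 1 - c) = frac (r - c)"
      using frac_1_eq[of "r - c"] by (simp only: diff_add_eq)
    then show "(deriv ^^ 0) \<phi> (c + frac (r + 1 - c)) = (deriv ^^ 0) \<phi> (c + frac (r - c))"
      by simp
  qed
  moreover have "(deriv ^^ n) (P 0) r = (deriv ^^ n) \<phi> r" if "r \<in> {c..c+1}" for n r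
  proof (cases "r = c + 1")
    case True
    then show ?thesis
      using z[of c n] z[of "c + 1" n] by (simp add: higher_deriv_family[of P, OF *] P_def)
  next
    case False
    then have "frac (r - c) = r - c" using that by (subst frac_eq) auto
    then show ?thesis by (simp add: higher_deriv_family[of P, OF *] P_def)
  qed
  ultimately show ?thesis
    using smooth_family[of P, OF *] by (intro exI[of _ "P 0"]) blast
qed

section \<open>Mollifiers and approximation of point values\<close>

definition step_family :: "nat \<Rightarrow> real \<Rightarrow> real" where
  "step_family = (SOME F. (\<forall>n s. (F n has_real_derivative F (Suc n) s) (at s)) \<and>
     (\<forall>s. 0 \<le> F 0 s \<and> F 0 s \<le> 1 \<and> 0 \<le> F (Suc 0) s) \<and>
     (\<forall>s\<le>0. \<forall>n. F n s = 0) \<and> (\<forall>s\<ge>1. F 0 s = 1))"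

lemma
  shows DERIV_step_family: "(step_family n has_real_derivative step_family (Suc n) s) (at s)"
    and step_nonneg: "0 \<le> step_family 0 s" and step_le_1: "step_family 0 s \<le> 1"
    and bump_nonneg: "0 \<le> step_family (Suc 0) s"
    and step_family_0: "s \<le> 0 \<Longrightarrow> step_family n s = 0"
    and step_1: "s \<ge> 1 \<Longrightarrow> step_family 0 s = 1"
  using someI_ex[OF smooth_step_exists] unfolding step_family_def[symmetric] by blast+

lemma step_family_scaled_DERIV:
  assumes "e \<noteq> 0"
  shows "((\<lambda>r. step_family n ((r - a) / e)) has_real_derivative step_family (Suc n) ((r - a) / e) / e) (at r)"
proof -
  have "((\<lambda>r. (r - a) / e) has_real_derivative 1 / e) (at r)"
    by (auto intro!: derivative_eq_intros simp: assms)
  from DERIV_chain'[OF this DERIV_step_family] show ?thesis by simp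
qed

text \<open>The bump rescaled to unit mass on [a, a + e]. The support lies on one side of a, so a
  kernel placed at an end of an interval can be kept inside the interval.\<close>

definition mollifier :: "real \<Rightarrow> real \<Rightarrow> real \<Rightarrow> real" where
  "mollifier e a r = step_family (Suc 0) ((r - a) / e) / e"

lemma mollifier_continuous: "e > 0 \<Longrightarrow> continuous_on A (mollifier e a)"
  unfolding mollifier_def
  by (rule DERIV_continuous_on) (rule DERIV_cdivide, rule has_field_derivative_at_within, rule step_family_scaled_DERIV, simp)

lemma bump_0: "s \<ge> 1 \<Longrightarrow> step_family (Suc 0) s = 0"
proof -
  assume "s \<ge> 1"
  have "closed {s. step_family (Suc 0) s = 0}"
    by (intro closed_Collect_eq) (auto intro: DERIV_continuous_on DERIV_step_family)
  moreover have "step_family (Suc 0) s = 0" if "s \<in> {1<..}" for s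
  proof -
    have "(step_family 0 has_real_derivative 0) (at s)"
      by (rule has_field_derivative_transform_within_open[of "\<lambda>_. 1" _ _ "{1<..}"])
        (use that step_1 in auto)
    then show ?thesis
      using DERIV_unique[OF _ DERIV_step_family[of 0 s]] by simp
  qed
  ultimately have "closure {1<..} \<subseteq> {s. step_family (Suc 0) s = 0}"
    by (intro closure_minimal) auto
  then show ?thesis using \<open>s \<ge> 1\<close> by auto
qed

lemma mollifier_integral:
  assumes "e > 0" "u \<le> a" "a + e \<le> v"
  shows "(mollifier e a has_integral 1) {u..v}"
proof -
  have "(mollifier e a has_integral (step_family 0 ((v - a) / e) - step_family 0 ((u - a) / e))) {u..v}"
    using assms step_family_scaled_DERIV[of e 0 a]
    by (intro fundamental_theorem_of_calculus)
      (auto simp: mollifier_def has_real_derivative_iff_has_vector_derivative[symmetric]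
        intro: has_field_derivative_at_within)
  moreover have "step_family 0 ((v - a) / e) = 1" "step_family 0 ((u - a) / e) = 0"
    using assms step_1[of "(v - a) / e"] step_family_0[of "(u - a) / e" 0]
    by (auto simp: field_simps)
  ultimately show ?thesis by simp
qed

lemma mollifier_approx:
  fixes f :: "real \<Rightarrow> 'a::euclidean_space"
  assumes e: "e > 0" "u \<le> a" "a + e \<le> v" and cont: "continuous_on {u..v} f"
    and near: "\<And>r. r \<in> {a..a+e} \<Longrightarrow> norm (f r - y) \<le> \<omega>"
  shows "norm (integral {u..v} (\<lambda>r. mollifier e a r *\<^sub>R f r) - y) \<le> \<omega>"
proof -
  have int: "(\<lambda>r. mollifier e a r *\<^sub>R f r) integrable_on {u..v}"
    "(\<lambda>r. mollifier e a r *\<^sub>R (f r - y)) integrable_on {u..v}"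
    by (intro integrable_continuous_real continuous_intros cont mollifier_continuous e)+
  have "integral {u..v} (\<lambda>r. mollifier e a r *\<^sub>R y) = y"
    using integral_unique[OF has_integral_scaleR_left[OF mollifier_integral[OF e], of y]] by simp
  then have "integral {u..v} (\<lambda>r. mollifier e a r *\<^sub>R f r) - y
      = integral {u..v} (\<lambda>r. mollifier e a r *\<^sub>R (f r - y))"
    using has_integral_scaleR_left[OF mollifier_integral[OF e], of y] int(1)
    by (simp add: scaleR_diff_right HK_integral_diff has_integral_integrable)
  also have "norm \<dots> \<le> integral {u..v} (\<lambda>r. mollifier e a r * \<omega>)"
  proof (rule integral_norm_bound_integral)
    show "(\<lambda>r. mollifier e a r * \<omega>) integrable_on {u..v}"
      using has_integral_mult_left[OF mollifier_integral[OF e]] by blast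
    fix r assume "r \<in> {u..v}"
    show "norm (mollifier e a r *\<^sub>R (f r - y)) \<le> mollifier e a r * \<omega>"
    proof (cases "r \<in> {a..a+e}")
      case True
      then show ?thesis
        using near[OF True] bump_nonneg e by (simp add: mollifier_def divide_right_mono mult_left_mono)
    next
      case False
      then have "mollifier e a r = 0"
        using step_family_0[of "(r - a) / e" "Suc 0"] bump_0[of "(r - a) / e"] e
        by (auto simp: mollifier_def field_simps)
      then show ?thesis by simp
    qed
  qed (rule int)
  also have "\<dots> = \<omega>"
    using integral_unique[OF has_integral_mult_left[OF mollifier_integral[OF e], of \<omega>]] by simp
  finally show ?thesis .
qed

subsection \<open>Weak derivatives\<close>

text \<open>The derivative is a unit kernel at the left end minus one at the right end, so testing
  with a plateau produces an increment.\<close>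

definition plateau :: "real \<Rightarrow> real \<Rightarrow> real \<Rightarrow> real \<Rightarrow> real" where
  "plateau a b e r = step_family 0 ((r - a) / e) - step_family 0 ((r - (b - e)) / e)"

lemma
  assumes "0 < e"
  shows smooth_plateau: "smooth (plateau a b e)"
    and deriv_plateau: "deriv (plateau a b e) = (\<lambda>r. mollifier e a r - mollifier e (b - e) r)"
proof -
  define F where "F n r = step_family n ((r - a) / e) / e ^ n - step_family n ((r - (b - e)) / e) / e ^ n" for n r
  have d: "(F n has_real_derivative F (Suc n) s) (at s)" for n s
  proof -
    have "(F n has_real_derivative step_family (Suc n) ((s - a) / e) / e / e ^ n - step_family (Suc n) ((s - (b - e)) / e) / e / e ^ n) (at s)"
      unfolding F_def by (intro DERIV_diff DERIV_cdivide step_family_scaled_DERIV) (use assms in simp_all)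
    then show ?thesis by (simp add: F_def)
  qed
  have F0: "F 0 = plateau a b e" by (simp add: F_def plateau_def fun_eq_iff)
  show "smooth (plateau a b e)" using smooth_family[of F, OF d] by (simp add: F0)
  show "deriv (plateau a b e) = (\<lambda>r. mollifier e a r - mollifier e (b - e) r)"
    using higher_deriv_family[of F 1, OF d] by (simp add: F0) (simp add: F_def mollifier_def fun_eq_iff)
qed

lemma
  assumes "0 < e" "2 * e \<le> b - a"
  shows plateau_nonneg: "0 \<le> plateau a b e r" and plateau_le_1: "plateau a b e r \<le> 1"
    and plateau_0: "r \<notin> {a<..<b} \<Longrightarrow> plateau a b e r = 0"
    and plateau_1: "r \<in> {a+e..b-e} \<Longrightarrow> plateau a b e r = 1"
proof -
  have 1: "step_family 0 ((r - a) / e) = 1" if "r \<ge> a + e"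
    using that assms by (intro step_1) (simp add: field_simps)
  have 2: "step_family 0 ((r - a) / e) = 0" if "r \<le> a"
    using that assms by (intro step_family_0) (simp add: field_simps)
  have 3: "step_family 0 ((r - (b - e)) / e) = 1" if "r \<ge> b"
    using that assms by (intro step_1) (simp add: field_simps)
  have 4: "step_family 0 ((r - (b - e)) / e) = 0" if "r \<le> b - e"
    using that assms by (intro step_family_0) (simp add: field_simps)
  show "0 \<le> plateau a b e r"
    using 1 4 assms step_nonneg step_le_1 by (cases "r \<le> b - e") (auto simp: plateau_def)
  show "plateau a b e r \<le> 1"
    using step_nonneg[of "(r - (b - e)) / e"] step_le_1[of "(r - a) / e"] by (simp add: plateau_def)
  show "r \<notin> {a<..<b} \<Longrightarrow> plateau a b e r = 0"
    using 1 2 3 4 assms by (cases "r \<le> a") (auto simp: plateau_def)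
  show "r \<in> {a+e..b-e} \<Longrightarrow> plateau a b e r = 1"
    using 1 4 by (simp add: plateau_def)
qed

text \<open>The width of the ramps tends to zero with n, and the summand 2 keeps them from
  overlapping already for n = 0.\<close>

definition pplateau :: "real \<Rightarrow> real \<Rightarrow> nat \<Rightarrow> real \<Rightarrow> real" where
  "pplateau a b n r = plateau a b ((b - a) / (real n + 2)) (frac r)"

lemma plateau_width:
  assumes "a < b"
  shows "0 < (b - a) / (real n + 2)" "2 * ((b - a) / (real n + 2)) \<le> b - a"
  using assms mult_right_mono[of a b "real n"] by (auto simp: field_simps)

lemma plateau_width_lim: "(\<lambda>n. (b - a) / (real n + 2)) \<longlonglongrightarrow> (0::real)"
  using LIMSEQ_ignore_initial_segment[OF lim_const_over_n[of "b - a"], of 2] by (simp add: add.commute)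

context
  fixes a b :: real
  assumes ab: "0 \<le> a" "a < b" "b \<le> 1"
begin

lemma
  shows smooth_pplateau: "smooth (pplateau a b n)" and periodic_pplateau: "periodic (pplateau a b n)"
    and pplateau_eq: "r \<in> {0..1} \<Longrightarrow> pplateau a b n r = plateau a b ((b - a) / (real n + 2)) r"
    and deriv_pplateau: "r \<in> {0..1} \<Longrightarrow> deriv (pplateau a b n) r
      = mollifier ((b - a) / (real n + 2)) a r - mollifier ((b - a) / (real n + 2)) (b - (b - a) / (real n + 2)) r"
proof -
  let ?e = "(b - a) / (real n + 2)"
  note w = plateau_width[OF ab(2), of n]
  have "plateau a b ?e r = 0" if "r \<notin> {0..0+1}" for r
    using that ab by (intro plateau_0 w) auto
  from smooth_periodization[of _ 0, OF smooth_plateau[OF w(1)] this]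
  obtain \<psi> where \<psi>: "smooth \<psi>" "periodic \<psi>"
    "\<And>k r. r \<in> {0..1} \<Longrightarrow> (deriv ^^ k) \<psi> r = (deriv ^^ k) (plateau a b ?e) r"
    by auto
  have eq: "pplateau a b n = \<psi>"
  proof
    fix r
    have "\<psi> r = \<psi> (frac r)" using periodic_frac[OF \<psi>(2)] by simp
    also have "\<dots> = plateau a b ?e (frac r)" using \<psi>(3)[of "frac r" 0] by (simp add: less_imp_le[OF frac_lt_1])
    finally show "pplateau a b n r = \<psi> r" by (simp add: pplateau_def)
  qed
  show "smooth (pplateau a b n)" "periodic (pplateau a b n)" by (simp_all add: eq \<psi>)
  show "r \<in> {0..1} \<Longrightarrow> pplateau a b n r = plateau a b ?e r"
    using \<psi>(3)[of r 0] by (simp add: eq)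
  show "r \<in> {0..1} \<Longrightarrow> deriv (pplateau a b n) r = mollifier ?e a r - mollifier ?e (b - ?e) r"
    using \<psi>(3)[of r 1] deriv_plateau[OF w(1)] by (simp add: eq)
qed

lemma pplateau_bounds: "0 \<le> pplateau a b n r" "pplateau a b n r \<le> 1"
  unfolding pplateau_def by (intro plateau_nonneg plateau_le_1 plateau_width ab)+

lemma pplateau_zero: "r \<in> {0..1} \<Longrightarrow> r \<notin> {a<..<b} \<Longrightarrow> pplateau a b n r = 0"
  using plateau_0[OF plateau_width[OF ab(2)]] by (simp add: pplateau_eq)

lemma pplateau_tendsto:
  assumes "r \<in> {0..1}"
  shows "(\<lambda>n. pplateau a b n r) \<longlonglongrightarrow> indicator {a<..<b} r"
proof (cases "r \<in> {a<..<b}")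
  case True
  have "\<forall>\<^sub>F n in sequentially. (b - a) / (real n + 2) < min (r - a) (b - r)"
    using True by (intro order_tendstoD[OF plateau_width_lim]) auto
  then have "\<forall>\<^sub>F n in sequentially. pplateau a b n r = 1"
    by eventually_elim (use assms in \<open>auto simp: pplateau_eq intro!: plateau_1 plateau_width[OF ab(2)]\<close>)
  then show ?thesis using True by (simp add: tendsto_eventually)
next
  case False
  then show ?thesis using assms by (simp add: pplateau_zero)
qed

lemma pplateau_integral_tendsto:
  fixes w :: "real \<Rightarrow> 'a::euclidean_space"
  assumes w: "integrable I_measure w"
  shows "(\<lambda>n. \<integral>z. pplateau a b n z *\<^sub>R w z \<partial>I_measure) \<longlonglongrightarrow> integral {a..b} w"
proof -
  have meas: "(\<lambda>z. pplateau a b n z *\<^sub>R w z) \<in> borel_measurable I_measure" for n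
    using w continuous_imp_measurable_on_sets_lebesgue[OF smooth_continuous0[OF smooth_pplateau], of "{0..1}" n]
    by (intro borel_measurable_scaleR) auto
  have ind: "integrable I_measure (\<lambda>z. indicator {a<..<b} z *\<^sub>R w z)"
    by (rule integrable_mult_indicator) (use w ab in \<open>auto simp: sets_restrict_space_iff\<close>)
  have "(\<lambda>n. \<integral>z. pplateau a b n z *\<^sub>R w z \<partial>I_measure) \<longlonglongrightarrow> (\<integral>z. indicator {a<..<b} z *\<^sub>R w z \<partial>I_measure)"
  proof (rule integral_dominated_convergence[where w = "\<lambda>z. norm (w z)"])
    show "AE z in I_measure. (\<lambda>n. pplateau a b n z *\<^sub>R w z) \<longlonglongrightarrow> indicator {a<..<b} z *\<^sub>R w z"
      by (rule AE_I2) (auto intro!: tendsto_intros pplateau_tendsto)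
    show "AE z in I_measure. norm (pplateau a b n z *\<^sub>R w z) \<le> norm (w z)" for n
      by (rule AE_I2) (use pplateau_bounds in \<open>auto simp: mult_left_le_one_le\<close>)
  qed (use w meas ind in auto)
  also have "(\<integral>z. indicator {a<..<b} z *\<^sub>R w z \<partial>I_measure) = integral {0..1} (\<lambda>z. indicator {a<..<b} z *\<^sub>R w z)"
    by (rule lebesgue_integral_eq_integral[OF ind]) simp
  also have "(\<lambda>z. indicator {a<..<b} z *\<^sub>R w z) = (\<lambda>z. if z \<in> {a<..<b} then w z else 0)"
    by (auto simp: indicator_def)
  also have "integral {0..1} \<dots> = integral {a<..<b} w"
    using ab by (subst HK_integral_restrict_Int) (simp add: Int_absorb2 subset_iff)
  also have "\<dots> = integral {a..b} w"
    using integral_open_interval_real[of a b w] by (simp add: box_real)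
  finally show ?thesis .
qed

text \<open>Each ramp contributes a unit kernel concentrating at an end point. Together with
  \<open>pplateau_integral_tendsto\<close> this turns an integration by parts with smooth test
  functions into a formula for increments.\<close>

lemma pplateau_deriv_integral_tendsto:
  fixes f :: "real \<Rightarrow> 'a::euclidean_space"
  assumes f: "continuous_on UNIV f"
  shows "(\<lambda>n. \<integral>z. deriv (pplateau a b n) z *\<^sub>R f z \<partial>I_measure) \<longlonglongrightarrow> f a - f b"
proof (rule metric_LIMSEQ_I)
  fix \<omega> :: real assume "\<omega> > 0"
  define e where "e n = (b - a) / (real n + 2)" for n
  note w = plateau_width[OF ab(2), folded e_def]
  have "isCont f a" "isCont f b" using f by (simp_all add: continuous_on_eq_continuous_at)
  then obtain da db where d: "da > 0" "db > 0" "\<And>r. dist r a < da \<Longrightarrow> dist (f r) (f a) < \<omega> / 3"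
     "\<And>r. dist r b < db \<Longrightarrow> dist (f r) (f b) < \<omega> / 3"
    using \<open>\<omega> > 0\<close> unfolding continuous_at_eps_delta by (metis dist_norm zero_less_divide_iff zero_less_numeral)
  have "\<forall>\<^sub>F n in sequentially. e n < min da db"
    unfolding e_def using d by (intro order_tendstoD[OF plateau_width_lim]) auto
  then obtain N where N: "\<And>n. n \<ge> N \<Longrightarrow> e n < da \<and> e n < db"
    by (auto simp: eventually_sequentially)
  have "dist (\<integral>z. deriv (pplateau a b n) z *\<^sub>R f z \<partial>I_measure) (f a - f b) < \<omega>" if "n \<ge> N" for n
  proof -
    have cont: "continuous_on {0..1} f" using f continuous_on_subset by blast
    have "(\<integral>z. deriv (pplateau a b n) z *\<^sub>R f z \<partial>I_measure) = integral {0..1} (\<lambda>z. deriv (pplateau a b n) z *\<^sub>R f z)"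
      by (intro I_integral_continuous continuous_intros smooth_continuous1 smooth_pplateau cont)
    also have "\<dots> = integral {0..1} (\<lambda>z. mollifier (e n) a z *\<^sub>R f z - mollifier (e n) (b - e n) z *\<^sub>R f z)"
      by (rule integral_cong) (simp add: deriv_pplateau e_def scaleR_diff_left)
    also have "\<dots> = integral {0..1} (\<lambda>z. mollifier (e n) a z *\<^sub>R f z) - integral {0..1} (\<lambda>z. mollifier (e n) (b - e n) z *\<^sub>R f z)"
      by (intro HK_integral_diff integrable_continuous_real continuous_intros mollifier_continuous w cont)
    finally have eq: "(\<integral>z. deriv (pplateau a b n) z *\<^sub>R f z \<partial>I_measure) - (f a - f b)
        = (integral {0..1} (\<lambda>z. mollifier (e n) a z *\<^sub>R f z) - f a)
          - (integral {0..1} (\<lambda>z. mollifier (e n) (b - e n) z *\<^sub>R f z) - f b)" by simp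
    have "norm (f r - f a) \<le> \<omega> / 3" if "r \<in> {a..a + e n}" for r
      using d(3)[of r] N[OF \<open>n \<ge> N\<close>] that by (simp add: dist_norm less_imp_le)
    then have 1: "norm (integral {0..1} (\<lambda>z. mollifier (e n) a z *\<^sub>R f z) - f a) \<le> \<omega> / 3"
      using w[of n] ab by (intro mollifier_approx cont) auto
    have "norm (f r - f b) \<le> \<omega> / 3" if "r \<in> {b - e n..b - e n + e n}" for r
      using d(4)[of r] N[OF \<open>n \<ge> N\<close>] that by (simp add: dist_norm less_imp_le)
    then have 2: "norm (integral {0..1} (\<lambda>z. mollifier (e n) (b - e n) z *\<^sub>R f z) - f b) \<le> \<omega> / 3"
      using w[of n] ab by (intro mollifier_approx cont) auto
    show ?thesis
      unfolding dist_norm eq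
      using norm_triangle_ineq4[of "integral {0..1} (\<lambda>z. mollifier (e n) a z *\<^sub>R f z) - f a" "integral {0..1} (\<lambda>z. mollifier (e n) (b - e n) z *\<^sub>R f z) - f b"] 1 2 \<open>\<omega> > 0\<close>
      by linarith
  qed
  then show "\<exists>N. \<forall>n\<ge>N. dist (\<integral>z. deriv (pplateau a b n) z *\<^sub>R f z \<partial>I_measure) (f a - f b) < \<omega>"
    by blast
qed

end

text \<open>Lebesgue differentiation with one-sided averages, applied to w extended by zero; for z
  other than 0 and 1 short averages see only values inside the period.\<close>

lemma AE_right_average:
  fixes w :: "real \<Rightarrow> 'a::euclidean_space"
  assumes w: "integrable I_measure w"
  shows "AE z in I_measure. ((\<lambda>h. integral {z..z+h} w /\<^sub>R h) \<longlongrightarrow> w z) (at_right 0) \<and> z \<in> {0<..<1}"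
proof -
  define v where "v = (\<lambda>z. if z \<in> {0..1} then w z else 0)"
  have "w integrable_on {0..1}" using w by (rule integrable_on_lebesgue_on) simp
  then have "v integrable_on UNIV" unfolding v_def by (simp only: integrable_restrict_UNIV)
  then have "v integrable_on cbox a b" for a b using integrable_on_subcbox by blast
  then obtain N where N: "negligible N"
    "\<And>x e. \<lbrakk>x \<notin> N; 0 < e\<rbrakk> \<Longrightarrow> \<exists>d>0. \<forall>h. 0 < h \<and> h < d \<longrightarrow>
        norm (integral (cbox x (x + h *\<^sub>R One)) v /\<^sub>R h ^ DIM(real) - v x) < e"
    by (rule integrable_ccontinuous_explicit) blast
  have "N \<union> {0, 1} \<in> null_sets lebesgue"
    using N(1) by (simp add: negligible_iff_null_sets[symmetric])
  then have "AE z in lebesgue. z \<notin> N \<union> {0, 1}" by (rule AE_not_in)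
  then have "AE z in I_measure. z \<notin> N \<union> {0, 1}"
    by (subst AE_restrict_space_iff) (auto elim!: eventually_mono simp del: AE_conj_iff Un_insert_right)
  moreover have "AE z in I_measure. z \<in> {0..1}" by (rule AE_I2) simp
  ultimately show ?thesis
  proof eventually_elim
    case (elim z)
    then have z: "0 < z" "z < 1" "z \<notin> N" by auto
    have "((\<lambda>h. integral {z..z+h} w /\<^sub>R h) \<longlongrightarrow> w z) (at_right 0)"
    proof (rule tendstoI)
      fix e :: real assume "e > 0"
      with N(2)[OF z(3)] obtain d where d: "d > 0" "\<And>h. 0 < h \<and> h < d \<Longrightarrow> norm (integral {z..z+h} v /\<^sub>R h - v z) < e"
        by auto
      show "\<forall>\<^sub>F h in at_right 0. dist (integral {z..z+h} w /\<^sub>R h) (w z) < e"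
      proof (rule eventually_at_rightI[of 0 "min d (1 - z)"])
        fix h assume h: "h \<in> {0<..<min d (1 - z)}"
        have "integral {z..z+h} v = integral {z..z+h} w"
          using h z by (intro integral_cong) (auto simp: v_def)
        then show "dist (integral {z..z+h} w /\<^sub>R h) (w z) < e"
          using d(2)[of h] h z by (simp add: dist_norm v_def)
      qed (use d z in auto)
    qed
    then show ?case using z by simp
  qed
qed

lemma AE_zero_if_integrals_zero:
  fixes w :: "real \<Rightarrow> 'a::euclidean_space"
  assumes w: "integrable I_measure w" and z: "\<And>a b. 0 \<le> a \<Longrightarrow> a < b \<Longrightarrow> b \<le> 1 \<Longrightarrow> integral {a..b} w = 0"
  shows "AE z in I_measure. w z = 0"
  using AE_right_average[OF w]
proof eventually_elim
  case (elim z)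
  have "\<forall>\<^sub>F h in at_right 0. integral {z..z+h} w /\<^sub>R h = 0"
    by (rule eventually_at_rightI[of 0 "1 - z"]) (use elim z in auto)
  then have "((\<lambda>h. integral {z..z+h} w /\<^sub>R h) \<longlongrightarrow> 0) (at_right 0)"
    by (rule tendsto_eventually)
  then show ?case using elim tendsto_unique[OF trivial_limit_at_right_real] by blast
qed

text \<open>Plateaus that fill up (a, b) show that both candidates have the same integral over every
  subinterval.\<close>

lemma weak_deriv_unique:
  assumes "has_weak_deriv f g" "has_weak_deriv f k"
  shows "AE z in I_measure. g z = k z"
proof -
  have int: "integrable I_measure g" "integrable I_measure k"
    using assms by (auto simp: has_weak_deriv_def)
  then have int': "integrable I_measure (\<lambda>z. g z - k z)" by simp
  have "AE z in I_measure. g z - k z = 0"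
  proof (rule AE_zero_if_integrals_zero[OF int'])
    fix a b :: real assume ab: "0 \<le> a" "a < b" "b \<le> 1"
    have "(\<integral>z. pplateau a b n z *\<^sub>R g z \<partial>I_measure) = (\<integral>z. pplateau a b n z *\<^sub>R k z \<partial>I_measure)" for n
    proof -
      have "(\<integral>z. deriv (pplateau a b n) z *\<^sub>R f z \<partial>I_measure) = - (\<integral>z. pplateau a b n z *\<^sub>R g z \<partial>I_measure)"
        "(\<integral>z. deriv (pplateau a b n) z *\<^sub>R f z \<partial>I_measure) = - (\<integral>z. pplateau a b n z *\<^sub>R k z \<partial>I_measure)"
        using assms smooth_pplateau[OF ab] periodic_pplateau[OF ab] unfolding has_weak_deriv_def by blast+
      then show ?thesis by simp
    qed
    then have "integral {a..b} g = integral {a..b} k"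
      using pplateau_integral_tendsto[OF ab int(1)] pplateau_integral_tendsto[OF ab int(2)] LIMSEQ_unique by auto
    moreover have "g integrable_on {a..b}" "k integrable_on {a..b}"
      using integrable_on_lebesgue_on[OF int(1)] integrable_on_lebesgue_on[OF int(2)] ab
      by (auto intro: integrable_on_subinterval)
    ultimately show "integral {a..b} (\<lambda>z. g z - k z) = 0"
      by (simp add: HK_integral_diff)
  qed
  then show ?thesis by simp
qed

lemma weak_deriv_AE_eq: "has_weak_deriv f g \<Longrightarrow> AE z in I_measure. weak_deriv f z = g z"
  unfolding weak_deriv_def by (metis someI weak_deriv_unique)

lemma has_weak_deriv_weak_deriv: "has_weak_deriv f g \<Longrightarrow> has_weak_deriv f (weak_deriv f)"
  unfolding weak_deriv_def by (metis someI)

lemma weak_deriv_increment: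
  fixes f :: "real \<Rightarrow> 'a::euclidean_space"
  assumes f: "continuous_on UNIV f" and k: "integrable I_measure k"
    and parts: "\<And>\<phi>. smooth \<phi> \<Longrightarrow> periodic \<phi> \<Longrightarrow>
      (\<integral>z. deriv \<phi> z *\<^sub>R f z \<partial>I_measure) = - (\<integral>z. \<phi> z *\<^sub>R k z \<partial>I_measure)"
    and ab: "0 \<le> a" "a < b" "b \<le> 1"
  shows "f b - f a = integral {a..b} k"
proof -
  have "(\<lambda>n. - (\<integral>z. pplateau a b n z *\<^sub>R k z \<partial>I_measure)) \<longlonglongrightarrow> - integral {a..b} k"
    by (intro tendsto_minus pplateau_integral_tendsto ab k)
  then have "f a - f b = - integral {a..b} k"
    using pplateau_deriv_integral_tendsto[OF ab f] LIMSEQ_unique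
    by (simp add: parts smooth_pplateau[OF ab] periodic_pplateau[OF ab])
  then show ?thesis by (simp add: algebra_simps)
qed

section \<open>Integration by parts for Lipschitz functions\<close>

lemma tendsto_inverse_at_right: "filterlim (\<lambda>n. inverse (real (Suc n))) (at_right 0) sequentially"
  using LIMSEQ_inverse_real_of_nat by (auto simp: filterlim_at)

lemma lipschitz_continuous:
  fixes f :: "real \<Rightarrow> 'a::real_normed_vector"
  assumes "\<And>x y. norm (f x - f y) \<le> L * \<bar>x - y\<bar>"
  shows "continuous_on A f"
proof -
  have "L-lipschitz_on UNIV f"
    using assms order_trans[OF norm_ge_zero assms[of 1 0]] by (intro lipschitz_onI) (simp_all add: dist_norm)
  then show ?thesis
    using lipschitz_on_continuous_on continuous_on_subset by blast
qed

lemma norm_quotient_le: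
  assumes "0 < h" "norm x \<le> K * \<bar>h\<bar>"
  shows "norm (x /\<^sub>R h) \<le> K"
  using assms by (simp add: divide_inverse[symmetric] mult.commute[of "inverse h"] pos_divide_le_eq)

lemma integral_periodic_shift:
  fixes f :: "real \<Rightarrow> 'a::euclidean_space"
  assumes "continuous_on UNIV f" "periodic f"
  shows "integral {0..1} (\<lambda>z. f (z + h)) = integral {0..1} f"
proof -
  have "integral {0..1} (f \<circ> (\<lambda>z. z + h)) = integral {0 + h..1 + h} f"
    by (rule integral_shift) (rule continuous_on_subset[OF assms(1)], simp)
  then show ?thesis using integral_periodic[OF assms, of h] by (simp add: o_def add.commute)
qed

text \<open>By passing to the limit in summation by parts for difference quotients.\<close>

lemma lipschitz_parts:
  fixes f :: "real \<Rightarrow> 'a::euclidean_space" and g :: "real \<Rightarrow> 'b::euclidean_space"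
    and prod :: "'b \<Rightarrow> 'a \<Rightarrow> 'c::euclidean_space"
  assumes bb: "bounded_bilinear prod"
    and f: "periodic f" "\<And>x y. norm (f x - f y) \<le> K * \<bar>x - y\<bar>"
      "f' \<in> borel_measurable I_measure"
      "AE z in I_measure. ((\<lambda>h. (f (z + h) - f z) /\<^sub>R h) \<longlongrightarrow> f' z) (at_right 0)"
    and g: "periodic g" "\<And>x y. norm (g x - g y) \<le> L * \<bar>x - y\<bar>"
      "g' \<in> borel_measurable I_measure"
      "AE z in I_measure. ((\<lambda>h. (g z - g (z - h)) /\<^sub>R h) \<longlongrightarrow> g' z) (at_right 0)"
  shows "integrable I_measure (\<lambda>z. prod (g z) (f' z))"
    and "integrable I_measure (\<lambda>z. prod (g' z) (f z))"
    and "(\<integral>z. prod (g z) (f' z) \<partial>I_measure) = - (\<integral>z. prod (g' z) (f z) \<partial>I_measure)"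
proof -
  interpret bounded_bilinear prod by (rule bb)
  have cf: "continuous_on A f" and cg: "continuous_on A g" for A
    using lipschitz_continuous f(2) g(2) by blast+
  have K: "K \<ge> 0" and L: "L \<ge> 0"
    using order_trans[OF norm_ge_zero f(2)[of 1 0]] order_trans[OF norm_ge_zero g(2)[of 1 0]] by simp_all
  obtain C where C: "C \<ge> 0" "\<And>x y. norm (prod x y) \<le> norm x * norm y * C"
    using nonneg_bounded by blast
  have "bounded (f ` {0..1})" "bounded (g ` {0..1})"
    by (intro compact_imp_bounded compact_continuous_image cf cg compact_Icc)+
  then obtain Bf Bg where B: "\<And>x. x \<in> {0..1} \<Longrightarrow> norm (f x) \<le> Bf" "\<And>x. x \<in> {0..1} \<Longrightarrow> norm (g x) \<le> Bg"
    unfolding bounded_iff by (metis imageI)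
  have B0: "Bf \<ge> 0" "Bg \<ge> 0" using order_trans[OF norm_ge_zero B(1)[of 0]] order_trans[OF norm_ge_zero B(2)[of 0]] by simp_all
  define h where "h n = inverse (real (Suc n))" for n
  have h: "h n > 0" for n by (simp add: h_def)
  define F where "F n z = (f (z + h n) - f z) /\<^sub>R h n" for n z
  define G where "G n z = (g z - g (z - h n)) /\<^sub>R h n" for n z
  have meas: "u \<in> borel_measurable I_measure" if "continuous_on UNIV u" for u :: "real \<Rightarrow> 'd::euclidean_space"
    using continuous_imp_measurable_on_sets_lebesgue[OF continuous_on_subset[OF that]] by auto
  have meas2: "(\<lambda>z. prod (u z) (v z)) \<in> borel_measurable I_measure"
    if "u \<in> borel_measurable I_measure" "v \<in> borel_measurable I_measure" for u v
    by (rule borel_measurable_bilinear) (use that bb in \<open>auto simp: bilinear_conv_bounded_bilinear\<close>)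
  have cF: "continuous_on A (F n)" and cG: "continuous_on A (G n)" for A n
    unfolding F_def G_def
    by (intro continuous_intros continuous_on_compose2[OF cf[of UNIV]] continuous_on_compose2[OF cg[of UNIV]]; simp)+
  have cPF: "continuous_on A (\<lambda>z. prod (g z) (F n z))" and cPG: "continuous_on A (\<lambda>z. prod (G n z) (f z))" for A n
    by (intro continuous_on cF cG cf cg)+
  have F_le: "norm (F n z) \<le> K" for n z
    using norm_quotient_le[OF h[of n] f(2)[of "z + h n" z, simplified]] h[of n] by (simp add: F_def)
  have G_le: "norm (G n z) \<le> L" for n z
    using norm_quotient_le[OF h[of n] g(2)[of z "z - h n", simplified]] h[of n] by (simp add: G_def)
  have limF: "AE z in I_measure. (\<lambda>n. prod (g z) (F n z)) \<longlonglongrightarrow> prod (g z) (f' z)"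
    using f(4)
    by eventually_elim
      (unfold F_def h_def, intro tendsto tendsto_const filterlim_compose[OF _ tendsto_inverse_at_right])
  have limG: "AE z in I_measure. (\<lambda>n. prod (G n z) (f z)) \<longlonglongrightarrow> prod (g' z) (f z)"
    using g(4)
    by eventually_elim
      (unfold G_def h_def, intro tendsto tendsto_const filterlim_compose[OF _ tendsto_inverse_at_right])
  have bF: "AE z in I_measure. norm (prod (g z) (F n z)) \<le> Bg * K * C" for n
    by (rule AE_I2) (auto intro!: order_trans[OF C(2)] mult_mono mult_nonneg_nonneg B F_le B0 C K)
  have bG: "AE z in I_measure. norm (prod (G n z) (f z)) \<le> L * Bf * C" for n
    by (rule AE_I2) (auto intro!: order_trans[OF C(2)] mult_mono mult_nonneg_nonneg B G_le B0 C L)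
  have const: "integrable I_measure (\<lambda>_. c :: real)" for c
    using continuous_imp_integrable_real[of 0 1 "\<lambda>_. c"] by auto
  note dctF = meas2[OF meas[OF cg] f(3)] meas[OF cPF] const limF bF
  note dctG = meas2[OF g(3) meas[OF cf]] meas[OF cPG] const limG bG
  show "integrable I_measure (\<lambda>z. prod (g z) (f' z))"
    by (rule integrable_dominated_convergence[OF dctF])
  show "integrable I_measure (\<lambda>z. prod (g' z) (f z))"
    by (rule integrable_dominated_convergence[OF dctG])
  \<comment> \<open>Translation by \<open>h n\<close> over a full period turns the forward quotient
    of f into the backward quotient of g; this is why the hypotheses on the two functions use
    opposite sides.\<close>
  have eq: "(\<integral>z. prod (g z) (F n z) \<partial>I_measure) = - (\<integral>z. prod (G n z) (f z) \<partial>I_measure)" for n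
  proof -
    have c1: "continuous_on A (\<lambda>z. prod (g (z - h n)) (f z))" for A
      by (intro continuous_on cf continuous_on_compose2[OF cg[of UNIV]] continuous_intros) auto
    have c2: "continuous_on A (\<lambda>z. prod (g z) (f (z + h n)))" for A
      by (intro continuous_on cg continuous_on_compose2[OF cf[of UNIV]] continuous_intros) auto
    have c3: "continuous_on A (\<lambda>z. prod (g z) (f z))" for A
      by (intro continuous_on cg cf)
    have "periodic (\<lambda>z. prod (g (z - h n)) (f z))"
      using f(1) g(1) unfolding periodic_def by (metis diff_add_eq)
    from integral_periodic_shift[OF c1 this, of "h n"]
    have sh: "integral {0..1} (\<lambda>z. prod (g z) (f (z + h n))) = integral {0..1} (\<lambda>z. prod (g (z - h n)) (f z))"
      by simp
    have "(\<integral>z. prod (g z) (F n z) \<partial>I_measure) = integral {0..1} (\<lambda>z. prod (g z) (F n z))"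
      by (intro I_integral_continuous cPF)
    also have "\<dots> = integral {0..1} (\<lambda>z. inverse (h n) *\<^sub>R (prod (g z) (f (z + h n)) - prod (g z) (f z)))"
      by (simp add: F_def scaleR_right diff_right)
    also have "\<dots> = inverse (h n) *\<^sub>R (integral {0..1} (\<lambda>z. prod (g z) (f (z + h n))) - integral {0..1} (\<lambda>z. prod (g z) (f z)))"
      by (simp only: HK_integral_cmul)
        (subst HK_integral_diff, auto intro!: integrable_continuous_real c2 c3)
    also have "\<dots> = - (inverse (h n) *\<^sub>R (integral {0..1} (\<lambda>z. prod (g z) (f z)) - integral {0..1} (\<lambda>z. prod (g (z - h n)) (f z))))"
      by (simp add: sh scaleR_diff_right)
    also have "inverse (h n) *\<^sub>R (integral {0..1} (\<lambda>z. prod (g z) (f z)) - integral {0..1} (\<lambda>z. prod (g (z - h n)) (f z)))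
      = integral {0..1} (\<lambda>z. inverse (h n) *\<^sub>R (prod (g z) (f z) - prod (g (z - h n)) (f z)))"
      by (simp only: HK_integral_cmul)
        (subst HK_integral_diff, auto intro!: integrable_continuous_real c1 c3)
    also have "\<dots> = integral {0..1} (\<lambda>z. prod (G n z) (f z))"
      by (simp add: G_def scaleR_left diff_left)
    also have "\<dots> = (\<integral>z. prod (G n z) (f z) \<partial>I_measure)"
      by (intro I_integral_continuous(2)[symmetric] cPG)
    finally show ?thesis .
  qed
  have "(\<lambda>n. \<integral>z. prod (g z) (F n z) \<partial>I_measure) \<longlonglongrightarrow> (\<integral>z. prod (g z) (f' z) \<partial>I_measure)"
    by (rule integral_dominated_convergence[OF dctF])
  moreover have "(\<lambda>n. - (\<integral>z. prod (G n z) (f z) \<partial>I_measure)) \<longlonglongrightarrow> - (\<integral>z. prod (g' z) (f z) \<partial>I_measure)"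
    by (intro tendsto_minus integral_dominated_convergence[OF dctG])
  ultimately show "(\<integral>z. prod (g z) (f' z) \<partial>I_measure) = - (\<integral>z. prod (g' z) (f z) \<partial>I_measure)"
    unfolding eq by (rule LIMSEQ_unique)
qed

lemma vector_derivative_quotients:
  fixes f :: "real \<Rightarrow> 'a::real_normed_vector"
  assumes "(f has_vector_derivative d) (at z)"
  shows "((\<lambda>h. (f (z + h) - f z) /\<^sub>R h) \<longlongrightarrow> d) (at_right 0)"
    "((\<lambda>h. (f z - f (z - h)) /\<^sub>R h) \<longlongrightarrow> d) (at_right 0)"
proof -
  have "((\<lambda>h. norm (f (z + h) - f z - h *\<^sub>R d) / norm h) \<longlongrightarrow> 0) (at 0)"
    using assms unfolding has_vector_derivative_def has_derivative_at by blast
  moreover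
  have "norm (f (z + h) - f z - h *\<^sub>R d) / norm h = norm ((f (z + h) - f z) /\<^sub>R h - d)"
    if "h \<noteq> 0" for h
  proof -
    have "norm (f (z + h) - f z - h *\<^sub>R d) / norm h = norm (inverse h *\<^sub>R (f (z + h) - f z - h *\<^sub>R d))"
      by (simp add: divide_inverse mult.commute)
    then show ?thesis using that by (simp add: scaleR_diff_right)
  qed
  then have "\<forall>\<^sub>F h in at 0. norm (f (z + h) - f z - h *\<^sub>R d) / norm h = norm ((f (z + h) - f z) /\<^sub>R h - d)"
    by (simp add: eventually_at_filter)
  ultimately have "((\<lambda>h. norm ((f (z + h) - f z) /\<^sub>R h - d)) \<longlongrightarrow> 0) (at 0)"
    by (rule Lim_transform_eventually)
  then have lim: "((\<lambda>h. (f (z + h) - f z) /\<^sub>R h) \<longlongrightarrow> d) (at 0)"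
    by (simp add: tendsto_norm_zero_iff LIM_zero_iff)
  then show "((\<lambda>h. (f (z + h) - f z) /\<^sub>R h) \<longlongrightarrow> d) (at_right 0)"
    by (rule filterlim_mono) (auto simp: at_le)
  have "filterlim uminus (at (0::real)) (at_right 0)"
    by (auto simp: filterlim_at eventually_at_filter intro!: tendsto_eq_intros)
  from filterlim_compose[OF lim this]
  have "((\<lambda>h. (f (z - h) - f z) /\<^sub>R - h) \<longlongrightarrow> d) (at_right 0)" by simp
  moreover have "(f (z - h) - f z) /\<^sub>R - h = (f z - f (z - h)) /\<^sub>R h" for h
    by (simp add: scaleR_diff_right)
  ultimately show "((\<lambda>h. (f z - f (z - h)) /\<^sub>R h) \<longlongrightarrow> d) (at_right 0)" by simp
qed

lemma C1_lipschitz: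
  fixes f :: "real \<Rightarrow> 'a::real_normed_vector"
  assumes "\<And>z. (f has_vector_derivative f' z) (at z)" "\<And>z. norm (f' z) \<le> K"
  shows "norm (f x - f y) \<le> K * \<bar>x - y\<bar>"
proof -
  have "norm (f x - f y) \<le> K * norm (x - y)"
    using assms by (intro differentiable_bound[of UNIV f "\<lambda>z h. h *\<^sub>R f' z"])
      (auto simp: has_vector_derivative_def onorm_scaleR_left onorm_id)
  then show ?thesis by simp
qed

lemma periodic_bounded:
  fixes f :: "real \<Rightarrow> 'a::real_normed_vector"
  assumes "continuous_on UNIV f" "periodic f"
  shows "\<exists>K\<ge>0. \<forall>z. norm (f z) \<le> K"
proof -
  have "bounded (f ` {0..1})"
    by (intro compact_imp_bounded compact_continuous_image continuous_on_subset[OF assms(1)]) auto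
  then obtain B where B: "\<And>x. x \<in> {0..1} \<Longrightarrow> norm (f x) \<le> B" unfolding bounded_iff by (metis imageI)
  have "norm (f z) \<le> B" for z
    using B[of "frac z"] periodic_frac[OF assms(2), of z] by (simp add: less_imp_le[OF frac_lt_1])
  moreover have "B \<ge> 0" using order_trans[OF norm_ge_zero B[of 0]] by simp
  ultimately show ?thesis by blast
qed

lemma smooth_periodic_lipschitz:
  assumes "smooth \<phi>" "periodic \<phi>"
  shows "\<exists>L. \<forall>x y. norm (\<phi> x - \<phi> y) \<le> L * \<bar>x - y\<bar>"
proof -
  obtain K where "\<And>z. norm (deriv \<phi> z) \<le> K"
    using periodic_bounded[OF smooth_continuous1 periodic_deriv_smooth] assms by blast
  then show ?thesis
    using C1_lipschitz[of \<phi> "deriv \<phi>" K] smooth_DERIV0[OF assms(1)]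
    by (auto simp: has_real_derivative_iff_has_vector_derivative)
qed

lemma has_weak_deriv_lipschitz:
  fixes f :: "real \<Rightarrow> 'a::euclidean_space"
  assumes f: "periodic f" "\<And>x y. norm (f x - f y) \<le> K * \<bar>x - y\<bar>"
    and f': "periodic f'" "f' \<in> borel_measurable I_measure"
      "AE z in I_measure. ((\<lambda>h. (f (z + h) - f z) /\<^sub>R h) \<longlongrightarrow> f' z) (at_right 0)"
  shows "has_weak_deriv f f'" "AE z in I_measure. norm (f' z) \<le> K"
proof -
  have int: "integrable I_measure (\<lambda>z. \<phi> z *\<^sub>R f' z)"
    and parts: "(\<integral>z. \<phi> z *\<^sub>R f' z \<partial>I_measure) = - (\<integral>z. deriv \<phi> z *\<^sub>R f z \<partial>I_measure)"
    if \<phi>: "smooth \<phi>" "periodic \<phi>" for \<phi>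
  proof -
    obtain L where L: "\<And>x y. norm (\<phi> x - \<phi> y) \<le> L * \<bar>x - y\<bar>"
      using smooth_periodic_lipschitz[OF \<phi>] by blast
    have m: "deriv \<phi> \<in> borel_measurable I_measure"
      using continuous_imp_measurable_on_sets_lebesgue[OF smooth_continuous1[OF \<phi>(1)]] by auto
    have q: "AE z in I_measure. ((\<lambda>h. (\<phi> z - \<phi> (z - h)) /\<^sub>R h) \<longlongrightarrow> deriv \<phi> z) (at_right 0)"
      using smooth_DERIV0[OF \<phi>(1)]
      by (intro AE_I2 vector_derivative_quotients) (simp add: has_real_derivative_iff_has_vector_derivative)
    show "integrable I_measure (\<lambda>z. \<phi> z *\<^sub>R f' z)"
      "(\<integral>z. \<phi> z *\<^sub>R f' z \<partial>I_measure) = - (\<integral>z. deriv \<phi> z *\<^sub>R f z \<partial>I_measure)"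
      using lipschitz_parts[OF bounded_bilinear_scaleR f f'(2,3) \<phi>(2) L m q] by blast+
  qed
  \<comment> \<open>The constant test function yields the integrability of \<open>f'\<close>
    itself.\<close>
  have "smooth (\<lambda>_. 1)" by (rule smooth_const)
  then have "integrable I_measure (\<lambda>z. 1 *\<^sub>R f' z)" by (intro int) (auto simp: periodic_def)
  then show "has_weak_deriv f f'"
    unfolding has_weak_deriv_def using f(1) f'(1) parts lipschitz_continuous[OF f(2)] I_integral_continuous(1)[of 0 1 f]
    by simp
  show "AE z in I_measure. norm (f' z) \<le> K"
    using f'(3)
  proof eventually_elim
    case (elim z)
    have "norm ((f (z + h) - f z) /\<^sub>R h) \<le> K" if "h > 0" for h
      using norm_quotient_le[OF that f(2)[of "z + h" z, simplified]] that by simp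
    then have "\<forall>\<^sub>F h in at_right 0. norm ((f (z + h) - f z) /\<^sub>R h) \<le> K"
      by (intro eventually_at_rightI[of 0 1]) auto
    then show ?case
      by (rule tendsto_upperbound[OF tendsto_norm[OF elim]]) simp
  qed
qed

section \<open>Mesh elements and piecewise estimates\<close>

lemma node_le: "node J j \<le> node J (Suc j)"
  by (simp add: node_def divide_right_mono)

abbreviation element :: "nat \<Rightarrow> nat \<Rightarrow> real set" where
  "element J j \<equiv> {node J j..node J (Suc j)}"

abbreviation open_element :: "nat \<Rightarrow> nat \<Rightarrow> real set" where
  "open_element J j \<equiv> {node J j<..<node J (Suc j)}"

lemma in_element:
  assumes "1 \<le> J"
  shows "z \<in> element J j \<longleftrightarrow> real j \<le> z * real J \<and> z * real J \<le> real j + 1"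
    "z \<in> open_element J j \<longleftrightarrow> real j < z * real J \<and> z * real J < real j + 1"
  using assms by (auto simp: node_def field_simps)

text \<open>The translates of the elements by integers tile the line. Division of the tile index by
  J identifies each tile with an element of the period, where the bound is given, and a Lipschitz
  bound on finitely many closed pieces covering an interval passes to the interval.\<close>

lemma piecewise_lipschitz:
  fixes f :: "real \<Rightarrow> 'a::real_normed_vector"
  assumes per: "periodic f" and J: "1 \<le> J" and L: "0 \<le> L"
    and lip: "\<And>j a b. j < J \<Longrightarrow> a \<in> element J j \<Longrightarrow> b \<in> element J j \<Longrightarrow> norm (f a - f b) \<le> L * \<bar>a - b\<bar>"
  shows "norm (f a - f b) \<le> L * \<bar>a - b\<bar>"
proof -
  have J0: "0 < real J" using J by simp
  define U where "U i = {real_of_int i / real J..(real_of_int i + 1) / real J}" for i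
  have Ul: "L-lipschitz_on (U i) f" for i
  proof (rule lipschitz_onI[OF _ L])
    fix a b assume ab: "a \<in> U i" "b \<in> U i"
    define q j where "q = i div int J" and "j = nat (i mod int J)"
    have j: "j < J" using J by (simp add: j_def nat_less_iff)
    have i: "real_of_int i = real_of_int q * real J + real j"
    proof -
      have "i = q * int J + int j" using J by (simp add: q_def j_def)
      then show ?thesis by (metis of_int_add of_int_mult of_int_of_nat_eq)
    qed
    have el: "x - of_int q \<in> element J j" if "x \<in> U i" for x
      using that J0 unfolding in_element(1)[OF J] U_def i by (simp add: field_simps)
    have "f x = f (x - of_int q)" for x using periodic_of_int[OF per, of "x - of_int q" q] by simp
    then show "dist (f a) (f b) \<le> L * dist a b"
      using lip[OF j el[OF ab(1)] el[OF ab(2)]] by (simp add: dist_norm dist_real_def)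
  qed
  obtain N :: nat where N: "\<bar>a\<bar> \<le> real N" "\<bar>b\<bar> \<le> real N"
    using real_arch_simple[of "max \<bar>a\<bar> \<bar>b\<bar>"] by auto
  have "L-lipschitz_on {- real N..real N} f"
  proof (rule lipschitz_on_closed_Union[of "{- int (N * J)..int (N * J)}" L U])
    show "{- real N..real N} \<subseteq> (\<Union>i\<in>{- int (N * J)..int (N * J)}. U i)"
    proof
      fix x assume x: "x \<in> {- real N..real N}"
      have "x * real J \<le> real N * real J" "- (real N * real J) \<le> x * real J"
        using x J0 mult_right_mono[of "- real N" x "real J"] by (auto intro: mult_right_mono)
      then have "- int (N * J) \<le> \<lfloor>x * real J\<rfloor>" "\<lfloor>x * real J\<rfloor> \<le> int (N * J)"
        by (simp_all add: le_floor_iff floor_le_iff)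
      moreover have "x \<in> U \<lfloor>x * real J\<rfloor>"
        using J0 unfolding U_def by (auto simp: pos_divide_le_eq pos_le_divide_eq)
      ultimately show "x \<in> (\<Union>i\<in>{- int (N * J)..int (N * J)}. U i)" by auto
    qed
  qed (use Ul L in \<open>auto simp: U_def\<close>)
  from lipschitz_onD[OF this, of a b] N show ?thesis by (auto simp: dist_norm dist_real_def abs_le_iff)
qed

lemma AE_quotient_of_increment:
  fixes f :: "real \<Rightarrow> 'a::euclidean_space"
  assumes k: "integrable I_measure k" and inc: "\<And>a b. 0 \<le> a \<Longrightarrow> a < b \<Longrightarrow> b \<le> 1 \<Longrightarrow> f b - f a = integral {a..b} k"
  shows "AE z in I_measure. ((\<lambda>h. (f (z + h) - f z) /\<^sub>R h) \<longlongrightarrow> k z) (at_right 0)"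
  using AE_right_average[OF k]
proof eventually_elim
  case (elim z)
  have "\<forall>\<^sub>F h in at_right 0. integral {z..z+h} k /\<^sub>R h = (f (z + h) - f z) /\<^sub>R h"
    by (rule eventually_at_rightI[of 0 "1 - z"]) (use elim inc[of z] in auto)
  then show ?case
    by (rule Lim_transform_eventually[OF conjunct1[OF elim]])
qed

subsection \<open>The spaces of square integrable and of bounded functions\<close>

lemma l2_inner_self: "l2_inner f f = (\<integral>z. (norm (f z))^2 \<partial>I_measure)"
  by (simp add: l2_inner_def power2_norm_eq_inner)

lemma l2_inner_self_nonneg: "0 \<le> l2_inner f f"
  by (simp add: l2_inner_self)

lemma l2_norm_power2: "(l2_norm f)^2 = l2_inner f f"
  by (simp add: l2_norm_def l2_inner_self_nonneg)

lemma l2_norm_nonneg: "0 \<le> l2_norm f"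
  by (simp add: l2_norm_def l2_inner_self_nonneg)

lemma L2_integrable_inner:
  assumes "f \<in> L2_space" "g \<in> L2_space"
  shows "integrable I_measure (\<lambda>z. f z \<bullet> g z)"
proof (rule Bochner_Integration.integrable_bound)
  show "integrable I_measure (\<lambda>z. (norm (f z))^2 + (norm (g z))^2)"
    using assms by (auto simp: L2_space_def)
  show "(\<lambda>z. f z \<bullet> g z) \<in> borel_measurable I_measure"
    using assms by (auto simp: L2_space_def)
  have "\<bar>f z \<bullet> g z\<bar> \<le> (norm (f z))^2 + (norm (g z))^2" for z
    using Cauchy_Schwarz_ineq2[of "f z" "g z"] sum_squares_bound[of "norm (f z)" "norm (g z)"]
      mult_nonneg_nonneg[OF norm_ge_zero[of "f z"] norm_ge_zero[of "g z"]]
    by linarith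
  then show "AE z in I_measure. norm (f z \<bullet> g z) \<le> norm ((norm (f z))^2 + (norm (g z))^2)"
    by (intro AE_I2) simp
qed

lemma L2_space_add: "f \<in> L2_space \<Longrightarrow> g \<in> L2_space \<Longrightarrow> (\<lambda>z. f z + g z) \<in> L2_space"
proof -
  assume fg: "f \<in> L2_space" "g \<in> L2_space"
  have "integrable I_measure (\<lambda>z. (norm (f z))^2 + 2 * (f z \<bullet> g z) + (norm (g z))^2)"
    using fg L2_integrable_inner[OF fg] by (auto simp: L2_space_def)
  then have "integrable I_measure (\<lambda>z. (norm (f z + g z))^2)"
    by (simp add: power2_norm_eq_inner inner_add inner_commute algebra_simps)
  then show ?thesis using fg by (auto simp: L2_space_def periodic_def)
qed

lemma L2_space_scale: "f \<in> L2_space \<Longrightarrow> (\<lambda>z. c *\<^sub>R f z) \<in> L2_space"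
  by (auto simp: L2_space_def periodic_def power_mult_distrib)

lemma L2_space_diff: "f \<in> L2_space \<Longrightarrow> g \<in> L2_space \<Longrightarrow> (\<lambda>z. f z - g z) \<in> L2_space"
  using L2_space_add[of f "\<lambda>z. -1 *\<^sub>R g z"] L2_space_scale[of g "-1"] by simp

lemma L2_space_continuous: "continuous_on UNIV f \<Longrightarrow> periodic f \<Longrightarrow> f \<in> L2_space"
  unfolding L2_space_def
  using continuous_imp_measurable_on_sets_lebesgue[OF continuous_on_subset, of UNIV f "{0..1}"]
  by (auto intro!: continuous_imp_integrable_real continuous_intros intro: continuous_on_subset)

lemma l2_inner_add_left: "f \<in> L2_space \<Longrightarrow> g \<in> L2_space \<Longrightarrow> k \<in> L2_space \<Longrightarrow>
    l2_inner (\<lambda>z. f z + g z) k = l2_inner f k + l2_inner g k"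
  by (simp add: l2_inner_def inner_add_left L2_integrable_inner)

lemma l2_inner_diff_left: "f \<in> L2_space \<Longrightarrow> g \<in> L2_space \<Longrightarrow> k \<in> L2_space \<Longrightarrow>
    l2_inner (\<lambda>z. f z - g z) k = l2_inner f k - l2_inner g k"
  by (simp add: l2_inner_def inner_diff_left L2_integrable_inner)

lemma l2_inner_scale_left: "l2_inner (\<lambda>z. c *\<^sub>R f z) k = c * l2_inner f k"
  by (simp add: l2_inner_def)

lemma l2_inner_commute: "l2_inner f g = l2_inner g f"
  by (simp add: l2_inner_def inner_commute)

lemma l2_Cauchy_Schwarz:
  assumes f: "f \<in> L2_space" and g: "g \<in> L2_space"
  shows "\<bar>l2_inner f g\<bar> \<le> l2_norm f * l2_norm g"
proof -
  define A B C where "A = l2_inner f f" and "B = l2_inner f g" and "C = l2_inner g g"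
  have pos: "0 \<le> A + 2 * s * B + s^2 * C" for s
  proof -
    have s: "(\<lambda>z. s *\<^sub>R g z) \<in> L2_space" by (intro L2_space_scale g)
    have "0 \<le> l2_inner (\<lambda>z. f z + s *\<^sub>R g z) (\<lambda>z. f z + s *\<^sub>R g z)"
      by (rule l2_inner_self_nonneg)
    also have "\<dots> = l2_inner f (\<lambda>z. f z + s *\<^sub>R g z) + s * l2_inner g (\<lambda>z. f z + s *\<^sub>R g z)"
      using f s by (simp add: l2_inner_add_left L2_space_add l2_inner_scale_left)
    also have "\<dots> = A + 2 * s * B + s^2 * C"
      using f g s
      by (simp add: l2_inner_commute[of _ "\<lambda>z. f z + s *\<^sub>R g z"] l2_inner_add_left l2_inner_scale_left
          A_def B_def C_def l2_inner_commute[of g f] algebra_simps power2_eq_square)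
    finally show ?thesis .
  qed
  have "B^2 \<le> A * C"
  proof (cases "C = 0")
    case True
    \<comment> \<open>If C = 0, the polynomial is affine in s, and for nonzero B the choice s = -(A
      + 1)/(2B) would give it the value -1.\<close>
    have "B = 0"
    proof (rule ccontr)
      assume "B \<noteq> 0"
      then have "2 * (- (A + 1) / (2 * B)) * B = - (A + 1)" by (simp add: field_simps)
      then show False using pos[of "- (A + 1) / (2 * B)"] True by (simp only:)
    qed
    then show ?thesis using True by simp
  next
    case False
    then have "C > 0" using l2_inner_self_nonneg[of g] by (simp add: C_def)
    then show ?thesis using pos[of "- B / C"] by (simp add: field_simps power2_eq_square)
  qed
  then have "sqrt (B^2) \<le> sqrt (A * C)" by (rule real_sqrt_le_mono)
  then show ?thesis by (simp add: l2_norm_def A_def B_def C_def real_sqrt_mult)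
qed

lemma l2_norm_triangle:
  assumes f: "f \<in> L2_space" and g: "g \<in> L2_space"
  shows "l2_norm (\<lambda>z. f z + g z) \<le> l2_norm f + l2_norm g"
proof (rule power2_le_imp_le)
  have "(l2_norm (\<lambda>z. f z + g z))^2 = l2_inner f f + 2 * l2_inner f g + l2_inner g g"
  proof -
    let ?s = "\<lambda>z. f z + g z"
    have s: "?s \<in> L2_space" by (rule L2_space_add[OF f g])
    have "l2_inner ?s ?s = l2_inner ?s f + l2_inner ?s g"
      using l2_inner_add_left[OF f g s] by (simp add: l2_inner_commute[of ?s f] l2_inner_commute[of ?s g])
    then show ?thesis
      by (simp add: l2_norm_power2 l2_inner_add_left[OF f g f] l2_inner_add_left[OF f g g] l2_inner_commute[of g f])
  qed
  also have "\<dots> \<le> (l2_norm f + l2_norm g)^2"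
    using l2_Cauchy_Schwarz[OF f g] by (simp add: power2_sum l2_norm_power2)
  finally show "(l2_norm (\<lambda>z. f z + g z))^2 \<le> (l2_norm f + l2_norm g)^2" .
qed (simp add: l2_norm_nonneg)

lemma l2_norm_AE_cong:
  assumes "AE z in I_measure. f z = g z" "f \<in> borel_measurable I_measure" "g \<in> borel_measurable I_measure"
  shows "l2_norm f = l2_norm g"
proof -
  have "l2_inner f f = l2_inner g g"
    unfolding l2_inner_def using assms by (intro integral_cong_AE) auto
  then show ?thesis by (simp add: l2_norm_def)
qed

lemma l2_norm_le_AE:
  assumes "AE z in I_measure. norm (f z) \<le> B" "0 \<le> B" "f \<in> L2_space"
  shows "l2_norm f \<le> B"
proof -
  have "(\<integral>z. (norm (f z))^2 \<partial>I_measure) \<le> (\<integral>z. B^2 \<partial>I_measure)"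
  proof (rule integral_mono_AE)
    show "integrable I_measure (\<lambda>z. (norm (f z))^2)" using assms(3) by (simp add: L2_space_def)
    show "integrable I_measure (\<lambda>z. B^2)" by (rule continuous_imp_integrable_real) simp
    show "AE z in I_measure. (norm (f z))^2 \<le> B^2"
      using assms(1) by eventually_elim (simp add: power_mono)
  qed
  also have "\<dots> = integral {0..1} (\<lambda>z::real. B^2)"
    by (rule I_integral_continuous(2)) simp
  finally have "l2_inner f f \<le> B^2" by (simp add: l2_inner_self)
  from real_sqrt_le_mono[OF this] show ?thesis
    using assms(2) by (simp add: l2_norm_def)
qed

text \<open>The two properties that \<open>second_order_space\<close> requires of its base space.
  Invariance under changes on null sets is essential because \<open>weak_deriv\<close> picks an
  arbitrary representative.\<close>

locale function_class =
  fixes P :: "(real \<Rightarrow> 'a::euclidean_space) set"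
  assumes class_diff: "f \<in> P \<Longrightarrow> g \<in> P \<Longrightarrow> (\<lambda>z. f z - g z) \<in> P"
    and class_AE: "f \<in> P \<Longrightarrow> AE z in I_measure. g z = f z \<Longrightarrow> periodic g \<Longrightarrow> integrable I_measure g \<Longrightarrow> g \<in> P"

lemma has_weak_deriv_AE:
  assumes "has_weak_deriv f k" "AE z in I_measure. g z = f z" "periodic g" "integrable I_measure g"
  shows "has_weak_deriv g k"
proof -
  have "(\<integral>z. deriv \<phi> z *\<^sub>R g z \<partial>I_measure) = (\<integral>z. deriv \<phi> z *\<^sub>R f z \<partial>I_measure)" if "smooth \<phi>" for \<phi>
  proof (rule integral_cong_AE)
    have "deriv \<phi> \<in> borel_measurable I_measure"
      using continuous_imp_measurable_on_sets_lebesgue[OF smooth_continuous1[OF that]] by auto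
    then show "(\<lambda>z. deriv \<phi> z *\<^sub>R g z) \<in> borel_measurable I_measure" "(\<lambda>z. deriv \<phi> z *\<^sub>R f z) \<in> borel_measurable I_measure"
      using assms by (auto simp: has_weak_deriv_def)
    show "AE z in I_measure. deriv \<phi> z *\<^sub>R g z = deriv \<phi> z *\<^sub>R f z"
      using assms(2) by eventually_elim simp
  qed
  then show ?thesis using assms by (simp add: has_weak_deriv_def)
qed

lemma integrable_continuous_scaleR:
  fixes f :: "real \<Rightarrow> 'a::euclidean_space"
  assumes "continuous_on UNIV \<phi>" "integrable I_measure f"
  shows "integrable I_measure (\<lambda>z. \<phi> z *\<^sub>R f z)"
proof -
  have "bounded (\<phi> ` {0..1})"
    by (intro compact_imp_bounded compact_continuous_image continuous_on_subset[OF assms(1)]) auto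
  then obtain B where B: "\<And>x. x \<in> {0..1} \<Longrightarrow> norm (\<phi> x) \<le> B" unfolding bounded_iff by (metis imageI)
  have m: "\<phi> \<in> borel_measurable I_measure"
    using continuous_imp_measurable_on_sets_lebesgue[OF continuous_on_subset[OF assms(1)]] by auto
  show ?thesis
  proof (rule Bochner_Integration.integrable_bound)
    show "integrable I_measure (\<lambda>z. B *\<^sub>R f z)" using assms(2) by simp
    show "(\<lambda>z. \<phi> z *\<^sub>R f z) \<in> borel_measurable I_measure" using m assms(2) by simp
    show "AE z in I_measure. norm (\<phi> z *\<^sub>R f z) \<le> norm (B *\<^sub>R f z)"
      by (rule AE_I2) (use B in \<open>fastforce intro: mult_right_mono\<close>)
  qed
qed

lemma has_weak_deriv_diff:
  assumes "has_weak_deriv f g" "has_weak_deriv f' g'"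
  shows "has_weak_deriv (\<lambda>z. f z - f' z) (\<lambda>z. g z - g' z)"
proof -
  have "(\<integral>z. deriv \<phi> z *\<^sub>R (f z - f' z) \<partial>I_measure) = - (\<integral>z. \<phi> z *\<^sub>R (g z - g' z) \<partial>I_measure)"
    if \<phi>: "smooth \<phi>" "periodic \<phi>" for \<phi>
  proof -
    have "(\<integral>z. deriv \<phi> z *\<^sub>R (f z - f' z) \<partial>I_measure)
        = (\<integral>z. deriv \<phi> z *\<^sub>R f z \<partial>I_measure) - (\<integral>z. deriv \<phi> z *\<^sub>R f' z \<partial>I_measure)"
      unfolding scaleR_diff_right
      by (intro Bochner_Integration.integral_diff integrable_continuous_scaleR smooth_continuous1 \<phi>)
        (use assms in \<open>auto simp: has_weak_deriv_def\<close>)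
    also have "\<dots> = - (\<integral>z. \<phi> z *\<^sub>R g z \<partial>I_measure) + (\<integral>z. \<phi> z *\<^sub>R g' z \<partial>I_measure)"
      using assms \<phi> by (simp add: has_weak_deriv_def)
    also have "\<dots> = - ((\<integral>z. \<phi> z *\<^sub>R g z \<partial>I_measure) - (\<integral>z. \<phi> z *\<^sub>R g' z \<partial>I_measure))" by simp
    also have "(\<integral>z. \<phi> z *\<^sub>R g z \<partial>I_measure) - (\<integral>z. \<phi> z *\<^sub>R g' z \<partial>I_measure) = (\<integral>z. \<phi> z *\<^sub>R (g z - g' z) \<partial>I_measure)"
      unfolding scaleR_diff_right
      by (intro Bochner_Integration.integral_diff[symmetric] integrable_continuous_scaleR smooth_continuous0 \<phi>)
        (use assms in \<open>auto simp: has_weak_deriv_def\<close>)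
    finally show ?thesis .
  qed
  then show ?thesis
    using assms by (auto simp: has_weak_deriv_def periodic_def)
qed

context function_class
begin

lemma second_orderD:
  assumes "f \<in> second_order_space P"
  shows "f \<in> P" "has_weak_deriv f (weak_deriv f)" "weak_deriv f \<in> P"
    "has_weak_deriv (weak_deriv f) (weak_deriv (weak_deriv f))" "weak_deriv (weak_deriv f) \<in> P"
proof -
  obtain g k where gk: "f \<in> P" "g \<in> P" "has_weak_deriv f g" "k \<in> P" "has_weak_deriv g k"
    using assms by (auto simp: second_order_space_def)
  show "f \<in> P" by fact
  show 1: "has_weak_deriv f (weak_deriv f)" by (rule has_weak_deriv_weak_deriv[OF gk(3)])
  have ae: "AE z in I_measure. weak_deriv f z = g z" by (rule weak_deriv_AE_eq[OF gk(3)])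
  have pi: "periodic (weak_deriv f)" "integrable I_measure (weak_deriv f)"
    using 1 by (auto simp: has_weak_deriv_def)
  show "weak_deriv f \<in> P" by (rule class_AE[OF gk(2) ae pi])
  have 2: "has_weak_deriv (weak_deriv f) k" by (rule has_weak_deriv_AE[OF gk(5) ae pi])
  show 3: "has_weak_deriv (weak_deriv f) (weak_deriv (weak_deriv f))"
    by (rule has_weak_deriv_weak_deriv[OF 2])
  show "weak_deriv (weak_deriv f) \<in> P"
    by (rule class_AE[OF gk(4) weak_deriv_AE_eq[OF 2]]) (use 3 in \<open>auto simp: has_weak_deriv_def\<close>)
qed

lemma second_order_diff:
  assumes f: "f \<in> second_order_space P" and g: "g \<in> second_order_space P"
  shows "(\<lambda>z. f z - g z) \<in> second_order_space P"
    "AE z in I_measure. weak_deriv (\<lambda>z. f z - g z) z = weak_deriv f z - weak_deriv g z"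
    "AE z in I_measure. weak_deriv (weak_deriv (\<lambda>z. f z - g z)) z = weak_deriv (weak_deriv f) z - weak_deriv (weak_deriv g) z"
proof -
  note ff = second_orderD[OF f] and gg = second_orderD[OF g]
  note d1 = has_weak_deriv_diff[OF ff(2) gg(2)] and d2 = has_weak_deriv_diff[OF ff(4) gg(4)]
  show s: "(\<lambda>z. f z - g z) \<in> second_order_space P"
    unfolding second_order_space_def using d1 d2 ff gg class_diff by blast
  show ae: "AE z in I_measure. weak_deriv (\<lambda>z. f z - g z) z = weak_deriv f z - weak_deriv g z"
    by (rule weak_deriv_AE_eq[OF d1])
  have "has_weak_deriv (weak_deriv (\<lambda>z. f z - g z)) (\<lambda>z. weak_deriv (weak_deriv f) z - weak_deriv (weak_deriv g) z)"
    by (rule has_weak_deriv_AE[OF d2 ae]) (use second_orderD(2)[OF s] in \<open>auto simp: has_weak_deriv_def\<close>)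
  then show "AE z in I_measure. weak_deriv (weak_deriv (\<lambda>z. f z - g z)) z = weak_deriv (weak_deriv f) z - weak_deriv (weak_deriv g) z"
    by (rule weak_deriv_AE_eq)
qed

end

lemma L2_space_measurable: "f \<in> L2_space \<Longrightarrow> f \<in> borel_measurable I_measure"
  by (simp add: L2_space_def)

interpretation L2: function_class L2_space
proof
  show "f \<in> L2_space \<Longrightarrow> g \<in> L2_space \<Longrightarrow> (\<lambda>z. f z - g z) \<in> L2_space" for f g :: "real \<Rightarrow> 'a"
    by (rule L2_space_diff)
  fix f g :: "real \<Rightarrow> 'a"
  assume f: "f \<in> L2_space" and ae: "AE z in I_measure. g z = f z" and g: "periodic g" "integrable I_measure g"
  have "integrable I_measure (\<lambda>z. (norm (g z))^2)"
    by (rule integrable_cong_AE_imp[of _ "\<lambda>z. (norm (f z))^2"])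
      (use f g ae in \<open>auto simp: L2_space_def elim!: eventually_mono\<close>)
  then show "g \<in> L2_space" using g by (simp add: L2_space_def)
qed

lemma Linf_space_iff:
  "f \<in> Linf_space \<longleftrightarrow> periodic f \<and> f \<in> borel_measurable I_measure \<and> (\<exists>C. AE z in I_measure. norm (f z) \<le> C)"
proof -
  have "esssup I_measure (\<lambda>z. ennreal (norm (f z))) < \<infinity> \<longleftrightarrow> (\<exists>C. AE z in I_measure. norm (f z) \<le> C)"
    if m: "f \<in> borel_measurable I_measure"
  proof
    assume fin: "esssup I_measure (\<lambda>z. ennreal (norm (f z))) < \<infinity>"
    have "AE z in I_measure. norm (f z) \<le> enn2real (esssup I_measure (\<lambda>z. ennreal (norm (f z))))"
      using esssup_AE[of "\<lambda>z. ennreal (norm (f z))" I_measure]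
      by eventually_elim (use fin enn2real_mono in fastforce)
    then show "\<exists>C. AE z in I_measure. norm (f z) \<le> C" by blast
  next
    assume "\<exists>C. AE z in I_measure. norm (f z) \<le> C"
    then obtain C where "AE z in I_measure. norm (f z) \<le> C" by blast
    then have "AE z in I_measure. ennreal (norm (f z)) \<le> ennreal C"
      by eventually_elim (rule ennreal_leI)
    then have "esssup I_measure (\<lambda>z. ennreal (norm (f z))) \<le> ennreal C"
      using m by (intro esssup_I) auto
    also have "\<dots> < \<infinity>" by simp
    finally show "esssup I_measure (\<lambda>z. ennreal (norm (f z))) < \<infinity>" .
  qed
  then show ?thesis by (auto simp: Linf_space_def)
qed

lemma linf_norm_AE:
  assumes "f \<in> Linf_space"
  shows "AE z in I_measure. norm (f z) \<le> linf_norm f"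
  using esssup_AE[of "\<lambda>z. ennreal (norm (f z))" I_measure]
proof eventually_elim
  case (elim z)
  have "enn2real (ennreal (norm (f z))) \<le> linf_norm f"
    unfolding linf_norm_def by (rule enn2real_mono[OF elim]) (use assms in \<open>simp add: Linf_space_def\<close>)
  then show ?case by simp
qed

lemma linf_norm_nonneg: "0 \<le> linf_norm f"
  by (simp add: linf_norm_def)

interpretation Linf: function_class Linf_space
proof
  fix f g :: "real \<Rightarrow> 'a"
  assume fg: "f \<in> Linf_space" "g \<in> Linf_space"
  have "AE z in I_measure. norm (f z - g z) \<le> linf_norm f + linf_norm g"
    using linf_norm_AE[OF fg(1)] linf_norm_AE[OF fg(2)]
    by eventually_elim (meson add_mono norm_triangle_ineq4 order_trans)
  then show "(\<lambda>z. f z - g z) \<in> Linf_space"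
    using fg by (auto simp: Linf_space_iff periodic_def)
next
  fix f g :: "real \<Rightarrow> 'a"
  assume f: "f \<in> Linf_space" and ae: "AE z in I_measure. g z = f z" and g: "periodic g" "integrable I_measure g"
  have "AE z in I_measure. norm (g z) \<le> linf_norm f"
    using linf_norm_AE[OF f] ae by eventually_elim simp
  then show "g \<in> Linf_space" using g by (auto simp: Linf_space_iff)
qed

lemma Linf_subset_L2: "Linf_space \<subseteq> L2_space"
proof
  fix f :: "real \<Rightarrow> 'a" assume f: "f \<in> Linf_space"
  have "integrable I_measure (\<lambda>z. (norm (f z))^2)"
  proof (rule Bochner_Integration.integrable_bound)
    show "integrable I_measure (\<lambda>_. (linf_norm f)^2)" by (rule continuous_imp_integrable_real) simp
    show "(\<lambda>z. (norm (f z))^2) \<in> borel_measurable I_measure"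
    proof -
      have "f \<in> borel_measurable I_measure" using f by (simp add: Linf_space_def)
      then show ?thesis by simp
    qed
    show "AE z in I_measure. norm ((norm (f z))^2) \<le> norm ((linf_norm f)^2)"
      using linf_norm_AE[OF f] by eventually_elim (simp add: power_mono)
  qed
  then show "f \<in> L2_space" using f by (auto simp: Linf_space_def L2_space_def)
qed

lemma AE_le_continuous:
  fixes f :: "real \<Rightarrow> real"
  assumes f: "continuous_on UNIV f" "periodic f" and ae: "AE z in I_measure. f z \<le> C"
  shows "f z \<le> C"
proof -
  have "f z \<le> C" if z: "0 \<le> z" "z < 1" for z
  proof (rule ccontr)
    assume "\<not> f z \<le> C"
    then have "z \<in> f -` {C<..}" by simp
    moreover have "open (f -` {C<..})" by (intro open_vimage f(1)) auto
    ultimately obtain d where d: "d > 0" "\<And>\<sigma>. dist \<sigma> z < d \<Longrightarrow> f \<sigma> > C"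
      unfolding open_dist by (metis greaterThan_iff vimageE)
    have "AE \<sigma> in lebesgue. \<sigma> \<in> {0..1} \<longrightarrow> f \<sigma> \<le> C"
      using ae by (simp add: AE_restrict_space_iff)
    then have "{\<sigma>. \<not> (\<sigma> \<in> {0..1} \<longrightarrow> f \<sigma> \<le> C)} \<in> null_sets lebesgue"
      by (simp add: completion.AE_iff_null_sets)
    then have "{z<..<min (z + d) 1} \<in> null_sets lebesgue"
    proof (rule null_sets_completion_subset[rotated])
      show "{z<..<min (z + d) 1} \<subseteq> {\<sigma>. \<not> (\<sigma> \<in> {0..1} \<longrightarrow> f \<sigma> \<le> C)}"
      proof
        fix \<sigma> assume \<sigma>: "\<sigma> \<in> {z<..<min (z + d) 1}"
        then have "f \<sigma> > C" by (intro d(2)) (auto simp: dist_real_def)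
        then show "\<sigma> \<in> {\<sigma>. \<not> (\<sigma> \<in> {0..1} \<longrightarrow> f \<sigma> \<le> C)}" using \<sigma> z by auto
      qed
    qed
    then show False
      using d z negligible_interval(2)[of z "min (z + d) 1"] by (auto simp: negligible_iff_null_sets box_real)
  qed
  from this[of "frac z"] show ?thesis
    using periodic_frac[OF f(2), of z] by (simp add: frac_lt_1)
qed

text \<open>The norm is the Euclidean length of the triple of L2 norms, so the reverse triangle
  inequality is applied in each entry and then to the triple. Weak derivatives of a difference agree
  with the differences only almost everywhere, which the L2 norms do not notice.\<close>

lemma h2_norm_diff_le:
  assumes f: "f \<in> H2_space" and g: "g \<in> H2_space"
  shows "\<bar>h2_norm f - h2_norm g\<bar> \<le> h2_norm (\<lambda>z. f z - g z)"
proof -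
  define v where "v f = (l2_norm f, l2_norm (weak_deriv f), l2_norm (weak_deriv (weak_deriv f)))" for f :: "real \<Rightarrow> 'a"
  have vn: "h2_norm f = norm (v f)" for f
    by (simp add: h2_norm_def v_def norm_Pair add.assoc)
  note L2 = L2.second_orderD[folded H2_space_def] and diff = L2.second_order_diff[folded H2_space_def]
  have tri: "\<bar>l2_norm f - l2_norm g\<bar> \<le> l2_norm (\<lambda>z. f z - g z)" if "f \<in> L2_space" "g \<in> L2_space" for f g :: "real \<Rightarrow> 'a"
    using l2_norm_triangle[OF L2_space_diff[OF that] that(2)] l2_norm_triangle[OF L2_space_diff[OF that(2,1)] that(1)]
    by (simp add: l2_norm_def l2_inner_self norm_minus_commute)
  have ms: "\<And>f::real \<Rightarrow> 'a. f \<in> H2_space \<Longrightarrow> weak_deriv f \<in> borel_measurable I_measure"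
    "\<And>f::real \<Rightarrow> 'a. f \<in> H2_space \<Longrightarrow> weak_deriv (weak_deriv f) \<in> borel_measurable I_measure"
    using L2(3,5) L2_space_measurable by blast+
  have d1: "l2_norm (weak_deriv (\<lambda>z. f z - g z)) = l2_norm (\<lambda>z. weak_deriv f z - weak_deriv g z)"
    by (rule l2_norm_AE_cong[OF diff(2)[OF f g]]) (use ms f g diff(1)[OF f g] in auto)
  have d2: "l2_norm (weak_deriv (weak_deriv (\<lambda>z. f z - g z))) = l2_norm (\<lambda>z. weak_deriv (weak_deriv f) z - weak_deriv (weak_deriv g) z)"
    by (rule l2_norm_AE_cong[OF diff(3)[OF f g]]) (use ms f g diff(1)[OF f g] in auto)
  have mono3: "norm (a, b, c) \<le> norm (a', b', c')" if "\<bar>a\<bar> \<le> a'" "\<bar>b\<bar> \<le> b'" "\<bar>c\<bar> \<le> c'" for a b c a' b' c' :: real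
  proof -
    have "a^2 \<le> a'^2" "b^2 \<le> b'^2" "c^2 \<le> c'^2"
      using that by (auto intro!: abs_le_square_iff[THEN iffD1])
    then show ?thesis by (simp add: norm_Pair)
  qed
  have "\<bar>norm (v f) - norm (v g)\<bar> \<le> norm (v f - v g)" by (rule norm_triangle_ineq3)
  also have "\<dots> \<le> norm (v (\<lambda>z. f z - g z))"
    unfolding v_def diff_Pair d1 d2
    by (intro mono3 tri L2 f g)
  finally show ?thesis by (simp add: vn)
qed

subsection \<open>Time dependent functions\<close>

abbreviation window :: "real \<Rightarrow> (real \<Rightarrow> real) \<Rightarrow> real \<Rightarrow> real \<Rightarrow> real" where
  "window T G s t \<equiv> \<integral>r. indicator {s<..<t} r * G r \<partial>time_measure T"

lemma time_integral_continuous: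
  fixes f :: "real \<Rightarrow> real"
  assumes "continuous_on {0..T} f"
  shows "integrable (time_measure T) f" "(\<integral>t. f t \<partial>time_measure T) = integral {0..T} f"
proof -
  have "f absolutely_integrable_on {0..T}"
    using assms by (rule absolutely_integrable_continuous_real)
  then have "f absolutely_integrable_on {0<..<T}"
    by (rule set_integrable_subset) auto
  then show 1: "integrable (time_measure T) f"
    by (rule absolutely_integrable_imp_integrable) simp
  have "(\<integral>t. f t \<partial>time_measure T) = integral {0<..<T} f"
    by (rule lebesgue_integral_eq_integral[OF 1]) simp
  then show "(\<integral>t. f t \<partial>time_measure T) = integral {0..T} f"
    using integral_open_interval_real[of 0 T f] by (simp add: box_real)
qed

text \<open>The derivative of a plateau on (s, t) tests f against unit kernels near s and near t, so
  the tested quantity comes arbitrarily close to the increment up to sign.\<close>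

lemma time_increment_bound:
  fixes f :: "real \<Rightarrow> real"
  assumes f: "continuous_on {0..T} f" and st: "0 \<le> s" "s < t" "t \<le> T"
    and test: "\<And>\<phi>. \<lbrakk>smooth \<phi>; \<And>r. 0 \<le> \<phi> r \<and> \<phi> r \<le> 1;
      \<exists>a b. s < a \<and> b < t \<and> (\<forall>r. r \<notin> {a..b} \<longrightarrow> \<phi> r = 0)\<rbrakk> \<Longrightarrow> \<bar>\<integral>r. deriv \<phi> r * f r \<partial>time_measure T\<bar> \<le> C"
  shows "\<bar>f t - f s\<bar> \<le> C"
proof (rule field_le_epsilon)
  fix \<omega> :: real assume "\<omega> > 0"
  have near: "\<exists>d>0. \<forall>r\<in>{0..T}. dist r y < d \<longrightarrow> dist (f r) (f y) < \<omega> / 2" if "y \<in> {0..T}" for y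
    using f that \<open>\<omega> > 0\<close> unfolding continuous_on_iff by (meson half_gt_zero)
  obtain d1 where d1: "d1 > 0" "\<And>r. r \<in> {0..T} \<Longrightarrow> dist r s < d1 \<Longrightarrow> dist (f r) (f s) < \<omega> / 2"
    using near[of s] st by auto
  obtain d2 where d2: "d2 > 0" "\<And>r. r \<in> {0..T} \<Longrightarrow> dist r t < d2 \<Longrightarrow> dist (f r) (f t) < \<omega> / 2"
    using near[of t] st by auto
  \<comment> \<open>A quarter of the length leaves room for a margin e and a ramp e on either side;
    a third of the continuity radius keeps both kernels, which reach a distance 2 e from the end
    points, inside it.\<close>
  define e where "e = min (min d1 d2 / 3) ((t - s) / 4)"
  have e: "e > 0" "2 * e < d1" "2 * e < d2" "4 * e \<le> t - s"
    using d1(1) d2(1) st by (auto simp: e_def min_def)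
  define \<phi> where "\<phi> = plateau (s + e) (t - e) e"
  have w: "2 * e \<le> (t - e) - (s + e)" using e by simp
  have "\<phi> r = 0" if "r \<notin> {s + e..t - e}" for r
    unfolding \<phi>_def by (rule plateau_0[OF e(1) w]) (use that in auto)
  then have "\<exists>a b. s < a \<and> b < t \<and> (\<forall>r. r \<notin> {a..b} \<longrightarrow> \<phi> r = 0)"
    using e(1) by (intro exI[of _ "s + e"] exI[of _ "t - e"] conjI allI impI) simp_all
  then have "\<bar>\<integral>r. deriv \<phi> r * f r \<partial>time_measure T\<bar> \<le> C"
    using smooth_plateau[OF e(1)] plateau_nonneg[OF e(1) w] plateau_le_1[OF e(1) w]
    by (intro test) (simp_all add: \<phi>_def)
  moreover have "(\<integral>r. deriv \<phi> r * f r \<partial>time_measure T)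
      = integral {0..T} (\<lambda>r. mollifier e (s + e) r * f r) - integral {0..T} (\<lambda>r. mollifier e (t - e - e) r * f r)"
  proof -
    have d: "deriv \<phi> r * f r = mollifier e (s + e) r * f r - mollifier e (t - e - e) r * f r" for r
      by (simp add: \<phi>_def deriv_plateau[OF e(1)] algebra_simps)
    have "(\<integral>r. deriv \<phi> r * f r \<partial>time_measure T) = integral {0..T} (\<lambda>r. deriv \<phi> r * f r)"
      unfolding d by (intro time_integral_continuous continuous_intros mollifier_continuous e f)
    then show ?thesis
      unfolding d
      by (simp add: HK_integral_diff integrable_continuous_real continuous_intros mollifier_continuous e f)
  qed
  moreover have "norm (integral {0..T} (\<lambda>r. mollifier e (s + e) r *\<^sub>R f r) - f s) \<le> \<omega> / 2"
    by (intro mollifier_approx e f) (use e st d1(2) in \<open>auto simp: dist_real_def intro!: less_imp_le\<close>)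
  moreover have "norm (integral {0..T} (\<lambda>r. mollifier e (t - e - e) r *\<^sub>R f r) - f t) \<le> \<omega> / 2"
    by (intro mollifier_approx e f) (use e st d2(2) in \<open>auto simp: dist_real_def intro!: less_imp_le\<close>)
  ultimately show "\<bar>f t - f s\<bar> \<le> C + \<omega>" by (simp only: real_norm_def real_scaleR_def)
qed

text \<open>A function that is not integrable has Bochner integral 0 by convention, so the bound
  also covers pairings in time about whose measurability nothing is known.\<close>

lemma norm_integral_le_AE:
  fixes f :: "'b \<Rightarrow> 'a::{banach, second_countable_topology}"
  assumes "integrable M g" "AE x in M. norm (f x) \<le> g x"
  shows "norm (\<integral>x. f x \<partial>M) \<le> (\<integral>x. g x \<partial>M)"
proof (cases "integrable M f")
  case True
  have "norm (\<integral>x. f x \<partial>M) \<le> (\<integral>x. norm (f x) \<partial>M)" by (rule integral_norm_bound)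
  also have "\<dots> \<le> (\<integral>x. g x \<partial>M)" using True assms by (intro integral_mono_AE) auto
  finally show ?thesis .
next
  case False
  have "AE x in M. 0 \<le> g x" using assms(2) by eventually_elim (rule order_trans[OF norm_ge_zero])
  then have "0 \<le> (\<integral>x. g x \<partial>M)" by (rule integral_nonneg_AE)
  then show ?thesis using False by (simp add: not_integrable_integral_eq)
qed

lemma time_indicator_integrable:
  fixes G :: "real \<Rightarrow> real"
  assumes "integrable (time_measure T) G" "0 \<le> s" "t \<le> T"
  shows "integrable (time_measure T) (\<lambda>r. indicator {s<..<t} r * G r)"
proof -
  have "{s<..<t} \<subseteq> {0<..<T}" using assms by auto
  then have "{s<..<t} \<in> sets (time_measure T)" by (simp add: sets_restrict_space_iff)
  from integrable_mult_indicator[OF this assms(1)] show ?thesis by simp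
qed

text \<open>The pairing is compared with the linear function with slope c. With c = 0 this bounds an
  increment; with c the pairing at the final time it bounds the defect of a difference quotient. For
  other c than 0 the integral of the pairing has to be split, hence the alternative of
  continuity.\<close>

lemma time_pairing_bound:
  assumes wd: "has_weak_time_deriv T u v" and \<psi>: "\<psi> \<in> L2_space"
    and cont: "continuous_on {0..T} (\<lambda>r. l2_inner (u r) \<psi>)"
    and st: "0 \<le> s" "s < t" "t \<le> T"
    and c: "c = 0 \<or> continuous_on {0..T} (\<lambda>r. l2_inner (v r) \<psi>)"
    and G: "integrable (time_measure T) G"
      "AE r in time_measure T. r \<in> {s<..<t} \<longrightarrow> \<bar>l2_inner (v r) \<psi> - c\<bar> \<le> G r"
  shows "\<bar>l2_inner (u t) \<psi> - l2_inner (u s) \<psi> - c * (t - s)\<bar> \<le> (window T G s t)"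
proof -
  define f where "f r = l2_inner (u r) \<psi> - c * r" for r
  have cf: "continuous_on {0..T} f" unfolding f_def by (intro continuous_intros cont)
  have "\<bar>f t - f s\<bar> \<le> (window T G s t)"
  proof (rule time_increment_bound[OF cf st])
    fix \<phi> assume \<phi>: "smooth \<phi>" "\<And>r. 0 \<le> \<phi> r \<and> \<phi> r \<le> 1"
      "\<exists>a b. s < a \<and> b < t \<and> (\<forall>r. r \<notin> {a..b} \<longrightarrow> \<phi> r = 0)"
    obtain a b where ab: "s < a" "b < t" "\<And>r. r \<notin> {a..b} \<Longrightarrow> \<phi> r = 0" using \<phi>(3) by blast
    have i1: "(\<integral>r. deriv \<phi> r * l2_inner (u r) \<psi> \<partial>time_measure T) = - (\<integral>r. \<phi> r * l2_inner (v r) \<psi> \<partial>time_measure T)"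
    proof -
      have "0 < a \<and> b < T" using ab st by auto
      then show ?thesis using wd \<phi>(1) ab(3) \<psi> unfolding has_weak_time_deriv_def by blast
    qed
    have i2: "(\<integral>r. deriv \<phi> r * (c * r) \<partial>time_measure T) = - (\<integral>r. \<phi> r * c \<partial>time_measure T)"
    proof -
      have "((\<lambda>r. deriv \<phi> r * (c * r) + \<phi> r * c) has_integral (\<phi> T * (c * T) - \<phi> 0 * (c * 0))) {0..T}"
        using st by (intro fundamental_theorem_of_calculus)
          (auto intro!: derivative_eq_intros smooth_DERIV0[OF \<phi>(1), THEN has_field_derivative_at_within]
            simp: has_real_derivative_iff_has_vector_derivative[symmetric])
      moreover have "\<phi> T = 0" using ab(2,3) st by auto
      ultimately have "integral {0..T} (\<lambda>r. deriv \<phi> r * (c * r) + \<phi> r * c) = 0"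
        by (simp add: integral_unique)
      then have "integral {0..T} (\<lambda>r. deriv \<phi> r * (c * r)) + integral {0..T} (\<lambda>r. \<phi> r * c) = 0"
        by (subst (asm) HK_integral_add)
          (intro integrable_continuous_real continuous_intros smooth_continuous0 smooth_continuous1 \<phi>(1))+
      moreover have "(\<integral>r. deriv \<phi> r * (c * r) \<partial>time_measure T) = integral {0..T} (\<lambda>r. deriv \<phi> r * (c * r))"
        by (intro time_integral_continuous continuous_intros smooth_continuous1 \<phi>(1))
      moreover have "(\<integral>r. \<phi> r * c \<partial>time_measure T) = integral {0..T} (\<lambda>r. \<phi> r * c)"
        by (intro time_integral_continuous continuous_intros smooth_continuous0 \<phi>(1))
      ultimately show ?thesis by linarith
    qed
    have "(\<integral>r. deriv \<phi> r * f r \<partial>time_measure T)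
        = (\<integral>r. deriv \<phi> r * l2_inner (u r) \<psi> \<partial>time_measure T) - (\<integral>r. deriv \<phi> r * (c * r) \<partial>time_measure T)"
      unfolding f_def right_diff_distrib
      by (intro Bochner_Integration.integral_diff time_integral_continuous continuous_intros smooth_continuous1 \<phi>(1) cont)
    also have "\<dots> = - ((\<integral>r. \<phi> r * l2_inner (v r) \<psi> \<partial>time_measure T) - (\<integral>r. \<phi> r * c \<partial>time_measure T))"
      unfolding i1 i2 by simp
    also have "(\<integral>r. \<phi> r * l2_inner (v r) \<psi> \<partial>time_measure T) - (\<integral>r. \<phi> r * c \<partial>time_measure T)
        = (\<integral>r. \<phi> r * (l2_inner (v r) \<psi> - c) \<partial>time_measure T)"
      using c
    proof
      assume "continuous_on {0..T} (\<lambda>r. l2_inner (v r) \<psi>)"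
      then show ?thesis
        unfolding right_diff_distrib
        by (intro Bochner_Integration.integral_diff[symmetric] time_integral_continuous continuous_intros smooth_continuous0[OF \<phi>(1)])
    qed simp
    finally have "\<bar>\<integral>r. deriv \<phi> r * f r \<partial>time_measure T\<bar> = norm (\<integral>r. \<phi> r * (l2_inner (v r) \<psi> - c) \<partial>time_measure T)"
      by simp
    also have "\<dots> \<le> (window T G s t)"
    proof (rule norm_integral_le_AE)
      show "integrable (time_measure T) (\<lambda>r. indicator {s<..<t} r * G r)"
        using G(1) st by (intro time_indicator_integrable) auto
      show "AE r in time_measure T. norm (\<phi> r * (l2_inner (v r) \<psi> - c)) \<le> indicator {s<..<t} r * G r"
        using G(2)
      proof eventually_elim
        case (elim r)
        show ?case
        proof (cases "r \<in> {s<..<t}")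
          case True
          then have "\<phi> r * \<bar>l2_inner (v r) \<psi> - c\<bar> \<le> 1 * G r"
            using elim \<phi>(2)[of r] by (intro mult_mono) auto
          then show ?thesis using True \<phi>(2)[of r] by (simp add: abs_mult)
        next
          case False
          then have "\<phi> r = 0" using ab by auto
          then show ?thesis using False by simp
        qed
      qed
    qed
    finally show "\<bar>\<integral>r. deriv \<phi> r * f r \<partial>time_measure T\<bar> \<le> (window T G s t)" .
  qed
  then show ?thesis by (simp add: f_def algebra_simps)
qed

text \<open>G is the limit of the norms of the simple approximations: it is measurable, agrees
  almost everywhere with the norm of u, and the absolute value makes it nonnegative also where the
  limit is a mere default.\<close>

lemma L2_time_norm_bound:
  assumes u: "u \<in> L2_time T V N" and N: "\<And>f. 0 \<le> N f"
    and tri: "\<And>f g. f \<in> V \<Longrightarrow> g \<in> V \<Longrightarrow> \<bar>N f - N g\<bar> \<le> N (\<lambda>z. f z - g z)"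
  shows "\<exists>G. (\<forall>t. 0 \<le> G t) \<and> G \<in> borel_measurable (time_measure T) \<and> integrable (time_measure T) (\<lambda>t. (G t)^2) \<and>
    (AE t in time_measure T. u t \<in> V \<and> N (u t) = G t)"
proof -
  obtain S where S: "AE t in time_measure T. u t \<in> V"
    "\<And>n. simple_function (time_measure T) (S n)" "\<And>n t. t \<in> {0<..<T} \<Longrightarrow> S n t \<in> V"
    "AE t in time_measure T. (\<lambda>n. N (\<lambda>z. S n t z - u t z)) \<longlonglongrightarrow> 0"
    and fin: "(\<integral>\<^sup>+ t. ennreal ((N (u t))^2) \<partial>time_measure T) < \<infinity>"
    using u unfolding L2_time_def strongly_measurable_time_def by blast
  define G where "G t = \<bar>lim (\<lambda>n. N (S n t))\<bar>" for t
  have "(\<lambda>t. N (S n t)) \<in> borel_measurable (time_measure T)" for n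
    using simple_function_compose1[OF S(2), of N] by (rule borel_measurable_simple_function)
  then have Gm: "G \<in> borel_measurable (time_measure T)"
    unfolding G_def by (intro borel_measurable_abs borel_measurable_lim_metric)
  have "AE t in time_measure T. t \<in> {0<..<T}" by (rule AE_I2) simp
  with S(1,4) have ae: "AE t in time_measure T. u t \<in> V \<and> N (u t) = G t"
  proof eventually_elim
    case (elim t)
    have "(\<lambda>n. N (S n t) - N (u t)) \<longlonglongrightarrow> 0"
      by (rule Lim_null_comparison[OF always_eventually elim(2)]) (use tri S(3)[OF elim(3)] elim(1) in auto)
    then have "(\<lambda>n. N (S n t)) \<longlonglongrightarrow> N (u t)" by (simp add: LIM_zero_iff)
    then show ?case using elim(1) N[of "u t"] by (simp add: G_def limI)
  qed
  have "(\<integral>\<^sup>+ t. ennreal ((G t)^2) \<partial>time_measure T) = (\<integral>\<^sup>+ t. ennreal ((N (u t))^2) \<partial>time_measure T)"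
  proof (rule nn_integral_cong_AE)
    show "AE t in time_measure T. ennreal ((G t)^2) = ennreal ((N (u t))^2)"
      using ae by eventually_elim simp
  qed
  then have "integrable (time_measure T) (\<lambda>t. (G t)^2)"
    using fin Gm by (intro integrableI_nonneg) auto
  then show ?thesis using Gm ae by (intro exI[of _ G]) (auto simp: G_def)
qed

lemma I_measurable_continuous:
  fixes f :: "real \<Rightarrow> 'a::euclidean_space"
  assumes "continuous_on UNIV f"
  shows "f \<in> borel_measurable I_measure"
  using continuous_imp_measurable_on_sets_lebesgue[OF continuous_on_subset[OF assms], of "{0..1}"] by auto

lemma compact_uniform_bound:
  assumes S: "compact (S :: real set)"
    and loc: "\<And>s. s \<in> S \<Longrightarrow> \<exists>d>0. \<exists>B. \<forall>t\<in>S. dist t s < d \<longrightarrow> P t (B :: real)"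
    and mono: "\<And>t B B'. P t B \<Longrightarrow> B \<le> B' \<Longrightarrow> P t B'"
  shows "\<exists>B. \<forall>t\<in>S. P t B"
proof -
  have "\<forall>s. \<exists>d B. s \<in> S \<longrightarrow> d > 0 \<and> (\<forall>t\<in>S. dist t s < d \<longrightarrow> P t B)" using loc by blast
  then obtain d B where dB: "\<And>s. s \<in> S \<Longrightarrow> d s > 0" "\<And>s t. s \<in> S \<Longrightarrow> t \<in> S \<Longrightarrow> dist t s < d s \<Longrightarrow> P t (B s)"
    by metis
  have "S \<subseteq> (\<Union>s\<in>S. ball s (d s))" using dB(1) by auto
  from compactE_image[OF S _ this] obtain C where C: "C \<subseteq> S" "finite C" "S \<subseteq> (\<Union>s\<in>C. ball s (d s))"
    by auto
  have "P t (Max (insert 0 (B ` C)))" if "t \<in> S" for t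
  proof -
    obtain s where s: "s \<in> C" "dist t s < d s" using C(3) \<open>t \<in> S\<close> by (auto simp: dist_commute)
    then have "P t (B s)" using dB(2) C(1) \<open>t \<in> S\<close> by blast
    then show ?thesis by (rule mono) (use s C(2) in auto)
  qed
  then show ?thesis by blast
qed

text \<open>By the mean value theorem each component has a critical point in every period, so the
  oscillation of the derivative bounds the component itself. The factor 2 counts the
  components.\<close>

lemma periodic_derivative_bound:
  fixes f :: "real \<Rightarrow> real^2"
  assumes f: "periodic f" "\<And>z. (f has_vector_derivative f' z) (at z)"
    and osc: "\<And>a b i. a \<le> b \<Longrightarrow> b \<le> a + 1 \<Longrightarrow> norm (f' a - f' b) \<le> K"
  shows "norm (f' a) \<le> 2 * K"
proof -
  have "\<bar>f' a $ i\<bar> \<le> K" for i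
  proof -
    have d: "((\<lambda>z. f z $ i) has_real_derivative f' z $ i) (at z)" for z
      using bounded_linear.has_vector_derivative[OF bounded_linear_vec_nth f(2)]
      by (simp add: has_real_derivative_iff_has_vector_derivative)
    obtain \<xi> where \<xi>: "a < \<xi>" "\<xi> < a + 1" "f (a + 1) $ i - f a $ i = (a + 1 - a) * (f' \<xi> $ i)"
      using MVT2[of a "a + 1" "\<lambda>z. f z $ i" "\<lambda>z. f' z $ i"] d by auto
    then have "f' \<xi> $ i = 0" using f(1) by (simp add: periodic_def)
    then have "\<bar>f' a $ i\<bar> = \<bar>(f' a - f' \<xi>) $ i\<bar>" by simp
    also have "\<dots> \<le> norm (f' a - f' \<xi>)" by (rule component_le_norm_cart)
    also have "\<dots> \<le> K" using osc \<xi> by simp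
    finally show ?thesis .
  qed
  then have "(\<Sum>i\<in>UNIV. \<bar>f' a $ i\<bar>) \<le> (\<Sum>i\<in>(UNIV :: 2 set). K)" by (intro sum_mono)
  then show ?thesis using norm_le_l1_cart[of "f' a"] by simp
qed

lemma periodic_d_rho:
  assumes "periodic f" "\<And>z. (f has_vector_derivative f' z) (at z)"
  shows "periodic f'"
  unfolding periodic_def
proof
  fix s
  have "((\<lambda>x. x + 1) has_vector_derivative 1) (at s)"
    by (auto intro!: derivative_eq_intros simp: has_real_derivative_iff_has_vector_derivative[symmetric])
  from vector_diff_chain_at[OF this assms(2)]
  have "((\<lambda>x. f (x + 1)) has_vector_derivative f' (s + 1)) (at s)"
    by (simp add: o_def)
  moreover have "(\<lambda>x. f (x + 1)) = f" using assms(1) by (auto simp: periodic_def)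
  ultimately show "f' (s + 1) = f' s" using assms(2) vector_derivative_unique_at by metis
qed

section \<open>Bounded second weak derivatives give Lipschitz first derivatives\<close>

lemma antiderivative_exists:
  fixes f :: "real \<Rightarrow> 'a::euclidean_space"
  assumes f: "continuous_on UNIV f"
  shows "\<exists>F. \<forall>x. (F has_vector_derivative f x) (at x)"
proof (intro exI allI)
  let ?F = "\<lambda>x. integral {- (\<bar>x\<bar> + 1)..x} f - integral {- (\<bar>x\<bar> + 1)..0} f"
  fix x :: real
  define R where "R = \<bar>x\<bar> + 2"
  have i: "f integrable_on {a..b}" for a b by (intro integrable_continuous_real continuous_on_subset[OF f]) auto
  have "((\<lambda>y. integral {- R..y} f) has_vector_derivative f x) (at x within {- R..R})"
    by (rule integral_has_vector_derivative) (auto simp: R_def intro: continuous_on_subset[OF f])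
  then have "((\<lambda>y. integral {- R..y} f) has_vector_derivative f x) (at x)"
    by (subst (asm) at_within_Icc_at) (auto simp: R_def)
  then have "((\<lambda>y. integral {- R..y} f - integral {- R..0} f) has_vector_derivative f x) (at x)"
    using has_vector_derivative_diff[OF _ has_vector_derivative_const] by fastforce
  then show "(?F has_vector_derivative f x) (at x)"
  proof (rule has_vector_derivative_transform_within_open[of _ _ _ "{x - 1<..<x + 1}"])
    fix y assume "y \<in> {x - 1<..<x + 1}"
    then have "- R \<le> - (\<bar>y\<bar> + 1)" "- (\<bar>y\<bar> + 1) \<le> y" "- (\<bar>y\<bar> + 1) \<le> 0" by (auto simp: R_def)
    then have "integral {- R..- (\<bar>y\<bar> + 1)} f + integral {- (\<bar>y\<bar> + 1)..z} f = integral {- R..z} f" if "z = y \<or> z = 0" for z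
      using that by (intro HK_integral_combine i) auto
    from this[of y, symmetric] this[of 0, symmetric] show "integral {- R..y} f - integral {- R..0} f = ?F y" by simp
  qed auto
qed

lemma smooth_antiderivative:
  assumes \<psi>: "smooth \<psi>" "periodic \<psi>" "integral {0..1} \<psi> = 0"
  shows "\<exists>\<phi>. smooth \<phi> \<and> periodic \<phi> \<and> deriv \<phi> = \<psi>"
proof -
  obtain \<phi> where \<phi>: "\<And>s. (\<phi> has_real_derivative \<psi> s) (at s)"
    using antiderivative_exists[OF smooth_continuous0[OF \<psi>(1)]] by (auto simp: has_real_derivative_iff_has_vector_derivative)
  then have d: "deriv \<phi> = \<psi>" by (auto intro: DERIV_imp_deriv)
  have "(deriv ^^ n) \<phi> field_differentiable at s" for n s
  proof (cases n)
    case 0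
    then show ?thesis using \<phi> by (auto simp: field_differentiable_def)
  next
    case (Suc m)
    then show ?thesis using \<psi>(1) by (simp add: smooth_def funpow_Suc_right d del: funpow.simps)
  qed
  moreover have "\<phi> (s + 1) - \<phi> s = 0" for s
  proof -
    have "((\<lambda>s. \<phi> (s + 1) - \<phi> s) has_real_derivative \<psi> (s + 1) - \<psi> s) (at s)" for s
      using DERIV_diff[OF DERIV_shift[THEN iffD1, OF \<phi>] \<phi>] .
    then have "\<phi> (s + 1) - \<phi> s = \<phi> (0 + 1) - \<phi> 0"
      using \<psi>(2) by (intro DERIV_isconst_all) (simp add: periodic_def)
    moreover have "integral {0..1} \<psi> = \<phi> 1 - \<phi> 0"
      by (rule integral_unique, rule fundamental_theorem_of_calculus)
        (auto simp: has_real_derivative_iff_has_vector_derivative[symmetric] intro: has_field_derivative_at_within[OF \<phi>])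
    ultimately show ?thesis using \<psi>(3) by simp
  qed
  ultimately show ?thesis using d by (auto simp: smooth_def periodic_def)
qed

lemma smooth_minus_const:
  assumes "smooth \<psi>"
  shows "smooth (\<lambda>s. \<psi> s - c)"
proof -
  have "smooth ((\<lambda>n s. (deriv ^^ n) \<psi> s - (if n = 0 then c else 0)) 0)"
    by (rule smooth_family) (use DERIV_diff[OF smooth_DERIV[OF assms] DERIV_const] in \<open>simp, fastforce?\<close>)
  then show ?thesis by simp
qed

text \<open>The lemma of du Bois-Reymond. A test function minus its mean is the derivative of a
  periodic test function, so u minus its mean m pairs to zero with every test function. This says
  that u - m is a weak derivative of 0, and uniqueness applies.\<close>

lemma AE_const_of_weak_deriv_zero:
  fixes u :: "real \<Rightarrow> 'a::euclidean_space"
  assumes u: "has_weak_deriv u (\<lambda>_. 0)"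
  shows "\<exists>m. AE z in I_measure. u z = m"
proof -
  define m where "m = (\<integral>z. u z \<partial>I_measure)"
  have per: "periodic u" and ui: "integrable I_measure u" using u by (auto simp: has_weak_deriv_def)
  have ci: "integrable I_measure (\<lambda>_. m)" by (rule I_integral_continuous(1)) simp
  have "(\<integral>z. \<psi> z *\<^sub>R (u z - m) \<partial>I_measure) = 0" if \<psi>: "smooth \<psi>" "periodic \<psi>" for \<psi>
  proof -
    define c where "c = integral {0..1} \<psi>"
    have c\<psi>: "continuous_on {0..1} \<psi>" by (rule smooth_continuous0[OF \<psi>(1)])
    have "integral {0..1} (\<lambda>s. \<psi> s - c) = 0"
      using HK_integral_diff[OF integrable_continuous_real[OF c\<psi>] integrable_const_ivl] by (simp add: c_def)
    moreover have "periodic (\<lambda>s. \<psi> s - c)" using \<psi>(2) by (simp add: periodic_def)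
    ultimately obtain \<phi> where \<phi>: "smooth \<phi>" "periodic \<phi>" "deriv \<phi> = (\<lambda>s. \<psi> s - c)"
      using smooth_antiderivative[OF smooth_minus_const[OF \<psi>(1)]] by blast
    have i: "integrable I_measure (\<lambda>z. \<psi> z *\<^sub>R u z)"
      by (rule integrable_continuous_scaleR[OF smooth_continuous0[OF \<psi>(1)] ui])
    have "(\<integral>z. (\<psi> z - c) *\<^sub>R u z \<partial>I_measure) = 0" using u \<phi> unfolding has_weak_deriv_def by fastforce
    then have "(\<integral>z. \<psi> z *\<^sub>R u z \<partial>I_measure) = c *\<^sub>R m"
      using i ui by (simp add: scaleR_diff_left m_def)
    moreover have "(\<integral>z. \<psi> z *\<^sub>R m \<partial>I_measure) = c *\<^sub>R m"
      using I_integral_continuous(1,2)[OF c\<psi>] by (simp add: c_def)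
    ultimately show ?thesis
      using i I_integral_continuous(1)[OF c\<psi>] by (auto simp: scaleR_diff_right)
  qed
  then have "has_weak_deriv (\<lambda>_. 0) (\<lambda>z. u z - m)"
    using per ui ci by (simp add: has_weak_deriv_def periodic_def)
  moreover have "has_weak_deriv (\<lambda>_ :: real. 0 :: 'a) (\<lambda>_. 0)" by (simp add: has_weak_deriv_def periodic_def)
  ultimately have "AE z in I_measure. u z - m = 0" by (rule weak_deriv_unique)
  then have "AE z in I_measure. u z = m" by eventually_elim simp
  then show ?thesis ..
qed

lemma norm_integral_interval_le:
  fixes k :: "real \<Rightarrow> 'a::euclidean_space"
  assumes k: "integrable I_measure k" "AE z in I_measure. norm (k z) \<le> K" and ab: "0 \<le> a" "a \<le> b" "b \<le> 1"
  shows "norm (integral {a..b} k) \<le> K * (b - a)"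
proof -
  have sub: "{a..b} \<subseteq> {0..1}" using ab by auto
  have i: "integrable (lebesgue_on {a..b}) k"
    by (rule integrable_subinterval[OF k(1) sub])
  have "AE z in lebesgue. z \<in> {0..1} \<longrightarrow> norm (k z) \<le> K"
    using k(2) by (simp add: AE_restrict_space_iff)
  then have "AE z in lebesgue_on {a..b}. norm (k z) \<le> K"
    by (subst AE_restrict_space_iff) (use sub in \<open>auto elim!: eventually_mono\<close>)
  from norm_integral_le_AE[OF I_integral_continuous(1)[OF continuous_on_const] this]
  have "norm (integral {a..b} k) \<le> (\<integral>z. K \<partial>lebesgue_on {a..b})"
    using lebesgue_integral_eq_integral[OF i] by simp
  also have "\<dots> = integral {a..b} (\<lambda>_. K)" by (rule I_integral_continuous(2)) simp
  finally show ?thesis using ab by (simp add: mult.commute)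
qed

text \<open>The primitive of the bounded second weak derivative differs from the first one by a
  constant, so \<open>f\<close> is a primitive of a Lipschitz function.\<close>

lemma C11_of_weak_derivs:
  fixes f :: "real \<Rightarrow> 'a::euclidean_space"
  assumes f: "continuous_on UNIV f" "has_weak_deriv f g" and gk: "has_weak_deriv g k" and k: "AE z in I_measure. norm (k z) \<le> K" "0 \<le> K"
  obtains f' where "\<And>z. (f has_vector_derivative f' z) (at z)" "\<And>a b. norm (f' a - f' b) \<le> K * \<bar>a - b\<bar>"
    "AE z in I_measure. ((\<lambda>h. (f' (z + h) - f' z) /\<^sub>R h) \<longlongrightarrow> k z) (at_right 0)"
proof -
  have per: "periodic f" "periodic k" and ki: "integrable I_measure k" using f gk by (auto simp: has_weak_deriv_def)
  have kH: "k integrable_on {a..b}" if "0 \<le> a" "b \<le> 1" for a b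
    using integrable_on_subinterval[OF integrable_on_lebesgue_on[OF ki]] that by auto
  \<comment> \<open>The primitive is continuous across the integers because k has mean zero, which
    follows by testing with the constant 1.\<close>
  define P where "P z = integral {0..frac z} k" for z
  have k0: "integral {0..1} k = 0"
  proof -
    have "(\<integral>z. deriv (\<lambda>_. 1) z *\<^sub>R g z \<partial>I_measure) = - (\<integral>z. 1 *\<^sub>R k z \<partial>I_measure)"
      using gk smooth_const[of 1] by (auto simp: has_weak_deriv_def periodic_def)
    then show ?thesis using lebesgue_integral_eq_integral[OF ki] by simp
  qed
  have P01: "P z = integral {0..z} k" if "0 \<le> z" "z \<le> 1" for z
    using that k0 by (cases "z = 1") (simp_all add: P_def frac_eq)
  have inc: "P b - P a = integral {a..b} k" if "0 \<le> a" "a \<le> b" "b \<le> 1" for a b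
    using that HK_integral_combine[of 0 a b k] kH[of 0 b] by (simp add: P01 algebra_simps)
  have perP: "periodic P" by (simp add: periodic_def P_def frac_1_eq)
  \<comment> \<open>With one element per period, the element is [0, 1] and
    \<open>piecewise_lipschitz\<close> extends the bound to the line.\<close>
  have pw: "norm (P a - P b) \<le> K * \<bar>a - b\<bar>" if "j < 1" "a \<in> element 1 j" "b \<in> element 1 j" for j a b
  proof -
    have le: "norm (P b - P a) \<le> K * (b - a)" if "0 \<le> a" "a \<le> b" "b \<le> 1" for a b
      unfolding inc[OF that] by (rule norm_integral_interval_le[OF ki k(1) that])
    show ?thesis
      using le[of a b] le[of b a] that by (cases "a \<le> b") (auto simp: node_def norm_minus_commute)
  qed
  have Plip: "norm (P a - P b) \<le> K * \<bar>a - b\<bar>" for a b by (rule piecewise_lipschitz[OF perP order_refl k(2) pw])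
  have Pq: "AE z in I_measure. ((\<lambda>h. (P (z + h) - P z) /\<^sub>R h) \<longlongrightarrow> k z) (at_right 0)"
    by (rule AE_quotient_of_increment[OF ki]) (simp add: inc)
  have "has_weak_deriv P k"
    by (rule has_weak_deriv_lipschitz[OF perP Plip per(2) borel_measurable_integrable[OF ki] Pq])
  from has_weak_deriv_diff[OF gk this] obtain m where m: "AE z in I_measure. g z - P z = m"
    using AE_const_of_weak_deriv_zero by auto
  define f' where "f' z = P z + m" for z
  have lip: "norm (f' a - f' b) \<le> K * \<bar>a - b\<bar>" for a b using Plip by (simp add: f'_def)
  have cf': "continuous_on A f'" for A by (rule lipschitz_continuous[OF lip])
  have ae: "AE z in I_measure. g z = f' z" using m by eventually_elim (simp add: f'_def algebra_simps)
  have f'i: "integrable I_measure f'" by (rule I_integral_continuous(1)[OF cf'])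
  have parts: "(\<integral>z. deriv \<phi> z *\<^sub>R f z \<partial>I_measure) = - (\<integral>z. \<phi> z *\<^sub>R f' z \<partial>I_measure)"
    if \<phi>: "smooth \<phi>" "periodic \<phi>" for \<phi>
  proof -
    have "(\<integral>z. \<phi> z *\<^sub>R g z \<partial>I_measure) = (\<integral>z. \<phi> z *\<^sub>R f' z \<partial>I_measure)"
      by (rule integral_cong_AE)
        (use f(2) f'i ae in \<open>auto intro!: borel_measurable_integrable integrable_continuous_scaleR smooth_continuous0 \<phi>(1) simp: has_weak_deriv_def\<close>)
    then show ?thesis using f(2) \<phi> by (simp add: has_weak_deriv_def)
  qed
  obtain F where F: "\<And>z. (F has_vector_derivative f' z) (at z)" using antiderivative_exists[OF cf'] by blast
  have Finc: "F b - F a = integral {a..b} f'" if "a \<le> b" for a b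
    by (rule integral_unique[symmetric], rule fundamental_theorem_of_calculus[OF that has_vector_derivative_at_within[OF F]])
  define C where "C = f 0 - F 0"
  have eq: "f z = F z + C" if "0 \<le> z" "z \<le> 1" for z
    using weak_deriv_increment[OF f(1) f'i parts, of 0 z] Finc[of 0 z] that
    by (cases "z = 0") (simp_all add: C_def algebra_simps)
  have "periodic f'" using perP by (simp add: periodic_def f'_def)
  then have "((\<lambda>s. F (s + 1) - F s) has_vector_derivative 0) (at x within UNIV)" for x
  proof -
    have "((\<lambda>s::real. s + 1) has_vector_derivative 1) (at x)"
      by (auto intro!: derivative_eq_intros simp: has_real_derivative_iff_has_vector_derivative[symmetric])
    from has_vector_derivative_diff[OF vector_diff_chain_at[OF this F] F[of x]]
    show ?thesis using \<open>periodic f'\<close> by (simp add: periodic_def o_def)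
  qed
  then obtain q where q: "F (s + 1) - F s = q" for s
    using has_vector_derivative_zero_constant[of UNIV "\<lambda>s. F (s + 1) - F s"] by auto
  have "f (0 + 1) = f 0" using per(1) unfolding periodic_def by blast
  then have "q = 0" using q[of 0] eq[of 0] eq[of 1] by simp
  then have perF: "periodic F" using q by (simp add: periodic_def)
  have "f = (\<lambda>z. F z + C)"
  proof
    fix z :: real
    show "f z = F z + C"
      using eq[of "frac z"] periodic_frac[OF per(1), of z] periodic_frac[OF perF, of z] by (simp add: less_imp_le[OF frac_lt_1])
  qed
  then have "(f has_vector_derivative f' z) (at z)" for z
    using has_vector_derivative_add[OF F has_vector_derivative_const[of C], of z] by simp
  moreover have "AE z in I_measure. ((\<lambda>h. (f' (z + h) - f' z) /\<^sub>R h) \<longlongrightarrow> k z) (at_right 0)"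
    using Pq by (simp add: f'_def)
  ultimately show ?thesis using that lip by blast
qed

lemma W2inf_C11:
  fixes f :: "real \<Rightarrow> real^2"
  assumes f: "f \<in> W2inf_space" and cont: "continuous_on UNIV f"
  shows "(f has_vector_derivative d_rho f z) (at z)"
    "norm (d_rho f a - d_rho f b) \<le> w2inf_norm f * \<bar>a - b\<bar>"
    "norm (f z) \<le> w2inf_norm f" "norm (d_rho f z) \<le> 2 * w2inf_norm f"
    "AE z in I_measure. ((\<lambda>h. (d_rho f (z + h) - d_rho f z) /\<^sub>R h) \<longlongrightarrow> weak_deriv (weak_deriv f) z) (at_right 0)"
proof -
  note ff = Linf.second_orderD[OF f[unfolded W2inf_space_def]]
  have per: "periodic f" using ff(1) by (simp add: Linf_space_def)
  define K where "K = linf_norm (weak_deriv (weak_deriv f))"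
  have K: "0 \<le> K" "K \<le> w2inf_norm f" "linf_norm f \<le> w2inf_norm f"
    by (simp_all add: K_def w2inf_norm_def linf_norm_nonneg)
  obtain f' where f': "\<And>a. (f has_vector_derivative f' a) (at a)" "\<And>a b. norm (f' a - f' b) \<le> K * \<bar>a - b\<bar>"
    "AE z in I_measure. ((\<lambda>h. (f' (z + h) - f' z) /\<^sub>R h) \<longlongrightarrow> weak_deriv (weak_deriv f) z) (at_right 0)"
    using C11_of_weak_derivs[OF cont ff(2,4) linf_norm_AE[OF ff(5), folded K_def] K(1)] by blast
  have eq: "d_rho f z = f' z" for z using f'(1) by (rule vector_derivative_at)
  show "AE z in I_measure. ((\<lambda>h. (d_rho f (z + h) - d_rho f z) /\<^sub>R h) \<longlongrightarrow> weak_deriv (weak_deriv f) z) (at_right 0)"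
    using f'(3) by (simp add: eq)
  show "(f has_vector_derivative d_rho f z) (at z)" using f'(1) by (simp add: eq)
  have lip: "norm (f' a - f' b) \<le> w2inf_norm f * \<bar>a - b\<bar>" for a b
    using order_trans[OF f'(2) mult_right_mono[OF K(2)]] by simp
  then show "norm (d_rho f a - d_rho f b) \<le> w2inf_norm f * \<bar>a - b\<bar>" by (simp add: eq)
  show "norm (d_rho f z) \<le> 2 * w2inf_norm f"
    unfolding eq
  proof (rule periodic_derivative_bound[OF per f'(1)])
    fix a b :: real assume "a \<le> b" "b \<le> a + 1"
    then show "norm (f' a - f' b) \<le> w2inf_norm f"
      using lip[of a b] mult_left_mono[of "\<bar>a - b\<bar>" 1 "w2inf_norm f"] K by simp
  qed
  have "norm (f z) \<le> linf_norm f"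
    by (rule AE_le_continuous[OF _ _ linf_norm_AE[OF ff(1)]])
      (use cont per in \<open>auto intro!: continuous_intros simp: periodic_def\<close>)
  then show "norm (f z) \<le> w2inf_norm f" using K by simp
qed

text \<open>One constant carries the upper bounds, the Lipschitz bound of the derivative and,
  through 1/B, both lower bounds. Enlarging B weakens every clause, so the largest constant of a
  finite cover is admissible.\<close>

definition regular_curve :: "real \<Rightarrow> (real \<Rightarrow> real^2) \<Rightarrow> bool" where
  "regular_curve B f \<longleftrightarrow> 1 \<le> B \<and> periodic f \<and>
     (\<forall>z. (f has_vector_derivative d_rho f z) (at z) \<and> norm (f z) \<le> B \<and> norm (d_rho f z) \<le> B \<and>
        1 / B \<le> f z \<bullet> e1 \<and> 1 / B \<le> norm (d_rho f z)) \<and>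
     (\<forall>a b. norm (d_rho f a - d_rho f b) \<le> B * \<bar>a - b\<bar>)"

lemma regular_curve_mono:
  assumes "regular_curve B f" "B \<le> B'"
  shows "regular_curve B' f"
proof -
  have "1 / B' \<le> 1 / B" using assms by (intro divide_left_mono) (auto simp: regular_curve_def)
  moreover have "B * \<bar>a - b\<bar> \<le> B' * \<bar>a - b\<bar>" for a b using assms(2) by (intro mult_right_mono) auto
  ultimately show ?thesis using assms unfolding regular_curve_def by (meson order_trans)
qed

lemma e1_inner_le: "\<bar>v \<bullet> e1\<bar> \<le> norm v"
  using Cauchy_Schwarz_ineq2[of v e1] by (simp add: norm_axis_1)

text \<open>A perturbation of size 1/(4B) changes the values by at most 1/(4B) and the derivative by
  at most 1/(2B), the factor 2 stemming from \<open>W2inf_C11\<close>. At least 1/(2B) of both lower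
  bounds survives.\<close>

lemma regular_curve_perturb:
  assumes f: "regular_curve B f" and g: "g \<in> W2inf_space" "continuous_on UNIV g"
    and d: "(\<lambda>z. g z - f z) \<in> W2inf_space" "w2inf_norm (\<lambda>z. g z - f z) \<le> 1 / (4 * B)"
  shows "regular_curve (2 * B + 1) g"
proof -
  define \<delta> where "\<delta> = w2inf_norm (\<lambda>z. g z - f z)"
  have B: "1 \<le> B" and fd: "\<And>z. (f has_vector_derivative d_rho f z) (at z)"
    and f1: "\<And>z. norm (f z) \<le> B" "\<And>z. norm (d_rho f z) \<le> B" "\<And>z. 1 / B \<le> f z \<bullet> e1"
      "\<And>z. 1 / B \<le> norm (d_rho f z)" "\<And>a b. norm (d_rho f a - d_rho f b) \<le> B * \<bar>a - b\<bar>"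
    using f by (auto simp: regular_curve_def)
  have cf: "continuous_on UNIV f"
    using fd by (meson continuous_at_imp_continuous_on has_vector_derivative_continuous)
  have gd: "\<And>z. (g has_vector_derivative d_rho g z) (at z)" by (rule W2inf_C11[OF g])
  have "continuous_on UNIV (\<lambda>z. g z - f z)" by (intro continuous_intros g cf)
  note D = W2inf_C11[OF d(1) this, folded \<delta>_def]
  have dd: "d_rho (\<lambda>z. g z - f z) z = d_rho g z - d_rho f z" for z
    by (rule vector_derivative_at) (intro derivative_intros gd fd)
  have \<delta>: "0 \<le> \<delta>" "\<delta> \<le> 1 / (4 * B)" "1 / (4 * B) \<le> 1 / 4"
    using order_trans[OF norm_ge_zero D(3)] d(2) B by (auto simp: \<delta>_def field_simps)
  then have \<delta>4: "\<delta> \<le> 1 / 4" by linarith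
  define u where "u = 1 / (4 * B)"
  define l where "l = 1 / (2 * B + 1)"
  have q: "\<delta> \<le> u" "1 / B = 4 * u" "l \<le> 2 * u"
    using B \<delta>(2) by (auto simp: u_def l_def field_simps)
  have "norm (g z) \<le> 2 * B + 1" for z
    using norm_triangle_sub[of "g z" "f z"] f1(1)[of z] D(3)[of z] \<delta> B by linarith
  moreover have "norm (d_rho g z) \<le> 2 * B + 1" for z
    using norm_triangle_sub[of "d_rho g z" "d_rho f z"] f1(2)[of z] D(4)[of z] \<delta>4 B by (simp add: dd)
  moreover have "l \<le> g z \<bullet> e1" for z
  proof -
    have "g z \<bullet> e1 = f z \<bullet> e1 + (g z - f z) \<bullet> e1" by (simp add: inner_diff_left)
    then show ?thesis
      using e1_inner_le[of "g z - f z"] D(3)[of z] f1(3)[of z, unfolded q(2)] \<delta>(1) q(1,3) by linarith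
  qed
  moreover have "l \<le> norm (d_rho g z)" for z
    using norm_triangle_sub[of "d_rho f z" "d_rho g z"] D(4)[of z, unfolded dd] f1(4)[of z, unfolded q(2)] \<delta>(1) q(1,3)
      norm_minus_commute[of "d_rho f z" "d_rho g z"] by linarith
  moreover have "norm (d_rho g a - d_rho g b) \<le> (2 * B + 1) * \<bar>a - b\<bar>" for a b
  proof -
    have "norm (d_rho g a - d_rho g b) \<le> norm ((d_rho g a - d_rho f a) - (d_rho g b - d_rho f b)) + norm (d_rho f a - d_rho f b)"
      using norm_triangle_ineq[of "(d_rho g a - d_rho f a) - (d_rho g b - d_rho f b)" "d_rho f a - d_rho f b"] by simp
    also have "\<dots> \<le> \<delta> * \<bar>a - b\<bar> + B * \<bar>a - b\<bar>"
      using D(2)[of a b] f1(5)[of a b] by (simp add: dd)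
    also have "\<dots> \<le> (2 * B + 1) * \<bar>a - b\<bar>"
      using \<delta>4 B by (simp only: distrib_right[symmetric]) (intro mult_right_mono, auto)
    finally show ?thesis .
  qed
  moreover have "periodic g" using Linf.second_orderD(1)[OF g(1)[unfolded W2inf_space_def]] by (simp add: Linf_space_def)
  ultimately show ?thesis using B gd by (simp add: regular_curve_def l_def)
qed

lemma regular_curve_exists:
  assumes f: "f \<in> W2inf_space" "continuous_on UNIV f"
    and pos: "\<And>z. f z \<bullet> e1 > 0" "\<And>z. norm (d_rho f z) > 0"
  shows "\<exists>B. regular_curve B f"
proof -
  define w where "w = w2inf_norm f"
  note C = W2inf_C11[OF f, folded w_def]
  have per: "periodic f" using Linf.second_orderD(1)[OF f(1)[unfolded W2inf_space_def]] by (simp add: Linf_space_def)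
  have perd: "periodic (d_rho f)" by (rule periodic_d_rho[OF per C(1)])
  have low: "\<exists>m>0. \<forall>z. m \<le> u z" if u: "continuous_on UNIV u" "periodic u" "\<And>z. u z > 0" for u :: "real \<Rightarrow> real"
  proof -
    obtain m where "m \<in> {0..1}" "\<And>y. y \<in> {0..1} \<Longrightarrow> u m \<le> u y"
      using continuous_attains_inf[of "{0..1}" u] continuous_on_subset[OF u(1)] by auto
    then have "u m \<le> u z" for z
      using periodic_frac[OF u(2), of z] by (metis atLeastAtMost_iff frac_ge_0 frac_lt_1 less_imp_le)
    then show ?thesis using u(3) by blast
  qed
  have "continuous_on UNIV (d_rho f)" by (rule lipschitz_continuous[OF C(2)])
  then have c: "continuous_on UNIV (\<lambda>z. f z \<bullet> e1)" "continuous_on UNIV (\<lambda>z. norm (d_rho f z))"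
    by (intro continuous_intros f(2); assumption)+
  have p: "periodic (\<lambda>z. f z \<bullet> e1)" "periodic (\<lambda>z. norm (d_rho f z))"
    using per perd by (simp_all add: periodic_def)
  obtain m1 where m1: "m1 > 0" "\<And>z. m1 \<le> f z \<bullet> e1" using low[OF c(1) p(1) pos(1)] by blast
  obtain m2 where m2: "m2 > 0" "\<And>z. m2 \<le> norm (d_rho f z)" using low[OF c(2) p(2) pos(2)] by blast
  note m = m1 m2
  define B where "B = 1 + 2 * w + 1 / m1 + 1 / m2"
  have w: "w \<ge> 0" using order_trans[OF norm_ge_zero C(3)[of 0]] .
  have B: "1 \<le> B" "2 * w \<le> B" "w \<le> B" "1 / m1 \<le> B" "1 / m2 \<le> B" using w m by (auto simp: B_def)
  have "1 / B \<le> m1" "1 / B \<le> m2" using B m by (auto simp: divide_le_eq mult.commute)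
  moreover have "w * \<bar>a - b\<bar> \<le> B * \<bar>a - b\<bar>" for a b using B by (intro mult_right_mono) auto
  ultimately have "regular_curve B f"
    unfolding regular_curve_def using B m C per by (meson order_trans)
  then show ?thesis ..
qed

section \<open>Regularity of the solution drawn from the equation\<close>

locale regular_solution =
  fixes T :: real and x x_t x_tt :: "real \<Rightarrow> real \<Rightarrow> real^2"
  assumes T: "T > 0"
    and x_continuous_rep: "\<And>t. t \<in> {0..T} \<Longrightarrow> continuous_on UNIV (x t)"
    and x_reg: "x \<in> C_time T W2inf_space w2inf_norm"
    and x_t_deriv: "has_weak_time_deriv T x x_t"
    and x_t_reg: "x_t \<in> L2_time T H2_space h2_norm"
    and x_t_continuous_rep: "x_t \<in> C_time T L2_space l2_norm"
    and x_tt_deriv: "has_weak_time_deriv T x_t x_tt"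
    and x_tt_reg: "x_tt \<in> L2_time T L2_space l2_norm"
    and pde: "\<And>t. t \<in> {0<..T} \<Longrightarrow> AE z in I_measure.
        ((x t z \<bullet> e1) * (norm (d_rho (x t) z))^2) *\<^sub>R x_t t z
        - weak_deriv (\<lambda>\<sigma>. (x t \<sigma> \<bullet> e1) *\<^sub>R d_rho (x t) \<sigma>) z
        + (norm (d_rho (x t) z))^2 *\<^sub>R e1 = 0"
    and x_rho_pos: "\<And>t z. t \<in> {0..T} \<Longrightarrow> norm (d_rho (x t) z) > 0"
    and x_e1_pos: "\<And>t z. t \<in> {0..T} \<Longrightarrow> x t z \<bullet> e1 > 0"
begin

lemma x_W2inf: "t \<in> {0..T} \<Longrightarrow> x t \<in> W2inf_space"
  using x_reg by (simp add: C_time_def)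

lemma x_diff_W2inf: "t \<in> {0..T} \<Longrightarrow> s \<in> {0..T} \<Longrightarrow> (\<lambda>z. x t z - x s z) \<in> W2inf_space"
  using Linf.second_order_diff(1)[folded W2inf_space_def] x_W2inf by blast

lemma x_diff_continuous: "t \<in> {0..T} \<Longrightarrow> s \<in> {0..T} \<Longrightarrow> continuous_on UNIV (\<lambda>z. x t z - x s z)"
  by (intro continuous_intros x_continuous_rep)

text \<open>Continuity in time with values in W^{2,\<infinity>} makes the perturbation lemma
  applicable near each time, and compactness of [0, T] leaves finitely many constants.\<close>

lemma uniform_regular: "\<exists>B. \<forall>t\<in>{0..T}. regular_curve B (x t)"
proof (rule compact_uniform_bound)
  show "compact {0..T}" by simp
  show "regular_curve B (x t) \<Longrightarrow> B \<le> B' \<Longrightarrow> regular_curve B' (x t)" for t B B'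
    by (rule regular_curve_mono)
  fix s assume s: "s \<in> {0..T}"
  obtain B where B: "regular_curve B (x s)"
    using regular_curve_exists[OF x_W2inf[OF s] x_continuous_rep[OF s]] x_e1_pos[OF s] x_rho_pos[OF s] by blast
  then have "1 / (4 * B) > 0" by (simp add: regular_curve_def)
  moreover have "((\<lambda>t. w2inf_norm (\<lambda>z. x t z - x s z)) \<longlongrightarrow> 0) (at s within {0..T})"
    using x_reg s by (simp add: C_time_def)
  ultimately have "\<forall>\<^sub>F t in at s within {0..T}. w2inf_norm (\<lambda>z. x t z - x s z) < 1 / (4 * B)"
    by (intro order_tendstoD)
  then obtain d where d: "d > 0" "\<And>t. t \<in> {0..T} \<Longrightarrow> t \<noteq> s \<Longrightarrow> dist t s < d \<Longrightarrow> w2inf_norm (\<lambda>z. x t z - x s z) < 1 / (4 * B)"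
    unfolding eventually_at by blast
  have "regular_curve (2 * B + 1) (x t)" if t: "t \<in> {0..T}" "dist t s < d" for t
  proof (cases "t = s")
    case True
    then show ?thesis using regular_curve_mono[OF B, of "2 * B + 1"] B by (simp add: regular_curve_def)
  next
    case False
    then show ?thesis
      using regular_curve_perturb[OF B x_W2inf[OF t(1)] x_continuous_rep[OF t(1)] x_diff_W2inf[OF t(1) s]] d(2)[OF t(1) _ t(2)]
      by (simp add: less_imp_le)
  qed
  then show "\<exists>d>0. \<exists>B. \<forall>t\<in>{0..T}. dist t s < d \<longrightarrow> regular_curve B (x t)" using d(1) by blast
qed

text \<open>The equation is tested with \<open>\<eta>\<close>; the Lipschitz field F = (x . e1)
  x_rho is integrated by parts, and replacing \<open>x_t\<close> by d leaves only their difference.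
  The second claim solves the equation for \<open>x_t\<close>: the coefficient is at least B^-3, the
  derivative of F at most 2 B^2 and the source at most B^2.\<close>

lemma weak_form_defect:
  assumes t: "t \<in> {0<..T}" and B: "regular_curve B (x t)"
    and \<eta>: "periodic \<eta>" "\<And>a b. norm (\<eta> a - \<eta> b) \<le> L * \<bar>a - b\<bar>" "\<eta>' \<in> borel_measurable I_measure"
      "AE z in I_measure. ((\<lambda>h. (\<eta> z - \<eta> (z - h)) /\<^sub>R h) \<longlongrightarrow> \<eta>' z) (at_right 0)"
    and d: "continuous_on UNIV d" "periodic d"
  shows "\<bar>\<integral>z. (x t z \<bullet> e1) * (norm (d_rho (x t) z))^2 * (d z \<bullet> \<eta> z)
      + (x t z \<bullet> e1) * (d_rho (x t) z \<bullet> \<eta>' z) + (norm (d_rho (x t) z))^2 * (e1 \<bullet> \<eta> z) \<partial>I_measure\<bar>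
    \<le> B ^ 3 * l2_norm (\<lambda>z. d z - x_t t z) * l2_norm \<eta>"
    and "AE z in I_measure. norm (x_t t z) \<le> 3 * B ^ 5"
proof -
  have t': "t \<in> {0..T}" using t by simp
  define f f' where "f = x t" and "f' = d_rho f"
  have B1: "1 \<le> B" "periodic f" and fd: "\<And>z. (f has_vector_derivative f' z) (at z)"
    and fb: "\<And>z. norm (f z) \<le> B" "\<And>z. norm (f' z) \<le> B" "\<And>z. 1 / B \<le> f z \<bullet> e1" "\<And>z. 1 / B \<le> norm (f' z)"
    and flip: "\<And>a b. norm (f' a - f' b) \<le> B * \<bar>a - b\<bar>"
    using B by (auto simp: regular_curve_def f_def f'_def)
  have B0: "0 < B" using B1 by simp
  have cf: "continuous_on A f" for A
    using x_continuous_rep[OF t'] continuous_on_subset by (auto simp: f_def)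
  have cf': "continuous_on A f'" for A by (rule lipschitz_continuous[OF flip])
  have pf': "periodic f'" by (rule periodic_d_rho[OF B1(2) fd])
  note W = Linf.second_orderD[OF x_W2inf[OF t', unfolded W2inf_space_def], folded f_def]
  define k where "k = weak_deriv (weak_deriv f)"
  have k: "integrable I_measure k" "periodic k" "k \<in> borel_measurable I_measure"
    using W(4,5) by (auto simp: k_def has_weak_deriv_def Linf_space_def)
  have qk: "AE z in I_measure. ((\<lambda>h. (f' (z + h) - f' z) /\<^sub>R h) \<longlongrightarrow> k z) (at_right 0)"
    using W2inf_C11(5)[OF x_W2inf[OF t'] x_continuous_rep[OF t']] by (simp add: f_def f'_def k_def)
  define F where "F = (\<lambda>z. (f z \<bullet> e1) *\<^sub>R f' z)"
  define F' where "F' = (\<lambda>z. (f z \<bullet> e1) *\<^sub>R k z + (f' z \<bullet> e1) *\<^sub>R f' z)"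
  have F: "periodic F" "periodic F'" using B1(2) pf' k(2) by (auto simp: periodic_def F_def F'_def)
  have Flip: "norm (F a - F b) \<le> (2 * B^2) * \<bar>a - b\<bar>" for a b
  proof -
    have "F a - F b = (f a \<bullet> e1) *\<^sub>R (f' a - f' b) + ((f a - f b) \<bullet> e1) *\<^sub>R f' b"
      by (simp add: F_def algebra_simps inner_diff_left)
    then have "norm (F a - F b) \<le> \<bar>f a \<bullet> e1\<bar> * norm (f' a - f' b) + \<bar>(f a - f b) \<bullet> e1\<bar> * norm (f' b)"
      by (metis norm_scaleR norm_triangle_ineq)
    also have "\<dots> \<le> B * (B * \<bar>a - b\<bar>) + (B * \<bar>a - b\<bar>) * B"
      using B0 by (intro add_mono mult_mono flip fb order_trans[OF e1_inner_le] C1_lipschitz[OF fd fb(2)]) auto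
    finally show ?thesis by (simp add: power2_eq_square algebra_simps)
  qed
  have mf: "f \<in> borel_measurable I_measure" "f' \<in> borel_measurable I_measure"
    by (intro I_measurable_continuous cf cf')+
  then have F'm: "F' \<in> borel_measurable I_measure" using k(3) by (simp add: F'_def)
  have qF: "AE z in I_measure. ((\<lambda>h. (F (z + h) - F z) /\<^sub>R h) \<longlongrightarrow> F' z) (at_right 0)"
    using qk
  proof eventually_elim
    case (elim z)
    have "(\<lambda>h. z + h) \<midarrow>0\<rightarrow> z" by (auto intro!: tendsto_eq_intros)
    then have sh: "((\<lambda>h. z + h) \<longlongrightarrow> z) (at_right 0)" by (rule filterlim_mono) (auto simp: at_le)
    have "isCont f z" using fd by (rule has_vector_derivative_continuous)
    from isCont_tendsto_compose[OF this sh]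
    have "((\<lambda>h. (f (z + h) \<bullet> e1) *\<^sub>R ((f' (z + h) - f' z) /\<^sub>R h) + (((f (z + h) - f z) /\<^sub>R h) \<bullet> e1) *\<^sub>R f' z) \<longlongrightarrow> F' z) (at_right 0)"
      unfolding F'_def by (intro tendsto_intros elim vector_derivative_quotients(1)[OF fd])
    moreover have "(f (z + h) \<bullet> e1) *\<^sub>R ((f' (z + h) - f' z) /\<^sub>R h) + (((f (z + h) - f z) /\<^sub>R h) \<bullet> e1) *\<^sub>R f' z
        = (F (z + h) - F z) /\<^sub>R h" for h
      by (simp add: F_def algebra_simps inner_diff_left)
    ultimately show ?case by simp
  qed
  note wd = has_weak_deriv_lipschitz[OF F(1) Flip F(2) F'm qF]
  have eq: "AE z in I_measure. ((f z \<bullet> e1) * (norm (f' z))^2) *\<^sub>R x_t t z + (norm (f' z))^2 *\<^sub>R e1 = F' z"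
    using pde[OF t, folded f_def, folded f'_def F_def] weak_deriv_AE_eq[OF wd(1)]
  proof eventually_elim
    case (elim z)
    then have "F' z = weak_deriv F z" by simp
    then show ?case using elim(1) by (simp add: F_def f'_def algebra_simps eq_diff_eq)
  qed
  show "AE z in I_measure. norm (x_t t z) \<le> 3 * B ^ 5"
    using eq wd(2)
  proof eventually_elim
    case (elim z)
    define q where "q = (f z \<bullet> e1) * (norm (f' z))^2"
    have "(1 / B) * (1 / B)^2 \<le> q"
      unfolding q_def using fb(3,4)[of z] B0 order_trans[OF _ fb(3), of 0 z] by (intro mult_mono power_mono) auto
    then have q: "1 \<le> B ^ 3 * q" using B0 by (simp add: field_simps power2_eq_square power3_eq_cube)
    have "q *\<^sub>R x_t t z = F' z - (norm (f' z))^2 *\<^sub>R e1"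
      using elim(1) by (simp add: q_def eq_diff_eq)
    then have "norm (q *\<^sub>R x_t t z) \<le> norm (F' z) + (norm (f' z))^2"
      by (metis norm_triangle_ineq4 norm_scaleR norm_axis_1 mult.right_neutral abs_power2)
    also have "\<dots> \<le> 2 * B^2 + B^2" using elim(2) fb(2)[of z] by (intro add_mono power_mono) auto
    finally have *: "\<bar>q\<bar> * norm (x_t t z) \<le> 3 * B^2" by simp
    have "norm (x_t t z) \<le> (B ^ 3 * q) * norm (x_t t z)"
      using mult_right_mono[OF q, of "norm (x_t t z)"] by simp
    also have "\<dots> \<le> B ^ 3 * (\<bar>q\<bar> * norm (x_t t z))"
      using B0 by (simp add: mult.assoc mult_left_mono mult_right_mono)
    also have "\<dots> \<le> B ^ 3 * (3 * B^2)" using * B0 by (intro mult_left_mono) auto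
    finally show ?case by (simp add: eval_nat_numeral mult_ac)
  qed
  note P = lipschitz_parts[OF bounded_bilinear_inner F(1) Flip F'm qF \<eta>]
  have c\<eta>: "continuous_on UNIV \<eta>" by (rule lipschitz_continuous[OF \<eta>(2)])
  have x_tL2: "x_t t \<in> L2_space" using x_t_continuous_rep t' by (simp add: C_time_def)
  have L2: "\<eta> \<in> L2_space" "(\<lambda>z. d z - x_t t z) \<in> L2_space"
    by (intro L2_space_diff L2_space_continuous c\<eta> \<eta>(1) d x_tL2)+
  define c where "c z = (f z \<bullet> e1) * (norm (f' z))^2" for z
  have cc: "continuous_on UNIV c" unfolding c_def by (intro continuous_intros cf cf')
  have ci: "integrable I_measure (\<lambda>z. c z * ((d z - x_t t z) \<bullet> \<eta> z))"
    using integrable_continuous_scaleR[OF cc L2_integrable_inner[OF L2(2,1)]] by simp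
  have "(\<integral>z. (f z \<bullet> e1) * (norm (f' z))^2 * (d z \<bullet> \<eta> z) + (f z \<bullet> e1) * (f' z \<bullet> \<eta>' z) + (norm (f' z))^2 * (e1 \<bullet> \<eta> z) \<partial>I_measure)
      = (\<integral>z. c z * ((d z - x_t t z) \<bullet> \<eta> z) + (\<eta> z \<bullet> F' z + \<eta>' z \<bullet> F z) \<partial>I_measure)"
  proof (rule integral_cong_AE)
    have m: "d \<in> borel_measurable I_measure" "\<eta> \<in> borel_measurable I_measure" "x_t t \<in> borel_measurable I_measure"
      "F \<in> borel_measurable I_measure" "c \<in> borel_measurable I_measure"
      using I_measurable_continuous[OF d(1)] I_measurable_continuous[OF c\<eta>] I_measurable_continuous[OF cc] mf
        L2_space_measurable[OF x_tL2] by (simp_all add: F_def)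
    show "(\<lambda>z. (f z \<bullet> e1) * (norm (f' z))^2 * (d z \<bullet> \<eta> z) + (f z \<bullet> e1) * (f' z \<bullet> \<eta>' z) + (norm (f' z))^2 * (e1 \<bullet> \<eta> z)) \<in> borel_measurable I_measure"
      using mf m \<eta>(3) by simp
    show "(\<lambda>z. c z * ((d z - x_t t z) \<bullet> \<eta> z) + (\<eta> z \<bullet> F' z + \<eta>' z \<bullet> F z)) \<in> borel_measurable I_measure"
      using mf m \<eta>(3) F'm by simp
    show "AE z in I_measure. (f z \<bullet> e1) * (norm (f' z))^2 * (d z \<bullet> \<eta> z) + (f z \<bullet> e1) * (f' z \<bullet> \<eta>' z) + (norm (f' z))^2 * (e1 \<bullet> \<eta> z)
        = c z * ((d z - x_t t z) \<bullet> \<eta> z) + (\<eta> z \<bullet> F' z + \<eta>' z \<bullet> F z)"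
      using eq
    proof eventually_elim
      case (elim z)
      show ?case
        unfolding elim[symmetric] F_def c_def
        by (simp add: inner_add_right inner_diff_left inner_commute algebra_simps)
    qed
  qed
  also have "\<dots> = (\<integral>z. c z * ((d z - x_t t z) \<bullet> \<eta> z) \<partial>I_measure)"
    using ci P by simp
  also have "\<dots> = l2_inner (\<lambda>z. c z *\<^sub>R (d z - x_t t z)) \<eta>" by (simp add: l2_inner_def)
  finally have main: "\<bar>\<integral>z. (f z \<bullet> e1) * (norm (f' z))^2 * (d z \<bullet> \<eta> z) + (f z \<bullet> e1) * (f' z \<bullet> \<eta>' z) + (norm (f' z))^2 * (e1 \<bullet> \<eta> z) \<partial>I_measure\<bar>
      = \<bar>l2_inner (\<lambda>z. c z *\<^sub>R (d z - x_t t z)) \<eta>\<bar>" by simp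
  have cle: "\<bar>c z\<bar> \<le> B ^ 3" for z
  proof -
    have "\<bar>c z\<bar> = \<bar>f z \<bullet> e1\<bar> * (norm (f' z))^2" by (simp add: c_def abs_mult)
    also have "\<dots> \<le> B * B^2" using B0 by (intro mult_mono power_mono fb order_trans[OF e1_inner_le]) auto
    finally show ?thesis by (simp add: power2_eq_square power3_eq_cube)
  qed
  define v where "v = (\<lambda>z. c z *\<^sub>R (d z - x_t t z))"
  have vi: "(norm (v z))^2 \<le> (B ^ 3)^2 * (norm (d z - x_t t z))^2" for z
    using power_mono[OF mult_right_mono[OF cle norm_ge_zero], of z "d z - x_t t z" 2]
    by (simp add: v_def power_mult_distrib)
  have "periodic c" using B1(2) pf' by (simp add: periodic_def c_def)
  moreover have vm: "v \<in> borel_measurable I_measure"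
    using I_measurable_continuous[OF cc] L2_space_measurable[OF L2(2)] by (simp add: v_def)
  moreover have di: "integrable I_measure (\<lambda>z. (B ^ 3)^2 * (norm (d z - x_t t z))^2)"
    using L2(2) by (simp add: L2_space_def)
  moreover have vint: "integrable I_measure (\<lambda>z. (norm (v z))^2)"
    by (rule Bochner_Integration.integrable_bound[OF di]) (use vi vm in auto)
  ultimately have vL2: "v \<in> L2_space"
    using L2(2) by (auto simp: L2_space_def periodic_def v_def)
  have "l2_inner v v \<le> (\<integral>z. (B ^ 3)^2 * (norm (d z - x_t t z))^2 \<partial>I_measure)"
    unfolding l2_inner_self by (rule integral_mono[OF vint di vi])
  also have "\<dots> = (B ^ 3 * l2_norm (\<lambda>z. d z - x_t t z))^2"
    by (simp add: power_mult_distrib l2_norm_power2 l2_inner_self)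
  finally have "l2_norm v \<le> B ^ 3 * l2_norm (\<lambda>z. d z - x_t t z)"
    unfolding l2_norm_power2[symmetric] using B0 by (elim power2_le_imp_le) (simp add: l2_norm_nonneg)
  then have "\<bar>l2_inner v \<eta>\<bar> \<le> B ^ 3 * l2_norm (\<lambda>z. d z - x_t t z) * l2_norm \<eta>"
    using l2_Cauchy_Schwarz[OF vL2 L2(1)] l2_norm_nonneg[of \<eta>] by (meson mult_right_mono order_trans)
  with main show "\<bar>\<integral>z. (x t z \<bullet> e1) * (norm (d_rho (x t) z))^2 * (d z \<bullet> \<eta> z)
      + (x t z \<bullet> e1) * (d_rho (x t) z \<bullet> \<eta>' z) + (norm (d_rho (x t) z))^2 * (e1 \<bullet> \<eta> z) \<partial>I_measure\<bar>
    \<le> B ^ 3 * l2_norm (\<lambda>z. d z - x_t t z) * l2_norm \<eta>"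
    by (simp add: v_def f_def f'_def)
qed

end

lemma pairing_continuous:
  assumes u: "\<And>t. t \<in> {0..T} \<Longrightarrow> u t \<in> L2_space"
    and lim: "\<And>s. s \<in> {0..T} \<Longrightarrow> ((\<lambda>t. l2_norm (\<lambda>z. u t z - u s z)) \<longlongrightarrow> 0) (at s within {0..T})"
    and \<psi>: "\<psi> \<in> L2_space"
  shows "continuous_on {0..T} (\<lambda>t. l2_inner (u t) \<psi>)"
  unfolding continuous_on_def
proof
  fix s assume s: "s \<in> {0..T}"
  have "((\<lambda>t. l2_inner (u t) \<psi> - l2_inner (u s) \<psi>) \<longlongrightarrow> 0) (at s within {0..T})"
  proof (rule Lim_null_comparison)
    show "((\<lambda>t. l2_norm (\<lambda>z. u t z - u s z) * l2_norm \<psi>) \<longlongrightarrow> 0) (at s within {0..T})"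
      using tendsto_mult_right[OF lim[OF s], of "l2_norm \<psi>"] by simp
    show "\<forall>\<^sub>F t in at s within {0..T}. norm (l2_inner (u t) \<psi> - l2_inner (u s) \<psi>) \<le> l2_norm (\<lambda>z. u t z - u s z) * l2_norm \<psi>"
      unfolding eventually_at_filter
    proof (intro always_eventually allI impI)
      fix t assume t: "t \<in> {0..T}"
      show "norm (l2_inner (u t) \<psi> - l2_inner (u s) \<psi>) \<le> l2_norm (\<lambda>z. u t z - u s z) * l2_norm \<psi>"
        using l2_Cauchy_Schwarz[OF L2_space_diff[OF u[OF t] u[OF s]] \<psi>]
        by (simp add: l2_inner_diff_left[OF u[OF t] u[OF s] \<psi>])
    qed
  qed
  then show "((\<lambda>t. l2_inner (u t) \<psi>) \<longlongrightarrow> l2_inner (u s) \<psi>) (at s within {0..T})"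
    by (simp add: LIM_zero_iff)
qed

lemma time_indicator_const:
  assumes "0 \<le> s" "s \<le> t" "t \<le> T"
  shows "(\<integral>r. indicator {s<..<t} r * c \<partial>time_measure T) = c * (t - s)"
proof -
  have sub: "{s<..<t} \<subseteq> {0<..<T}" using assms by auto
  have "(\<integral>r. indicator {s<..<t} r * c \<partial>time_measure T) = (\<integral>r. indicator {s<..<t} r \<partial>time_measure T) * c"
    by simp
  also have "(\<integral>r. indicator {s<..<t} r \<partial>time_measure T) = measure (time_measure T) {s<..<t}"
  proof -
    have "{s<..<t} \<inter> space (time_measure T) = {s<..<t}" using sub by auto
    then show ?thesis by (simp only: Bochner_Integration.integral_indicator)
  qed
  also have "\<dots> = measure lebesgue {s<..<t}"
    using sub by (intro measure_restrict_space) auto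
  also have "\<dots> = t - s" using assms by (simp add: measure_completion)
  finally show ?thesis by simp
qed

lemma l2_self_le:
  assumes "f \<in> L2_space" "\<bar>l2_inner f f\<bar> \<le> I * l2_norm f" "0 \<le> I"
  shows "l2_norm f \<le> I"
proof (cases "l2_norm f = 0")
  case False
  then have "l2_norm f > 0" using l2_norm_nonneg[of f] by simp
  moreover have "l2_norm f * l2_norm f \<le> I * l2_norm f"
    using assms(2) by (simp add: l2_norm_power2[symmetric] power2_eq_square)
  ultimately show ?thesis by simp
qed (use assms in simp)

text \<open>Both derivatives are moved onto u, so the functions \<open>\<phi>\<close> enter only
  through an L2 norm, which for plateaus stays bounded while their ramps steepen.\<close>

lemma H2_pairing:
  assumes u: "u \<in> H2_space" and S: "finite S" and \<phi>: "\<And>j. j \<in> S \<Longrightarrow> smooth (\<phi> j)" "\<And>j. j \<in> S \<Longrightarrow> periodic (\<phi> j)"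
  shows "\<bar>l2_inner u (\<lambda>z. \<Sum>j\<in>S. deriv (deriv (\<phi> j)) z *\<^sub>R c j)\<bar> \<le> h2_norm u * l2_norm (\<lambda>z. \<Sum>j\<in>S. \<phi> j z *\<^sub>R c j)"
proof -
  note uu = L2.second_orderD[OF u[unfolded H2_space_def]]
  define k where "k = weak_deriv (weak_deriv u)"
  have int: "integrable I_measure (\<lambda>z. \<theta> z *\<^sub>R v z)" if "continuous_on UNIV \<theta>" "integrable I_measure v" for \<theta> and v :: "real \<Rightarrow> 'a"
    by (rule integrable_continuous_scaleR[OF that])
  have iu: "integrable I_measure u" "integrable I_measure k"
    using uu(2,4) by (auto simp: has_weak_deriv_def k_def)
  have pair: "l2_inner v (\<lambda>z. \<Sum>j\<in>S. \<theta> j z *\<^sub>R c j) = (\<Sum>j\<in>S. (\<integral>z. \<theta> j z *\<^sub>R v z \<partial>I_measure) \<bullet> c j)"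
    if \<theta>: "\<And>j. j \<in> S \<Longrightarrow> continuous_on UNIV (\<theta> j)" and v: "integrable I_measure v" for \<theta> and v :: "real \<Rightarrow> 'a"
  proof -
    have "l2_inner v (\<lambda>z. \<Sum>j\<in>S. \<theta> j z *\<^sub>R c j) = (\<integral>z. (\<Sum>j\<in>S. (\<theta> j z *\<^sub>R v z) \<bullet> c j) \<partial>I_measure)"
      by (simp add: l2_inner_def inner_sum_right)
    also have "\<dots> = (\<Sum>j\<in>S. \<integral>z. (\<theta> j z *\<^sub>R v z) \<bullet> c j \<partial>I_measure)"
      by (intro Bochner_Integration.integral_sum integrable_inner_left) (use int \<theta> v in auto)
    also have "\<dots> = (\<Sum>j\<in>S. (\<integral>z. \<theta> j z *\<^sub>R v z \<partial>I_measure) \<bullet> c j)"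
      by (intro sum.cong refl integral_inner_left) (use int \<theta> v in auto)
    finally show ?thesis .
  qed
  have "(\<integral>z. deriv (deriv (\<phi> j)) z *\<^sub>R u z \<partial>I_measure) = (\<integral>z. \<phi> j z *\<^sub>R k z \<partial>I_measure)" if "j \<in> S" for j
  proof -
    note \<phi>j = \<phi>[OF that]
    have "(\<integral>z. deriv (deriv (\<phi> j)) z *\<^sub>R u z \<partial>I_measure) = - (\<integral>z. deriv (\<phi> j) z *\<^sub>R weak_deriv u z \<partial>I_measure)"
      using uu(2) smooth_deriv[OF \<phi>j(1)] periodic_deriv_smooth[OF \<phi>j] by (simp add: has_weak_deriv_def)
    also have "\<dots> = (\<integral>z. \<phi> j z *\<^sub>R k z \<partial>I_measure)"
      using uu(4) \<phi>j by (simp add: has_weak_deriv_def k_def)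
    finally show ?thesis .
  qed
  then have "l2_inner u (\<lambda>z. \<Sum>j\<in>S. deriv (deriv (\<phi> j)) z *\<^sub>R c j) = l2_inner k (\<lambda>z. \<Sum>j\<in>S. \<phi> j z *\<^sub>R c j)"
    using pair[of "\<lambda>j. deriv (deriv (\<phi> j))" u] pair[of \<phi> k] iu \<phi>
    by (simp add: smooth_continuous0 smooth_continuous2)
  moreover have "(\<lambda>z. \<Sum>j\<in>S. \<phi> j z *\<^sub>R c j) \<in> L2_space"
  proof (rule L2_space_continuous)
    show "continuous_on UNIV (\<lambda>z. \<Sum>j\<in>S. \<phi> j z *\<^sub>R c j)"
      by (intro continuous_intros smooth_continuous0 \<phi>)
    show "periodic (\<lambda>z. \<Sum>j\<in>S. \<phi> j z *\<^sub>R c j)"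
      using \<phi>(2) by (auto simp: periodic_def intro!: sum.cong)
  qed
  ultimately have "\<bar>l2_inner u (\<lambda>z. \<Sum>j\<in>S. deriv (deriv (\<phi> j)) z *\<^sub>R c j)\<bar> \<le> l2_norm k * l2_norm (\<lambda>z. \<Sum>j\<in>S. \<phi> j z *\<^sub>R c j)"
    using l2_Cauchy_Schwarz[OF uu(5)] by (simp add: k_def)
  also have "l2_norm k \<le> h2_norm u"
    unfolding h2_norm_def k_def by (rule real_le_rsqrt) simp
  finally show ?thesis by (simp add: mult_right_mono l2_norm_nonneg)
qed

text \<open>At each point at most one plateau is nonzero, and it is at most 1, so no mixed terms
  occur in the square.\<close>

lemma l2_norm_disjoint_plateaus:
  fixes c :: "nat \<Rightarrow> 'a::euclidean_space"
  assumes S: "finite S" and ab: "\<And>j. j \<in> S \<Longrightarrow> 0 \<le> a j \<and> a j < b j \<and> b j \<le> 1"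
    and disj: "\<And>i j. i \<in> S \<Longrightarrow> j \<in> S \<Longrightarrow> i \<noteq> j \<Longrightarrow> {a i<..<b i} \<inter> {a j<..<b j} = {}"
  shows "(l2_norm (\<lambda>z. \<Sum>j\<in>S. pplateau (a j) (b j) n z *\<^sub>R c j))^2 \<le> (\<Sum>j\<in>S. (norm (c j))^2 * (b j - a j))"
proof -
  define \<psi> where "\<psi> z = (\<Sum>j\<in>S. pplateau (a j) (b j) n z *\<^sub>R c j)" for z
  have cont: "continuous_on A \<psi>" for A
    unfolding \<psi>_def by (intro continuous_intros smooth_continuous0 smooth_pplateau) (use ab in auto)
  have ind: "integrable I_measure (\<lambda>z. indicator {a j<..<b j} z * (norm (c j))^2)"
    and ind2: "(\<integral>z. indicator {a j<..<b j} z * (norm (c j))^2 \<partial>I_measure) = (norm (c j))^2 * (b j - a j)" if "j \<in> S" for j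
  proof -
    have sub: "{a j<..<b j} \<subseteq> {0..1}" using ab[OF that] by auto
    then have meas: "{a j<..<b j} \<in> sets I_measure" by (simp add: sets_restrict_space_iff)
    have m: "measure I_measure {a j<..<b j} = b j - a j"
      using ab[OF that] sub by (subst measure_restrict_space) (auto simp: measure_completion)
    have "integrable I_measure (\<lambda>_. (norm (c j))^2)" by (rule continuous_imp_integrable_real) simp
    from integrable_mult_indicator[OF meas this]
    show "integrable I_measure (\<lambda>z. indicator {a j<..<b j} z * (norm (c j))^2)" by simp
    show "(\<integral>z. indicator {a j<..<b j} z * (norm (c j))^2 \<partial>I_measure) = (norm (c j))^2 * (b j - a j)"
      using sub by (simp add: m Int_absorb2)
  qed
  have le: "(norm (\<psi> z))^2 \<le> (\<Sum>j\<in>S. indicator {a j<..<b j} z * (norm (c j))^2)" if z: "z \<in> {0..1}" for z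
  proof (cases "\<exists>i\<in>S. z \<in> {a i<..<b i}")
    case True
    then obtain i where i: "i \<in> S" "z \<in> {a i<..<b i}" by blast
    have "\<psi> z = (\<Sum>j\<in>S. if j = i then pplateau (a i) (b i) n z *\<^sub>R c i else 0)"
      unfolding \<psi>_def
    proof (rule sum.cong[OF refl])
      fix j assume j: "j \<in> S"
      show "pplateau (a j) (b j) n z *\<^sub>R c j = (if j = i then pplateau (a i) (b i) n z *\<^sub>R c i else 0)"
      proof (cases "j = i")
        case False
        then have "z \<notin> {a j<..<b j}" using disj[OF j i(1)] i(2) by blast
        then show ?thesis using pplateau_zero[of "a j" "b j" z n] ab[OF j] z False by simp
      qed simp
    qed
    then have "norm (\<psi> z) \<le> norm (c i)"
      using S i pplateau_bounds[of "a i" "b i" n z] ab[OF i(1)] by (simp add: mult_left_le_one_le)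
    then have "(norm (\<psi> z))^2 \<le> indicator {a i<..<b i} z * (norm (c i))^2"
      using i(2) by (simp add: power_mono)
    also have "\<dots> \<le> (\<Sum>j\<in>S. indicator {a j<..<b j} z * (norm (c j))^2)"
      by (rule member_le_sum[OF i(1)]) (use S in auto)
    finally show ?thesis .
  next
    case False
    have "\<psi> z = 0"
      unfolding \<psi>_def
    proof (rule sum.neutral, rule ballI)
      fix j assume j: "j \<in> S"
      then show "pplateau (a j) (b j) n z *\<^sub>R c j = 0"
        using pplateau_zero[of "a j" "b j" z n] ab[OF j] False z by auto
    qed
    then show ?thesis by (simp add: sum_nonneg)
  qed
  have "(l2_norm \<psi>)^2 = (\<integral>z. (norm (\<psi> z))^2 \<partial>I_measure)" by (simp add: l2_norm_power2 l2_inner_self)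
  also have "\<dots> \<le> (\<integral>z. (\<Sum>j\<in>S. indicator {a j<..<b j} z * (norm (c j))^2) \<partial>I_measure)"
  proof (rule integral_mono)
    show "integrable I_measure (\<lambda>z. (norm (\<psi> z))^2)"
      by (intro continuous_imp_integrable_real continuous_intros cont)
  qed (use ind le in auto)
  also have "\<dots> = (\<Sum>j\<in>S. \<integral>z. indicator {a j<..<b j} z * (norm (c j))^2 \<partial>I_measure)"
    by (rule Bochner_Integration.integral_sum) (rule ind)
  also have "\<dots> = (\<Sum>j\<in>S. (norm (c j))^2 * (b j - a j))"
    by (rule sum.cong[OF refl ind2])
  finally show ?thesis by (simp add: \<psi>_def[abs_def])
qed

section \<open>Increments of the solution in time\<close>

context regular_solution
begin

lemma x_L2: "t \<in> {0..T} \<Longrightarrow> x t \<in> L2_space"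
  using Linf.second_orderD(1)[OF x_W2inf[unfolded W2inf_space_def]] Linf_subset_L2 by blast

lemma x_periodic: "t \<in> {0..T} \<Longrightarrow> periodic (x t)"
  using x_L2 by (simp add: L2_space_def)

lemma x_t_L2: "t \<in> {0..T} \<Longrightarrow> x_t t \<in> L2_space"
  using x_t_continuous_rep by (simp add: C_time_def)

lemma x_pairing_continuous:
  assumes \<psi>: "\<psi> \<in> L2_space"
  shows "continuous_on {0..T} (\<lambda>t. l2_inner (x t) \<psi>)"
proof (rule pairing_continuous[OF x_L2 _ \<psi>])
  fix s assume s: "s \<in> {0..T}"
  show "((\<lambda>t. l2_norm (\<lambda>z. x t z - x s z)) \<longlongrightarrow> 0) (at s within {0..T})"
  proof (rule Lim_null_comparison)
    show "((\<lambda>t. w2inf_norm (\<lambda>z. x t z - x s z)) \<longlongrightarrow> 0) (at s within {0..T})"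
      using x_reg s by (simp add: C_time_def)
    show "\<forall>\<^sub>F t in at s within {0..T}. norm (l2_norm (\<lambda>z. x t z - x s z)) \<le> w2inf_norm (\<lambda>z. x t z - x s z)"
      unfolding eventually_at_filter
    proof (intro always_eventually allI impI)
      fix t assume t: "t \<in> {0..T}"
      note C = W2inf_C11(3)[OF x_diff_W2inf[OF t s] x_diff_continuous[OF t s]]
      have "0 \<le> w2inf_norm (\<lambda>z. x t z - x s z)" using order_trans[OF norm_ge_zero C] by blast
      then have "l2_norm (\<lambda>z. x t z - x s z) \<le> w2inf_norm (\<lambda>z. x t z - x s z)"
        by (intro l2_norm_le_AE AE_I2 C L2_space_diff x_L2 t s)
      then show "norm (l2_norm (\<lambda>z. x t z - x s z)) \<le> w2inf_norm (\<lambda>z. x t z - x s z)"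
        by (simp add: l2_norm_nonneg)
    qed
  qed
qed

lemma x_t_pairing_continuous: "\<psi> \<in> L2_space \<Longrightarrow> continuous_on {0..T} (\<lambda>t. l2_inner (x_t t) \<psi>)"
  by (rule pairing_continuous) (use x_t_continuous_rep in \<open>auto simp: C_time_def\<close>)

text \<open>A uniform bound by duality: the increment f is tested with its own direction on the set
  A where its length exceeds the claimed bound M. As \<open>x_t\<close> is bounded through the
  equation, the integral of |f| over A is at most M times the measure of A, so A is a null set, and
  continuity does the rest.\<close>

lemma x_increment_bound:
  assumes B: "\<And>t. t \<in> {0..T} \<Longrightarrow> regular_curve B (x t)" and st: "0 \<le> s" "s < t" "t \<le> T"
  shows "norm (x t z - x s z) \<le> 3 * B ^ 5 * (t - s)"
proof -
  define M f where "M = 3 * B ^ 5 * (t - s)" and "f = (\<lambda>z. x t z - x s z)"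
  have t: "t \<in> {0..T}" "s \<in> {0..T}" using st by auto
  have cf: "continuous_on UNIV f" unfolding f_def by (rule x_diff_continuous[OF t])
  have pf: "periodic f" using x_periodic t by (simp add: f_def periodic_def)
  have mf: "f \<in> borel_measurable I_measure"
    by (rule I_measurable_continuous[OF cf])
  define A where "A = {z \<in> {0..1}. norm (f z) > M}"
  have A: "A \<in> sets I_measure"
  proof -
    have "{z \<in> space I_measure. norm (f z) > M} \<in> sets I_measure" using mf by measurable
    then show ?thesis by (simp add: A_def)
  qed
  have M0: "0 \<le> M" using B[OF t(1)] st by (simp add: M_def regular_curve_def)
  define \<psi> where "\<psi> z = (if norm (f z) > M then sgn (f z) else 0)" for z
  have sgn: "norm (\<psi> z) = indicator A z" "f z \<bullet> \<psi> z = indicator A z * norm (f z)" if "z \<in> {0..1}" for z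
  proof -
    have "norm (\<psi> z) = indicator A z \<and> f z \<bullet> \<psi> z = indicator A z * norm (f z)"
    proof (cases "M < norm (f z)")
      case True
      then have "f z \<noteq> 0" using M0 by auto
      then show ?thesis
        using True that by (simp add: \<psi>_def A_def norm_sgn) (simp add: sgn_div_norm dot_square_norm power2_eq_square)
    qed (simp add: \<psi>_def A_def)
    then show "norm (\<psi> z) = indicator A z" "f z \<bullet> \<psi> z = indicator A z * norm (f z)" by simp_all
  qed
  have \<psi>m: "\<psi> \<in> borel_measurable I_measure"
  proof -
    have "(\<lambda>z. indicator A z *\<^sub>R (f z /\<^sub>R norm (f z))) \<in> borel_measurable I_measure"
      using mf A by (intro borel_measurable_scaleR borel_measurable_indicator) auto
    moreover have "\<psi> z = indicator A z *\<^sub>R (f z /\<^sub>R norm (f z))" if "z \<in> space I_measure" for z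
      using that by (simp add: \<psi>_def A_def sgn_div_norm)
    ultimately show ?thesis
      by (subst measurable_cong[where g = "\<lambda>z. indicator A z *\<^sub>R (f z /\<^sub>R norm (f z))"])
  qed
  have i1: "integrable I_measure (\<lambda>_. 1 :: real)" by (rule continuous_imp_integrable_real) simp
  have iA: "integrable I_measure (indicat_real A)"
    using integrable_mult_indicator[OF A i1] by simp
  have "integrable I_measure (\<lambda>z. (norm (\<psi> z))^2)"
  proof (rule Bochner_Integration.integrable_bound[OF i1])
    show "(\<lambda>z. (norm (\<psi> z))^2) \<in> borel_measurable I_measure"
      using \<psi>m by simp
    show "AE z in I_measure. norm ((norm (\<psi> z))^2) \<le> norm (1 :: real)"
      by (rule AE_I2) (simp add: \<psi>_def norm_sgn)
  qed
  then have \<psi>: "\<psi> \<in> L2_space" using \<psi>m pf by (auto simp: L2_space_def \<psi>_def periodic_def)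
  define m :: real where "m = (\<integral>z. indicator A z \<partial>I_measure)"
  have bound: "\<bar>l2_inner (x_t r) \<psi>\<bar> \<le> 3 * B ^ 5 * m" if r: "r \<in> {0<..T}" for r
  proof -
    \<comment> \<open>The bound on \<open>x_t\<close> does not involve test functions, so it is read
      off with zero ones.\<close>
    have ae: "AE z in I_measure. norm (x_t r z) \<le> 3 * B ^ 5"
      using weak_form_defect(2)[OF r B, of "\<lambda>_. 0" 0 "\<lambda>_. 0" "\<lambda>_. 0"] r by (auto simp: periodic_def)
    have "norm (l2_inner (x_t r) \<psi>) \<le> (\<integral>z. 3 * B ^ 5 * indicator A z \<partial>I_measure)"
      unfolding l2_inner_def
    proof (rule norm_integral_le_AE)
      show "integrable I_measure (\<lambda>z. 3 * B ^ 5 * indicator A z)" using iA by simp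
      have "AE z in I_measure. z \<in> {0..1}" by (rule AE_I2) simp
      with ae show "AE z in I_measure. norm (x_t r z \<bullet> \<psi> z) \<le> 3 * B ^ 5 * indicator A z"
      proof eventually_elim
        case (elim z)
        have "norm (x_t r z \<bullet> \<psi> z) \<le> norm (x_t r z) * norm (\<psi> z)" by (simp add: Cauchy_Schwarz_ineq2)
        also have "\<dots> \<le> 3 * B ^ 5 * norm (\<psi> z)" by (intro mult_right_mono elim) auto
        finally show ?case using sgn(1)[OF elim(2)] by simp
      qed
    qed
    then show ?thesis by (simp add: m_def)
  qed
  have "\<bar>l2_inner (x t) \<psi> - l2_inner (x s) \<psi> - 0 * (t - s)\<bar> \<le> (\<integral>r. indicator {s<..<t} r * (3 * B ^ 5 * m) \<partial>time_measure T)"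
  proof (rule time_pairing_bound[OF x_t_deriv \<psi> x_pairing_continuous[OF \<psi>] st])
    show "integrable (time_measure T) (\<lambda>_. 3 * B ^ 5 * m)" by (rule time_integral_continuous(1)) simp
    show "AE r in time_measure T. r \<in> {s<..<t} \<longrightarrow> \<bar>l2_inner (x_t r) \<psi> - 0\<bar> \<le> 3 * B ^ 5 * m"
      by (rule AE_I2) (use bound in auto)
  qed simp
  also have "\<dots> = M * m" using st by (subst time_indicator_const) (auto simp: M_def)
  finally have "l2_inner f \<psi> \<le> M * m"
    using l2_inner_diff_left[OF x_L2[OF t(1)] x_L2[OF t(2)] \<psi>] by (simp add: f_def)
  moreover have "l2_inner f \<psi> = (\<integral>z. indicator A z * norm (f z) \<partial>I_measure)"
    unfolding l2_inner_def by (rule Bochner_Integration.integral_cong) (use sgn in auto)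
  moreover have if': "integrable I_measure (\<lambda>z. indicator A z * norm (f z))"
    using integrable_mult_indicator[OF A, of "\<lambda>z. norm (f z)"]
    by (simp add: continuous_imp_integrable_real continuous_on_norm continuous_on_subset[OF cf])
  moreover have "(\<integral>z. indicator A z * (norm (f z) - M) \<partial>I_measure) = (\<integral>z. indicator A z * norm (f z) \<partial>I_measure) - M * m"
    using if' iA by (simp add: right_diff_distrib m_def mult.commute)
  moreover have nn: "AE z in I_measure. 0 \<le> indicator A z * (norm (f z) - M)"
    by (rule AE_I2) (auto simp: A_def indicator_def)
  moreover have ii: "integrable I_measure (\<lambda>z. indicator A z * (norm (f z) - M))"
    using if' iA by (simp add: right_diff_distrib)
  ultimately have "(\<integral>z. indicator A z * (norm (f z) - M) \<partial>I_measure) = 0"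
    using integral_nonneg_AE[OF nn] by linarith
  then have "AE z in I_measure. indicator A z * (norm (f z) - M) = 0"
    using integral_nonneg_eq_0_iff_AE[OF ii nn] by simp
  moreover have "AE z in I_measure. z \<in> {0..1}" by (rule AE_I2) simp
  ultimately have "AE z in I_measure. norm (f z) \<le> M"
    by eventually_elim (auto simp: A_def indicator_def split: if_splits)
  then have "norm (f z) \<le> M"
    by (rule AE_le_continuous[rotated 2]) (use cf pf in \<open>auto intro!: continuous_intros simp: periodic_def\<close>)
  then show ?thesis by (simp add: M_def f_def)
qed

text \<open>The increment is tested with itself, and one factor of its norm is divided out.\<close>

lemma x_t_increment_bound:
  assumes G: "integrable (time_measure T) G" "AE r in time_measure T. x_tt r \<in> L2_space \<and> l2_norm (x_tt r) \<le> G r"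
    and st: "0 \<le> s" "s < t" "t \<le> T"
  defines "I \<equiv> window T G s t"
  shows "0 \<le> I" "l2_norm (\<lambda>z. x_t t z - x_t s z) \<le> I"
proof -
  define \<psi> where "\<psi> = (\<lambda>z. x_t t z - x_t s z)"
  have t: "t \<in> {0..T}" "s \<in> {0..T}" using st by auto
  have \<psi>: "\<psi> \<in> L2_space" unfolding \<psi>_def by (intro L2_space_diff x_t_L2 t)
  have "AE r in time_measure T. 0 \<le> indicator {s<..<t} r * G r"
    using G(2)
  proof eventually_elim
    case (elim r)
    then have "0 \<le> G r" using l2_norm_nonneg order_trans by blast
    then show ?case by simp
  qed
  then show I0: "0 \<le> I" unfolding I_def by (rule integral_nonneg_AE)
  have "\<bar>l2_inner (x_t t) \<psi> - l2_inner (x_t s) \<psi> - 0 * (t - s)\<bar> \<le> (\<integral>r. indicator {s<..<t} r * (G r * l2_norm \<psi>) \<partial>time_measure T)"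
  proof (rule time_pairing_bound[OF x_tt_deriv \<psi> x_t_pairing_continuous[OF \<psi>] st])
    show "integrable (time_measure T) (\<lambda>r. G r * l2_norm \<psi>)" using G(1) by simp
    show "AE r in time_measure T. r \<in> {s<..<t} \<longrightarrow> \<bar>l2_inner (x_tt r) \<psi> - 0\<bar> \<le> G r * l2_norm \<psi>"
      using G(2)
    proof eventually_elim
      case (elim r)
      then show ?case
        using l2_Cauchy_Schwarz[of "x_tt r" \<psi>] \<psi> mult_right_mono[OF _ l2_norm_nonneg[of \<psi>], of "l2_norm (x_tt r)" "G r"]
        by auto
    qed
  qed simp
  also have "\<dots> = I * l2_norm \<psi>" by (simp add: I_def flip: mult.assoc)
  finally have "\<bar>l2_inner \<psi> \<psi>\<bar> \<le> I * l2_norm \<psi>"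
    using l2_inner_diff_left[OF x_t_L2[OF t(1)] x_t_L2[OF t(2)] \<psi>] by (simp add: \<psi>_def)
  then show "l2_norm (\<lambda>z. x_t t z - x_t s z) \<le> I"
    using l2_self_le[OF \<psi> _ I0] by (simp add: \<psi>_def)
qed

text \<open>The defect \<open>\<psi>\<close> is tested with itself, with c the pairing of
  \<open>x_t\<close> at the final time. The integrand is then an increment of \<open>x_t\<close>
  over (r, t), controlled by the integral of G over (r, t) and hence over the whole step.\<close>

lemma difference_quotient_defect:
  assumes G: "integrable (time_measure T) G" "AE r in time_measure T. x_tt r \<in> L2_space \<and> l2_norm (x_tt r) \<le> G r"
    and st: "0 \<le> s" "s < t" "t \<le> T"
  shows "l2_norm (\<lambda>z. (x t z - x s z) /\<^sub>R (t - s) - x_t t z) \<le> (window T G s t)" (is "_ \<le> ?I")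
proof -
  define \<psi> where "\<psi> = (\<lambda>z. (x t z - x s z) /\<^sub>R (t - s) - x_t t z)"
  have t: "t \<in> {0..T}" "s \<in> {0..T}" using st by auto
  note d = L2_space_diff[OF x_L2[OF t(1)] x_L2[OF t(2)]]
  have \<psi>: "\<psi> \<in> L2_space" unfolding \<psi>_def by (intro L2_space_diff[OF L2_space_scale[OF d] x_t_L2[OF t(1)]])
  have I0: "0 \<le> ?I" by (rule x_t_increment_bound(1)[OF G st])
  define c where "c = l2_inner (x_t t) \<psi>"
  have "\<bar>l2_inner (x t) \<psi> - l2_inner (x s) \<psi> - c * (t - s)\<bar> \<le> (\<integral>r. indicator {s<..<t} r * (?I * l2_norm \<psi>) \<partial>time_measure T)"
  proof (rule time_pairing_bound[OF x_t_deriv \<psi> x_pairing_continuous[OF \<psi>] st])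
    show "c = 0 \<or> continuous_on {0..T} (\<lambda>r. l2_inner (x_t r) \<psi>)" using x_t_pairing_continuous[OF \<psi>] by simp
    show "integrable (time_measure T) (\<lambda>r. ?I * l2_norm \<psi>)" by (rule time_integral_continuous(1)) simp
    show "AE r in time_measure T. r \<in> {s<..<t} \<longrightarrow> \<bar>l2_inner (x_t r) \<psi> - c\<bar> \<le> ?I * l2_norm \<psi>"
    proof (rule AE_I2, rule impI)
      fix r assume "r \<in> {s<..<t}"
      then have r: "0 \<le> r" "r < t" "r \<in> {0..T}" "s < r" using st by auto
      have "l2_norm (\<lambda>z. x_t t z - x_t r z) \<le> (\<integral>\<sigma>. indicator {r<..<t} \<sigma> * G \<sigma> \<partial>time_measure T)"
        by (rule x_t_increment_bound(2)[OF G r(1,2) st(3)])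
      also have "\<dots> \<le> ?I"
      proof (rule integral_mono_AE)
        show "integrable (time_measure T) (\<lambda>\<sigma>. indicator {r<..<t} \<sigma> * G \<sigma>)"
          "integrable (time_measure T) (\<lambda>\<sigma>. indicator {s<..<t} \<sigma> * G \<sigma>)"
          using r st by (intro time_indicator_integrable G; simp)+
        show "AE \<sigma> in time_measure T. indicator {r<..<t} \<sigma> * G \<sigma> \<le> indicator {s<..<t} \<sigma> * G \<sigma>"
          using G(2)
        proof eventually_elim
          case (elim \<sigma>)
          then have "0 \<le> G \<sigma>" using l2_norm_nonneg order_trans by blast
          then show ?case using r(4) by (intro mult_right_mono) (auto simp: indicator_def)
        qed
      qed
      finally have le: "l2_norm (\<lambda>z. x_t t z - x_t r z) \<le> ?I" .
      have "\<bar>l2_inner (x_t r) \<psi> - c\<bar> = \<bar>l2_inner (\<lambda>z. x_t t z - x_t r z) \<psi>\<bar>"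
        unfolding c_def l2_inner_diff_left[OF x_t_L2[OF t(1)] x_t_L2[OF r(3)] \<psi>] by simp
      also have "\<dots> \<le> l2_norm (\<lambda>z. x_t t z - x_t r z) * l2_norm \<psi>"
        by (intro l2_Cauchy_Schwarz L2_space_diff x_t_L2 t r \<psi>)
      also have "\<dots> \<le> ?I * l2_norm \<psi>" by (intro mult_right_mono le l2_norm_nonneg)
      finally show "\<bar>l2_inner (x_t r) \<psi> - c\<bar> \<le> ?I * l2_norm \<psi>" .
    qed
  qed
  also have "\<dots> = ?I * l2_norm \<psi> * (t - s)"
    using st by (intro time_indicator_const) auto
  finally have b: "\<bar>l2_inner (x t) \<psi> - l2_inner (x s) \<psi> - c * (t - s)\<bar> \<le> ?I * l2_norm \<psi> * (t - s)" .
  have "l2_inner \<psi> \<psi> = l2_inner (\<lambda>z. (x t z - x s z) /\<^sub>R (t - s)) \<psi> - l2_inner (x_t t) \<psi>"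
    using l2_inner_diff_left[OF L2_space_scale[OF d] x_t_L2[OF t(1)] \<psi>] by (simp add: \<psi>_def)
  also have "\<dots> = (l2_inner (x t) \<psi> - l2_inner (x s) \<psi>) / (t - s) - c"
    by (simp add: l2_inner_scale_left l2_inner_diff_left[OF x_L2[OF t(1)] x_L2[OF t(2)] \<psi>] c_def divide_inverse mult.commute)
  also have "\<dots> = (l2_inner (x t) \<psi> - l2_inner (x s) \<psi> - c * (t - s)) / (t - s)"
    using st by (simp add: diff_divide_distrib)
  finally have e: "l2_inner \<psi> \<psi> = (l2_inner (x t) \<psi> - l2_inner (x s) \<psi> - c * (t - s)) / (t - s)" .
  have "\<bar>t - s\<bar> = t - s" using st by simp
  then have "\<bar>l2_inner \<psi> \<psi>\<bar> = \<bar>l2_inner (x t) \<psi> - l2_inner (x s) \<psi> - c * (t - s)\<bar> / (t - s)"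
    by (simp only: e abs_divide)
  also have "\<dots> \<le> ?I * l2_norm \<psi>" using b st by (simp only: pos_divide_le_eq diff_gt_0_iff_gt)
  finally show ?thesis using l2_self_le[OF \<psi> _ I0] by (simp add: \<psi>_def)
qed

text \<open>Increments of f_rho over disjoint intervals are limits of pairings of f with second
  derivatives of plateaus. In these pairings the time derivative of f appears with its H2 norm,
  against the L2 norm of the sum of plateaus.\<close>

lemma derivative_increments_bound:
  fixes c :: "nat \<Rightarrow> real^2"
  assumes G: "integrable (time_measure T) G" "AE r in time_measure T. x_t r \<in> H2_space \<and> h2_norm (x_t r) \<le> G r"
    and st: "0 \<le> s" "s < t" "t \<le> T"
    and S: "finite S" and ab: "\<And>j. j \<in> S \<Longrightarrow> 0 \<le> a j \<and> a j < b j \<and> b j \<le> 1"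
    and disj: "\<And>i j. i \<in> S \<Longrightarrow> j \<in> S \<Longrightarrow> i \<noteq> j \<Longrightarrow> {a i<..<b i} \<inter> {a j<..<b j} = {}"
  defines "I \<equiv> window T G s t"
    and "f \<equiv> \<lambda>z. x t z - x s z"
  shows "0 \<le> I" "\<bar>\<Sum>j\<in>S. (d_rho f (b j) - d_rho f (a j)) \<bullet> c j\<bar> \<le> I * sqrt (\<Sum>j\<in>S. (norm (c j))^2 * (b j - a j))"
proof -
  have t: "t \<in> {0..T}" "s \<in> {0..T}" using st by auto
  have h0: "0 \<le> h2_norm v" for v :: "real \<Rightarrow> real^2" by (simp add: h2_norm_def)
  have "AE r in time_measure T. 0 \<le> indicator {s<..<t} r * G r"
    using G(2)
  proof eventually_elim
    case (elim r)
    then have "0 \<le> G r" using h0 order_trans by blast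
    then show ?case by simp
  qed
  then show I0: "0 \<le> I" unfolding I_def by (rule integral_nonneg_AE)
  note C = W2inf_C11[OF x_diff_W2inf[OF t] x_diff_continuous[OF t], folded f_def]
  have pf: "periodic f" using x_periodic t by (simp add: f_def periodic_def)
  have cf: "continuous_on UNIV f" unfolding f_def by (rule x_diff_continuous[OF t])
  have cf': "continuous_on UNIV (d_rho f)" by (rule lipschitz_continuous[OF C(2)])
  define \<phi> where "\<phi> n j = pplateau (a j) (b j) n" for n j
  have \<phi>: "smooth (\<phi> n j)" "periodic (\<phi> n j)" if "j \<in> S" for n j
    unfolding \<phi>_def using ab[OF that] by (auto intro: smooth_pplateau periodic_pplateau)
  define R where "R = sqrt (\<Sum>j\<in>S. (norm (c j))^2 * (b j - a j))"
  have R: "l2_norm (\<lambda>z. \<Sum>j\<in>S. \<phi> n j z *\<^sub>R c j) \<le> R" for n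
    unfolding R_def \<phi>_def by (rule real_le_rsqrt[OF l2_norm_disjoint_plateaus[OF S ab disj]])
  have bound: "\<bar>\<Sum>j\<in>S. (\<integral>z. deriv (\<phi> n j) z *\<^sub>R d_rho f z \<partial>I_measure) \<bullet> c j\<bar> \<le> I * R" for n
  proof -
    define D where "D = (\<lambda>z. \<Sum>j\<in>S. deriv (deriv (\<phi> n j)) z *\<^sub>R c j)"
    have cD: "continuous_on UNIV D" unfolding D_def by (intro continuous_intros smooth_continuous2 \<phi>)
    have "periodic D"
      using periodic_deriv_smooth[OF smooth_deriv[OF \<phi>(1)] periodic_deriv_smooth[OF \<phi>]]
      by (auto simp: D_def periodic_def intro!: sum.cong)
    then have D: "D \<in> L2_space" by (rule L2_space_continuous[OF cD])
    have "\<bar>l2_inner (x t) D - l2_inner (x s) D - 0 * (t - s)\<bar> \<le> (\<integral>r. indicator {s<..<t} r * (G r * R) \<partial>time_measure T)"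
    proof (rule time_pairing_bound[OF x_t_deriv D x_pairing_continuous[OF D] st])
      show "integrable (time_measure T) (\<lambda>r. G r * R)" using G(1) by simp
      show "AE r in time_measure T. r \<in> {s<..<t} \<longrightarrow> \<bar>l2_inner (x_t r) D - 0\<bar> \<le> G r * R"
        using G(2)
      proof eventually_elim
        case (elim r)
        have "\<bar>l2_inner (x_t r) D\<bar> \<le> h2_norm (x_t r) * l2_norm (\<lambda>z. \<Sum>j\<in>S. \<phi> n j z *\<^sub>R c j)"
          unfolding D_def by (rule H2_pairing) (use elim S \<phi> in auto)
        also have "\<dots> \<le> G r * R"
          using elim order_trans[OF h0] by (intro mult_mono R l2_norm_nonneg) auto
        finally show ?case by simp
      qed
    qed simp
    also have "\<dots> = I * R" by (simp add: I_def flip: mult.assoc)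
    finally have 1: "\<bar>l2_inner f D\<bar> \<le> I * R"
      using l2_inner_diff_left[OF x_L2[OF t(1)] x_L2[OF t(2)] D] by (simp add: f_def)
    have parts: "(\<integral>z. deriv (deriv (\<phi> n j)) z *\<^sub>R f z \<partial>I_measure) = - (\<integral>z. deriv (\<phi> n j) z *\<^sub>R d_rho f z \<partial>I_measure)" if j: "j \<in> S" for j
    proof -
      note \<phi>' = smooth_deriv[OF \<phi>(1)[OF j]] periodic_deriv_smooth[OF \<phi>[OF j]]
      obtain L where L: "\<And>x y. norm (deriv (\<phi> n j) x - deriv (\<phi> n j) y) \<le> L * \<bar>x - y\<bar>"
        using smooth_periodic_lipschitz[OF \<phi>'] by blast
      have m: "deriv (deriv (\<phi> n j)) \<in> borel_measurable I_measure" "d_rho f \<in> borel_measurable I_measure"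
        by (intro I_measurable_continuous smooth_continuous2 \<phi>(1)[OF j] cf')+
      have q: "AE z in I_measure. ((\<lambda>h. (deriv (\<phi> n j) z - deriv (\<phi> n j) (z - h)) /\<^sub>R h) \<longlongrightarrow> deriv (deriv (\<phi> n j)) z) (at_right 0)"
        using smooth_DERIV0[OF \<phi>'(1)]
        by (intro AE_I2 vector_derivative_quotients) (simp add: has_real_derivative_iff_has_vector_derivative)
      have q2: "AE z in I_measure. ((\<lambda>h. (f (z + h) - f z) /\<^sub>R h) \<longlongrightarrow> d_rho f z) (at_right 0)"
        by (intro AE_I2 vector_derivative_quotients C(1))
      show ?thesis
        using lipschitz_parts(3)[OF bounded_bilinear_scaleR pf C1_lipschitz[OF C(1,4)] m(2) q2 \<phi>'(2) L m(1) q] by simp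
    qed
    have int: "integrable I_measure (\<lambda>z. deriv (deriv (\<phi> n j)) z *\<^sub>R f z)" if "j \<in> S" for j
      by (intro continuous_imp_integrable_real continuous_intros smooth_continuous2 \<phi>(1) that continuous_on_subset[OF cf]) simp
    have "l2_inner f D = (\<integral>z. (\<Sum>j\<in>S. (deriv (deriv (\<phi> n j)) z *\<^sub>R f z) \<bullet> c j) \<partial>I_measure)"
      by (simp add: l2_inner_def D_def inner_sum_right)
    also have "\<dots> = (\<Sum>j\<in>S. \<integral>z. (deriv (deriv (\<phi> n j)) z *\<^sub>R f z) \<bullet> c j \<partial>I_measure)"
      by (intro Bochner_Integration.integral_sum integrable_inner_left) (use int in auto)
    also have "\<dots> = (\<Sum>j\<in>S. (\<integral>z. deriv (deriv (\<phi> n j)) z *\<^sub>R f z \<partial>I_measure) \<bullet> c j)"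
      by (intro sum.cong refl integral_inner_left) (use int in auto)
    also have "\<dots> = - (\<Sum>j\<in>S. (\<integral>z. deriv (\<phi> n j) z *\<^sub>R d_rho f z \<partial>I_measure) \<bullet> c j)"
      by (simp add: parts sum_negf)
    finally show ?thesis using 1 by simp
  qed
  have "(\<lambda>n. \<bar>\<Sum>j\<in>S. (\<integral>z. deriv (\<phi> n j) z *\<^sub>R d_rho f z \<partial>I_measure) \<bullet> c j\<bar>) \<longlonglongrightarrow> \<bar>\<Sum>j\<in>S. (d_rho f (a j) - d_rho f (b j)) \<bullet> c j\<bar>"
    unfolding \<phi>_def
    by (intro tendsto_intros pplateau_deriv_integral_tendsto cf') (use ab in auto)
  then have "\<bar>\<Sum>j\<in>S. (d_rho f (a j) - d_rho f (b j)) \<bullet> c j\<bar> \<le> I * R"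
    by (rule LIMSEQ_le_const2) (use bound in auto)
  moreover have "(\<Sum>j\<in>S. (d_rho f (a j) - d_rho f (b j)) \<bullet> c j) = - (\<Sum>j\<in>S. (d_rho f (b j) - d_rho f (a j)) \<bullet> c j)"
    unfolding sum_negf[symmetric] by (intro sum.cong) (auto simp: inner_diff_left)
  ultimately show "\<bar>\<Sum>j\<in>S. (d_rho f (b j) - d_rho f (a j)) \<bullet> c j\<bar> \<le> I * sqrt (\<Sum>j\<in>S. (norm (c j))^2 * (b j - a j))"
    by (simp add: R_def)
qed

text \<open>With the increments themselves as coefficients the bound for the sum Q of their squares
  reads Q \<le> I sqrt(Q/J). The factor 1/J is the length of an element; it expresses the H2
  regularity in space.\<close>

lemma element_oscillation:
  assumes G: "integrable (time_measure T) G" "AE r in time_measure T. x_t r \<in> H2_space \<and> h2_norm (x_t r) \<le> G r"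
    and st: "0 \<le> s" "s < t" "t \<le> T"
    and J: "1 \<le> J" and el: "\<And>j. j < J \<Longrightarrow> a j \<in> {node J j..node J (Suc j)}" "\<And>j. j < J \<Longrightarrow> b j \<in> {node J j..node J (Suc j)}"
  defines "I \<equiv> window T G s t"
    and "f \<equiv> \<lambda>z. x t z - x s z"
  shows "(\<Sum>j<J. (norm (d_rho f (a j) - d_rho f (b j)))^2) \<le> I^2 / real J"
proof -
  \<comment> \<open>Plateaus live on nondegenerate intervals, so pairs of equal points, which
    contribute nothing, are dropped; u and v put the remaining pairs in order.\<close>
  define S where "S = {j. j < J \<and> a j \<noteq> b j}"
  define u v where "u j = min (a j) (b j)" and "v j = max (a j) (b j)" for j
  have el': "node J j \<le> u j" "v j \<le> node J (Suc j)" "u j < v j" if "j \<in> S" for j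
    using that el[of j] by (auto simp: S_def u_def v_def)
  have nd: "0 \<le> node J j" "node J (Suc j) \<le> 1" "node J (Suc j) - node J j = 1 / real J" if "j < J" for j
  proof -
    show "node J (Suc j) \<le> 1"
      using that by (auto simp: node_def divide_le_eq_1 simp del: of_nat_Suc)
  qed (use that in \<open>auto simp: node_def add_divide_distrib\<close>)
  have ab: "0 \<le> u j \<and> u j < v j \<and> v j \<le> 1" "v j - u j \<le> 1 / real J" if "j \<in> S" for j
    using el'[OF that] nd[of j] that by (auto simp: S_def)
  have sep: "node J (Suc i) \<le> node J j" if "i < j" for i j
    using that J by (auto simp: node_def intro!: divide_right_mono)
  have disj: "{u i<..<v i} \<inter> {u j<..<v j} = {}" if ij: "i \<in> S" "j \<in> S" "i \<noteq> j" for i j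
  proof (cases "i < j")
    case True
    then show ?thesis using el'[OF ij(1)] el'[OF ij(2)] sep[OF True] by (auto simp: disjoint_iff)
  next
    case False
    then have "j < i" using ij(3) by simp
    then show ?thesis using el'[OF ij(1)] el'[OF ij(2)] sep[of j i] by (auto simp: disjoint_iff)
  qed
  define c where "c j = d_rho f (v j) - d_rho f (u j)" for j
  have nc: "norm (c j) = norm (d_rho f (a j) - d_rho f (b j))" for j
    by (auto simp: c_def u_def v_def min_def max_def norm_minus_commute)
  define Q where "Q = (\<Sum>j\<in>S. (norm (c j))^2)"
  have Q0: "0 \<le> Q" by (simp add: Q_def sum_nonneg)
  note D = derivative_increments_bound(1)[OF G st, of S u v, folded I_def f_def]
    derivative_increments_bound(2)[OF G st, of S u v c, folded I_def f_def]
  have fS: "finite S" by (simp add: S_def)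
  have I0: "0 \<le> I" by (rule D(1)[OF fS ab(1) disj])
  have "Q = \<bar>\<Sum>j\<in>S. (d_rho f (v j) - d_rho f (u j)) \<bullet> c j\<bar>"
    using Q0 by (simp add: Q_def c_def power2_norm_eq_inner)
  also have "\<dots> \<le> I * sqrt (\<Sum>j\<in>S. (norm (c j))^2 * (v j - u j))" by (rule D(2)[OF fS ab(1) disj])
  also have "\<dots> \<le> I * sqrt (\<Sum>j\<in>S. (norm (c j))^2 * (1 / real J))"
    by (intro mult_left_mono I0 real_sqrt_le_mono sum_mono ab) auto
  also have "(\<Sum>j\<in>S. (norm (c j))^2 * (1 / real J)) = Q * (1 / real J)"
    by (simp only: Q_def sum_distrib_right)
  finally have "Q \<le> I * sqrt (Q * (1 / real J))" .
  then have "Q^2 \<le> (I * sqrt (Q * (1 / real J)))^2" using Q0 by (rule power_mono)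
  also have "\<dots> = I^2 * (Q / real J)" using Q0 by (simp add: power_mult_distrib)
  finally have "Q * Q \<le> (I^2 / real J) * Q" by (simp add: power2_eq_square mult.commute)
  then have "Q \<le> I^2 / real J"
    using Q0 mult_right_le_imp_le[of Q Q "I^2 / real J"] by (cases "Q = 0") simp_all
  moreover have "(\<Sum>j<J. (norm (d_rho f (a j) - d_rho f (b j)))^2) = Q"
    unfolding Q_def nc by (rule sum.mono_neutral_right) (auto simp: S_def)
  ultimately show ?thesis by simp
qed

text \<open>The case of one element per period bounds the oscillation of the derivative by I, and a
  periodic function has derivatives no larger than twice their oscillation.\<close>

lemma x_increment_derivative_bound:
  assumes G: "integrable (time_measure T) G" "AE r in time_measure T. x_t r \<in> H2_space \<and> h2_norm (x_t r) \<le> G r"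
    and st: "0 \<le> s" "s < t" "t \<le> T"
  defines "I \<equiv> window T G s t"
    and "f \<equiv> \<lambda>z. x t z - x s z"
  shows "norm (d_rho f z) \<le> 2 * I" "0 \<le> I"
proof -
  have t: "t \<in> {0..T}" "s \<in> {0..T}" using st by auto
  note C = W2inf_C11[OF x_diff_W2inf[OF t] x_diff_continuous[OF t], folded f_def]
  have pf: "periodic f" using x_periodic t by (simp add: f_def periodic_def)
  have pd: "periodic (d_rho f)" by (rule periodic_d_rho[OF pf C(1)])
  show I0: "0 \<le> I"
    using derivative_increments_bound(1)[OF G st, of "{}" "\<lambda>_. 0" "\<lambda>_. 0"] by (simp add: I_def)
  have "norm (d_rho f a - d_rho f b) \<le> I" for a b
  proof -
    have "(\<Sum>j<(1::nat). (norm (d_rho f (frac a) - d_rho f (frac b)))^2) \<le> I^2 / real 1"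
      unfolding I_def f_def
      by (rule element_oscillation[OF G st, of 1 "\<lambda>_. frac a" "\<lambda>_. frac b"])
        (auto simp: node_def less_imp_le[OF frac_lt_1])
    then have "(norm (d_rho f a - d_rho f b))^2 \<le> I^2"
      using periodic_frac[OF pd, of a] periodic_frac[OF pd, of b] by simp
    then show ?thesis using I0 by (rule power2_le_imp_le)
  qed
  then show "norm (d_rho f z) \<le> 2 * I"
    by (intro periodic_derivative_bound[OF pf C(1)])
qed

end

text \<open>Cauchy-Schwarz on each step yields the factor \<open>dt\<close>, and the steps are
  disjoint.\<close>

lemma sum_time_integrals:
  fixes G :: "real \<Rightarrow> real"
  assumes G: "G \<in> borel_measurable (time_measure T)" "integrable (time_measure T) (\<lambda>t. (G t)^2)"
    and T: "0 < T" and M: "1 \<le> M"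
  defines "dt \<equiv> T / real M"
  defines "I \<equiv> \<lambda>n. \<integral>r. indicator {real n * dt<..<real (Suc n) * dt} r * G r \<partial>time_measure T"
  shows "integrable (time_measure T) G"
    and "(\<Sum>n<M. (I n)^2) \<le> dt * (\<integral>r. (G r)^2 \<partial>time_measure T)"
proof -
  have c1: "integrable (time_measure T) (\<lambda>_. c :: real)" for c
    by (rule time_integral_continuous(1)) simp
  show iG: "integrable (time_measure T) G"
  proof (rule Bochner_Integration.integrable_bound)
    show "integrable (time_measure T) (\<lambda>t. 1 + (G t)^2)" using c1 G(2) by simp
    have "\<bar>G t\<bar> \<le> 1 + (G t)^2" for t
      using sum_squares_bound[of 1 "\<bar>G t\<bar>"] by simp
    then show "AE t in time_measure T. norm (G t) \<le> norm (1 + (G t)^2)" by (intro AE_I2) auto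
  qed (rule G(1))
  have dt: "dt > 0" using T M by (simp add: dt_def)
  define A where "A n = {real n * dt<..<real (Suc n) * dt}" for n
  have A: "0 \<le> real n * dt" "real n * dt \<le> real (Suc n) * dt" "real (Suc n) * dt \<le> T" if "n < M" for n
  proof -
    have "real (Suc n) * dt \<le> real M * dt" using that dt by (intro mult_right_mono) auto
    then show "real (Suc n) * dt \<le> T" using M by (simp add: dt_def)
  qed (use dt in auto)
  have i1: "integrable (time_measure T) (\<lambda>r. indicator (A n) r * F r)" if "n < M" "integrable (time_measure T) F" for n and F :: "real \<Rightarrow> real"
    unfolding A_def using A[OF that(1)] by (intro time_indicator_integrable that(2)) auto
  have "(I n)^2 \<le> dt * (\<integral>r. indicator (A n) r * (G r)^2 \<partial>time_measure T)" if n: "n < M" for n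
  proof -
    \<comment> \<open>The mean of G over the step: nonnegativity of the integral of (G - m)^2 is
      Cauchy-Schwarz on it.\<close>
    define m where "m = I n / dt"
    have "0 \<le> (\<integral>r. indicator (A n) r * (G r - m)^2 \<partial>time_measure T)" by simp
    also have "\<dots> = (\<integral>r. indicator (A n) r * (G r)^2 - 2 * m * (indicator (A n) r * G r) + indicator (A n) r * m^2 \<partial>time_measure T)"
      by (rule Bochner_Integration.integral_cong) (auto simp: power2_diff algebra_simps)
    also have "\<dots> = (\<integral>r. indicator (A n) r * (G r)^2 \<partial>time_measure T) - 2 * m * I n + (\<integral>r. indicator (A n) r * m^2 \<partial>time_measure T)"
      using i1[OF n G(2)] i1[OF n iG] i1[OF n c1, of "m^2"] by (simp add: I_def A_def)
    also have "(\<integral>r. indicator (A n) r * m^2 \<partial>time_measure T) = m^2 * dt"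
      unfolding A_def using A[OF n] by (subst time_indicator_const) (auto simp: algebra_simps)
    finally have "2 * m * I n - m^2 * dt \<le> (\<integral>r. indicator (A n) r * (G r)^2 \<partial>time_measure T)" by simp
    moreover have "2 * m * I n - m^2 * dt = (I n)^2 / dt"
      using dt by (simp add: m_def power2_eq_square field_simps)
    ultimately show ?thesis using dt by (simp add: divide_le_eq mult.commute)
  qed
  then have "(\<Sum>n<M. (I n)^2) \<le> (\<Sum>n<M. dt * (\<integral>r. indicator (A n) r * (G r)^2 \<partial>time_measure T))"
    by (intro sum_mono) simp
  also have "\<dots> = dt * (\<integral>r. (\<Sum>n<M. indicator (A n) r * (G r)^2) \<partial>time_measure T)"
    by (subst Bochner_Integration.integral_sum) (auto intro: i1 G(2) simp: sum_distrib_left)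
  also have "\<dots> \<le> dt * (\<integral>r. (G r)^2 \<partial>time_measure T)"
  proof (intro mult_left_mono integral_mono)
    show "integrable (time_measure T) (\<lambda>r. \<Sum>n<M. indicator (A n) r * (G r)^2)"
      by (intro Bochner_Integration.integrable_sum i1 G(2)) simp
    fix r
    have "(\<Sum>n<M. indicator (A n) r) \<le> (1 :: real)"
    proof (cases "\<exists>i<M. r \<in> A i")
      case True
      then obtain i where i: "i < M" "r \<in> A i" by blast
      have uniq: "j = i" if "r \<in> A j" for j
      proof (rule ccontr)
        assume "j \<noteq> i"
        then have "Suc j \<le> i \<or> Suc i \<le> j" by linarith
        then show False
        proof
          assume "Suc j \<le> i"
          then have "real (Suc j) * dt \<le> real i * dt" using dt by (intro mult_right_mono) auto
          then show False using that i(2) by (auto simp: A_def simp del: of_nat_Suc)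
        next
          assume "Suc i \<le> j"
          then have "real (Suc i) * dt \<le> real j * dt" using dt by (intro mult_right_mono) auto
          then show False using that i(2) by (auto simp: A_def simp del: of_nat_Suc)
        qed
      qed
      have "(\<Sum>n<M. indicator (A n) r) = (\<Sum>n<M. if n = i then 1 else (0 :: real))"
      proof (rule sum.cong[OF refl])
        fix n show "indicator (A n) r = (if n = i then 1 else (0 :: real))"
          using i(2) uniq[of n] by (cases "r \<in> A n") auto
      qed
      then show ?thesis by simp
    next
      case False
      then have "(\<Sum>n<M. indicator (A n) r) = (0 :: real)" by (intro sum.neutral) (auto simp: indicator_def)
      then show ?thesis by simp
    qed
    from mult_right_mono[OF this, of "(G r)^2"]
    show "(\<Sum>n<M. indicator (A n) r * (G r)^2) \<le> (G r)^2" by (simp add: sum_distrib_right)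
  qed (use G(2) dt in auto)
  finally show "(\<Sum>n<M. (I n)^2) \<le> dt * (\<integral>r. (G r)^2 \<partial>time_measure T)" .
qed

subsection \<open>The nodal form of the scheme\<close>

text \<open>The mean over an element of the product of three affine functions with given end values.\<close>

definition tri :: "real \<Rightarrow> real \<Rightarrow> 'a::real_inner \<Rightarrow> 'a \<Rightarrow> 'a \<Rightarrow> 'a \<Rightarrow> real" where
  "tri a b u u' v v' = (3 * a * (u \<bullet> v) + a * (u \<bullet> v') + a * (u' \<bullet> v) + b * (u \<bullet> v)
     + a * (u' \<bullet> v') + b * (u \<bullet> v') + b * (u' \<bullet> v) + 3 * b * (u' \<bullet> v')) / 12"

text \<open>Nodal values are indexed periodically by all natural numbers, so \<open>Suc j\<close> is
  always a legitimate neighbour and the last element is no special case.\<close>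

definition cyc :: "nat \<Rightarrow> (nat \<Rightarrow> 'a) \<Rightarrow> bool" where
  "cyc J U \<longleftrightarrow> (\<forall>j. U (j + J) = U j)"

definition slope :: "nat \<Rightarrow> (nat \<Rightarrow> 'a::real_vector) \<Rightarrow> nat \<Rightarrow> 'a" where
  "slope J U j = real J *\<^sub>R (U (Suc j) - U j)"

text \<open>The squared L2 norm by the trapezoidal rule (mass lumping). It dominates the exact norm
  of the piecewise affine function, see \<open>l2_norm_plin\<close>.\<close>

definition n2 :: "nat \<Rightarrow> (nat \<Rightarrow> 'a::real_normed_vector) \<Rightarrow> real" where
  "n2 J U = (\<Sum>j<J. (norm (U j))^2) / real J"

text \<open>Slopes are constant on elements, so this is exactly the squared H1 seminorm of the
  piecewise affine function.\<close>

definition s2 :: "nat \<Rightarrow> (nat \<Rightarrow> 'a::real_normed_vector) \<Rightarrow> real" where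
  "s2 J U = n2 J (slope J U)"

abbreviation mid :: "(nat \<Rightarrow> real^2) \<Rightarrow> nat \<Rightarrow> real" where
  "mid A j \<equiv> (A j + A (Suc j)) \<bullet> e1 / 2"

abbreviation tri_at :: "(nat \<Rightarrow> real^2) \<Rightarrow> (nat \<Rightarrow> 'a::real_inner) \<Rightarrow> (nat \<Rightarrow> 'a) \<Rightarrow> nat \<Rightarrow> real" where
  "tri_at A Z H j \<equiv> tri (A j \<bullet> e1) (A (Suc j) \<bullet> e1) (Z j) (Z (Suc j)) (H j) (H (Suc j))"

text \<open>The values lie in an arbitrary inner product space: the same form serves the vector
  problem and, for solvability, its scalar components.\<close>

definition mass :: "nat \<Rightarrow> (nat \<Rightarrow> real^2) \<Rightarrow> (nat \<Rightarrow> 'a::real_inner) \<Rightarrow> (nat \<Rightarrow> 'a) \<Rightarrow> real" where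
  "mass J A Z H = (\<Sum>j<J. (norm (slope J A j))^2 * tri_at A Z H j) / real J"

text \<open>The slope of H times the length of the element is the increment of H, so no factor J
  remains; the affine weight enters through its mean over the element.\<close>

definition stiff :: "nat \<Rightarrow> (nat \<Rightarrow> real^2) \<Rightarrow> (nat \<Rightarrow> 'a::real_inner) \<Rightarrow> (nat \<Rightarrow> 'a) \<Rightarrow> real" where
  "stiff J A V H = (\<Sum>j<J. mid A j * (slope J V j \<bullet> (H (Suc j) - H j)))"

definition source :: "nat \<Rightarrow> (nat \<Rightarrow> real^2) \<Rightarrow> (nat \<Rightarrow> real^2) \<Rightarrow> real" where
  "source J A H = (\<Sum>j<J. (norm (slope J A j))^2 * (mid H j)) / real J"

definition scheme_form :: "nat \<Rightarrow> (nat \<Rightarrow> real^2) \<Rightarrow> (nat \<Rightarrow> real^2) \<Rightarrow> (nat \<Rightarrow> real^2) \<Rightarrow> (nat \<Rightarrow> real^2) \<Rightarrow> real" where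
  "scheme_form J A Z V H = mass J A Z H + stiff J A V H + source J A H"

lemma tri_bound:
  assumes "\<bar>a\<bar> \<le> C" "\<bar>b\<bar> \<le> C"
  shows "\<bar>tri a b u u' v v'\<bar> \<le> C * (norm u + norm u') * (norm v + norm v')"
proof -
  have t: "\<bar>k * (x \<bullet> y)\<bar> \<le> C * (norm x * norm y)" if "\<bar>k\<bar> \<le> C" for k and x y :: 'a
    using that Cauchy_Schwarz_ineq2[of x y] by (simp add: abs_mult mult_mono)
  have e: "12 * tri a b u u' v v' = 3 * (a * (u \<bullet> v)) + a * (u \<bullet> v') + a * (u' \<bullet> v) + b * (u \<bullet> v)
     + a * (u' \<bullet> v') + b * (u \<bullet> v') + b * (u' \<bullet> v) + 3 * (b * (u' \<bullet> v'))"
    by (simp add: tri_def)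
  have "\<bar>12 * tri a b u u' v v'\<bar> \<le> 4 * (C * (norm u * norm v)) + 2 * (C * (norm u * norm v')) + 2 * (C * (norm u' * norm v)) + 4 * (C * (norm u' * norm v'))"
    unfolding e
    using t[OF assms(1), of u v, unfolded abs_le_iff] t[OF assms(1), of u v', unfolded abs_le_iff]
      t[OF assms(1), of u' v, unfolded abs_le_iff] t[OF assms(1), of u' v', unfolded abs_le_iff]
      t[OF assms(2), of u v, unfolded abs_le_iff] t[OF assms(2), of u v', unfolded abs_le_iff]
      t[OF assms(2), of u' v, unfolded abs_le_iff] t[OF assms(2), of u' v', unfolded abs_le_iff]
    by (intro abs_leI) linarith+
  also have "\<dots> \<le> 12 * (C * (norm u + norm u') * (norm v + norm v'))"
  proof -
    have "0 \<le> C" using assms by linarith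
    then have "0 \<le> C * (norm u * norm v)" "0 \<le> C * (norm u * norm v')" "0 \<le> C * (norm u' * norm v)" "0 \<le> C * (norm u' * norm v')"
      by auto
    then show ?thesis by (simp add: algebra_simps)
  qed
  finally show ?thesis by simp
qed

lemma tri_diff_left: "tri a b u u' v v' - tri c d u u' v v' = tri (a - c) (b - d) u u' v v'"
  unfolding tri_def by (simp add: field_simps)

lemma tri_diff_mid: "tri a b (u - w) (u' - w') v v' = tri a b u u' v v' - tri a b w w' v v'"
  unfolding tri_def inner_diff_left by (simp add: field_simps)

lemma tri_coercive:
  assumes "c \<le> a" "c \<le> b" "0 \<le> c"
  shows "c / 6 * ((norm u)^2 + (norm u')^2) \<le> tri a b u u' u u'"
proof -
  have e: "(norm (u + u'))^2 = (norm u)^2 + 2 * (u \<bullet> u') + (norm u')^2"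
    by (simp add: power2_norm_eq_inner inner_add inner_commute)
  have "tri a b u u' u u' = (a * (2 * (norm u)^2 + (norm (u + u'))^2) + b * ((norm (u + u'))^2 + 2 * (norm u')^2)) / 12"
    unfolding e tri_def by (simp add: power2_norm_eq_inner inner_commute algebra_simps)
  moreover have "c * (2 * (norm u)^2) \<le> a * (2 * (norm u)^2 + (norm (u + u'))^2)"
    using assms by (intro mult_mono) auto
  moreover have "c * (2 * (norm u')^2) \<le> b * ((norm (u + u'))^2 + 2 * (norm u')^2)"
    using assms by (intro mult_mono) auto
  ultimately show ?thesis by (simp add: algebra_simps)
qed

lemma cyc_mod:
  assumes "cyc J U"
  shows "U j = U (j mod J)"
proof -
  have "U (i + J * q) = U i" for i q
  proof (induction q)
    case (Suc q)
    have "U (i + J * q + J) = U (i + J * q)" using assms unfolding cyc_def by blast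
    then show ?case using Suc by (simp add: add.assoc add.commute[of J])
  qed simp
  from this[of "j mod J" "j div J"] show ?thesis by simp
qed

lemma cyc_sum_shift:
  fixes f :: "nat \<Rightarrow> 'a::ab_group_add"
  assumes "cyc J f"
  shows "(\<Sum>j<J. f (Suc j)) = (\<Sum>j<J. f j)"
proof -
  have "f J = f 0" using assms by (auto simp: cyc_def dest: spec[of _ 0])
  moreover have "(\<Sum>j<J. f (Suc j)) + f 0 = (\<Sum>j<J. f j) + f J"
    using sum.lessThan_Suc_shift[of f J] by (simp add: add.commute)
  ultimately show ?thesis by simp
qed

lemma cyc_slope: "cyc J U \<Longrightarrow> cyc J (slope J U)"
  unfolding cyc_def slope_def by (simp add: add_Suc[symmetric] del: add_Suc)

lemma n2_nonneg: "0 \<le> n2 J U" by (simp add: n2_def sum_nonneg)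

lemma s2_nonneg: "0 \<le> s2 J U" by (simp add: s2_def n2_nonneg)

lemma n2_shift: "cyc J U \<Longrightarrow> (\<Sum>j<J. (norm (U (Suc j)))^2) / real J = n2 J U"
  unfolding n2_def by (subst cyc_sum_shift[of J "\<lambda>j. (norm (U j))^2"]) (auto simp: cyc_def)

lemma summation_by_parts:
  fixes c H :: "nat \<Rightarrow> 'a::real_inner"
  assumes "cyc J c" "cyc J H"
  shows "(\<Sum>j<J. c j \<bullet> (H (Suc j) - H j)) = - (\<Sum>j<J. (c (Suc j) - c j) \<bullet> H (Suc j))"
proof -
  have "(\<Sum>j<J. c (Suc j) \<bullet> H (Suc j)) = (\<Sum>j<J. c j \<bullet> H j)"
    by (rule cyc_sum_shift) (use assms in \<open>auto simp: cyc_def\<close>)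
  then show ?thesis by (simp add: inner_diff_left inner_diff_right sum_subtractf)
qed

lemma young: "0 < \<epsilon> \<Longrightarrow> x * y \<le> \<epsilon> * y^2 + x^2 / (4 * \<epsilon>)" for x y :: real
proof -
  assume e: "0 < \<epsilon>"
  have "0 \<le> (2 * \<epsilon> * y - x)^2" by simp
  then have "4 * \<epsilon> * (x * y) \<le> 4 * \<epsilon> * (\<epsilon> * y^2) + x^2" by (simp add: power2_diff power_mult_distrib algebra_simps power2_eq_square)
  then show ?thesis using e by (simp add: field_simps)
qed

lemma sum2_sq: "(a + b)^2 \<le> 2 * a^2 + 2 * b^2" for a b :: real
  using sum_squares_bound[of a b] by (simp add: power2_sum)

lemma sum3_sq: "(a + b + c)^2 \<le> 3 * (a^2 + b^2 + c^2)" for a b c :: real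
  using sum_squares_bound[of a b] sum_squares_bound[of a c] sum_squares_bound[of b c]
  by (simp add: power2_eq_square algebra_simps)

lemma sum_young:
  fixes x y :: "nat \<Rightarrow> real"
  assumes "0 < \<epsilon>" "0 < real J"
  shows "(\<Sum>j<J. x j * y j) / real J \<le> \<epsilon> * ((\<Sum>j<J. (y j)^2) / real J) + ((\<Sum>j<J. (x j)^2) / real J) / (4 * \<epsilon>)"
proof -
  have "(\<Sum>j<J. x j * y j) \<le> (\<Sum>j<J. \<epsilon> * (y j)^2 + (x j)^2 / (4 * \<epsilon>))"
    by (intro sum_mono young assms)
  also have "\<dots> = \<epsilon> * (\<Sum>j<J. (y j)^2) + (\<Sum>j<J. (x j)^2) / (4 * \<epsilon>)"
    by (simp add: sum.distrib sum_distrib_left sum_divide_distrib)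
  finally show ?thesis
    using assms by (simp add: divide_right_mono add_divide_distrib[symmetric] flip: divide_divide_eq_left)
      (simp add: field_simps)?
qed

lemma pair_young:
  fixes H :: "nat \<Rightarrow> 'a::real_normed_vector"
  assumes H: "cyc J H" and e: "0 < \<epsilon>" and J: "0 < real J"
  shows "(\<Sum>j<J. x j * (norm (H j) + norm (H (Suc j)))) / real J \<le> \<epsilon> * n2 J H + ((\<Sum>j<J. (x j)^2) / real J) / \<epsilon>"
proof -
  have "(\<Sum>j<J. (norm (H j) + norm (H (Suc j)))^2) / real J \<le> (\<Sum>j<J. 2 * (norm (H j))^2 + 2 * (norm (H (Suc j)))^2) / real J"
    by (intro divide_right_mono sum_mono sum2_sq) simp
  also have "\<dots> = 2 * n2 J H + 2 * ((\<Sum>j<J. (norm (H (Suc j)))^2) / real J)"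
    by (simp add: n2_def sum.distrib sum_distrib_left add_divide_distrib)
  finally have "\<epsilon> / 4 * ((\<Sum>j<J. (norm (H j) + norm (H (Suc j)))^2) / real J) \<le> \<epsilon> / 4 * (4 * n2 J H)"
    using e n2_shift[OF H] by (intro mult_left_mono) auto
  moreover have "(\<Sum>j<J. x j * (norm (H j) + norm (H (Suc j)))) / real J \<le> (\<epsilon> / 4) * ((\<Sum>j<J. (norm (H j) + norm (H (Suc j)))^2) / real J)
      + ((\<Sum>j<J. (x j)^2) / real J) / (4 * (\<epsilon> / 4))"
    by (rule sum_young) (use e J in auto)
  ultimately show ?thesis by simp
qed

text \<open>The right-hand side contains no slope of H, although the stiffness terms do. Their
  difference is summed by parts in space, which moves the difference onto the coefficient times the
  slope of V and explains the bound required for the second differences of V.\<close>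

lemma form_lipschitz:
  assumes J: "1 \<le> J" and K: "1 \<le> K" and \<epsilon>: "0 < \<epsilon>"
    and cyc: "cyc J A" "cyc J B" "cyc J V" "cyc J H"
    and A: "\<And>j. norm (A j) \<le> K" "\<And>j. norm (slope J A j) \<le> K"
    and B: "\<And>j. norm (B j) \<le> K" "\<And>j. norm (slope J B j) \<le> K"
    and Z: "\<And>j. norm (Z j) \<le> K"
    and V: "\<And>j. norm (slope J V j) \<le> K" "\<And>j. norm (slope J V (Suc j) - slope J V j) \<le> K / real J"
  defines "D \<equiv> \<lambda>j. A j - B j"
  shows "\<bar>scheme_form J A Z V H - scheme_form J B Z V H\<bar> \<le> \<epsilon> * n2 J H + 1944 * K ^ 6 / \<epsilon> * (s2 J D + n2 J D)"
proof -
  have J0: "0 < real J" using J by simp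
  have cD: "cyc J D" using cyc(1,2) by (simp add: cyc_def D_def)
  define p x y where "p = slope J D" and "x j = norm (p j) + norm (D j) + norm (D (Suc j))"
    and "y j = norm (H j) + norm (H (Suc j))" for j
  have x0: "0 \<le> x j" and y0: "0 \<le> y j" for j by (simp_all add: x_def y_def)
  have pAB: "slope J A j - slope J B j = p j" for j
    by (simp add: p_def slope_def D_def algebra_simps)
  have K3: "K \<le> K ^ 3" "1 \<le> K ^ 3" using K by (auto intro: self_le_power)
  have K0: "0 \<le> K" using K by simp
  have sq: "\<bar>(norm (slope J A j))^2 - (norm (slope J B j))^2\<bar> \<le> 2 * K * norm (p j)" for j
  proof -
    have "\<bar>(norm (slope J A j))^2 - (norm (slope J B j))^2\<bar>
        = (norm (slope J A j) + norm (slope J B j)) * \<bar>norm (slope J A j) - norm (slope J B j)\<bar>"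
      by (simp add: power2_eq_square square_diff_square_factored abs_mult mult.commute)
    also have "\<dots> \<le> (2 * K) * norm (p j)"
      using A(2)[of j] B(2)[of j] norm_triangle_ineq3[of "slope J A j" "slope J B j"] pAB[of j] K0
      by (intro mult_mono) auto
    finally show ?thesis .
  qed
  have e1K: "\<bar>A j \<bullet> e1\<bar> \<le> K" for j using order_trans[OF e1_inner_le A(1)] .
  have t1: "\<bar>(norm (slope J A j))^2 * tri_at A Z H j
      - (norm (slope J B j))^2 * tri_at B Z H j\<bar> \<le> 6 * K ^ 3 * x j * y j" for j
  proof -
    let ?tA = "tri_at A Z H j"
    let ?tB = "tri_at B Z H j"
    have Zs: "norm (Z j) + norm (Z (Suc j)) \<le> 2 * K" using Z[of j] Z[of "Suc j"] by simp
    have 1: "\<bar>?tA\<bar> \<le> 2 * K^2 * y j"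
    proof -
      have "\<bar>?tA\<bar> \<le> K * (norm (Z j) + norm (Z (Suc j))) * (norm (H j) + norm (H (Suc j)))"
        by (rule tri_bound[OF e1K e1K])
      also have "\<dots> \<le> K * (2 * K) * y j" unfolding y_def by (intro mult_right_mono mult_left_mono Zs K0) auto
      finally show ?thesis by (simp add: power2_eq_square mult_ac)
    qed
    have 2: "\<bar>?tA - ?tB\<bar> \<le> 2 * K * x j * y j"
    proof -
      have "\<bar>?tA - ?tB\<bar> \<le> x j * (norm (Z j) + norm (Z (Suc j))) * (norm (H j) + norm (H (Suc j)))"
        unfolding tri_diff_left inner_diff_left[symmetric]
        by (rule tri_bound) (use e1_inner_le[of "D j"] e1_inner_le[of "D (Suc j)"] in \<open>auto simp: x_def D_def intro: order_trans\<close>)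
      also have "\<dots> \<le> x j * (2 * K) * y j" unfolding y_def by (intro mult_right_mono mult_left_mono Zs x0) auto
      finally show ?thesis by (simp add: mult_ac)
    qed
    have "(norm (slope J A j))^2 * ?tA - (norm (slope J B j))^2 * ?tB
      = ((norm (slope J A j))^2 - (norm (slope J B j))^2) * ?tA + (norm (slope J B j))^2 * (?tA - ?tB)"
      by (simp add: algebra_simps)
    then have "\<bar>(norm (slope J A j))^2 * ?tA - (norm (slope J B j))^2 * ?tB\<bar>
      \<le> \<bar>(norm (slope J A j))^2 - (norm (slope J B j))^2\<bar> * \<bar>?tA\<bar> + (norm (slope J B j))^2 * \<bar>?tA - ?tB\<bar>"
      by (simp add: abs_mult order_trans[OF abs_triangle_ineq])
    also have "\<dots> \<le> (2 * K * x j) * (2 * K^2 * y j) + K^2 * (2 * K * x j * y j)"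
    proof (intro add_mono mult_mono 1 2 power_mono B)
      show "\<bar>(norm (slope J A j))^2 - (norm (slope J B j))^2\<bar> \<le> 2 * K * x j"
        using sq[of j] mult_left_mono[of "norm (p j)" "x j" "2 * K"] K0 by (simp add: x_def)
    qed (use K0 x0 y0 in auto)
    also have "\<dots> = 6 * K ^ 3 * x j * y j" by (simp add: power2_eq_square power3_eq_cube algebra_simps)
    finally show ?thesis .
  qed
  have t3: "\<bar>((norm (slope J A j))^2 - (norm (slope J B j))^2) * (mid H j)\<bar> \<le> K ^ 3 * x j * y j" for j
  proof -
    have "\<bar>mid H j\<bar> \<le> y j / 2"
      using e1_inner_le[of "H j + H (Suc j)"] norm_triangle_ineq[of "H j" "H (Suc j)"] by (simp add: y_def)
    then have "\<bar>((norm (slope J A j))^2 - (norm (slope J B j))^2) * (mid H j)\<bar> \<le> (2 * K * x j) * (y j / 2)"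
      unfolding abs_mult
      using sq[of j] mult_left_mono[of "norm (p j)" "x j" "2 * K"] K0 y0 x0
      by (intro mult_mono) (auto simp: x_def)
    also have "\<dots> = K * (x j * y j)" by simp
    also have "\<dots> \<le> K ^ 3 * (x j * y j)" by (intro mult_right_mono K3) (simp add: x0 y0)
    finally show ?thesis by (simp add: mult.assoc)
  qed
  \<comment> \<open>The coefficient to which summation by parts is applied. Its increments contain
    either a slope of D or a second difference of V, and both carry a factor h.\<close>
  define c where "c j = mid D j *\<^sub>R slope J V j" for j
  have cc: "cyc J c" using cD cyc_slope[OF cyc(3)] by (auto simp: cyc_def c_def simp flip: add_Suc)
  have t2: "\<bar>(c (Suc j) - c j) \<bullet> H (Suc j)\<bar> \<le> (K * (x j + x (Suc j)) * y j) / real J" for j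
  proof -
    have "c (Suc j) - c j = ((D (Suc (Suc j)) - D j) \<bullet> e1 / 2) *\<^sub>R slope J V (Suc j)
        + mid D j *\<^sub>R (slope J V (Suc j) - slope J V j)"
      by (simp add: c_def algebra_simps inner_diff_left inner_add_left add_divide_distrib diff_divide_distrib)
    then have "norm (c (Suc j) - c j) \<le> \<bar>(D (Suc (Suc j)) - D j) \<bullet> e1 / 2\<bar> * norm (slope J V (Suc j))
        + \<bar>mid D j\<bar> * norm (slope J V (Suc j) - slope J V j)"
      by (metis norm_scaleR norm_triangle_ineq)
    also have "\<dots> \<le> ((norm (p j) + norm (p (Suc j))) / (2 * real J)) * K + ((norm (D j) + norm (D (Suc j))) / 2) * (K / real J)"
    proof (intro add_mono mult_mono V)
      have "D (Suc (Suc j)) - D j = (p j + p (Suc j)) /\<^sub>R real J"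
        using J0 by (simp add: p_def slope_def flip: scaleR_add_right)
      then have dn: "norm (D (Suc (Suc j)) - D j) \<le> (norm (p j) + norm (p (Suc j))) / real J"
        using J0 norm_triangle_ineq[of "p j" "p (Suc j)"] by (simp add: divide_inverse mult.commute mult_left_mono)
      show "\<bar>(D (Suc (Suc j)) - D j) \<bullet> e1 / 2\<bar> \<le> (norm (p j) + norm (p (Suc j))) / (2 * real J)"
        using order_trans[OF e1_inner_le dn] J0 by (simp add: field_simps)
      show "\<bar>mid D j\<bar> \<le> (norm (D j) + norm (D (Suc j))) / 2"
        using e1_inner_le[of "D j + D (Suc j)"] norm_triangle_ineq[of "D j" "D (Suc j)"] by simp
    qed (use K0 J0 in auto)
    also have "\<dots> \<le> K * (x j + x (Suc j)) / real J"
    proof -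
      have "((norm (p j) + norm (p (Suc j))) / (2 * real J)) * K + ((norm (D j) + norm (D (Suc j))) / 2) * (K / real J)
        = K * ((norm (p j) + norm (p (Suc j)) + norm (D j) + norm (D (Suc j))) / 2) / real J"
        using J0 by (simp add: field_simps)
      also have "\<dots> \<le> K * (x j + x (Suc j)) / real J"
        using K0 J0 by (intro divide_right_mono mult_left_mono) (auto simp: x_def)
      finally show ?thesis .
    qed
    finally have cb: "norm (c (Suc j) - c j) \<le> K * (x j + x (Suc j)) / real J" .
    have "\<bar>(c (Suc j) - c j) \<bullet> H (Suc j)\<bar> \<le> norm (c (Suc j) - c j) * norm (H (Suc j))" by (rule Cauchy_Schwarz_ineq2)
    also have "\<dots> \<le> (K * (x j + x (Suc j)) / real J) * y j"
      using K0 x0 J0 by (intro mult_mono cb) (auto simp: y_def)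
    finally show ?thesis by simp
  qed
  have st: "stiff J A V H - stiff J B V H = (\<Sum>j<J. c j \<bullet> (H (Suc j) - H j))"
    unfolding stiff_def sum_subtractf[symmetric]
    by (intro sum.cong refl) (simp add: c_def D_def inner_add_left inner_diff_left field_simps)
  define P where "P j = ((norm (slope J A j))^2 * tri_at A Z H j
      - (norm (slope J B j))^2 * tri_at B Z H j)
      + ((norm (slope J A j))^2 - (norm (slope J B j))^2) * (mid H j)
      - real J * ((c (Suc j) - c j) \<bullet> H (Suc j))" for j
  have eq: "scheme_form J A Z V H - scheme_form J B Z V H = (\<Sum>j<J. P j) / real J"
  proof -
    have "(\<Sum>j<J. real J * ((c (Suc j) - c j) \<bullet> H (Suc j))) / real J = (\<Sum>j<J. (c (Suc j) - c j) \<bullet> H (Suc j))"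
      using J0 by (simp flip: sum_distrib_left)
    then have "stiff J A V H - stiff J B V H = - ((\<Sum>j<J. real J * ((c (Suc j) - c j) \<bullet> H (Suc j))) / real J)"
      using st summation_by_parts[OF cc cyc(4)] by simp
    moreover have "(mass J A Z H - mass J B Z H) + (source J A H - source J B H)
      = (\<Sum>j<J. ((norm (slope J A j))^2 * tri_at A Z H j
      - (norm (slope J B j))^2 * tri_at B Z H j)
      + ((norm (slope J A j))^2 - (norm (slope J B j))^2) * (mid H j)) / real J"
      unfolding mass_def source_def diff_divide_distrib[symmetric] add_divide_distrib[symmetric] sum_subtractf[symmetric] sum.distrib[symmetric]
      by (intro arg_cong2[where f = "(/)"] sum.cong refl) (simp add: algebra_simps)
    ultimately show ?thesis
      unfolding scheme_form_def P_def sum_subtractf diff_divide_distrib by linarith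
  qed
  have Pb: "\<bar>P j\<bar> \<le> (9 * K ^ 3 * (x j + x (Suc j))) * y j" for j
  proof -
    have "\<bar>real J * ((c (Suc j) - c j) \<bullet> H (Suc j))\<bar> \<le> K * (x j + x (Suc j)) * y j"
      using t2[of j] J0 by (simp add: abs_mult field_simps)
    also have "\<dots> \<le> K ^ 3 * (x j + x (Suc j)) * y j" by (intro mult_right_mono K3) (simp_all add: x0 y0)
    finally have "\<bar>P j\<bar> \<le> 6 * K ^ 3 * x j * y j + K ^ 3 * x j * y j + K ^ 3 * (x j + x (Suc j)) * y j"
      using t1[of j] t3[of j] unfolding P_def by linarith
    also have "\<dots> \<le> (9 * K ^ 3 * (x j + x (Suc j))) * y j"
    proof -
      have "0 \<le> K ^ 3 * x j * y j" "0 \<le> K ^ 3 * x (Suc j) * y j" using K0 x0 y0 by auto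
      then show ?thesis by (simp add: algebra_simps)
    qed
    finally show ?thesis .
  qed
  have "\<bar>scheme_form J A Z V H - scheme_form J B Z V H\<bar> \<le> (\<Sum>j<J. (9 * K ^ 3 * (x j + x (Suc j))) * y j) / real J"
    unfolding eq using J0 by (simp add: divide_right_mono order_trans[OF sum_abs] sum_mono Pb)
  also have "\<dots> \<le> \<epsilon> * n2 J H + ((\<Sum>j<J. (9 * K ^ 3 * (x j + x (Suc j)))^2) / real J) / \<epsilon>"
    unfolding y_def by (rule pair_young[OF cyc(4) \<epsilon> J0])
  \<comment> \<open>The constant 1944 is 81 * 24: the factor 4 comes from two neighbouring elements,
    3 from the three terms in \<open>x j\<close>, and 2 from the two end values of D on an
    element.\<close>
  also have "(\<Sum>j<J. (9 * K ^ 3 * (x j + x (Suc j)))^2) / real J \<le> 81 * K ^ 6 * (24 * (s2 J D + n2 J D))"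
  proof -
    have cx: "cyc J (\<lambda>j. (x j)^2)"
      using cD cyc_slope[OF cD] by (auto simp: cyc_def x_def p_def simp flip: add_Suc)
    have "(\<Sum>j<J. (9 * K ^ 3 * (x j + x (Suc j)))^2) = 81 * K ^ 6 * (\<Sum>j<J. (x j + x (Suc j))^2)"
      by (simp add: power_mult_distrib sum_distrib_left flip: power_mult)
    also have "\<dots> \<le> 81 * K ^ 6 * (\<Sum>j<J. 2 * (x j)^2 + 2 * (x (Suc j))^2)"
      using K0 by (intro mult_left_mono sum_mono sum2_sq) auto
    also have "(\<Sum>j<J. 2 * (x j)^2 + 2 * (x (Suc j))^2) = 4 * (\<Sum>j<J. (x j)^2)"
      using cyc_sum_shift[OF cx] by (simp add: sum.distrib flip: sum_distrib_left)
    also have "(\<Sum>j<J. (x j)^2) \<le> (\<Sum>j<J. 3 * ((norm (p j))^2 + (norm (D j))^2 + (norm (D (Suc j)))^2))"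
      unfolding x_def by (intro sum_mono sum3_sq)
    finally have "(\<Sum>j<J. (9 * K ^ 3 * (x j + x (Suc j)))^2) / real J
      \<le> 81 * K ^ 6 * (4 * (\<Sum>j<J. 3 * ((norm (p j))^2 + (norm (D j))^2 + (norm (D (Suc j)))^2))) / real J"
      using K0 by (intro divide_right_mono) (auto simp: mult_left_mono)
    also have "\<dots> = 81 * K ^ 6 * (12 * (s2 J D + n2 J D + (\<Sum>j<J. (norm (D (Suc j)))^2) / real J))"
      by (simp add: s2_def p_def n2_def sum.distrib sum_distrib_left add_divide_distrib algebra_simps)
    also have "\<dots> \<le> 81 * K ^ 6 * (24 * (s2 J D + n2 J D))"
      unfolding n2_shift[OF cD] using K0 s2_nonneg[of J D] by (intro mult_left_mono) auto
    finally show ?thesis .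
  qed
  finally show ?thesis using \<epsilon> by (simp add: divide_right_mono mult_left_mono field_simps)
qed

section \<open>Energy estimate for the nodal error\<close>

lemma discrete_gronwall:
  fixes \<theta> :: "nat \<Rightarrow> real"
  assumes "0 \<le> a" "0 \<le> b" and step: "\<And>k. k \<le> N \<Longrightarrow> \<theta> k \<le> a + b * (\<Sum>m<k. \<theta> m)"
  shows "k \<le> N \<Longrightarrow> \<theta> k \<le> a * exp (b * real k)"
proof -
  assume k: "k \<le> N"
  have *: "a + b * (\<Sum>m<k. \<theta> m) \<le> a * (1 + b) ^ k" if "k \<le> N" for k
    using that
  proof (induction k)
    case (Suc k)
    have "a + b * (\<Sum>m<Suc k. \<theta> m) \<le> (a + b * (\<Sum>m<k. \<theta> m)) + b * (a + b * (\<Sum>m<k. \<theta> m))"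
      using mult_left_mono[OF step[of k] assms(2)] Suc.prems by (simp add: distrib_left)
    also have "\<dots> = (1 + b) * (a + b * (\<Sum>m<k. \<theta> m))" by (simp add: distrib_right)
    also have "\<dots> \<le> (1 + b) * (a * (1 + b) ^ k)" using Suc assms(2) by (intro mult_left_mono) auto
    finally show ?case by (simp add: mult_ac)
  qed (use assms in simp)
  have "(1 + b) ^ k \<le> exp b ^ k" using assms(2) by (intro power_mono) auto
  also have "\<dots> = exp (b * real k)" by (simp add: exp_of_nat2_mult)
  finally have "a * (1 + b) ^ k \<le> a * exp (b * real k)" using assms(1) by (intro mult_left_mono)
  then show ?thesis using step[OF k] *[OF k] by linarith
qed

text \<open>The dissipativity of the implicit Euler step: a . (a - b) is at least (|a|^2 - |b|^2)/2
  on each element. Both energies carry the weight of the same level A.\<close>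

lemma stiff_increment:
  fixes E E' :: "nat \<Rightarrow> real^2"
  assumes J: "1 \<le> J" and dt: "0 < dt" and pos: "\<And>j. 0 \<le> A j \<bullet> e1"
    and H: "\<And>j. H j = (E' j - E j) /\<^sub>R dt"
  defines "bw \<equiv> \<lambda>E. (\<Sum>j<J. mid A j * (norm (slope J E j))^2) / real J"
  shows "(bw E' - bw E) / (2 * dt) \<le> stiff J A E' H"
proof -
  have J0: "0 < real J" using J by simp
  have "mid A j * ((norm (slope J E' j))^2 - (norm (slope J E j))^2) / (2 * dt) / real J
      \<le> mid A j * (slope J E' j \<bullet> (H (Suc j) - H j))" for j
  proof -
    have "H (Suc j) - H j = (slope J E' j - slope J E j) /\<^sub>R (dt * real J)"
      using J0 dt by (simp add: H slope_def algebra_simps)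
    then have "slope J E' j \<bullet> (H (Suc j) - H j) = (slope J E' j \<bullet> (slope J E' j - slope J E j)) / (dt * real J)"
      by (simp add: divide_inverse mult.commute)
    moreover have "((norm (slope J E' j))^2 - (norm (slope J E j))^2) / 2 \<le> slope J E' j \<bullet> (slope J E' j - slope J E j)"
    proof -
      have "0 \<le> (norm (slope J E' j - slope J E j))^2" by simp
      then show ?thesis by (simp add: power2_norm_eq_inner inner_diff inner_commute algebra_simps diff_divide_distrib)
    qed
    ultimately have "((norm (slope J E' j))^2 - (norm (slope J E j))^2) / (2 * dt) / real J \<le> slope J E' j \<bullet> (H (Suc j) - H j)"
      using dt J0 by (simp add: field_simps)
    moreover have "0 \<le> mid A j" using pos[of j] pos[of "Suc j"] by (simp add: inner_add_left)
    ultimately show ?thesis by (metis mult_left_mono times_divide_eq_right)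
  qed
  then have "(\<Sum>j<J. mid A j * ((norm (slope J E' j))^2 - (norm (slope J E j))^2) / (2 * dt) / real J) \<le> stiff J A E' H"
    unfolding stiff_def by (intro sum_mono)
  moreover have "(\<Sum>j<J. mid A j * ((norm (slope J E' j))^2 - (norm (slope J E j))^2) / (2 * dt) / real J)
     = (bw E' - bw E) / (2 * dt)"
    unfolding bw_def diff_divide_distrib[symmetric] sum_subtractf[symmetric] sum_divide_distrib[symmetric] right_diff_distrib[symmetric]
    by (simp add: mult.commute)
  ultimately show ?thesis by simp
qed

text \<open>The squared slope contributes c^2 and the weight c/6 at both ends of an element; every
  node is an end of two elements, which doubles c^3/6.\<close>

lemma mass_coercive:
  assumes c: "0 \<le> c" and low: "\<And>j. c \<le> A j \<bullet> e1" "\<And>j. c \<le> norm (slope J A j)" and H: "cyc J H" and J: "1 \<le> J"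
  shows "c ^ 3 / 3 * n2 J H \<le> mass J A H H"
proof -
  have "c^2 * (c / 6 * ((norm (H j))^2 + (norm (H (Suc j)))^2))
    \<le> (norm (slope J A j))^2 * tri_at A H H j" for j
    using c low by (intro mult_mono power_mono tri_coercive) auto
  then have "(\<Sum>j<J. c^2 * (c / 6 * ((norm (H j))^2 + (norm (H (Suc j)))^2))) / real J \<le> mass J A H H"
    unfolding mass_def by (intro divide_right_mono sum_mono) auto
  moreover have "(\<Sum>j<J. c^2 * (c / 6 * ((norm (H j))^2 + (norm (H (Suc j)))^2))) / real J
    = c ^ 3 / 6 * (n2 J H + (\<Sum>j<J. (norm (H (Suc j)))^2) / real J)"
  proof -
    have e: "c^2 * (c / 6 * z) = c ^ 3 / 6 * z" for z by (simp add: power2_eq_square power3_eq_cube)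
    show ?thesis
      by (simp only: e sum_distrib_left[symmetric] sum.distrib n2_def times_divide_eq_right[symmetric] add_divide_distrib)
  qed
  ultimately have "c ^ 3 / 6 * (n2 J H + n2 J H) \<le> mass J A H H" by (simp only: n2_shift[OF H])
  then show ?thesis by (simp add: mult.commute)
qed

lemma mass_diff: "mass J A (\<lambda>j. Z j - W j) H = mass J A Z H - mass J A W H"
  unfolding mass_def tri_diff_mid by (simp add: right_diff_distrib sum_subtractf diff_divide_distrib)

lemma stiff_diff: "stiff J A (\<lambda>j. V j - W j) H = stiff J A V H - stiff J A W H"
proof -
  have "slope J (\<lambda>j. V j - W j) j = slope J V j - slope J W j" for j
    by (simp add: slope_def algebra_simps)
  then show ?thesis unfolding stiff_def by (simp add: inner_diff_left right_diff_distrib sum_subtractf)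
qed

text \<open>The energy argument in isolation from the differential equation: bounds for the
  interpolant Y, consistency up to the flux g, and summability of \<open>\<alpha>\<close> and
  \<open>\<kappa>\<close> with one common bound S. The lower bounds for Y are 2 c, so errors of size
  c leave c for U. The number of steps M is a parameter of its own, so the result can be applied to
  a solution constructed only up to some step.\<close>

locale scheme_error =
  fixes J M :: nat and dt T K c S :: real and Y U g :: "nat \<Rightarrow> nat \<Rightarrow> real^2" and \<alpha> \<kappa> :: "nat \<Rightarrow> real"
    and E D :: "nat \<Rightarrow> nat \<Rightarrow> real^2"
  defines "E \<equiv> \<lambda>n j. Y n j - U n j" and "D \<equiv> \<lambda>n j. (E n j - E (n - 1) j) /\<^sub>R dt"
  assumes J: "1 \<le> J" and dt: "0 < dt" "real M * dt \<le> T" and K: "1 \<le> K" and c: "0 < c" "c \<le> 1" and S: "0 \<le> S"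
    and cyc_Y: "\<And>n. cyc J (Y n)" and cyc_U: "\<And>n. n \<le> M \<Longrightarrow> cyc J (U n)"
    and Y: "\<And>n j. n \<le> M \<Longrightarrow> norm (Y n j) \<le> K" "\<And>n j. n \<le> M \<Longrightarrow> norm (slope J (Y n) j) \<le> K"
      "\<And>n j. n \<le> M \<Longrightarrow> 2 * c \<le> Y n j \<bullet> e1" "\<And>n j. n \<le> M \<Longrightarrow> 2 * c \<le> norm (slope J (Y n) j)"
      "\<And>n j. n \<le> M \<Longrightarrow> norm (slope J (Y n) (Suc j) - slope J (Y n) j) \<le> K / real J"
      "\<And>n j. n < M \<Longrightarrow> norm (Y (Suc n) j - Y n j) \<le> K * dt"
    and scheme: "\<And>m H. m < M \<Longrightarrow> cyc J H \<Longrightarrow> scheme_form J (U m) (\<lambda>j. (U (Suc m) j - U m j) /\<^sub>R dt) (U (Suc m)) H = 0"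
    and start: "\<And>j. U 0 j = Y 0 j"
    and consistent: "\<And>m H \<epsilon>. m < M \<Longrightarrow> cyc J H \<Longrightarrow> 0 < \<epsilon> \<Longrightarrow>
      \<bar>scheme_form J (Y m) (\<lambda>j. (Y (Suc m) j - Y m j) /\<^sub>R dt) (Y (Suc m)) H - (\<Sum>j<J. g (Suc m) j \<bullet> (H (Suc j) - H j))\<bar>
        \<le> \<epsilon> * n2 J H + \<alpha> m / \<epsilon>"
    and g: "\<And>n. 1 \<le> n \<Longrightarrow> n \<le> M \<Longrightarrow> n2 J (g n) \<le> S" "\<And>n. 1 \<le> n \<Longrightarrow> n < M \<Longrightarrow> n2 J (\<lambda>j. g (Suc n) j - g n j) \<le> \<kappa> n"
    and \<alpha>: "\<And>m. m < M \<Longrightarrow> 0 \<le> \<alpha> m" "(\<Sum>m<M. dt * \<alpha> m) \<le> S"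
    and \<kappa>: "\<And>m. 0 \<le> \<kappa> m" "(\<Sum>m<M. \<kappa> m / dt) \<le> S"
begin

definition "c1 = c ^ 3 / 3"

text \<open>The rates at which the squared norms of the error enter in a step: perturbation of the
  coefficients, change of the weight (K + 1/c1), and increment of the flux (1).\<close>

definition "C2 = 1944 * (K + 1) ^ 6 / (c1 / 8) + K + 1 / c1 + 1"

text \<open>A common lower bound, thanks to c \<le> 1, for c1/2 and c/4, which are the coefficients
  of the two quantities that the energy inequality controls.\<close>

definition "c4 = c ^ 3 / 12"

text \<open>The summands belong to the flux at the final level, to \<open>\<alpha>\<close>, to
  \<open>\<kappa>\<close> and to the Gronwall rate; in the latter, 1 + T accounts for bounding the
  values of the error by its difference quotients.\<close>

definition "C5 = (1 / c + 8 / c1 + 1 + C2 * (1 + T)) / c4"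

text \<open>The exponential is the Gronwall factor; 1 + T passes from the controlled quantities to
  the norm of the error itself.\<close>

definition "C6 = C5 * exp (C5 * T) * (1 + T)"

lemma J0: "0 < real J" using J by simp

lemma T0: "0 \<le> T"
proof -
  have "0 \<le> real M * dt" using dt(1) by simp
  then show ?thesis using dt(2) by linarith
qed

lemma constants: "0 < c1" "0 \<le> C2" "0 < c4" "c4 \<le> c1 / 2" "c4 \<le> c / 4" "0 \<le> C5" "0 \<le> C6"
proof -
  have "c ^ 3 \<le> c" using c by (simp add: power_le_one power3_eq_cube mult_le_one mult_left_le_one_le)
  then show "c4 \<le> c / 4" using c by (simp add: c4_def)
  show 1: "0 < c1" using c by (simp add: c1_def)
  then show 2: "0 \<le> C2" using K by (simp add: C2_def)
  show 3: "0 < c4" using c by (simp add: c4_def)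
  show "c4 \<le> c1 / 2" using c by (simp add: c1_def c4_def)
  have "0 \<le> 1 / c + 8 / c1 + 1 + C2 * (1 + T)" using c 1 2 T0 by (intro add_nonneg_nonneg mult_nonneg_nonneg) auto
  then show 5: "0 \<le> C5" using 3 by (simp add: C5_def)
  then show "0 \<le> C6" using T0 by (simp add: C6_def)
qed

text \<open>The bootstrap property: as long as it holds, the coefficients built from U obey the same
  kind of bounds as those built from Y.\<close>

definition "good n \<longleftrightarrow> (\<forall>j. norm (E n j) \<le> c \<and> norm (slope J (E n) j) \<le> c)"

lemma cyc_E: "n \<le> M \<Longrightarrow> cyc J (E n)"
  using cyc_Y[of n] cyc_U[of n] by (simp add: cyc_def E_def)

lemma cyc_D: "n \<le> M \<Longrightarrow> cyc J (D n)"
  using cyc_E[of n] cyc_E[of "n - 1"] by (simp add: cyc_def D_def)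

lemma slope_E: "slope J (E n) j = slope J (Y n) j - slope J (U n) j"
  by (simp add: slope_def E_def algebra_simps)

lemma goodD:
  assumes "good n" "n \<le> M"
  shows "norm (U n j) \<le> K + 1" "norm (slope J (U n) j) \<le> K + 1" "c \<le> U n j \<bullet> e1" "c \<le> norm (slope J (U n) j)"
proof -
  have e: "norm (E n j) \<le> c" "norm (slope J (E n) j) \<le> c" using assms by (auto simp: good_def)
  have u: "U n j = Y n j - E n j" by (simp add: E_def)
  have su: "slope J (U n) j = slope J (Y n) j - slope J (E n) j" by (simp add: slope_E)
  show "norm (U n j) \<le> K + 1"
    using norm_triangle_ineq4[of "Y n j" "E n j"] e(1) Y(1)[OF assms(2), of j] c unfolding u by linarith
  show "norm (slope J (U n) j) \<le> K + 1"
    using norm_triangle_ineq4[of "slope J (Y n) j" "slope J (E n) j"] e(2) Y(2)[OF assms(2), of j] c unfolding su by linarith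
  show "c \<le> U n j \<bullet> e1"
    using e1_inner_le[of "E n j"] e(1) Y(3)[OF assms(2), of j] unfolding u inner_diff_left by linarith
  show "c \<le> norm (slope J (U n) j)"
    using norm_triangle_ineq2[of "slope J (Y n) j" "slope J (E n) j"] e(2) Y(4)[OF assms(2), of j] unfolding su by linarith
qed

definition "bw m V = (\<Sum>j<J. (mid (U m) j) * (norm (slope J V j))^2) / real J"

text \<open>Flux and error have separate time indices because summation by parts in time pairs
  fluxes and errors of neighbouring levels.\<close>

definition "G a b = (\<Sum>j<J. g a j \<bullet> (E b (Suc j) - E b j))"

text \<open>The error equation at the coefficients of U is tested with the difference quotient of
  the error. Moving the coefficients to Y and the consistency error each cost c1/8 of the mass term,
  together the c1/4 on the right.\<close>

lemma step_inequality:
  assumes m: "m < M" and gd: "good m"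
  shows "c1 * (dt * n2 J (D (Suc m))) + (bw m (E (Suc m)) - bw m (E m)) / 2
    \<le> G (Suc m) (Suc m) - G (Suc m) m + (c1 / 4) * (dt * n2 J (D (Suc m)))
      + dt * (\<alpha> m / (c1 / 8) + 1944 * (K + 1) ^ 6 / (c1 / 8) * (s2 J (E m) + n2 J (E m)))"
proof -
  define H where "H = D (Suc m)"
  have cH: "cyc J H" unfolding H_def using m by (intro cyc_D) simp
  have Hd: "H j = (E (Suc m) j - E m j) /\<^sub>R dt" for j by (simp add: H_def D_def)
  define ZY where "ZY j = (Y (Suc m) j - Y m j) /\<^sub>R dt" for j
  define ZU where "ZU j = (U (Suc m) j - U m j) /\<^sub>R dt" for j
  have HZ: "H = (\<lambda>j. ZY j - ZU j)" by (simp add: fun_eq_iff Hd ZY_def ZU_def E_def algebra_simps)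
  have E': "E (Suc m) = (\<lambda>j. Y (Suc m) j - U (Suc m) j)" by (simp add: E_def)
  note gdm = goodD[OF gd less_imp_le[OF m]]
  have e8: "0 < c1 / 8" using constants by simp
  have "c1 * n2 J H + (bw m (E (Suc m)) - bw m (E m)) / (2 * dt) \<le> mass J (U m) H H + stiff J (U m) (E (Suc m)) H"
    unfolding c1_def
  proof (rule add_mono)
    show "c ^ 3 / 3 * n2 J H \<le> mass J (U m) H H"
      by (rule mass_coercive[OF less_imp_le[OF c(1)] gdm(3,4) cH J])
    show "(bw m (E (Suc m)) - bw m (E m)) / (2 * dt) \<le> stiff J (U m) (E (Suc m)) H"
      unfolding bw_def
      by (rule stiff_increment[OF J dt(1) _ Hd]) (use gdm(3) c in \<open>auto intro: order_trans less_imp_le\<close>)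
  qed
  \<comment> \<open>For fixed coefficients the form is affine in its second and third arguments, so
    the difference of the two instances is the linear part and the source cancels.\<close>
  also have "mass J (U m) H H + stiff J (U m) (E (Suc m)) H
      = scheme_form J (U m) ZY (Y (Suc m)) H - scheme_form J (U m) ZU (U (Suc m)) H"
    unfolding E' stiff_diff by (subst (1) HZ) (simp add: mass_diff scheme_form_def)
  also have "\<dots> = scheme_form J (U m) ZY (Y (Suc m)) H"
    using scheme[OF m cH] by (simp add: ZU_def[abs_def])
  also have "\<dots> \<le> scheme_form J (Y m) ZY (Y (Suc m)) H + (c1 / 8 * n2 J H + 1944 * (K + 1) ^ 6 / (c1 / 8) * (s2 J (E m) + n2 J (E m)))"
  proof -
    have ZK: "norm (ZY j) \<le> K + 1" for j
    proof -
      have "norm (ZY j) = norm (Y (Suc m) j - Y m j) / dt" using dt(1) by (simp add: ZY_def divide_inverse mult.commute)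
      also have "\<dots> \<le> K" using Y(6)[OF m, of j] dt(1) by (simp add: pos_divide_le_eq)
      finally show ?thesis by simp
    qed
    have "\<bar>scheme_form J (Y m) ZY (Y (Suc m)) H - scheme_form J (U m) ZY (Y (Suc m)) H\<bar>
      \<le> c1 / 8 * n2 J H + 1944 * (K + 1) ^ 6 / (c1 / 8) * (s2 J (\<lambda>j. Y m j - U m j) + n2 J (\<lambda>j. Y m j - U m j))"
    proof (rule form_lipschitz[OF J _ e8 cyc_Y cyc_U cyc_Y cH])
      show "norm (Y m j) \<le> K + 1" "norm (slope J (Y m) j) \<le> K + 1" "norm (slope J (Y (Suc m)) j) \<le> K + 1" for j
        using Y(1)[of m j] Y(2)[of m j] Y(2)[of "Suc m" j] m by simp_all
      show "norm (slope J (Y (Suc m)) (Suc j) - slope J (Y (Suc m)) j) \<le> (K + 1) / real J" for j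
        by (rule order_trans[OF Y(5)]) (use m J0 in \<open>auto intro: divide_right_mono\<close>)
    qed (use K m gdm ZK in auto)
    then show ?thesis by (simp add: E_def[symmetric]) (simp add: E_def)
  qed
  also have "scheme_form J (Y m) ZY (Y (Suc m)) H \<le> (\<Sum>j<J. g (Suc m) j \<bullet> (H (Suc j) - H j)) + (c1 / 8 * n2 J H + \<alpha> m / (c1 / 8))"
    using consistent[OF m cH e8] by (simp add: ZY_def[abs_def])
  also have "(\<Sum>j<J. g (Suc m) j \<bullet> (H (Suc j) - H j)) = (G (Suc m) (Suc m) - G (Suc m) m) / dt"
    unfolding G_def sum_subtractf[symmetric] sum_divide_distrib
    by (intro sum.cong refl) (simp add: Hd inner_diff_right divide_inverse algebra_simps)
  finally have "c1 * n2 J H + (bw m (E (Suc m)) - bw m (E m)) / (2 * dt) \<le> (G (Suc m) (Suc m) - G (Suc m) m) / dt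
      + (c1 / 4 * n2 J H + \<alpha> m / (c1 / 8) + 1944 * (K + 1) ^ 6 / (c1 / 8) * (s2 J (E m) + n2 J (E m)))" (is "?l \<le> ?r")
    by simp
  then have "dt * ?l \<le> dt * ?r" using dt(1) by (intro mult_left_mono) auto
  moreover have "dt * ?l = c1 * (dt * n2 J H) + (bw m (E (Suc m)) - bw m (E m)) / 2"
    using dt(1) by (simp add: distrib_left)
  moreover have "dt * ?r = G (Suc m) (Suc m) - G (Suc m) m + (c1 / 4) * (dt * n2 J H)
      + dt * (\<alpha> m / (c1 / 8) + 1944 * (K + 1) ^ 6 / (c1 / 8) * (s2 J (E m) + n2 J (E m)))"
    using dt(1) by (simp add: distrib_left)
  ultimately show ?thesis by (simp add: H_def)
qed

text \<open>The energy of step m carries the weight of U m, whereas the previous step left the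
  weight of U (m - 1). The weights differ by \<open>dt\<close> times K plus the difference quotient
  of the error. That quotient is controlled only in the mean; as \<open>good\<close> bounds one
  slope factor by c \<le> 1, the critical term becomes a product of slope and quotient, and Young's
  inequality applies.\<close>

lemma weight_update:
  assumes m: "1 \<le> m" "m < M" and gd: "good m"
  shows "(bw m (E m) - bw (m - 1) (E m)) / 2 \<le> dt * ((K + 1 / c1) * s2 J (E m)) + (c1 / 4) * (dt * n2 J (D m))"
proof -
  define p y where "p j = norm (slope J (E m) j)" and "y j = (norm (D m j) + norm (D m (Suc j))) / 2" for j
  have inc: "(mid (U m) j) - (mid (U (m - 1)) j) \<le> dt * (K + y j)" for j
  proof -
    have u: "U m j - U (m - 1) j = (Y m j - Y (m - 1) j) - dt *\<^sub>R D m j" for j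
      using dt(1) by (simp add: D_def E_def)
    have "(U m j - U (m - 1) j) \<bullet> e1 \<le> K * dt + dt * norm (D m j)" for j
    proof -
      have "(U m j - U (m - 1) j) \<bullet> e1 \<le> norm (U m j - U (m - 1) j)" using e1_inner_le[of "U m j - U (m - 1) j"] by linarith
      also have "\<dots> \<le> norm (Y m j - Y (m - 1) j) + norm (dt *\<^sub>R D m j)" unfolding u by (rule norm_triangle_ineq4)
      also have "\<dots> \<le> K * dt + dt * norm (D m j)" using Y(6)[of "m - 1" j] m dt(1) by simp
      finally show ?thesis .
    qed
    from this[of j] this[of "Suc j"] show ?thesis
      by (simp add: inner_diff_left inner_add_left y_def algebra_simps add_divide_distrib)
  qed
  have p1: "0 \<le> p j" "p j \<le> 1" for j using gd c by (auto simp: p_def good_def intro: order_trans)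
  have "bw m (E m) - bw (m - 1) (E m) = (\<Sum>j<J. ((mid (U m) j) - (mid (U (m - 1)) j)) * (p j)^2) / real J"
    unfolding bw_def p_def diff_divide_distrib[symmetric] sum_subtractf[symmetric] left_diff_distrib[symmetric] by simp
  also have "\<dots> \<le> (\<Sum>j<J. dt * K * (p j)^2 + dt * (p j * y j)) / real J"
  proof (intro divide_right_mono sum_mono)
    fix j
    have y0: "0 \<le> y j" by (simp add: y_def)
    have "((mid (U m) j) - (mid (U (m - 1)) j)) * (p j)^2 \<le> (dt * (K + y j)) * (p j)^2"
      by (intro mult_right_mono inc) auto
    also have "\<dots> = dt * K * (p j)^2 + dt * ((p j * y j) * p j)" by (simp add: power2_eq_square algebra_simps)
    also have "\<dots> \<le> dt * K * (p j)^2 + dt * (p j * y j)"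
      using dt(1) p1[of j] y0 by (intro add_left_mono mult_left_mono mult_left_le) auto
    finally show "((mid (U m) j) - (mid (U (m - 1)) j)) * (p j)^2 \<le> dt * K * (p j)^2 + dt * (p j * y j)" .
  qed (use J0 in simp)
  also have "\<dots> = dt * K * s2 J (E m) + dt * ((\<Sum>j<J. p j * y j) / real J)"
    by (simp add: s2_def n2_def p_def sum.distrib sum_distrib_left add_divide_distrib)
  also have "(\<Sum>j<J. p j * y j) / real J \<le> (c1 / 2) * ((\<Sum>j<J. (y j)^2) / real J) + ((\<Sum>j<J. (p j)^2) / real J) / (4 * (c1 / 2))"
    by (rule sum_young) (use constants J0 in auto)
  also have "(\<Sum>j<J. (y j)^2) / real J \<le> n2 J (D m)"
  proof -
    have "(\<Sum>j<J. (y j)^2) \<le> (\<Sum>j<J. ((norm (D m j))^2 + (norm (D m (Suc j)))^2) / 2)"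
    proof (intro sum_mono)
      fix j show "(y j)^2 \<le> ((norm (D m j))^2 + (norm (D m (Suc j)))^2) / 2"
        using sum_squares_bound[of "norm (D m j)" "norm (D m (Suc j))"]
        by (simp add: y_def power_divide power2_sum)
    qed
    then have "(\<Sum>j<J. (y j)^2) / real J \<le> (\<Sum>j<J. ((norm (D m j))^2 + (norm (D m (Suc j)))^2) / 2) / real J"
      using J0 by (intro divide_right_mono) auto
    also have "\<dots> = (n2 J (D m) + (\<Sum>j<J. (norm (D m (Suc j)))^2) / real J) / 2"
      by (simp add: n2_def sum.distrib add_divide_distrib flip: sum_divide_distrib)
    also have "\<dots> = n2 J (D m)" using m by (subst n2_shift[OF cyc_D]) auto
    finally show ?thesis .
  qed
  also have "(\<Sum>j<J. (p j)^2) / real J = s2 J (E m)" by (simp add: p_def s2_def n2_def)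
  finally have "bw m (E m) - bw (m - 1) (E m) \<le> dt * K * s2 J (E m) + dt * ((c1 / 2) * n2 J (D m) + s2 J (E m) / (4 * (c1 / 2)))"
    using dt(1) constants by (simp add: mult_left_mono)
  also have "\<dots> = dt * (K * s2 J (E m) + s2 J (E m) / (2 * c1)) + (c1 / 2) * (dt * n2 J (D m))" by (simp add: algebra_simps)
  also have "\<dots> \<le> dt * (2 * ((K + 1 / c1) * s2 J (E m))) + (c1 / 2) * (dt * n2 J (D m))"
  proof -
    have "s2 J (E m) / (2 * c1) \<le> 2 * (1 / c1 * s2 J (E m))" "K * s2 J (E m) \<le> 2 * (K * s2 J (E m))"
      using constants s2_nonneg[of J "E m"] K by (auto simp: field_simps)
    then show ?thesis using dt(1) by (intro add_right_mono mult_left_mono) (auto simp: distrib_right distrib_left)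
  qed
  finally show ?thesis by (simp add: algebra_simps)
qed

text \<open>For m = 0 both terms vanish because the initial error does, so only increments of g
  between levels from 1 on occur.\<close>

lemma g_increment:
  assumes m: "m < M"
  shows "\<bar>G (Suc m) m - G m m\<bar> \<le> dt * s2 J (E m) + \<kappa> m / dt"
proof (cases "m = 0")
  case True
  have "G a 0 = 0" for a by (simp add: G_def E_def start)
  then show ?thesis using True dt(1) s2_nonneg[of J "E 0"] \<kappa>(1)[of 0] by simp
next
  case False
  have "G (Suc m) m - G m m = (\<Sum>j<J. (g (Suc m) j - g m j) \<bullet> slope J (E m) j) / real J"
    unfolding G_def sum_subtractf[symmetric] sum_divide_distrib
    using J0 by (intro sum.cong refl) (simp add: slope_def inner_diff_left)
  then have "\<bar>G (Suc m) m - G m m\<bar> \<le> (\<Sum>j<J. norm (g (Suc m) j - g m j) * norm (slope J (E m) j)) / real J"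
    using J0 by (simp add: divide_right_mono order_trans[OF sum_abs] sum_mono Cauchy_Schwarz_ineq2)
  also have "\<dots> \<le> dt * ((\<Sum>j<J. (norm (slope J (E m) j))^2) / real J) + ((\<Sum>j<J. (norm (g (Suc m) j - g m j))^2) / real J) / (4 * dt)"
    by (rule sum_young[OF dt(1) J0])
  also have "\<dots> = dt * s2 J (E m) + n2 J (\<lambda>j. g (Suc m) j - g m j) / (4 * dt)"
    by (simp add: s2_def n2_def)
  also have "\<dots> \<le> dt * s2 J (E m) + \<kappa> m / dt"
  proof -
    have "n2 J (\<lambda>j. g (Suc m) j - g m j) / (4 * dt) \<le> \<kappa> m / (4 * dt)"
      using g(2)[of m] False m dt(1) by (intro divide_right_mono) auto
    also have "\<dots> \<le> \<kappa> m / dt" using \<kappa>(1)[of m] dt(1) by (intro divide_left_mono) auto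
    finally show ?thesis by simp
  qed
  finally show ?thesis .
qed

definition "r m = dt * (C2 * (s2 J (E m) + n2 J (E m))) + 8 / c1 * (dt * \<alpha> m) + \<kappa> m / dt"

text \<open>Of the mass term c1, a quarter is spent in \<open>step_inequality\<close>, half is kept
  in the sum, and the last quarter is carried along as the separate term for D k: it pays for the
  change of weight in the next step.\<close>

lemma energy:
  assumes "k \<le> M" and gd: "\<And>m. m < k \<Longrightarrow> good m"
  shows "(c1 / 2) * (\<Sum>m<k. dt * n2 J (D (Suc m))) + (c1 / 4) * (dt * n2 J (D k)) + bw (k - 1) (E k) / 2
    \<le> G k k + (\<Sum>m<k. r m)"
  using assms
proof (induction k)
  case 0
  \<comment> \<open>By truncated subtraction the predecessor of level 0 is level 0 itself, so D 0
    vanishes.\<close>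
  have "E 0 j = 0" "D 0 j = 0" for j by (simp_all add: E_def D_def start)
  then show ?case by (simp add: n2_def bw_def G_def slope_def)
next
  case (Suc k)
  have k: "k < M" and gk: "good k" using Suc.prems by auto
  have IH: "(c1 / 2) * (\<Sum>m<k. dt * n2 J (D (Suc m))) + (c1 / 4) * (dt * n2 J (D k)) + bw (k - 1) (E k) / 2 \<le> G k k + (\<Sum>m<k. r m)"
    using Suc by simp
  have wu: "(bw k (E k) - bw (k - 1) (E k)) / 2 \<le> dt * ((K + 1 / c1) * s2 J (E k)) + (c1 / 4) * (dt * n2 J (D k))"
  proof (cases "k = 0")
    case True
    have "0 \<le> (K + 1 / c1) * s2 J (E k)" using constants K s2_nonneg[of J "E k"] by (intro mult_nonneg_nonneg) auto
    then show ?thesis using True dt(1) constants n2_nonneg[of J "D 0"] by simp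
  next
    case False
    then show ?thesis using weight_update[of k] k gk by simp
  qed
  define q where "q = 1944 * (K + 1) ^ 6 / (c1 / 8)"
  define X where "X = s2 J (E k)"
  define W where "W = n2 J (E k)"
  have XW: "0 \<le> X" "0 \<le> W" by (simp_all add: X_def W_def s2_nonneg n2_nonneg)
  have "dt * (\<alpha> k / (c1 / 8) + q * (X + W)) + dt * ((K + 1 / c1) * X) + (dt * X + \<kappa> k / dt) \<le> r k"
  proof -
    have e: "r k = dt * (q * (X + W) + (K + 1 / c1 + 1) * (X + W)) + 8 / c1 * (dt * \<alpha> k) + \<kappa> k / dt"
      by (simp add: r_def C2_def q_def X_def W_def algebra_simps)
    define kk where "kk = K + 1 / c1"
    have "0 \<le> (kk + 1) * W" using K constants XW by (intro mult_nonneg_nonneg) (auto simp: kk_def)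
    then have "dt * (q * (X + W) + (kk * X + X)) \<le> dt * (q * (X + W) + (kk + 1) * (X + W))"
      using dt(1) by (intro mult_left_mono) (auto simp: algebra_simps)
    then show ?thesis unfolding e kk_def[symmetric] by (simp add: algebra_simps)
  qed
  then have "(\<Sum>m<k. r m) + (dt * (\<alpha> k / (c1 / 8) + q * (X + W)) + dt * ((K + 1 / c1) * X) + (dt * X + \<kappa> k / dt)) \<le> (\<Sum>m<Suc k. r m)"
    by simp
  moreover have "(c1 / 2) * (\<Sum>m<Suc k. dt * n2 J (D (Suc m))) = (c1 / 2) * (\<Sum>m<k. dt * n2 J (D (Suc m))) + (c1 / 2) * (dt * n2 J (D (Suc k)))"
    by (simp add: distrib_left)
  moreover have "\<bar>G (Suc k) k - G k k\<bar> \<le> dt * X + \<kappa> k / dt" unfolding X_def by (rule g_increment[OF k])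
  ultimately show ?case
    using IH wu step_inequality[OF k gk]
    unfolding q_def[symmetric] X_def[symmetric] W_def[symmetric] diff_Suc_1 diff_divide_distrib abs_le_iff
    by (simp add: algebra_simps) linarith?
qed

lemma n2_E_bound:
  assumes "k \<le> M"
  shows "n2 J (E k) \<le> T * (\<Sum>m<k. dt * n2 J (D (Suc m)))"
proof -
  have E: "E k j = (\<Sum>m<k. dt *\<^sub>R D (Suc m) j)" for j
  proof (induction k)
    case 0
    show ?case by (simp add: E_def start)
  next
    case (Suc k)
    then show ?case using dt(1) by (simp add: D_def)
  qed
  have kd: "real k * dt \<le> T"
  proof -
    have "real k * dt \<le> real M * dt" using assms dt(1) by (intro mult_right_mono) auto
    then show ?thesis using dt(2) by simp
  qed
  have "(norm (E k j))^2 \<le> T * (\<Sum>m<k. dt * (norm (D (Suc m) j))^2)" for j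
  proof -
    have "norm (E k j) \<le> (\<Sum>m<k. dt * norm (D (Suc m) j))"
      unfolding E using dt(1) by (intro order_trans[OF norm_sum]) simp
    then have "(norm (E k j))^2 \<le> (\<Sum>m<k. dt * norm (D (Suc m) j))^2" by (intro power_mono) auto
    also have "\<dots> = dt^2 * (\<Sum>m<k. 1 * norm (D (Suc m) j))^2" by (simp add: power_mult_distrib flip: sum_distrib_left)
    also have "\<dots> \<le> dt^2 * ((\<Sum>m<k. 1^2) * (\<Sum>m<k. (norm (D (Suc m) j))^2))"
      by (intro mult_left_mono Cauchy_Schwarz_ineq_sum) auto
    also have "\<dots> = (real k * dt) * (\<Sum>m<k. dt * (norm (D (Suc m) j))^2)"
      by (simp add: power2_eq_square sum_distrib_left[symmetric] mult_ac)
    also have "\<dots> \<le> T * (\<Sum>m<k. dt * (norm (D (Suc m) j))^2)"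
      using kd dt(1) by (intro mult_right_mono sum_nonneg) auto
    finally show ?thesis .
  qed
  then have "n2 J (E k) \<le> (\<Sum>j<J. T * (\<Sum>m<k. dt * (norm (D (Suc m) j))^2)) / real J"
    unfolding n2_def by (intro divide_right_mono sum_mono) auto
  also have "\<dots> = T * (\<Sum>m<k. dt * n2 J (D (Suc m)))"
  proof -
    have "(\<Sum>j<J. \<Sum>m<k. dt * (norm (D (Suc m) j))^2) = (\<Sum>m<k. \<Sum>j<J. dt * (norm (D (Suc m) j))^2)" by (rule sum.swap)
    then show ?thesis by (auto simp: n2_def simp flip: sum_distrib_left sum_divide_distrib times_divide_eq_right)
  qed
  finally show ?thesis .
qed

text \<open>Gronwall for the sum of the squared difference quotients plus the squared seminorm of
  the error. The values of the error are no separate unknown: they are bounded by the quotients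
  through \<open>n2_E_bound\<close>.\<close>

lemma error_bound:
  assumes k: "k \<le> M" and gd: "\<And>m. m < k \<Longrightarrow> good m"
  shows "s2 J (E k) \<le> C6 * S" "n2 J (E k) \<le> C6 * S" "(\<Sum>m<k. dt * n2 J (D (Suc m))) \<le> C6 * S"
proof -
  define Q where "Q k = (\<Sum>m<k. dt * n2 J (D (Suc m)))" for k
  define \<theta> where "\<theta> k = Q k + s2 J (E k)" for k
  have Q0: "0 \<le> Q k" for k unfolding Q_def by (intro sum_nonneg mult_nonneg_nonneg n2_nonneg less_imp_le[OF dt(1)])
  have n2Q: "n2 J (E m) \<le> T * \<theta> m" if "m \<le> M" for m
    using n2_E_bound[OF that] mult_left_mono[of "Q m" "\<theta> m" T] T0 s2_nonneg[of J "E m"] by (simp add: Q_def \<theta>_def)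
  have main: "\<theta> l \<le> C5 * S + (C5 * dt) * (\<Sum>m<l. \<theta> m)" if l: "l \<le> k" for l
  proof (cases "l = 0")
    case True
    have "E 0 j = 0" for j by (simp add: E_def start)
    then show ?thesis using True constants S by (simp add: \<theta>_def Q_def s2_def n2_def slope_def)
  next
    case False
    have lM: "l \<le> M" "l - 1 < M" "l - 1 < k" "1 \<le> l" using l k False by auto
    note en = energy[OF lM(1) gd[OF less_le_trans[OF _ l]]]
    have bwl: "c * s2 J (E l) \<le> bw (l - 1) (E l)"
    proof -
      have "(\<Sum>j<J. c * (norm (slope J (E l) j))^2) / real J \<le> bw (l - 1) (E l)"
        unfolding bw_def
      proof (intro divide_right_mono sum_mono mult_right_mono)
        fix j show "c \<le> (U (l - 1) j + U (l - 1) (Suc j)) \<bullet> e1 / 2"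
          using goodD(3)[OF gd[OF lM(3)], of j] goodD(3)[OF gd[OF lM(3)], of "Suc j"] lM by (simp add: inner_add_left)
      qed auto
      then show ?thesis by (simp add: s2_def n2_def flip: sum_distrib_left)
    qed
    \<comment> \<open>The flux at the final level is not an increment and is absorbed: the energy
      provides c/2 times the squared seminorm, of which one half is used up here.\<close>
    have Gl: "G l l \<le> (c / 4) * s2 J (E l) + S / c"
    proof -
      have "G l l = (\<Sum>j<J. g l j \<bullet> slope J (E l) j) / real J"
        unfolding G_def sum_divide_distrib using J0 by (intro sum.cong refl) (simp add: slope_def)
      also have "\<dots> \<le> (\<Sum>j<J. norm (g l j) * norm (slope J (E l) j)) / real J"
        using J0 by (intro divide_right_mono sum_mono norm_cauchy_schwarz) auto
      also have "\<dots> \<le> (c / 4) * ((\<Sum>j<J. (norm (slope J (E l) j))^2) / real J) + ((\<Sum>j<J. (norm (g l j))^2) / real J) / (4 * (c / 4))"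
        by (rule sum_young) (use c J0 in auto)
      also have "\<dots> \<le> (c / 4) * s2 J (E l) + S / c"
        using divide_right_mono[OF g(1)[OF lM(4,1)] less_imp_le[OF c(1)]] by (simp add: s2_def n2_def)
      finally show ?thesis .
    qed
    have rs: "(\<Sum>m<l. r m) \<le> dt * (C2 * (1 + T)) * (\<Sum>m<l. \<theta> m) + (8 / c1 + 1) * S"
    proof -
      have "(\<Sum>m<l. r m) \<le> (\<Sum>m<l. dt * (C2 * (1 + T)) * \<theta> m + 8 / c1 * (dt * \<alpha> m) + \<kappa> m / dt)"
      proof (rule sum_mono)
        fix m assume "m \<in> {..<l}"
        then have "m \<le> M" using lM by simp
        then have "s2 J (E m) + n2 J (E m) \<le> (1 + T) * \<theta> m"
          using n2Q[of m] Q0[of m] by (simp add: \<theta>_def distrib_right)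
        then have "dt * (C2 * (s2 J (E m) + n2 J (E m))) \<le> dt * (C2 * ((1 + T) * \<theta> m))"
          using dt(1) constants by (intro mult_left_mono) auto
        then show "r m \<le> dt * (C2 * (1 + T)) * \<theta> m + 8 / c1 * (dt * \<alpha> m) + \<kappa> m / dt"
          by (simp add: r_def mult_ac)
      qed
      also have "\<dots> = dt * (C2 * (1 + T)) * (\<Sum>m<l. \<theta> m) + 8 / c1 * (\<Sum>m<l. dt * \<alpha> m) + (\<Sum>m<l. \<kappa> m / dt)"
        by (simp add: sum.distrib sum_distrib_left)
      also have "8 / c1 * (\<Sum>m<l. dt * \<alpha> m) \<le> 8 / c1 * S"
        using constants dt(1) \<alpha> lM by (intro mult_left_mono order_trans[OF sum_mono2[of "{..<M}" "{..<l}"] \<alpha>(2)]) auto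
      also have "(\<Sum>m<l. \<kappa> m / dt) \<le> S"
        using dt(1) \<kappa> lM by (intro order_trans[OF sum_mono2[of "{..<M}" "{..<l}"] \<kappa>(2)]) auto
      finally show ?thesis by (simp add: distrib_right)
    qed
    have "0 \<le> (c1 / 4) * (dt * n2 J (D l))" using constants dt(1) n2_nonneg[of J "D l"] by simp
    then have "(c1 / 2) * Q l + (c / 4) * s2 J (E l) \<le> S / c + (dt * (C2 * (1 + T)) * (\<Sum>m<l. \<theta> m) + (8 / c1 + 1) * S)"
      using en bwl Gl rs times_divide_eq_left[of c 4 "s2 J (E l)"] unfolding Q_def by linarith
    moreover have "c4 * Q l \<le> (c1 / 2) * Q l" "c4 * s2 J (E l) \<le> (c / 4) * s2 J (E l)"
      using constants Q0 s2_nonneg by (intro mult_right_mono; simp)+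
    ultimately have "c4 * \<theta> l \<le> (1 / c + 8 / c1 + 1) * S + dt * (C2 * (1 + T)) * (\<Sum>m<l. \<theta> m)"
      by (simp add: \<theta>_def distrib_left distrib_right)
    also have "\<dots> \<le> (1 / c + 8 / c1 + 1 + C2 * (1 + T)) * S + (1 / c + 8 / c1 + 1 + C2 * (1 + T)) * (dt * (\<Sum>m<l. \<theta> m))"
    proof -
      have "0 \<le> \<theta> m" for m by (simp add: \<theta>_def Q0 s2_nonneg)
      then have "0 \<le> dt * (\<Sum>m<l. \<theta> m)" using dt(1) by (simp add: sum_nonneg)
      moreover have "0 \<le> 1 / c + 8 / c1 + 1" "0 \<le> C2 * (1 + T)" using c constants T0 by auto
      ultimately have "0 \<le> (1 / c + 8 / c1 + 1) * (dt * (\<Sum>m<l. \<theta> m))" "0 \<le> C2 * (1 + T) * S"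
        using S by (auto intro!: mult_nonneg_nonneg)
      then show ?thesis by (simp add: algebra_simps)
    qed
    also have "\<dots> = c4 * (C5 * S + (C5 * dt) * (\<Sum>m<l. \<theta> m))"
      using constants by (simp add: C5_def distrib_left)
    finally show ?thesis using constants(3) by simp
  qed
  have "\<theta> k \<le> C5 * S * exp (C5 * dt * real k)"
    by (rule discrete_gronwall[OF _ _ main order_refl]) (use constants S dt(1) in auto)
  also have "\<dots> \<le> C5 * S * exp (C5 * T)"
  proof -
    have "real k * dt \<le> real M * dt" using k dt(1) by (intro mult_right_mono) auto
    then have "C5 * (dt * real k) \<le> C5 * T"
      using constants dt(2) by (intro mult_left_mono) (auto simp: mult.commute)
    then show ?thesis using constants S by (intro mult_left_mono) (auto simp: mult.assoc)
  qed
  finally have \<theta>: "\<theta> k \<le> C5 * S * exp (C5 * T)" .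
  define Z where "Z = C5 * S * exp (C5 * T)"
  have Z: "0 \<le> Z" "C6 * S = Z + T * Z" using constants S by (auto simp: Z_def C6_def algebra_simps)
  have TZ: "0 \<le> T * Z" using Z T0 by simp
  have "s2 J (E k) \<le> Z" "Q k \<le> Z" using \<theta> Q0[of k] s2_nonneg[of J "E k"] by (simp_all add: \<theta>_def Z_def)
  then show "s2 J (E k) \<le> C6 * S" "(\<Sum>m<k. dt * n2 J (D (Suc m))) \<le> C6 * S"
    using Z TZ by (simp_all add: Q_def)
  have "n2 J (E k) \<le> T * Z"
    using n2Q[OF k] mult_left_mono[OF \<theta> T0] by (simp add: Z_def)
  then show "n2 J (E k) \<le> C6 * S" using Z by simp
qed

lemma inverse_inequality:
  assumes "cyc J V"
  shows "(norm (V j))^2 \<le> real J * n2 J V"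
proof -
  have "V j = V (j mod J)" by (rule cyc_mod[OF assms])
  moreover have "j mod J \<in> {..<J}" using J by simp
  then have "(norm (V (j mod J)))^2 \<le> (\<Sum>j<J. (norm (V j))^2)"
    by (intro member_le_sum) auto
  ultimately show ?thesis using J0 by (simp add: n2_def)
qed

text \<open>The coefficients of a step come from the old level, so the estimate at level k
  presupposes \<open>good\<close> only below k. The inverse inequality, which costs the factor J,
  then yields \<open>good k\<close>, and the induction closes without any continuation
  argument.\<close>

theorem stability:
  assumes small: "real J * (C6 * S) \<le> c^2" and k: "k \<le> M"
  shows "good k" "s2 J (E k) \<le> C6 * S" "n2 J (E k) \<le> C6 * S" "(\<Sum>m<k. dt * n2 J (D (Suc m))) \<le> C6 * S"
proof -
  have gd: "good k" if "k \<le> M" for k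
    using that
  proof (induction k rule: less_induct)
    case (less k)
    then have prev: "good m" if "m < k" for m using that by simp
    note eb = error_bound[OF less.prems prev]
    note cE = cyc_E[OF less.prems]
    have "(norm (E k j))^2 \<le> c^2" "(norm (slope J (E k) j))^2 \<le> c^2" for j
      using inverse_inequality[OF cE, of j] inverse_inequality[OF cyc_slope[OF cE], of j]
        mult_left_mono[OF eb(2), of "real J"] mult_left_mono[OF eb(1), of "real J"] small
      by (auto simp: s2_def)
    then show ?case using c unfolding good_def by (meson less_imp_le power2_le_imp_le)
  qed
  show "good k" by (rule gd[OF k])
  show "s2 J (E k) \<le> C6 * S" "n2 J (E k) \<le> C6 * S" "(\<Sum>m<k. dt * n2 J (D (Suc m))) \<le> C6 * S"
    by (rule error_bound[OF k], use gd k in simp)+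
qed

end

subsection \<open>Piecewise affine functions\<close>

definition plin :: "nat \<Rightarrow> (nat \<Rightarrow> 'a::real_vector) \<Rightarrow> real \<Rightarrow> 'a" where
  "plin J U z = (let s = frac z * real J; k = nat \<lfloor>s\<rfloor> in U k + (s - real k) *\<^sub>R (U (Suc k) - U k))"

text \<open>A representative of the derivative that is defined everywhere; at a node it takes the
  slope of the element to the right.\<close>

definition dplin :: "nat \<Rightarrow> (nat \<Rightarrow> 'a::real_vector) \<Rightarrow> real \<Rightarrow> 'a" where
  "dplin J U z = slope J U (nat \<lfloor>frac z * real J\<rfloor>)"

lemma periodic_plin: "periodic (plin J U)" "periodic (dplin J U)"
  by (simp_all add: periodic_def plin_def dplin_def frac_1_eq)

lemma element_width: "1 \<le> J \<Longrightarrow> node J (Suc j) - node J j = 1 / real J"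
  by (simp add: node_def add_divide_distrib)

lemma open_element_index:
  assumes "j < J" "real j \<le> z * real J" "z * real J < real j + 1"
  shows "frac z = z" "nat \<lfloor>frac z * real J\<rfloor> = j"
proof -
  have J0: "0 < real J" using assms by simp
  have "0 \<le> z * real J" using assms(2) of_nat_0_le_iff[of j] by linarith
  then have 0: "0 \<le> z" using J0 by (simp add: zero_le_mult_iff)
  have "real j + 1 \<le> real J" using assms(1) by linarith
  then have "z * real J < 1 * real J" using assms(3) by linarith
  then have 1: "z < 1" using J0 by (simp only: mult_less_cancel_right_pos)
  show f: "frac z = z" using 0 1 by (simp add: frac_eq)
  have "\<lfloor>z * real J\<rfloor> = int j" using assms by (intro floor_unique) auto
  then show "nat \<lfloor>frac z * real J\<rfloor> = j" by (simp add: f)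
qed

text \<open>At its right end point an element hands over to the next one or wraps around to node 0;
  periodicity of the nodal values makes both formulas agree there.\<close>

lemma plin_element:
  assumes j: "j < J" and cyc: "cyc J U" and z: "z \<in> element J j"
  shows "plin J U z = U j + (z * real J - real j) *\<^sub>R (U (Suc j) - U j)"
proof -
  have J: "1 \<le> J" using j by simp
  have b: "real j \<le> z * real J" "z * real J \<le> real j + 1" using z in_element(1)[OF J] by blast+
  show ?thesis
  proof (cases "z * real J < real j + 1")
    case True
    then show ?thesis using open_element_index[OF j b(1) True] by (simp add: plin_def Let_def)
  next
    case False
    then have e: "z * real J = real (Suc j)" using b by simp
    show ?thesis
    proof (cases "Suc j = J")
      case True
      then have "z = 1" using e J by simp
      then have l: "plin J U z = U 0" by (simp add: plin_def)
      have "U (Suc j) = U 0" using cyc unfolding cyc_def True by (metis add_0)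
      moreover have "z * real J - real j = 1" using e by simp
      ultimately show ?thesis unfolding l by simp
    next
      case False
      then have "Suc j < J" using j by simp
      from open_element_index[OF this, of z] e have "frac z = z" "nat \<lfloor>frac z * real J\<rfloor> = Suc j" by auto
      then show ?thesis unfolding plin_def Let_def using e by simp
    qed
  qed
qed

lemma plin_node: "j \<le> J \<Longrightarrow> 1 \<le> J \<Longrightarrow> cyc J U \<Longrightarrow> plin J U (node J j) = U j"
proof (cases "j = J")
  case True
  assume "1 \<le> J" "cyc J U"
  then have "J - 1 < J" "node J j \<in> element J (J - 1)" using True by (auto simp: node_def divide_right_mono)
  then show ?thesis using plin_element[of "J - 1" J U "node J j"] \<open>cyc J U\<close> \<open>1 \<le> J\<close> True by (simp add: node_def)
next
  case False
  assume "j \<le> J" "1 \<le> J" "cyc J U"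
  then show ?thesis using plin_element[of j J U "node J j"] False by (simp add: node_def divide_right_mono)
qed

lemma plin_lipschitz:
  assumes J: "1 \<le> J" and cyc: "cyc J U" and L: "\<And>j. norm (slope J U j) \<le> L"
  shows "norm (plin J U a - plin J U b) \<le> L * \<bar>a - b\<bar>"
proof (rule piecewise_lipschitz[OF periodic_plin(1) J])
  show "0 \<le> L" using order_trans[OF norm_ge_zero L] .
  fix j a b assume j: "j < J" and ab: "a \<in> element J j" "b \<in> element J j"
  have "plin J U a - plin J U b = (a - b) *\<^sub>R slope J U j"
    unfolding plin_element[OF j cyc ab(1)] plin_element[OF j cyc ab(2)] by (simp add: slope_def algebra_simps)
  then show "norm (plin J U a - plin J U b) \<le> L * \<bar>a - b\<bar>" using mult_right_mono[OF L[of j] abs_ge_zero[of "a - b"]] by (simp add: mult.commute)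
qed

lemma cyc_bounded:
  fixes U :: "nat \<Rightarrow> 'a::real_normed_vector"
  assumes "1 \<le> J" "cyc J U"
  shows "\<exists>L. \<forall>j. norm (U j) \<le> L"
proof -
  have "norm (U j) \<le> Max ((\<lambda>i. norm (U i)) ` {..<J})" for j
  proof -
    have "U j = U (j mod J)" by (rule cyc_mod[OF assms(2)])
    then show ?thesis using assms(1) by (auto intro!: Max_ge)
  qed
  then show ?thesis by blast
qed

lemma plin_continuous:
  assumes "1 \<le> J" "cyc J U"
  shows "continuous_on A (plin J (U :: nat \<Rightarrow> 'a::real_normed_vector))"
proof -
  obtain L where "\<And>j. norm (slope J U j) \<le> L" using cyc_bounded[OF assms(1) cyc_slope[OF assms(2)]] by blast
  then show ?thesis using lipschitz_continuous[OF plin_lipschitz[OF assms]] by blast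
qed

lemma dplin_open: "j < J \<Longrightarrow> z \<in> open_element J j \<Longrightarrow> dplin J U z = slope J U j"
  using in_element(2)[of J z j] open_element_index[of j J z] by (simp add: dplin_def)

lemma plin_has_vector_derivative:
  fixes U :: "nat \<Rightarrow> 'a::real_normed_vector"
  assumes j: "j < J" and cyc: "cyc J U" and z: "z \<in> open_element J j"
  shows "(plin J U has_vector_derivative slope J U j) (at z)"
proof -
  have "((\<lambda>z. U j + (z * real J - real j) *\<^sub>R (U (Suc j) - U j)) has_vector_derivative slope J U j) (at z)"
    unfolding slope_def by (auto intro!: derivative_eq_intros)
  then show ?thesis
  proof (rule has_vector_derivative_transform_within_open[OF _ open_greaterThanLessThan z])
    fix \<sigma> assume "\<sigma> \<in> open_element J j"
    then show "U j + (\<sigma> * real J - real j) *\<^sub>R (U (Suc j) - U j) = plin J U \<sigma>"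
      using plin_element[OF j cyc, of \<sigma>] by simp
  qed
qed

lemma AE_open_element:
  assumes J: "1 \<le> J"
  shows "AE z in I_measure. \<exists>j<J. z \<in> open_element J j"
proof -
  have "node J ` {..J} \<in> null_sets lebesgue"
    by (simp add: finite_imp_null_set_lborel null_sets_completionI)
  then have "AE z in lebesgue. z \<notin> node J ` {..J}" by (rule AE_not_in)
  then have "AE z in I_measure. z \<notin> node J ` {..J}"
    by (subst AE_restrict_space_iff) (auto elim!: eventually_mono)
  moreover have "AE z in I_measure. z \<in> {0..1}" by (rule AE_I2) simp
  ultimately show ?thesis
  proof eventually_elim
    case (elim z)
    have J0: "0 < real J" using J by simp
    define j where "j = nat \<lfloor>z * real J\<rfloor>"
    have s: "0 \<le> z * real J" "z * real J \<le> real J" using elim(2) by (auto simp: mult_left_le_one_le)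
    have jf: "real j \<le> z * real J" "z * real J < real j + 1" using s(1) by (auto simp: j_def)
    have no: "z * real J \<noteq> real i" if "i \<le> J" for i
    proof
      assume "z * real J = real i"
      then have "z = node J i" using J0 by (simp add: node_def field_simps)
      then show False using elim(1) that by auto
    qed
    have "real j \<le> real J" using jf s by linarith
    then have jJ: "j \<le> J" by simp
    moreover have "j \<noteq> J" using no[of J] jf(1) s(2) by auto
    ultimately have "j < J" by simp
    moreover have "z \<in> open_element J j" unfolding in_element(2)[OF J] using jf no[OF jJ] by auto
    ultimately show ?case by blast
  qed
qed

text \<open>F is prescribed only inside the elements. The nodes form a null set, so the unspecified
  values of \<open>d_rho\<close> there are harmless.\<close>

lemma piecewise_integral:
  fixes F :: "real \<Rightarrow> 'a::euclidean_space"
  assumes J: "1 \<le> J" and cont: "\<And>j. j < J \<Longrightarrow> continuous_on (element J j) (g j)"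
    and eq: "\<And>j z. j < J \<Longrightarrow> z \<in> open_element J j \<Longrightarrow> F z = g j z"
  shows "integrable I_measure F" "(\<integral>z. F z \<partial>I_measure) = (\<Sum>j<J. integral (element J j) (g j))"
proof -
  have el: "has_bochner_integral (lebesgue_on (element J j)) F (integral (element J j) (g j))" if j: "j < J" for j
  proof -
    have gi: "g j absolutely_integrable_on element J j" using cont[OF j] by (rule absolutely_integrable_continuous_real)
    have neg: "negligible {node J j, node J (Suc j)}" by simp
    have "F z = g j z" if "z \<in> element J j - {node J j, node J (Suc j)}" for z
      by (rule eq[OF j]) (use that in auto)
    then have Fi: "F absolutely_integrable_on element J j" and e: "integral (element J j) F = integral (element J j) (g j)"
      using absolutely_integrable_spike[OF gi neg] integral_spike[OF neg] by metis+
    have i: "integrable (lebesgue_on (element J j)) F" by (rule absolutely_integrable_imp_integrable[OF Fi]) simp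
    show ?thesis
      using lebesgue_integral_eq_integral[OF i] i e by (simp add: has_bochner_integral_iff)
  qed
  have "has_bochner_integral (lebesgue_on {node J 0..node J k}) F (\<Sum>j<k. integral (element J j) (g j))" if "k \<le> J" for k
    using that
  proof (induction k)
    case 0
    have "{0 :: real} \<in> null_sets lebesgue" by (simp add: null_sets_completionI)
    then show ?case using has_bochner_integral_null[of "{0::real}" F] by (simp add: node_def)
  next
    case (Suc k)
    then show ?case
      using has_bochner_integral_combine[of "node J 0" "node J k" "node J (Suc k)" F] el[of k]
      by (simp add: node_def divide_right_mono)
  qed
  from this[of J] J have "has_bochner_integral I_measure F (\<Sum>j<J. integral (element J j) (g j))"
    by (simp add: node_def)
  then show "integrable I_measure F" "(\<integral>z. F z \<partial>I_measure) = (\<Sum>j<J. integral (element J j) (g j))"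
    by (auto simp: has_bochner_integral_iff)
qed

lemma has_integral_cubic:
  assumes J: "1 \<le> J"
  shows "((\<lambda>z. c0 + c1 * (z * real J - real j) + c2 * (z * real J - real j)^2 + c3 * (z * real J - real j) ^ 3)
    has_integral (c0 + c1 / 2 + c2 / 3 + c3 / 4) / real J) (element J j)"
proof -
  have J0: "real J \<noteq> 0" using J by simp
  define F where "F z = (c0 * (z * real J - real j) + c1 / 2 * (z * real J - real j)^2 + c2 / 3 * (z * real J - real j) ^ 3
    + c3 / 4 * (z * real J - real j) ^ 4) / real J" for z
  have "((\<lambda>z. c0 + c1 * (z * real J - real j) + c2 * (z * real J - real j)^2 + c3 * (z * real J - real j) ^ 3)
    has_integral (F (node J (Suc j)) - F (node J j))) (element J j)"
  proof (rule fundamental_theorem_of_calculus)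
    fix x
    have "(F has_real_derivative (c0 + c1 * (x * real J - real j) + c2 * (x * real J - real j)^2 + c3 * (x * real J - real j) ^ 3)) (at x within element J j)"
      unfolding F_def using J0
      by (auto intro!: derivative_eq_intros simp: field_simps power2_eq_square power3_eq_cube)
    then show "(F has_vector_derivative (c0 + c1 * (x * real J - real j) + c2 * (x * real J - real j)^2 + c3 * (x * real J - real j) ^ 3)) (at x within element J j)"
      by (simp add: has_real_derivative_iff_has_vector_derivative)
  qed (use J in \<open>simp add: node_def divide_right_mono\<close>)
  moreover have "node J (Suc j) * real J - real j = 1" "node J j * real J - real j = 0" using J0 by (simp_all add: node_def)
  ultimately show ?thesis by (simp add: F_def)
qed

lemma integral_tri:
  fixes u :: "'a::real_inner"
  assumes J: "1 \<le> J"
  shows "integral (element J j) (\<lambda>z. (a + (z * real J - real j) * (b - a)) *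
      ((u + (z * real J - real j) *\<^sub>R (u' - u)) \<bullet> (v + (z * real J - real j) *\<^sub>R (v' - v)))) = tri a b u u' v v' / real J"
proof -
  define p q r where "p = u \<bullet> v" and "q = u \<bullet> (v' - v) + (u' - u) \<bullet> v" and "r = (u' - u) \<bullet> (v' - v)"
  have "(a + s * (b - a)) * ((u + s *\<^sub>R (u' - u)) \<bullet> (v + s *\<^sub>R (v' - v)))
      = a * p + (a * q + (b - a) * p) * s + (a * r + (b - a) * q) * s^2 + ((b - a) * r) * s ^ 3" for s
    by (simp add: inner_add_left inner_add_right p_def q_def r_def algebra_simps power2_eq_square power3_eq_cube)
  then have "integral (element J j) (\<lambda>z. (a + (z * real J - real j) * (b - a)) *
      ((u + (z * real J - real j) *\<^sub>R (u' - u)) \<bullet> (v + (z * real J - real j) *\<^sub>R (v' - v))))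
    = (a * p + (a * q + (b - a) * p) / 2 + (a * r + (b - a) * q) / 3 + ((b - a) * r) / 4) / real J"
    using integral_unique[OF has_integral_cubic[OF J]] by simp
  also have "a * p + (a * q + (b - a) * p) / 2 + (a * r + (b - a) * q) / 3 + ((b - a) * r) / 4 = tri a b u u' v v'"
    by (simp add: tri_def p_def q_def r_def inner_diff_left inner_diff_right field_simps)
  finally show ?thesis .
qed

lemma integral_affine:
  assumes J: "1 \<le> J"
  shows "integral (element J j) (\<lambda>z. a + (z * real J - real j) * (b - a)) = (a + b) / 2 / real J"
  using integral_unique[OF has_integral_cubic[OF J, of a "b - a" j 0 0]] by (simp add: field_simps)

lemma l2_norm_plin:
  fixes H :: "nat \<Rightarrow> 'a::euclidean_space"
  assumes J: "1 \<le> J" and cyc: "cyc J H"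
  shows "(l2_norm (plin J H))^2 \<le> n2 J H"
proof -
  have "l2_inner (plin J H) (plin J H) = (\<Sum>j<J. integral (element J j) (\<lambda>z. (1 + (z * real J - real j) * (1 - 1)) *
      ((H j + (z * real J - real j) *\<^sub>R (H (Suc j) - H j)) \<bullet> (H j + (z * real J - real j) *\<^sub>R (H (Suc j) - H j)))))"
    unfolding l2_inner_def
    by (rule piecewise_integral[OF J]) (auto intro!: continuous_intros simp: plin_element[OF _ cyc])
  also have "\<dots> = (\<Sum>j<J. tri 1 1 (H j) (H (Suc j)) (H j) (H (Suc j)) / real J)"
    by (simp only: integral_tri[OF J])
  also have "\<dots> \<le> (\<Sum>j<J. ((norm (H j))^2 + (norm (H (Suc j)))^2) / 2 / real J)"
  proof (intro sum_mono divide_right_mono)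
    fix j
    have "0 \<le> (norm (H j - H (Suc j)))^2" by simp
    then have "2 * (H j \<bullet> H (Suc j)) \<le> H j \<bullet> H j + H (Suc j) \<bullet> H (Suc j)"
      by (simp add: power2_norm_eq_inner inner_diff inner_commute)
    then show "tri 1 1 (H j) (H (Suc j)) (H j) (H (Suc j)) \<le> ((norm (H j))^2 + (norm (H (Suc j)))^2) / 2"
      by (simp add: tri_def power2_norm_eq_inner inner_commute)
  qed simp
  also have "\<dots> = (n2 J H + (\<Sum>j<J. (norm (H (Suc j)))^2) / real J) / 2"
    by (simp add: n2_def sum.distrib add_divide_distrib flip: sum_divide_distrib)
  finally show ?thesis by (simp add: n2_shift[OF cyc] l2_norm_power2)
qed

subsection \<open>The finite element space\<close>

lemma plin_in_Vh:
  assumes J: "1 \<le> J" and cyc: "cyc J u"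
  shows "plin J u \<in> Vh J"
  unfolding Vh_def
proof (intro CollectI conjI ballI)
  show "periodic (plin J u)" by (rule periodic_plin)
  show "continuous_on UNIV (plin J u)" by (rule plin_continuous[OF J cyc])
  fix j assume "j \<in> {1..J}"
  then have j: "j - 1 < J" "Suc (j - 1) = j" by auto
  show "\<exists>a b. \<forall>z\<in>{node J (j - 1)..node J j}. plin J u z = a + b * z"
    by (rule exI[of _ "u (j - 1) - real (j - 1) * (u j - u (j - 1))"], rule exI[of _ "real J * (u j - u (j - 1))"])
      (use plin_element[OF j(1) cyc, unfolded j(2)] in \<open>auto simp: algebra_simps\<close>)
qed

lemma cyc_nodes: "periodic f \<Longrightarrow> 1 \<le> J \<Longrightarrow> cyc J (\<lambda>j. f (node J j))"
  by (simp add: cyc_def node_def add_divide_distrib periodic_def)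

lemma Vh_eq_plin:
  assumes J: "1 \<le> J" and \<xi>: "\<xi> \<in> Vh J"
  shows "\<xi> = plin J (\<lambda>j. \<xi> (node J j))"
proof
  fix z :: real
  have per: "periodic \<xi>" using \<xi> by (simp add: Vh_def)
  have J0: "0 < real J" using J by simp
  define \<sigma> where "\<sigma> = frac z"
  have \<sigma>: "0 \<le> \<sigma>" "\<sigma> < 1" by (simp_all add: \<sigma>_def frac_lt_1)
  define j where "j = nat \<lfloor>\<sigma> * real J\<rfloor>"
  have jf: "real j \<le> \<sigma> * real J" "\<sigma> * real J < real j + 1" using \<sigma>(1) J0 by (auto simp: j_def)
  have "\<sigma> * real J < real J" using \<sigma> J0 by simp
  then have j: "j < J" using jf by linarith
  have el: "\<sigma> \<in> element J j" using jf in_element(1)[OF J] by simp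
  have "Suc j \<in> {1..J}" using j by simp
  then obtain a b where ab: "\<And>x. x \<in> element J j \<Longrightarrow> \<xi> x = a + b * x"
  proof -
    have "\<forall>j\<in>{1..J}. \<exists>a b. \<forall>z\<in>{node J (j - 1)..node J j}. \<xi> z = a + b * z" using \<xi> by (simp add: Vh_def)
    from bspec[OF this \<open>Suc j \<in> {1..J}\<close>] show ?thesis using that by auto
  qed
  have nn: "node J j \<in> element J j" "node J (Suc j) \<in> element J j" by (auto simp: node_def divide_right_mono)
  have "plin J (\<lambda>j. \<xi> (node J j)) \<sigma> = \<xi> \<sigma>"
    unfolding plin_element[OF j cyc_nodes[OF per J] el] ab[OF el] ab[OF nn(1)] ab[OF nn(2)]
    using J0 by (simp add: node_def field_simps)
  then show "\<xi> z = plin J (\<lambda>j. \<xi> (node J j)) z"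
    using periodic_frac[OF per, of z] periodic_frac[OF periodic_plin(1), of J "\<lambda>j. \<xi> (node J j)" z] by (simp add: \<sigma>_def)
qed

lemma plin_component: "plin J U z $ i = plin J (\<lambda>j. U j $ i) z"
  by (simp add: plin_def Let_def)

lemma plin_in_Vh_vec: "1 \<le> J \<Longrightarrow> cyc J U \<Longrightarrow> plin J U \<in> Vh_vec J"
  by (auto intro!: plin_in_Vh simp: Vh_vec_def plin_component cyc_def)

lemma Vh_vec_eq_plin:
  assumes J: "1 \<le> J" and X: "X \<in> Vh_vec J"
  shows "X = plin J (\<lambda>j. X (node J j))" "periodic X" "cyc J (\<lambda>j. X (node J j))"
proof -
  have c: "(\<lambda>z. X z $ i) = plin J (\<lambda>j. X (node J j) $ i)" for i
    using Vh_eq_plin[OF J, of "\<lambda>z. X z $ i"] X by (simp add: Vh_vec_def)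
  have "X z $ i = plin J (\<lambda>j. X (node J j)) z $ i" for z i
    unfolding plin_component using fun_cong[OF c, of z i] .
  then show 1: "X = plin J (\<lambda>j. X (node J j))" by (simp add: fun_eq_iff vec_eq_iff)
  show "periodic X" by (subst 1) (rule periodic_plin)
  then show "cyc J (\<lambda>j. X (node J j))" using J by (rule cyc_nodes)
qed

lemma interp_vec_eq_plin:
  assumes J: "1 \<le> J" and f: "periodic f"
  shows "interp_vec J f = plin J (\<lambda>j. f (node J j))"
proof -
  have "interp J (\<lambda>\<sigma>. f \<sigma> $ i) = plin J (\<lambda>j. f (node J j) $ i)" for i
    unfolding interp_def
  proof (rule the_equality)
    have cyc: "cyc J (\<lambda>j. f (node J j) $ i)" using cyc_nodes[OF f J] by (simp add: cyc_def)
    show "plin J (\<lambda>j. f (node J j) $ i) \<in> Vh J \<and> (\<forall>j\<le>J. plin J (\<lambda>j. f (node J j) $ i) (node J j) = f (node J j) $ i)"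
      using plin_in_Vh[OF J cyc] plin_node[OF _ J cyc] by auto
    fix \<xi> assume \<xi>: "\<xi> \<in> Vh J \<and> (\<forall>j\<le>J. \<xi> (node J j) = f (node J j) $ i)"
    have "\<xi> (node J j) = f (node J j) $ i" for j
    proof -
      have per: "periodic \<xi>" using \<xi> by (simp add: Vh_def)
      have nd: "node J j = node J (j mod J) + of_int (int (j div J))"
      proof -
        have "real j = real (j mod J) + real (j div J) * real J" by (metis mod_mult_div_eq add.commute mult.commute of_nat_add of_nat_mult)
        then show ?thesis using J by (simp add: node_def field_simps)
      qed
      have "j mod J \<le> J" using J by (simp add: less_imp_le)
      then show ?thesis
        unfolding nd periodic_of_int[OF per] periodic_of_int[OF f] using \<xi> by blast
    qed
    then show "\<xi> = plin J (\<lambda>j. f (node J j) $ i)" using Vh_eq_plin[OF J, of \<xi>] \<xi> by simp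
  qed
  then show ?thesis by (simp add: interp_vec_def[abs_def] fun_eq_iff vec_eq_iff plin_component)
qed

text \<open>The affine piece of element j extended to the whole line: it is differentiable at the
  nodes too, so calculus on closed elements has no boundary cases.\<close>

definition aff :: "nat \<Rightarrow> (nat \<Rightarrow> 'a::real_vector) \<Rightarrow> nat \<Rightarrow> real \<Rightarrow> 'a" where
  "aff J U j z = U j + (z * real J - real j) *\<^sub>R (U (Suc j) - U j)"

lemma aff_derivative: "(aff J U j has_vector_derivative slope J U j) (at z)" for U :: "nat \<Rightarrow> 'a::real_normed_vector"
  unfolding aff_def[abs_def] slope_def by (auto intro!: derivative_eq_intros)

lemma aff_node: "1 \<le> J \<Longrightarrow> aff J U j (node J j) = U j" "1 \<le> J \<Longrightarrow> aff J U j (node J (Suc j)) = U (Suc j)"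
  by (simp_all add: aff_def node_def)

lemma aff_continuous: "continuous_on S (aff J U j)" for U :: "nat \<Rightarrow> 'a::real_normed_vector"
  unfolding aff_def[abs_def] by (intro continuous_intros)

lemma aff_norm:
  fixes U :: "nat \<Rightarrow> 'a::real_normed_vector"
  assumes J: "1 \<le> J" and z: "z \<in> element J j" and K: "norm (U j) \<le> K" "norm (U (Suc j)) \<le> K"
  shows "norm (aff J U j z) \<le> K"
proof -
  define s where "s = z * real J - real j"
  have s: "0 \<le> s" "s \<le> 1" using z in_element(1)[OF J] by (auto simp: s_def)
  have "aff J U j z = (1 - s) *\<^sub>R U j + s *\<^sub>R U (Suc j)" by (simp add: aff_def s_def algebra_simps)
  then have "norm (aff J U j z) \<le> (1 - s) * norm (U j) + s * norm (U (Suc j))"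
    using s norm_triangle_ineq[of "(1 - s) *\<^sub>R U j" "s *\<^sub>R U (Suc j)"] by simp
  also have "\<dots> \<le> (1 - s) * K + s * K" using s K by (intro add_mono mult_left_mono) auto
  finally show ?thesis by (simp add: algebra_simps)
qed

lemma aff_norm_sum:
  fixes U :: "nat \<Rightarrow> 'a::real_normed_vector"
  assumes "1 \<le> J" "z \<in> element J j"
  shows "norm (aff J U j z) \<le> norm (U j) + norm (U (Suc j))"
  by (rule aff_norm[OF assms]) auto

lemma form_elements:
  assumes J: "1 \<le> J"
  shows "mass J A Z H = (\<Sum>j<J. integral (element J j) (\<lambda>z. (norm (slope J A j))^2 * ((aff J A j z \<bullet> e1) * (aff J Z j z \<bullet> aff J H j z))))"
    and "stiff J A V H = (\<Sum>j<J. integral (element J j) (\<lambda>z. (aff J A j z \<bullet> e1) * (slope J V j \<bullet> slope J H j)))"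
    and "source J A H = (\<Sum>j<J. integral (element J j) (\<lambda>z. (norm (slope J A j))^2 * (e1 \<bullet> aff J H j z)))"
proof -
  have e: "aff J A j z \<bullet> e1 = A j \<bullet> e1 + (z * real J - real j) * (A (Suc j) \<bullet> e1 - A j \<bullet> e1)" for A :: "nat \<Rightarrow> real^2" and j z
    by (simp add: aff_def inner_add_left inner_diff_left)
  show "mass J A Z H = (\<Sum>j<J. integral (element J j) (\<lambda>z. (norm (slope J A j))^2 * ((aff J A j z \<bullet> e1) * (aff J Z j z \<bullet> aff J H j z))))"
    unfolding mass_def sum_divide_distrib e aff_def[of J Z] aff_def[of J H]
    by (simp only: HK_integral_mult_right integral_tri[OF J] times_divide_eq_right)
  show "stiff J A V H = (\<Sum>j<J. integral (element J j) (\<lambda>z. (aff J A j z \<bullet> e1) * (slope J V j \<bullet> slope J H j)))"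
    unfolding stiff_def e using J
    by (intro sum.cong refl) (simp only: HK_integral_mult_left integral_affine[OF J], simp add: slope_def[of J H] inner_add_left)
  show "source J A H = (\<Sum>j<J. integral (element J j) (\<lambda>z. (norm (slope J A j))^2 * (e1 \<bullet> aff J H j z)))"
    unfolding source_def sum_divide_distrib inner_commute[of e1] e
    by (simp only: HK_integral_mult_right integral_affine[OF J] times_divide_eq_right inner_add_left)
qed

text \<open>The bridge between the scheme as defined with inner products of functions and its nodal
  form: inside an element all factors are affine or constant, and the difference quotient in time is
  again piecewise affine.\<close>

lemma scheme_eq_form:
  assumes J: "1 \<le> J" and cyc: "cyc J A" "cyc J V" "cyc J H"
    and X: "X m = plin J A" "X (m + 1) = plin J V"
  shows "l2_inner (\<lambda>z. (X m z \<bullet> e1) *\<^sub>R D_t dt X (m + 1) z) (\<lambda>z. (norm (d_rho (X m) z))^2 *\<^sub>R plin J H z)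
        + l2_inner (\<lambda>z. (X m z \<bullet> e1) *\<^sub>R d_rho (X (m + 1)) z) (d_rho (plin J H))
        + l2_inner (\<lambda>z. plin J H z \<bullet> e1) (\<lambda>z. (norm (d_rho (X m) z))^2)
    = scheme_form J A (\<lambda>j. (V j - A j) /\<^sub>R dt) V H"
proof -
  have d: "d_rho (plin J U) z = slope J U j" "plin J U z = aff J U j z"
    if "j < J" "cyc J U" "z \<in> open_element J j" for U :: "nat \<Rightarrow> real^2" and j z
    using vector_derivative_at[OF plin_has_vector_derivative[OF that]] plin_element[OF that(1,2), of z] that(3) by (auto simp: aff_def)
  define Z where "Z j = (V j - A j) /\<^sub>R dt" for j
  have D: "D_t dt X (m + 1) z = aff J Z j z" if "j < J" "z \<in> open_element J j" for j z
    unfolding D_t_def add_diff_cancel_right' X d(2)[OF that(1) cyc(1) that(2)] d(2)[OF that(1) cyc(2) that(2)] aff_def Z_def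
    by (simp add: algebra_simps)
  show ?thesis
    unfolding scheme_form_def Z_def[abs_def, symmetric] form_elements[OF J] l2_inner_def X
    by (intro arg_cong2[of _ _ _ _ "(+)"] piecewise_integral(2)[OF J] continuous_intros aff_continuous)
      (simp_all add: d[OF _ cyc(1)] d[OF _ cyc(2)] d[OF _ cyc(3)] D[unfolded Suc_eq_plus1[symmetric]] inner_commute[of e1])
qed

subsection \<open>Solvability of one time step\<close>

text \<open>Elimination of the last unknown. The Schur complement \<open>A'\<close> inherits
  positivity of the quadratic form, so the induction applies to it; the matrix may be
  non-symmetric.\<close>

lemma positive_definite_solve:
  fixes A :: "nat \<Rightarrow> nat \<Rightarrow> real"
  assumes "\<And>u. \<exists>i<n. u i \<noteq> 0 \<Longrightarrow> 0 < (\<Sum>i<n. \<Sum>j<n. A i j * u i * u j)"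
  shows "\<exists>u. \<forall>i<n. (\<Sum>j<n. A i j * u j) = b i"
  using assms
proof (induction n arbitrary: A b)
  case (Suc n)
  have a: "0 < A n n"
  proof -
    have "0 < (\<Sum>i<Suc n. \<Sum>j<Suc n. A i j * (if i = n then 1 else 0) * (if j = n then 1 else 0))"
      by (rule Suc.prems) auto
    then show ?thesis by (simp add: if_distrib cong: if_cong)
  qed
  define A' where "A' i j = A i j - A i n * A n j / A n n" for i j
  have "0 < (\<Sum>i<n. \<Sum>j<n. A' i j * u i * u j)" if u: "\<exists>i<n. u i \<noteq> 0" for u
  proof -
    \<comment> \<open>The last entry is chosen such that the last row annihilates the extended
      vector; the full quadratic form then reduces to that of the Schur complement.\<close>
    define w where "w = - (\<Sum>j<n. A n j * u j) / A n n"
    define v where "v i = (if i = n then w else u i)" for i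
    have "0 < (\<Sum>i<Suc n. \<Sum>j<Suc n. A i j * v i * v j)"
      by (rule Suc.prems) (use u in \<open>auto simp: v_def less_Suc_eq\<close>)
    also have "\<dots> = (\<Sum>i<n. (\<Sum>j<n. A i j * u i * u j) + A i n * u i * w) + ((\<Sum>j<n. A n j * w * u j) + A n n * w * w)"
      by (simp add: v_def)
    also have "(\<Sum>j<n. A n j * w * u j) + A n n * w * w = 0"
    proof -
      have "(\<Sum>j<n. A n j * w * u j) = w * (\<Sum>j<n. A n j * u j)" by (simp add: sum_distrib_left mult_ac)
      also have "(\<Sum>j<n. A n j * u j) = - (A n n * w)" using a by (simp add: w_def)
      finally show ?thesis by simp
    qed
    also have "(\<Sum>i<n. (\<Sum>j<n. A i j * u i * u j) + A i n * u i * w) + 0 = (\<Sum>i<n. \<Sum>j<n. A' i j * u i * u j)"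
    proof -
      have "A i n * u i * w = (\<Sum>j<n. - (A i n * A n j / A n n) * u i * u j)" for i
        by (simp add: w_def sum_distrib_left sum_divide_distrib sum_negf[symmetric] mult_ac)
      then show ?thesis by (simp add: A'_def sum.distrib[symmetric] algebra_simps)
    qed
    finally show ?thesis .
  qed
  from Suc.IH[OF this, of "\<lambda>i. b i - A i n * b n / A n n"]
  obtain u where u: "\<And>i. i < n \<Longrightarrow> (\<Sum>j<n. A' i j * u j) = b i - A i n * b n / A n n" by blast
  define w where "w = (b n - (\<Sum>j<n. A n j * u j)) / A n n"
  define v where "v i = (if i = n then w else u i)" for i
  have "(\<Sum>j<Suc n. A i j * v j) = b i" if i: "i < Suc n" for i
  proof -
    have s: "(\<Sum>j<Suc n. A i j * v j) = (\<Sum>j<n. A i j * u j) + A i n * w" by (simp add: v_def)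
    show ?thesis
    proof (cases "i = n")
      case True
      then show ?thesis unfolding s using a by (simp add: w_def)
    next
      case False
      then have "(\<Sum>j<n. A' i j * u j) = b i - A i n * b n / A n n" using u i by simp
      moreover have "(\<Sum>j<n. A' i j * u j) = (\<Sum>j<n. A i j * u j) - A i n * (\<Sum>j<n. A n j * u j) / A n n"
      proof -
        have "A' i j * u j = A i j * u j - A i n / A n n * (A n j * u j)" for j by (simp add: A'_def left_diff_distrib)
        then show ?thesis by (simp add: sum_subtractf sum_distrib_left sum_divide_distrib)
      qed
      ultimately show ?thesis unfolding s using a by (simp add: w_def field_simps)
    qed
  qed
  then show ?case by blast
qed simp

lemma mass_linear:
  "mass J A Z (\<lambda>j. \<Sum>i\<in>S. u i *\<^sub>R f i j) = (\<Sum>i\<in>S. u i * mass J A Z (f i))"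
  "mass J A (\<lambda>j. \<Sum>i\<in>S. u i *\<^sub>R f i j) Z = (\<Sum>i\<in>S. u i * mass J A (f i) Z)"
proof -
  have t: "tri a b u u' (\<Sum>i\<in>S. c i *\<^sub>R f i j) (\<Sum>i\<in>S. c i *\<^sub>R f i k) = (\<Sum>i\<in>S. c i * tri a b u u' (f i j) (f i k))"
    "tri a b (\<Sum>i\<in>S. c i *\<^sub>R f i j) (\<Sum>i\<in>S. c i *\<^sub>R f i k) u u' = (\<Sum>i\<in>S. c i * tri a b (f i j) (f i k) u u')"
    for a b and u u' :: 'a and c j k
    by (simp_all add: tri_def inner_sum_right inner_sum_left sum_distrib_left sum_divide_distrib distrib_left add_divide_distrib mult_ac flip: sum.distrib)
  show "mass J A Z (\<lambda>j. \<Sum>i\<in>S. u i *\<^sub>R f i j) = (\<Sum>i\<in>S. u i * mass J A Z (f i))"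
    unfolding mass_def t sum_distrib_left sum_divide_distrib by (subst sum.swap) (simp add: mult_ac)
  show "mass J A (\<lambda>j. \<Sum>i\<in>S. u i *\<^sub>R f i j) Z = (\<Sum>i\<in>S. u i * mass J A (f i) Z)"
    unfolding mass_def t sum_distrib_left sum_divide_distrib by (subst sum.swap) (simp add: mult_ac)
qed

lemma stiff_linear:
  "stiff J A Z (\<lambda>j. \<Sum>i\<in>S. u i *\<^sub>R f i j) = (\<Sum>i\<in>S. u i * stiff J A Z (f i))"
  "stiff J A (\<lambda>j. \<Sum>i\<in>S. u i *\<^sub>R f i j) Z = (\<Sum>i\<in>S. u i * stiff J A (f i) Z)"
proof -
  have d: "(\<Sum>i\<in>S. u i *\<^sub>R f i j) - (\<Sum>i\<in>S. u i *\<^sub>R f i k) = (\<Sum>i\<in>S. u i *\<^sub>R (f i j - f i k))" for j k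
    by (simp add: scaleR_diff_right sum_subtractf)
  show "stiff J A Z (\<lambda>j. \<Sum>i\<in>S. u i *\<^sub>R f i j) = (\<Sum>i\<in>S. u i * stiff J A Z (f i))"
    unfolding stiff_def d inner_sum_right sum_distrib_left by (subst sum.swap) (simp add: mult_ac)
  show "stiff J A (\<lambda>j. \<Sum>i\<in>S. u i *\<^sub>R f i j) Z = (\<Sum>i\<in>S. u i * stiff J A (f i) Z)"
    unfolding stiff_def slope_def d scaleR_sum_right inner_sum_left sum_distrib_left by (subst sum.swap) (simp add: mult_ac)
qed

text \<open>The equations for the two components of the unknown decouple.\<close>

definition step_form :: "nat \<Rightarrow> real \<Rightarrow> (nat \<Rightarrow> real^2) \<Rightarrow> (nat \<Rightarrow> 'a::real_inner) \<Rightarrow> (nat \<Rightarrow> 'a) \<Rightarrow> real" where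
  "step_form J dt A V H = mass J A V H / dt + stiff J A V H"

lemma step_form_coercive:
  fixes V :: "nat \<Rightarrow> 'a::real_inner"
  assumes J: "1 \<le> J" and dt: "0 < dt" and c: "0 < c" and cyc: "cyc J V"
    and A: "\<And>j. c \<le> A j \<bullet> e1" "\<And>j. c \<le> norm (slope J A j)"
  shows "c ^ 3 / 3 * n2 J V / dt \<le> step_form J dt A V V"
proof -
  have "c ^ 3 / 3 * n2 J V \<le> mass J A V V" by (rule mass_coercive) (use assms in auto)
  moreover have "0 \<le> stiff J A V V"
    unfolding stiff_def
  proof (intro sum_nonneg mult_nonneg_nonneg)
    fix j show "0 \<le> mid A j" using A(1)[of j] A(1)[of "Suc j"] c by (simp add: inner_add_left)
    show "0 \<le> slope J V j \<bullet> (V (Suc j) - V j)" by (simp add: slope_def)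
  qed
  ultimately show ?thesis
    using divide_right_mono[of "c ^ 3 / 3 * n2 J V" "mass J A V V" dt] dt unfolding step_form_def by simp
qed

text \<open>The nodal values of the standard hat functions, repeated periodically.\<close>

definition hat :: "nat \<Rightarrow> nat \<Rightarrow> nat \<Rightarrow> real" where
  "hat J i j = (if j mod J = i then 1 else 0)"

lemma cyc_hat_expansion:
  assumes J: "1 \<le> J" and cyc: "cyc J (V :: nat \<Rightarrow> 'a::real_vector)"
  shows "V j = (\<Sum>i<J. hat J i j *\<^sub>R V i)"
proof -
  have "V j = V (j mod J)" by (rule cyc_mod[OF cyc])
  also have "\<dots> = (\<Sum>i<J. if j mod J = i then V i else 0)"
    using J by (simp add: sum.delta')
  also have "\<dots> = (\<Sum>i<J. hat J i j *\<^sub>R V i)" by (intro sum.cong refl) (simp add: hat_def)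
  finally show ?thesis .
qed

lemma cyc_hat: "cyc J (hat J i)" by (simp add: cyc_def hat_def)

lemma n2_eq_0:
  assumes J: "1 \<le> J" and cyc: "cyc J V" and n: "n2 J V \<le> 0"
  shows "V j = 0"
proof -
  have "(\<Sum>j<J. (norm (V j))^2) = 0"
    using n J n2_nonneg[of J V] by (simp add: n2_def divide_le_0_iff) (smt (verit) sum_nonneg zero_le_power2)
  then have "V i = 0" if "i < J" for i using that by (simp add: sum_nonneg_eq_0_iff)
  then show ?thesis using cyc_hat_expansion[OF J cyc, of j] by simp
qed

lemma step_form_scalar_solve:
  assumes J: "1 \<le> J" and dt: "0 < dt" and c: "0 < c"
    and A: "\<And>j. c \<le> A j \<bullet> e1" "\<And>j. c \<le> norm (slope J A j)"
  shows "\<exists>v :: nat \<Rightarrow> real. cyc J v \<and> (\<forall>i<J. step_form J dt A v (hat J i) = b i)"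
proof -
  have lin: "step_form J dt A (\<lambda>j. \<Sum>i<J. u i *\<^sub>R hat J i j) H = (\<Sum>i<J. u i * step_form J dt A (hat J i) H)"
    "step_form J dt A H (\<lambda>j. \<Sum>i<J. u i *\<^sub>R hat J i j) = (\<Sum>i<J. u i * step_form J dt A H (hat J i))" for u H
    unfolding step_form_def mass_linear stiff_linear
    by (simp_all add: sum_divide_distrib distrib_left sum.distrib)
  define a where "a i j = step_form J dt A (hat J j) (hat J i)" for i j
  have "\<exists>u. \<forall>i<J. (\<Sum>j<J. a i j * u j) = b i"
  proof (rule positive_definite_solve)
    fix u :: "nat \<Rightarrow> real" assume "\<exists>i<J. u i \<noteq> 0"
    then obtain i where i: "i < J" "u i \<noteq> 0" by blast
    define v where "v j = (\<Sum>i<J. u i *\<^sub>R hat J i j)" for j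
    have cv: "cyc J v" using cyc_hat[of J] by (simp add: cyc_def v_def)
    have "v i = (\<Sum>k<J. if i = k then u k else 0)" unfolding v_def using i by (intro sum.cong) (auto simp: hat_def)
    then have "v i \<noteq> 0" using i by simp
    then have "0 < n2 J v" using n2_eq_0[OF J cv] by force
    then have "0 < c ^ 3 / 3 * n2 J v / dt" using c dt by simp
    also have "\<dots> \<le> step_form J dt A v v" by (rule step_form_coercive[OF J dt c cv A])
    also have "\<dots> = (\<Sum>i<J. \<Sum>j<J. a i j * u i * u j)"
      unfolding v_def lin a_def sum_distrib_left by (subst sum.swap) (simp add: mult_ac)
    finally show "0 < (\<Sum>i<J. \<Sum>j<J. a i j * u i * u j)" .
  qed
  then obtain u where u: "\<And>i. i < J \<Longrightarrow> (\<Sum>j<J. a i j * u j) = b i" by blast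
  have "cyc J (\<lambda>j. \<Sum>i<J. u i *\<^sub>R hat J i j)" using cyc_hat[of J] by (simp add: cyc_def)
  moreover have "step_form J dt A (\<lambda>j. \<Sum>i<J. u i *\<^sub>R hat J i j) (hat J i) = b i" if "i < J" for i
    unfolding lin using u[OF that] by (simp add: a_def mult.commute)
  ultimately show ?thesis by blast
qed

lemma mass_component: "mass J A Z H = (\<Sum>i\<in>UNIV. mass J A (\<lambda>j. Z j $ i) (\<lambda>j. H j $ i))" for Z H :: "nat \<Rightarrow> real^2"
  unfolding mass_def tri_def inner_vec_def UNIV_2 by (simp add: sum_divide_distrib add_divide_distrib distrib_left sum.distrib mult_ac)

lemma stiff_component: "stiff J A Z H = (\<Sum>i\<in>UNIV. stiff J A (\<lambda>j. Z j $ i) (\<lambda>j. H j $ i))" for Z H :: "nat \<Rightarrow> real^2"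
  unfolding stiff_def slope_def inner_vec_def[of "_ :: real^2" "_ *\<^sub>R _"] UNIV_2
  by (simp add: inner_vec_def UNIV_2 distrib_left sum.distrib mult_ac)

lemma source_linear: "source J A (\<lambda>j. \<Sum>i\<in>S. u i *\<^sub>R f i j) = (\<Sum>i\<in>S. u i * source J A (f i))"
proof -
  have "(norm (slope J A j))^2 * (((\<Sum>i\<in>S. u i *\<^sub>R f i j) + (\<Sum>i\<in>S. u i *\<^sub>R f i (Suc j))) \<bullet> e1 / 2)
    = (\<Sum>i\<in>S. u i * ((norm (slope J A j))^2 * (mid (f i) j)))" for j
    by (simp add: inner_sum_left sum_distrib_left sum_divide_distrib inner_add_left distrib_left add_divide_distrib mult_ac flip: sum.distrib)
  then show ?thesis
    unfolding source_def sum_distrib_left sum_divide_distrib by (subst sum.swap) (simp add: sum_divide_distrib)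
qed

lemma sum_pairs: "(\<Sum>k\<in>A. \<Sum>i\<in>B. g k i) = (\<Sum>p\<in>A \<times> B. g (fst p) (snd p))"
  by (rule trans[OF sum.cartesian_product]) (simp add: split_def)

lemma step_solvable:
  assumes J: "1 \<le> J" and dt: "0 < dt" and c: "0 < c" and cyc: "cyc J A"
    and A: "\<And>j. c \<le> A j \<bullet> e1" "\<And>j. c \<le> norm (slope J A j)"
  shows "\<exists>V. cyc J V \<and> (\<forall>H. cyc J H \<longrightarrow> scheme_form J A (\<lambda>j. (V j - A j) /\<^sub>R dt) V H = 0)"
proof -
  \<comment> \<open>All terms of the step equation without the unknown, moved to the right-hand
    side. The scalar systems are tested with hats in one coordinate direction; bilinearity recovers
    arbitrary H.\<close>
  define F where "F H = mass J A A H / dt - source J A H" for H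
  have "\<exists>v :: nat \<Rightarrow> real. cyc J v \<and> (\<forall>i<J. step_form J dt A v (hat J i) = F (\<lambda>j. axis k (hat J i j)))" for k :: 2
    by (rule step_form_scalar_solve[OF J dt c A])
  then obtain v :: "2 \<Rightarrow> nat \<Rightarrow> real" where v: "\<And>k. cyc J (v k)" "\<And>k i. i < J \<Longrightarrow> step_form J dt A (v k) (hat J i) = F (\<lambda>j. axis k (hat J i j))"
    by metis
  define V :: "nat \<Rightarrow> real^2" where "V j = (\<chi> k. v k j)" for j
  have cV: "cyc J V" using v(1) by (simp add: cyc_def V_def)
  have "scheme_form J A (\<lambda>j. (V j - A j) /\<^sub>R dt) V H = 0" if H: "cyc J H" for H
  proof -
    have Hk: "H j $ k = (\<Sum>i<J. (H i $ k) *\<^sub>R hat J i j)" for j k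
      using arg_cong[OF cyc_hat_expansion[OF J H, of j], of "\<lambda>v. v $ k"] by (simp add: mult.commute)
    have Hax: "H j = (\<Sum>k\<in>UNIV. \<Sum>i<J. (H i $ k) *\<^sub>R axis k (hat J i j))" for j
      by (simp add: vec_eq_iff forall_2 UNIV_2 axis_def Hk[of j])
    have Flin: "F (\<lambda>j. \<Sum>i\<in>S. u i *\<^sub>R f i j) = (\<Sum>i\<in>S. u i * F (f i))" for S :: "(2 \<times> nat) set" and u f
      unfolding F_def mass_linear source_linear by (simp add: sum_divide_distrib right_diff_distrib sum_subtractf)
    have "step_form J dt A V H = (\<Sum>k\<in>UNIV. step_form J dt A (v k) (\<lambda>j. H j $ k))"
      unfolding step_form_def mass_component[of J A V H] stiff_component[of J A V H]
      by (simp add: V_def sum.distrib sum_divide_distrib)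
    also have "\<dots> = (\<Sum>k\<in>UNIV. \<Sum>i<J. (H i $ k) * step_form J dt A (v k) (hat J i))"
    proof (intro sum.cong refl)
      fix k
      have "(\<lambda>j. H j $ k) = (\<lambda>j. \<Sum>i<J. (H i $ k) *\<^sub>R hat J i j)" using Hk by blast
      then have "step_form J dt A (v k) (\<lambda>j. H j $ k) = step_form J dt A (v k) (\<lambda>j. \<Sum>i<J. (H i $ k) *\<^sub>R hat J i j)" by (rule arg_cong)
      also have "\<dots> = (\<Sum>i<J. (H i $ k) * step_form J dt A (v k) (hat J i))"
        unfolding step_form_def mass_linear stiff_linear by (simp add: sum_divide_distrib distrib_left sum.distrib)
      finally show "step_form J dt A (v k) (\<lambda>j. H j $ k) = (\<Sum>i<J. (H i $ k) * step_form J dt A (v k) (hat J i))" .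
    qed
    also have "\<dots> = (\<Sum>k\<in>UNIV. \<Sum>i<J. (H i $ k) * F (\<lambda>j. axis k (hat J i j)))"
      using v(2) by (intro sum.cong refl) simp
    also have "\<dots> = F (\<lambda>j. \<Sum>p\<in>UNIV\<times>{..<J}. (H (snd p) $ fst p) *\<^sub>R axis (fst p) (hat J (snd p) j))"
      by (rule trans[OF sum_pairs Flin[symmetric]])
    also have "(\<lambda>j. \<Sum>p\<in>UNIV\<times>{..<J}. (H (snd p) $ fst p) *\<^sub>R axis (fst p) (hat J (snd p) j)) = H"
      by (rule ext) (rule trans[OF sum_pairs[symmetric] Hax[symmetric]])
    finally have "step_form J dt A V H = F H" .
    moreover have "mass J A (\<lambda>j. (V j - A j) /\<^sub>R dt) H = mass J A V H / dt - mass J A A H / dt"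
    proof -
      have "tri a b ((u - w) /\<^sub>R dt) ((u' - w') /\<^sub>R dt) h h' = tri a b u u' h h' / dt - tri a b w w' h h' / dt"
        for a b and u w u' w' h h' :: "real^2"
        using dt unfolding tri_def inner_scaleR_left inner_diff_left by (simp add: field_simps)
      then show ?thesis
        unfolding mass_def by (simp add: right_diff_distrib sum_subtractf sum_divide_distrib diff_divide_distrib mult_ac)
    qed
    ultimately show ?thesis by (simp add: scheme_form_def step_form_def F_def)
  qed
  then show ?thesis using cV by blast
qed

lemma step_unique:
  assumes J: "1 \<le> J" and dt: "0 < dt" and c: "0 < c" and cyc: "cyc J V" "cyc J W"
    and A: "\<And>j. c \<le> A j \<bullet> e1" "\<And>j. c \<le> norm (slope J A j)"
    and eq: "\<And>H. cyc J H \<Longrightarrow> scheme_form J A (\<lambda>j. (V j - A j) /\<^sub>R dt) V H = 0"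
      "\<And>H. cyc J H \<Longrightarrow> scheme_form J A (\<lambda>j. (W j - A j) /\<^sub>R dt) W H = 0"
  shows "V j = W j"
proof -
  define D where "D j = V j - W j" for j
  have cD: "cyc J D" using cyc by (simp add: cyc_def D_def)
  have m: "mass J A (\<lambda>j. (V j - A j) /\<^sub>R dt) H - mass J A (\<lambda>j. (W j - A j) /\<^sub>R dt) H = mass J A D H / dt" for H
  proof -
    have "tri a b ((u - w) /\<^sub>R dt) ((u' - w') /\<^sub>R dt) h h' - tri a b ((v - w) /\<^sub>R dt) ((v' - w') /\<^sub>R dt) h h' = tri a b (u - v) (u' - v') h h' / dt"
      for a b and u v w u' v' w' h h' :: "real^2"
      using dt unfolding tri_def inner_scaleR_left inner_diff_left by (simp add: field_simps)
    then show ?thesis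
      unfolding mass_def D_def diff_divide_distrib[symmetric] sum_subtractf[symmetric] right_diff_distrib[symmetric]
      by (simp add: sum_divide_distrib mult_ac)
  qed
  have st: "stiff J A V H - stiff J A W H = stiff J A D H" for H
    by (simp add: stiff_def slope_def D_def inner_diff_left algebra_simps flip: sum_subtractf)
  have "step_form J dt A D D = 0"
    using eq[OF cD] m[of D] st[of D] unfolding scheme_form_def step_form_def by linarith
  then have "c ^ 3 / 3 * n2 J D / dt \<le> 0" using step_form_coercive[OF J dt c cD A] by simp
  then have "n2 J D \<le> 0" using c dt by (simp add: divide_le_0_iff mult_le_0_iff)
  then show ?thesis using n2_eq_0[OF J cD, of j] unfolding D_def by simp
qed

subsection \<open>Consistency\<close>

lemma element_integral_bound:
  fixes f :: "real \<Rightarrow> 'a::euclidean_space"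
  assumes J: "1 \<le> J" and "continuous_on (element J j) f" "\<And>z. z \<in> element J j \<Longrightarrow> norm (f z) \<le> B"
  shows "norm (integral (element J j) f) \<le> B / real J"
proof -
  have "node J j \<le> node J (Suc j)" using J by (simp add: node_def divide_right_mono)
  from integral_bound[OF this assms(2,3)] show ?thesis by (simp add: element_width[OF J])
qed

text \<open>The slope of the interpolant differs from the derivative by no more than the oscillation
  of the derivative over the element; integrating from the left node, where the error vanishes,
  gains a factor h for the values.\<close>

lemma interpolation_error:
  fixes x :: "real \<Rightarrow> 'a::euclidean_space"
  assumes J: "1 \<le> J" and x: "\<And>z. (x has_vector_derivative x' z) (at z)"
    and osc: "\<And>a b. a \<in> element J j \<Longrightarrow> b \<in> element J j \<Longrightarrow> norm (x' a - x' b) \<le> d"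
    and z: "z \<in> element J j"
  shows "norm (x' z - slope J (\<lambda>j. x (node J j)) j) \<le> d"
    "norm (x z - aff J (\<lambda>j. x (node J j)) j z) \<le> d / real J"
proof -
  let ?p = "slope J (\<lambda>j. x (node J j)) j"
  have J0: "0 < real J" using J by simp
  note nn = node_le[of J j]
  have d0: "0 \<le> d" using osc[OF z z] by simp
  have 1: "norm (x' z - ?p) \<le> d" if z: "z \<in> element J j" for z
  proof -
    have "norm (x (node J (Suc j)) - x (node J j) - (node J (Suc j) - node J j) *\<^sub>R x' z) \<le> norm (node J (Suc j) - node J j) * d"
      by (rule vector_differentiable_bound_linearization[where S = "element J j"])
        (use x osc z nn in \<open>auto intro: has_vector_derivative_at_within simp: closed_segment_eq_real_ivl\<close>)
    also have "x (node J (Suc j)) - x (node J j) - (node J (Suc j) - node J j) *\<^sub>R x' z = (1 / real J) *\<^sub>R (?p - x' z)"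
      using J0 by (simp add: element_width[OF J] slope_def scaleR_diff_right)
    finally show ?thesis using J0 by (simp add: element_width[OF J] norm_minus_commute divide_le_cancel)
  qed
  show "norm (x' z - ?p) \<le> d" by (rule 1[OF z])
  let ?r = "\<lambda>z. x z - aff J (\<lambda>j. x (node J j)) j z"
  have "((\<lambda>z. x' z - ?p) has_integral ?r z - ?r (node J j)) {node J j..z}"
    by (rule fundamental_theorem_of_calculus)
      (use z in \<open>auto intro!: has_vector_derivative_diff has_vector_derivative_at_within[OF x] has_vector_derivative_at_within[OF aff_derivative]\<close>)
  then have "norm (?r z - ?r (node J j)) \<le> d * measure lborel {node J j..z}"
    by (rule has_integral_bound_real[OF d0 finite.emptyI]) (use z 1 in auto)
  also have "\<dots> \<le> d * (1 / real J)"
    using z element_width[OF J, of j] d0 by (intro mult_left_mono) auto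
  finally show "norm (?r z) \<le> d / real J" by (simp add: aff_node[OF J])
qed

lemma slope_bound:
  fixes x :: "real \<Rightarrow> 'a::real_normed_vector"
  assumes J: "1 \<le> J" and x: "\<And>z. (x has_vector_derivative x' z) (at z)" and K: "\<And>z. norm (x' z) \<le> K"
  shows "norm (slope J (\<lambda>j. x (node J j)) j) \<le> K"
proof -
  have J0: "0 < real J" using J by simp
  have "onorm (\<lambda>h. h *\<^sub>R x' z) \<le> K" for z
    using mult_right_mono[OF K abs_ge_zero] by (intro onorm_le) (simp add: mult.commute)
  then have "norm (x (node J (Suc j)) - x (node J j)) \<le> K * \<bar>node J (Suc j) - node J j\<bar>"
    using differentiable_bound[of UNIV x "\<lambda>z h. h *\<^sub>R x' z" K "node J (Suc j)" "node J j"] x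
    by (simp add: has_vector_derivative_def)
  also have "\<bar>node J (Suc j) - node J j\<bar> = 1 / real J" using element_width[OF J, of j] by simp
  finally have "real J * norm (x (node J (Suc j)) - x (node J j)) \<le> K" using J0 by (simp add: field_simps)
  then show ?thesis by (simp add: slope_def)
qed

lemma scheme_form_elements:
  assumes J: "1 \<le> J"
  shows "scheme_form J A Z V H = (\<Sum>j<J. integral (element J j) (\<lambda>z. (norm (slope J A j))^2 * ((aff J A j z \<bullet> e1) * (aff J Z j z \<bullet> aff J H j z))
    + (aff J A j z \<bullet> e1) * (slope J V j \<bullet> slope J H j) + (norm (slope J A j))^2 * (e1 \<bullet> aff J H j z)))"
  unfolding scheme_form_def form_elements[OF J] sum.distrib[symmetric]
  by (intro sum.cong refl)
    (subst HK_integral_add | (intro integrable_add integrable_continuous_real continuous_intros aff_continuous) | simp)+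

text \<open>The consistency analysis at a single time: x stands for the curve at the new level and d
  for its difference quotient in time. The derivative of d has the bound N, which will be merely
  square summable in time, so N and the oscillations \<open>osc\<close> are kept apart from
  K.\<close>

locale level =
  fixes J :: nat and K N :: real and osc :: "nat \<Rightarrow> real" and x x' d d' :: "real \<Rightarrow> real^2"
  assumes J: "1 \<le> J" and K: "1 \<le> K" and N: "0 \<le> N"
    and per: "periodic x" "periodic d"
    and deriv: "\<And>z. (x has_vector_derivative x' z) (at z)" "\<And>z. (d has_vector_derivative d' z) (at z)"
    and cont: "continuous_on UNIV x'" "continuous_on UNIV d'"
    and bounds: "\<And>z. norm (x z) \<le> K" "\<And>z. norm (x' z) \<le> K" "\<And>a b. norm (x' a - x' b) \<le> K * \<bar>a - b\<bar>"
      "\<And>z. norm (d z) \<le> K" "\<And>z. norm (d' z) \<le> N"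
    and osc: "\<And>j a b. j < J \<Longrightarrow> a \<in> element J j \<Longrightarrow> b \<in> element J j \<Longrightarrow> norm (d' a - d' b) \<le> osc j"
begin

definition "X j = x (node J j)"

definition "Dn j = d (node J j)"

abbreviation "p \<equiv> slope J X"

definition "r j z = x z - aff J X j z"

text \<open>The field that multiplies |x_rho|^2 when the mass and the source term are
  combined.\<close>

definition "w z = (x z \<bullet> e1) *\<^sub>R d z + e1"

text \<open>The part of the defect that meets the slope of the test function, after integrations by
  parts have removed all derivatives of r; without them it is of second order. The first term stems
  from |x'|^2 - |p|^2, the others from the stiffness term.\<close>

abbreviation "flux_fn j z \<equiv> (2 * (p j \<bullet> r j z)) *\<^sub>R w z - (r j z \<bullet> e1) *\<^sub>R x' z + (p j \<bullet> e1) *\<^sub>R r j z"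

definition "flux j = real J *\<^sub>R integral (element J j) (flux_fn j)"

lemma cyc: "cyc J X" "cyc J Dn"
  unfolding X_def[abs_def] Dn_def[abs_def] by (rule cyc_nodes[OF per(1) J] cyc_nodes[OF per(2) J])+

lemma J0: "0 < real J" using J by simp

lemma continuity: "continuous_on S x" "continuous_on S d" "continuous_on S x'" "continuous_on S d'"
  "continuous_on S (r j)" "continuous_on S w"
proof -
  show c: "continuous_on S x" "continuous_on S d"
    using deriv by (meson continuous_at_imp_continuous_on has_vector_derivative_continuous)+
  show "continuous_on S x'" "continuous_on S d'" by (rule continuous_on_subset[OF cont(1)], simp) (rule continuous_on_subset[OF cont(2)], simp)
  show "continuous_on S (r j)" unfolding r_def[abs_def] by (intro continuous_intros aff_continuous c)
  show "continuous_on S w" unfolding w_def[abs_def] by (intro continuous_intros c)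
qed

lemma r_bounds:
  assumes "z \<in> element J j"
  shows "norm (x' z - p j) \<le> K / real J" "norm (r j z) \<le> K / (real J)^2"
proof -
  have o: "norm (x' a - x' b) \<le> K / real J" if "a \<in> element J j" "b \<in> element J j" for a b
  proof -
    have "\<bar>a - b\<bar> \<le> 1 / real J" using that element_width[OF J, of j] by auto
    then have "K * \<bar>a - b\<bar> \<le> K * (1 / real J)" using K by (intro mult_left_mono) auto
    then show ?thesis using bounds(3)[of a b] by simp
  qed
  note i = interpolation_error[OF J deriv(1) o assms, folded X_def[abs_def]]
  show "norm (x' z - p j) \<le> K / real J" by (rule i(1))
  show "norm (r j z) \<le> K / (real J)^2" using i(2) by (simp add: r_def power2_eq_square)
qed

lemma p_bound: "norm (p j) \<le> K"
  unfolding X_def[abs_def] by (rule slope_bound[OF J deriv(1) bounds(2)])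

lemma d_bounds:
  assumes "j < J" "z \<in> element J j"
  shows "norm (d z - aff J Dn j z) \<le> osc j / real J"
  using interpolation_error(2)[OF J deriv(2) osc[OF assms(1)] assms(2), folded Dn_def[abs_def]] .

lemma w_bound: "norm (w z) \<le> 2 * K^2"
proof -
  have "norm (w z) \<le> \<bar>x z \<bullet> e1\<bar> * norm (d z) + 1"
    unfolding w_def by (rule order_trans[OF norm_triangle_ineq]) (simp add: norm_axis_1)
  also have "\<dots> \<le> K * K + 1"
    using K bounds by (intro add_mono mult_mono order_trans[OF e1_inner_le bounds(1)]) auto
  also have "\<dots> \<le> 2 * K^2" using one_le_power[OF K, of 2] by (simp add: power2_eq_square)
  finally show ?thesis .
qed

lemma flux_bound: "norm (flux j) \<le> 6 * K ^ 4 / (real J)^2"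
proof -
  have "norm (integral (element J j) (flux_fn j))
      \<le> 6 * K ^ 4 / (real J)^2 / real J"
  proof (rule element_integral_bound[OF J])
    fix z assume z: "z \<in> element J j"
    define R where "R = K / (real J)^2"
    have R: "norm (r j z) \<le> R" "0 \<le> R" using r_bounds(2)[OF z] K by (auto simp: R_def)
    have "norm ((2 * (p j \<bullet> r j z)) *\<^sub>R w z) \<le> 2 * (K * R) * (2 * K^2)"
      using Cauchy_Schwarz_ineq2[of "p j" "r j z"] mult_mono[OF p_bound[of j] R(1)] w_bound[of z] K R(2)
      by (simp only: norm_scaleR abs_mult abs_numeral) (intro mult_mono, auto)
    moreover have "norm ((r j z \<bullet> e1) *\<^sub>R x' z) \<le> R * K"
      using bounds(2)[of z] R order_trans[OF e1_inner_le R(1)] by (simp add: mult_mono)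
    moreover have "norm ((p j \<bullet> e1) *\<^sub>R r j z) \<le> K * R"
      using R order_trans[OF e1_inner_le p_bound[of j]] K by (simp add: mult_mono)
    ultimately have "norm (flux_fn j z)
      \<le> 2 * (K * R) * (2 * K^2) + R * K + K * R"
      by (meson norm_triangle_ineq norm_triangle_ineq4 add_mono order_trans)
    also have "\<dots> = (4 * K ^ 3 + 2 * K) * R" by (simp add: power2_eq_square power3_eq_cube algebra_simps)
    also have "\<dots> \<le> (6 * K ^ 3) * R" using K R(2) self_le_power[OF K, of 3] by (intro mult_right_mono) auto
    also have "\<dots> = 6 * K ^ 4 / (real J)^2" by (simp add: R_def power3_eq_cube power4_eq_xxxx)
    finally show "norm (flux_fn j z) \<le> 6 * K ^ 4 / (real J)^2" .
  qed (intro continuous_intros continuity)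
  then show ?thesis using J0 by (simp add: flux_def field_simps)
qed

text \<open>The stiffness defect is (r . e1) x' plus (y . e1) times the derivative of r, with y the
  affine interpolant. As r vanishes at the nodes, the second part is integrated by parts without
  boundary terms. This form appears in the defect, the other one is visibly small.\<close>

lemma flux_by_parts:
  "flux j = real J *\<^sub>R integral (element J j) (\<lambda>z. (2 * (p j \<bullet> r j z)) *\<^sub>R w z - ((x z \<bullet> e1) *\<^sub>R x' z - (aff J X j z \<bullet> e1) *\<^sub>R p j))"
proof -
  note nn = node_le[of J j]
  have ae: "((\<lambda>z. aff J X j z \<bullet> e1) has_real_derivative p j \<bullet> e1) (at z within S)" for z S
    unfolding has_real_derivative_iff_has_vector_derivative
    by (rule has_vector_derivative_at_within, rule bounded_linear.has_vector_derivative[OF bounded_linear_inner_left aff_derivative])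
  have "((\<lambda>z. (aff J X j z \<bullet> e1) *\<^sub>R (x' z - p j) + (p j \<bullet> e1) *\<^sub>R r j z) has_integral
      (aff J X j (node J (Suc j)) \<bullet> e1) *\<^sub>R r j (node J (Suc j)) - (aff J X j (node J j) \<bullet> e1) *\<^sub>R r j (node J j)) (element J j)"
    unfolding r_def
    by (rule fundamental_theorem_of_calculus[OF nn])
      (auto intro!: derivative_eq_intros ae has_vector_derivative_at_within[OF deriv(1)] has_vector_derivative_at_within[OF aff_derivative])
  then have z: "integral (element J j) (\<lambda>z. (aff J X j z \<bullet> e1) *\<^sub>R (x' z - p j) + (p j \<bullet> e1) *\<^sub>R r j z) = 0"
    by (intro integral_unique) (simp add: r_def aff_node[OF J] X_def)
  have "integral (element J j) (flux_fn j)
    - integral (element J j) (\<lambda>z. (aff J X j z \<bullet> e1) *\<^sub>R (x' z - p j) + (p j \<bullet> e1) *\<^sub>R r j z)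
    = integral (element J j) (\<lambda>z. flux_fn j z
      - ((aff J X j z \<bullet> e1) *\<^sub>R (x' z - p j) + (p j \<bullet> e1) *\<^sub>R r j z))"
    by (intro HK_integral_diff[symmetric] integrable_continuous_real continuous_intros continuity aff_continuous)
  also have "\<dots> = integral (element J j) (\<lambda>z. (2 * (p j \<bullet> r j z)) *\<^sub>R w z - ((x z \<bullet> e1) *\<^sub>R x' z - (aff J X j z \<bullet> e1) *\<^sub>R p j))"
    by (intro arg_cong[of _ _ "integral (element J j)"] ext) (simp add: r_def inner_diff_left algebra_simps)
  finally show ?thesis unfolding flux_def z by simp
qed

definition "weak_integrand \<eta> \<eta>' z = ((x z \<bullet> e1) * (norm (x' z))^2) * (d z \<bullet> \<eta> z)
      + (x z \<bullet> e1) * (x' z \<bullet> \<eta>' z) + (norm (x' z))^2 * (e1 \<bullet> \<eta> z)"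

text \<open>The splitting into f1 to f4 cancels everything of first order. What is left in
  \<open>err\<close> is quadratic in x' - p, contains r, or contains the interpolation error of d,
  and no slope of the test function occurs in it.\<close>

lemma element_defect:
  assumes j: "j < J"
  shows "\<bar>integral (element J j) (\<lambda>z. (norm (p j))^2 * ((aff J X j z \<bullet> e1) * (aff J Dn j z \<bullet> aff J H j z))
      + (aff J X j z \<bullet> e1) * (p j \<bullet> slope J H j) + (norm (p j))^2 * (e1 \<bullet> aff J H j z))
    - integral (element J j) (weak_integrand (aff J H j) (\<lambda>_. slope J H j)) - flux j \<bullet> (H (Suc j) - H j)\<bar>
    \<le> 5 * K ^ 4 * ((1 + N) / (real J)^2 + osc j / real J) * (norm (H j) + norm (H (Suc j))) / real J"
proof -
  let ?E = "element J j"
  let ?\<eta> = "aff J H j"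
  let ?q = "slope J H j"
  let ?y = "aff J X j"
  let ?z = "aff J Dn j"
  define h where "h = 1 / real J"
  have h0: "0 \<le> h" by (simp add: h_def)
  note nn = node_le[of J j]
  define w' where "w' z = (x' z \<bullet> e1) *\<^sub>R d z + (x z \<bullet> e1) *\<^sub>R d' z" for z
  have cw': "continuous_on S w'" for S unfolding w'_def by (intro continuous_intros continuity)
  define f1 where "f1 z = (norm (p j))^2 * ((?y z \<bullet> e1) * (?z z \<bullet> ?\<eta> z)) + (?y z \<bullet> e1) * (p j \<bullet> ?q) + (norm (p j))^2 * (e1 \<bullet> ?\<eta> z)" for z
  define f2 where "f2 = weak_integrand ?\<eta> (\<lambda>_. ?q)"
  define f3 where "f3 z = ((2 * (p j \<bullet> r j z)) *\<^sub>R w z - ((x z \<bullet> e1) *\<^sub>R x' z - (?y z \<bullet> e1) *\<^sub>R p j)) \<bullet> ?q" for z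
  \<comment> \<open>The derivative of (p . r)(w . \<open>\<eta>\<close>), which vanishes at both
    nodes. Added twice it trades the first order term 2 p . (x' - p) for terms with r.\<close>
  define f4 where "f4 z = (p j \<bullet> (x' z - p j)) * (w z \<bullet> ?\<eta> z) + (p j \<bullet> r j z) * (w' z \<bullet> ?\<eta> z + w z \<bullet> ?q)" for z
  define err where "err z = (norm (p j))^2 * ((?y z \<bullet> e1) * (?z z \<bullet> ?\<eta> z) - (x z \<bullet> e1) * (d z \<bullet> ?\<eta> z))
    - (norm (x' z - p j))^2 * (w z \<bullet> ?\<eta> z) + 2 * (p j \<bullet> r j z) * (w' z \<bullet> ?\<eta> z)" for z
  have cf: "continuous_on ?E f1" "continuous_on ?E f2" "continuous_on ?E f3" "continuous_on ?E f4" "continuous_on ?E err"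
    unfolding f1_def f2_def weak_integrand_def[abs_def] f3_def f4_def err_def
    by (intro continuous_intros aff_continuous continuity cw')+
  have i4: "integral ?E f4 = 0"
  proof -
    have "(f4 has_integral (p j \<bullet> r j (node J (Suc j))) * (w (node J (Suc j)) \<bullet> ?\<eta> (node J (Suc j)))
        - (p j \<bullet> r j (node J j)) * (w (node J j) \<bullet> ?\<eta> (node J j))) ?E"
    proof (rule fundamental_theorem_of_calculus[OF nn])
      fix z
      have "((\<lambda>z. (p j \<bullet> r j z) * (w z \<bullet> ?\<eta> z)) has_vector_derivative f4 z) (at z)"
        unfolding has_real_derivative_iff_has_vector_derivative[symmetric] has_field_derivative_def r_def w_def f4_def w'_def
        using deriv[of z, unfolded has_vector_derivative_def] aff_derivative[of J _ j z, unfolded has_vector_derivative_def]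
        by (auto intro!: derivative_eq_intros simp: fun_eq_iff algebra_simps inner_commute)
      then show "((\<lambda>z. (p j \<bullet> r j z) * (w z \<bullet> ?\<eta> z)) has_vector_derivative f4 z) (at z within ?E)"
        by (rule has_vector_derivative_at_within)
    qed
    then show ?thesis by (intro integral_unique) (simp add: r_def aff_node[OF J] X_def)
  qed
  have i3: "integral ?E f3 = flux j \<bullet> (H (Suc j) - H j)"
  proof -
    have c: "continuous_on ?E (\<lambda>z. (2 * (p j \<bullet> r j z)) *\<^sub>R w z - ((x z \<bullet> e1) *\<^sub>R x' z - (?y z \<bullet> e1) *\<^sub>R p j))"
      by (intro continuous_intros aff_continuous continuity)
    have "integral ?E f3 = integral ?E (\<lambda>z. (2 * (p j \<bullet> r j z)) *\<^sub>R w z - ((x z \<bullet> e1) *\<^sub>R x' z - (?y z \<bullet> e1) *\<^sub>R p j)) \<bullet> ?q"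
      unfolding f3_def
      using integral_linear[OF integrable_continuous_real[OF c] bounded_linear_inner_left[of ?q]] by (simp add: o_def)
    then show ?thesis unfolding flux_by_parts by (simp add: slope_def[of J H])
  qed
  have split: "f1 z - f2 z - f3 z + 2 * f4 z = err z" for z
  proof -
    define a where "a = p j \<bullet> (x' z - p j)"
    have e: "(norm (x' z))^2 = (norm (p j))^2 + 2 * a + (norm (x' z - p j))^2"
      by (simp add: a_def power2_norm_eq_inner inner_diff_left inner_diff_right inner_commute)
    show ?thesis
      unfolding f1_def f2_def weak_integrand_def f3_def f4_def err_def a_def[symmetric] e
      by (simp add: w_def inner_diff_left inner_add_left algebra_simps)
  qed
  have "integral ?E f1 - integral ?E f2 - integral ?E f3 + 2 * integral ?E f4 = integral ?E err"
  proof -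
    note i = integrable_continuous_real[OF cf(1)] integrable_continuous_real[OF cf(2)] integrable_continuous_real[OF cf(3)] integrable_continuous_real[OF cf(4)]
    have "((\<lambda>z. f1 z - f2 z - f3 z + 2 * f4 z) has_integral (integral ?E f1 - integral ?E f2 - integral ?E f3 + 2 * integral ?E f4)) ?E"
      by (intro has_integral_add has_integral_diff has_integral_mult_right integrable_integral i)
    then show ?thesis unfolding split using integral_unique by metis
  qed
  moreover have "norm (integral ?E err) \<le> 5 * K ^ 4 * ((1 + N) / (real J)^2 + osc j / real J) * (norm (H j) + norm (H (Suc j))) / real J"
  proof (rule element_integral_bound[OF J cf(5)])
    fix z assume z: "z \<in> ?E"
    define Q where "Q = norm (H j) + norm (H (Suc j))"
    define oh where "oh = osc j * h"
    have Q: "norm (?\<eta> z) \<le> Q" "0 \<le> Q" using aff_norm_sum[OF J z, of H] by (auto simp: Q_def)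
    have r1: "norm (x' z - p j) \<le> K * h" and r2: "norm (r j z) \<le> K * h^2"
      using r_bounds[OF z] by (auto simp: h_def power_divide)
    have dz: "norm (?z z - d z) \<le> oh" using d_bounds[OF j z] by (simp add: oh_def h_def norm_minus_commute)
    then have oh: "0 \<le> oh" using norm_ge_zero order_trans by blast
    have K0: "0 \<le> K" using K by simp
    have p2: "(norm (p j))^2 \<le> K^2" using p_bound[of j] by (intro power_mono) auto
    have zK: "norm (?z z) \<le> K" by (rule aff_norm[OF J z]) (simp_all add: Dn_def bounds)
    have "\<bar>(?y z \<bullet> e1) * (?z z \<bullet> ?\<eta> z) - (x z \<bullet> e1) * (d z \<bullet> ?\<eta> z)\<bar> \<le> (K * h^2) * (K * Q) + K * (oh * Q)"
    proof -
      have "(?y z \<bullet> e1) * (?z z \<bullet> ?\<eta> z) - (x z \<bullet> e1) * (d z \<bullet> ?\<eta> z)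
        = - ((r j z \<bullet> e1) * (?z z \<bullet> ?\<eta> z)) + (x z \<bullet> e1) * ((?z z - d z) \<bullet> ?\<eta> z)"
        by (simp add: r_def inner_diff_left algebra_simps)
      moreover have "\<bar>(r j z \<bullet> e1) * (?z z \<bullet> ?\<eta> z)\<bar> \<le> (K * h^2) * (K * Q)"
        unfolding abs_mult using K0 h0 Q
        by (intro mult_mono order_trans[OF e1_inner_le r2] order_trans[OF Cauchy_Schwarz_ineq2 mult_mono[OF zK Q(1)]]) auto
      moreover have "\<bar>(x z \<bullet> e1) * ((?z z - d z) \<bullet> ?\<eta> z)\<bar> \<le> K * (oh * Q)"
        unfolding abs_mult using K0 oh Q
        by (intro mult_mono order_trans[OF e1_inner_le bounds(1)] order_trans[OF Cauchy_Schwarz_ineq2 mult_mono[OF dz Q(1)]]) auto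
      ultimately show ?thesis by linarith
    qed
    then have t1: "\<bar>(norm (p j))^2 * ((?y z \<bullet> e1) * (?z z \<bullet> ?\<eta> z) - (x z \<bullet> e1) * (d z \<bullet> ?\<eta> z))\<bar> \<le> K^2 * ((K * h^2) * (K * Q) + K * (oh * Q))"
      unfolding abs_mult by (intro mult_mono) (use p2 in auto)
    have t2: "\<bar>(norm (x' z - p j))^2 * (w z \<bullet> ?\<eta> z)\<bar> \<le> (K * h)^2 * ((2 * K^2) * Q)"
      unfolding abs_mult abs_power2 using K0 Q
      by (intro mult_mono power_mono r1 order_trans[OF Cauchy_Schwarz_ineq2 mult_mono[OF w_bound Q(1)]]) (auto simp: abs_mult)
    have w'b: "norm (w' z) \<le> K * K + K * N"
      unfolding w'_def using K0 N bounds(4,5)[of z] order_trans[OF e1_inner_le bounds(1)[of z]] order_trans[OF e1_inner_le bounds(2)[of z]]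
      by (intro order_trans[OF norm_triangle_ineq] add_mono) (auto simp: mult_mono)
    have t3: "\<bar>2 * (p j \<bullet> r j z) * (w' z \<bullet> ?\<eta> z)\<bar> \<le> 2 * (K * (K * h^2)) * ((K * K + K * N) * Q)"
      unfolding abs_mult using K0 N Q h0
      by (intro mult_mono order_trans[OF Cauchy_Schwarz_ineq2 mult_mono[OF w'b Q(1)]] order_trans[OF Cauchy_Schwarz_ineq2 mult_mono[OF p_bound r2]]) auto
    have "norm (err z) \<le> K^2 * ((K * h^2) * (K * Q) + K * (oh * Q)) + (K * h)^2 * ((2 * K^2) * Q) + 2 * (K * (K * h^2)) * ((K * K + K * N) * Q)"
      unfolding err_def real_norm_def using t1 t2 t3 by linarith
    also have "\<dots> = (K ^ 4 * (5 * h^2) + K ^ 3 * oh + K ^ 3 * (2 * (N * h^2))) * Q"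
      by (simp add: power2_eq_square power3_eq_cube power4_eq_xxxx algebra_simps)
    also have "\<dots> \<le> (K ^ 4 * (5 * h^2) + K ^ 4 * oh + K ^ 4 * (2 * (N * h^2))) * Q"
      using K oh N Q(2) power_increasing[of 3 4 K] by (intro mult_right_mono add_mono) auto
    also have "\<dots> \<le> (K ^ 4 * (5 * h^2) + K ^ 4 * (5 * oh) + K ^ 4 * (5 * (N * h^2))) * Q"
      using K0 oh N Q(2) by (intro mult_right_mono add_mono mult_left_mono) auto
    also have "\<dots> = 5 * K ^ 4 * ((1 + N) / (real J)^2 + osc j / real J) * (norm (H j) + norm (H (Suc j)))"
    proof -
      have "(1 + N) / (real J)^2 + osc j / real J = h^2 + N * h^2 + oh"
        by (simp add: h_def oh_def power_divide add_divide_distrib)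
      then show ?thesis unfolding Q_def[symmetric] by (simp add: algebra_simps)
    qed
    finally show "norm (err z) \<le> 5 * K ^ 4 * ((1 + N) / (real J)^2 + osc j / real J) * (norm (H j) + norm (H (Suc j)))" .
  qed
  ultimately show ?thesis unfolding i3 i4 f1_def f2_def by simp
qed

text \<open>The squares of the element defects are averaged by Young's inequality. Each oscillation
  comes with a factor h, and their squares sum to N^2 h, so their contribution is of order h^4 like
  the others.\<close>

theorem consistency:
  assumes H: "cyc J H" and e: "0 < \<epsilon>" and osc2: "(\<Sum>j<J. (osc j)^2) \<le> N^2 / real J"
  shows "\<bar>scheme_form J X Dn X H - (\<Sum>j<J. flux j \<bullet> (H (Suc j) - H j)) - (\<integral>z. weak_integrand (plin J H) (dplin J H) z \<partial>I_measure)\<bar>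
    \<le> \<epsilon> * n2 J H + (150 * K ^ 8 * (1 + N^2) / real J ^ 4) / \<epsilon>"
proof -
  define a b where "a j = 5 * K ^ 4 * ((1 + N) / (real J)^2 + osc j / real J)" and "b j = norm (H j) + norm (H (Suc j))" for j
  have Q: "(\<integral>z. weak_integrand (plin J H) (dplin J H) z \<partial>I_measure)
    = (\<Sum>j<J. integral (element J j) (weak_integrand (aff J H j) (\<lambda>_. slope J H j)))"
  proof (rule piecewise_integral(2)[OF J])
    fix j assume j: "j < J"
    show "continuous_on (element J j) (weak_integrand (aff J H j) (\<lambda>_. slope J H j))"
      unfolding weak_integrand_def[abs_def] by (intro continuous_intros aff_continuous continuity)
    fix z assume z: "z \<in> open_element J j"
    then have "plin J H z = aff J H j z" using plin_element[OF j H, of z] by (simp add: aff_def)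
    then show "weak_integrand (plin J H) (dplin J H) z = weak_integrand (aff J H j) (\<lambda>_. slope J H j) z"
      using dplin_open[OF j z, of H] by (simp add: weak_integrand_def)
  qed
  have "\<bar>scheme_form J X Dn X H - (\<Sum>j<J. flux j \<bullet> (H (Suc j) - H j)) - (\<integral>z. weak_integrand (plin J H) (dplin J H) z \<partial>I_measure)\<bar>
    \<le> (\<Sum>j<J. a j * b j / real J)"
    unfolding Q scheme_form_elements[OF J] sum_subtractf[symmetric]
  proof (rule order_trans[OF sum_abs sum_mono])
    fix j assume "j \<in> {..<J}"
    then have "j < J" by simp
    from element_defect[OF this, of H]
    show "\<bar>integral (element J j) (\<lambda>z. (norm (p j))^2 * ((aff J X j z \<bullet> e1) * (aff J Dn j z \<bullet> aff J H j z))
      + (aff J X j z \<bullet> e1) * (p j \<bullet> slope J H j) + (norm (p j))^2 * (e1 \<bullet> aff J H j z))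
      - flux j \<bullet> (H (Suc j) - H j) - integral (element J j) (weak_integrand (aff J H j) (\<lambda>_. slope J H j))\<bar> \<le> a j * b j / real J"
      unfolding a_def b_def by (simp add: diff_diff_eq add.commute)
  qed
  also have "\<dots> = (\<Sum>j<J. a j * b j) / real J" by (simp add: sum_divide_distrib)
  also have "\<dots> \<le> \<epsilon> * n2 J H + ((\<Sum>j<J. (a j)^2) / real J) / \<epsilon>"
    unfolding b_def by (rule pair_young[OF H e J0])
  also have "\<dots> \<le> \<epsilon> * n2 J H + (150 * K ^ 8 * (1 + N^2) / real J ^ 4) / \<epsilon>"
  proof (intro add_left_mono)
    have K8: "0 \<le> K ^ 8" using K by simp
    have "(a j)^2 \<le> 50 * K ^ 8 * ((1 + N)^2 / real J ^ 4 + (osc j)^2 / (real J)^2)" for j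
    proof -
      have "(a j)^2 = 25 * K ^ 8 * ((1 + N) / (real J)^2 + osc j / real J)^2"
        by (simp add: a_def power_mult_distrib flip: power_mult)
      also have "\<dots> \<le> 25 * K ^ 8 * (2 * ((1 + N) / (real J)^2)^2 + 2 * (osc j / real J)^2)"
        using K8 by (intro mult_left_mono sum2_sq) auto
      also have "\<dots> = 50 * K ^ 8 * ((1 + N)^2 / real J ^ 4 + (osc j)^2 / (real J)^2)"
        by (simp add: power_divide distrib_left flip: power_mult)
      finally show ?thesis .
    qed
    then have "(\<Sum>j<J. (a j)^2) \<le> (\<Sum>j<J. 50 * K ^ 8 * ((1 + N)^2 / real J ^ 4 + (osc j)^2 / (real J)^2))"
      by (intro sum_mono) auto
    also have "\<dots> = 50 * K ^ 8 * (real J * ((1 + N)^2 / real J ^ 4) + (\<Sum>j<J. (osc j)^2) / (real J)^2)"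
      by (simp add: sum.distrib sum_divide_distrib flip: sum_distrib_left)
    also have "\<dots> \<le> 50 * K ^ 8 * (real J * ((1 + N)^2 / real J ^ 4) + (N^2 / real J) / (real J)^2)"
      using osc2 K8 by (intro mult_left_mono add_left_mono divide_right_mono) auto
    finally have "(\<Sum>j<J. (a j)^2) / real J \<le> 50 * K ^ 8 * (real J * ((1 + N)^2 / real J ^ 4) + (N^2 / real J) / (real J)^2) / real J"
      by (rule divide_right_mono) simp
    also have "\<dots> = 50 * K ^ 8 * ((1 + N)^2 + N^2) / real J ^ 4"
      using J0 by (simp add: field_simps power2_eq_square power4_eq_xxxx)
    also have "\<dots> \<le> 50 * K ^ 8 * (3 * (1 + N^2)) / real J ^ 4"
    proof (intro divide_right_mono mult_left_mono)
      show "(1 + N)^2 + N^2 \<le> 3 * (1 + N^2)" using sum_squares_bound[of 1 N] by (simp add: power2_sum)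
    qed (use K8 in auto)
    also have "\<dots> = 150 * K ^ 8 * (1 + N^2) / real J ^ 4" by (simp only: mult.assoc mult.left_commute[of _ 3])
    finally have "(\<Sum>j<J. (a j)^2) / real J \<le> 150 * K ^ 8 * (1 + N^2) / real J ^ 4" .
    then show "((\<Sum>j<J. (a j)^2) / real J) / \<epsilon> \<le> (150 * K ^ 8 * (1 + N^2) / real J ^ 4) / \<epsilon>"
      using divide_right_mono[of "(\<Sum>j<J. (a j)^2) / real J" "150 * K ^ 8 * (1 + N^2) / real J ^ 4" \<epsilon>] e by simp
  qed
  finally show ?thesis .
qed

end

section \<open>Increments of the flux between two time levels\<close>

lemma element_Cauchy_Schwarz:
  fixes f :: "real \<Rightarrow> real"
  assumes J: "1 \<le> J" and f: "continuous_on (element J j) f"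
  shows "(real J * integral (element J j) f)^2 \<le> real J * integral (element J j) (\<lambda>z. (f z)^2)"
proof -
  let ?E = "element J j"
  have J0: "0 < real J" using J by simp
  note nn = node_le[of J j]
  define c where "c = real J * integral ?E f"
  have "((\<lambda>z. (f z)^2 - 2 * c * f z + c^2) has_integral integral ?E (\<lambda>z. (f z)^2) - 2 * c * integral ?E f + c^2 / real J) ?E"
    using has_integral_const_real[of "c^2" "node J j" "node J (Suc j)"] nn element_width[OF J, of j]
    by (intro has_integral_add has_integral_diff has_integral_mult_right integrable_integral integrable_continuous_real continuous_intros f)
      (simp_all add: mult.commute)
  then have "0 \<le> integral ?E (\<lambda>z. (f z)^2) - 2 * c * integral ?E f + c^2 / real J"
  proof (rule has_integral_nonneg)
    fix z
    have "0 \<le> (f z - c)^2" by simp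
    then show "0 \<le> (f z)^2 - 2 * c * f z + c^2" by (simp add: power2_diff algebra_simps)
  qed
  also have "2 * c * integral ?E f = 2 * c^2 / real J" using J0 by (simp add: c_def power2_eq_square)
  finally show ?thesis unfolding c_def[symmetric] using J0 by (simp add: field_simps)
qed

lemma l2_norm_elements:
  fixes f :: "real \<Rightarrow> 'a::euclidean_space"
  assumes J: "1 \<le> J" and f: "continuous_on UNIV f"
  shows "(l2_norm f)^2 = (\<Sum>j<J. integral (element J j) (\<lambda>z. (norm (f z))^2))"
  unfolding l2_norm_power2 l2_inner_def
  by (rule piecewise_integral(2)[OF J])
    (auto intro!: continuous_intros continuous_on_subset[OF f] simp: power2_norm_eq_inner)

text \<open>Two neighbouring levels: x, d new and y, e old. L bounds the increment of the curve and
  of its derivative uniformly, and \<open>od\<close> is the oscillation of the increment of the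
  derivative on an element.\<close>

locale two_levels = a: level J K N1 osc1 x x' d d' + b: level J K N2 osc2 y y' e e'
  for J :: nat and K N1 N2 :: real and osc1 osc2 :: "nat \<Rightarrow> real" and x x' d d' y y' e e' :: "real \<Rightarrow> real^2" +
  fixes L :: real and od :: "nat \<Rightarrow> real"
  assumes L: "\<And>z. norm (x z - y z) \<le> L" "\<And>z. norm (x' z - y' z) \<le> L"
    and od: "\<And>j s t. j < J \<Longrightarrow> s \<in> element J j \<Longrightarrow> t \<in> element J j \<Longrightarrow> norm ((x' s - y' s) - (x' t - y' t)) \<le> od j"
begin

text \<open>Each term of the flux is a product containing r. Telescoping leaves either the increment
  of another factor times r, which is of order h^2, or the increment of r, which is the
  interpolation error of the increment and therefore h times \<open>od\<close>.\<close>

lemma flux_increment: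
  assumes j: "j < J"
  shows "norm (a.flux j - b.flux j) \<le> 8 * K ^ 3 * (L / (real J)^2 + od j / real J
    + real J * integral (element J j) (\<lambda>z. norm (d z - e z)) / (real J)^2)"
proof -
  let ?E = "element J j"
  define h where "h = 1 / real J"
  define oh where "oh = od j * h"
  define A where "A z = a.flux_fn j z" for z
  define B where "B z = b.flux_fn j z" for z
  have cA: "A integrable_on ?E" and cB: "B integrable_on ?E"
    unfolding A_def[abs_def] B_def[abs_def]
    by (intro integrable_continuous_real continuous_intros a.continuity b.continuity)+
  have cd: "continuous_on ?E (\<lambda>z. norm (d z - e z))" by (intro continuous_intros a.continuity b.continuity)
  have K0: "0 \<le> K" and h0: "0 \<le> h" using a.K by (simp_all add: h_def)
  have L0: "0 \<le> L" using order_trans[OF norm_ge_zero L(1)] .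
  have dxy: "((\<lambda>z. x z - y z) has_vector_derivative (x' z - y' z)) (at z)" for z
    by (intro has_vector_derivative_diff a.deriv b.deriv)
  have pq: "norm (a.p j - b.p j) \<le> L"
  proof -
    have "a.p j - b.p j = slope J (\<lambda>j. x (node J j) - y (node J j)) j"
      by (simp add: slope_def a.X_def b.X_def algebra_simps)
    then show ?thesis using slope_bound[OF a.J dxy L(2), of j] by simp
  qed
  have pt: "norm (A z - B z) \<le> 8 * K ^ 3 * (L * h^2 + oh) + 8 * K ^ 3 * h^2 * norm (d z - e z)" if z: "z \<in> ?E" for z
  proof -
    define \<delta> where "\<delta> = norm (d z - e z)"
    have \<delta>0: "0 \<le> \<delta>" by (simp add: \<delta>_def)
    define R where "R = K * h^2"
    have R0: "0 \<le> R" using K0 by (simp add: R_def)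
    have r: "norm (a.r j z) \<le> R" "norm (b.r j z) \<le> R"
      using a.r_bounds(2)[OF z] b.r_bounds(2)[OF z] by (simp_all add: R_def h_def power_divide)
    have dr: "norm (a.r j z - b.r j z) \<le> oh"
    proof -
      have "a.r j z - b.r j z = x z - y z - aff J (\<lambda>j. x (node J j) - y (node J j)) j z"
        by (simp add: a.r_def b.r_def a.X_def b.X_def aff_def algebra_simps)
      then show ?thesis
        using interpolation_error(2)[OF a.J dxy od[OF j] z] by (simp add: oh_def h_def)
    qed
    then have oh0: "0 \<le> oh" using norm_ge_zero order_trans by blast
    have dw: "norm (a.w z - b.w z) \<le> L * K + K * \<delta>"
    proof -
      have 1: "a.w z - b.w z = ((x z - y z) \<bullet> e1) *\<^sub>R d z + (y z \<bullet> e1) *\<^sub>R (d z - e z)"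
        by (simp add: a.w_def b.w_def inner_diff_left algebra_simps)
      have 2: "norm (((x z - y z) \<bullet> e1) *\<^sub>R d z) \<le> L * K"
        using order_trans[OF e1_inner_le L(1)[of z]] a.bounds(4)[of z] L0 by (simp add: mult_mono)
      have 3: "norm ((y z \<bullet> e1) *\<^sub>R (d z - e z)) \<le> K * \<delta>"
        using order_trans[OF e1_inner_le b.bounds(1)[of z]] K0 by (simp add: mult_mono \<delta>_def)
      show ?thesis unfolding 1 by (rule norm_triangle_mono[OF 2 3])
    qed
    have in3: "norm ((2 * (u \<bullet> v)) *\<^sub>R z) \<le> 2 * (cu * cv) * cz"
      if "norm u \<le> cu" "norm v \<le> cv" "norm z \<le> cz" "0 \<le> cu" "0 \<le> cv" for u v z :: "real^2" and cu cv cz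
      unfolding norm_scaleR abs_mult abs_numeral
      using order_trans[OF Cauchy_Schwarz_ineq2 mult_mono[OF that(1,2)]] that by (intro mult_mono) auto
    have in2: "norm ((u \<bullet> e1) *\<^sub>R z) \<le> cu * cz" if "norm u \<le> cu" "norm z \<le> cz" "0 \<le> cu" for u z :: "real^2" and cu cz
      using order_trans[OF e1_inner_le that(1)] that by (simp add: mult_mono)
    have "A z - B z = ((2 * ((a.p j - b.p j) \<bullet> a.r j z)) *\<^sub>R a.w z + (2 * (b.p j \<bullet> (a.r j z - b.r j z))) *\<^sub>R a.w z
        + (2 * (b.p j \<bullet> b.r j z)) *\<^sub>R (a.w z - b.w z))
      + (((a.p j - b.p j) \<bullet> e1) *\<^sub>R a.r j z + (b.p j \<bullet> e1) *\<^sub>R (a.r j z - b.r j z)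
        - ((a.r j z - b.r j z) \<bullet> e1) *\<^sub>R x' z - (b.r j z \<bullet> e1) *\<^sub>R (x' z - y' z))"
      by (simp add: A_def B_def inner_diff_left inner_diff_right scaleR_diff_left scaleR_diff_right)
    also have "norm \<dots> \<le> (2 * (L * R) * (2 * K^2) + 2 * (K * oh) * (2 * K^2) + 2 * (K * R) * (L * K + K * \<delta>))
      + (L * R + K * oh + oh * K + R * L)"
      using norm_triangle_mono[OF norm_triangle_mono[OF norm_triangle_mono[OF
            in3[OF pq r(1) a.w_bound L0 R0] in3[OF b.p_bound dr a.w_bound K0 oh0]] in3[OF b.p_bound r(2) dw K0 R0]]
          norm_triangle_le_diff[OF add_mono[OF norm_triangle_le_diff[OF add_mono[OF
            norm_triangle_mono[OF in2[OF pq r(1) L0] in2[OF b.p_bound dr K0]] in2[OF dr a.bounds(2) oh0]]] in2[OF r(2) L(2) R0]]]]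
      by simp
    also have "\<dots> = K ^ 3 * (6 * (L * h^2) + 4 * oh + 2 * (h^2 * \<delta>)) + K * (2 * (L * h^2) + 2 * oh)"
      by (simp add: R_def power2_eq_square power3_eq_cube algebra_simps)
    also have "\<dots> \<le> K ^ 3 * (6 * (L * h^2) + 4 * oh + 2 * (h^2 * \<delta>)) + K ^ 3 * (2 * (L * h^2) + 2 * oh)"
      using self_le_power[OF a.K, of 3] L0 oh0 by (intro add_left_mono mult_right_mono) auto
    also have "\<dots> = K ^ 3 * (8 * (L * h^2) + 6 * oh + 2 * (h^2 * \<delta>))" by (simp add: algebra_simps)
    also have "\<dots> \<le> K ^ 3 * (8 * (L * h^2) + 8 * oh + 8 * (h^2 * \<delta>))"
      using K0 oh0 \<delta>0 L0 by (intro mult_left_mono add_mono) auto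
    finally show ?thesis by (simp add: \<delta>_def algebra_simps)
  qed
  have "norm (integral ?E (\<lambda>z. A z - B z)) \<le> integral ?E (\<lambda>z. 8 * K ^ 3 * (L * h^2 + oh) + 8 * K ^ 3 * h^2 * norm (d z - e z))"
  proof (rule integral_norm_bound_integral)
    show "(\<lambda>z. A z - B z) integrable_on ?E" by (rule integrable_diff[OF cA cB])
    show "(\<lambda>z. 8 * K ^ 3 * (L * h^2 + oh) + 8 * K ^ 3 * h^2 * norm (d z - e z)) integrable_on ?E"
      by (intro integrable_continuous_real continuous_intros cd a.continuity b.continuity)
  qed (rule pt)
  also have "\<dots> = 8 * K ^ 3 * (L * h^2 + oh) / real J + 8 * K ^ 3 * h^2 * integral ?E (\<lambda>z. norm (d z - e z))"
  proof -
    have nn: "node J j \<le> node J (Suc j)" using a.J by (simp add: node_def divide_right_mono)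
    have "((\<lambda>z. 8 * K ^ 3 * (L * h^2 + oh) + 8 * K ^ 3 * h^2 * norm (d z - e z)) has_integral
        8 * K ^ 3 * (L * h^2 + oh) / real J + 8 * K ^ 3 * h^2 * integral ?E (\<lambda>z. norm (d z - e z))) ?E"
      using has_integral_const_real[of "8 * K ^ 3 * (L * h^2 + oh)" "node J j" "node J (Suc j)"] nn element_width[OF a.J, of j]
      by (intro has_integral_add has_integral_mult_right integrable_integral integrable_continuous_real cd) (simp_all add: mult.commute)
    then show ?thesis by (rule integral_unique)
  qed
  finally have "real J * norm (integral ?E (\<lambda>z. A z - B z)) \<le> real J * (8 * K ^ 3 * (L * h^2 + oh) / real J + 8 * K ^ 3 * h^2 * integral ?E (\<lambda>z. norm (d z - e z)))"
    by (rule mult_left_mono) simp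
  also have "\<dots> = 8 * K ^ 3 * (L * h^2 + oh + real J * integral ?E (\<lambda>z. norm (d z - e z)) * h^2)"
    using a.J0 by (simp add: distrib_left add_divide_distrib)
  finally have "real J * norm (integral ?E (\<lambda>z. A z - B z)) \<le> 8 * K ^ 3 * (L * h^2 + oh + real J * integral ?E (\<lambda>z. norm (d z - e z)) * h^2)" .
  moreover have "a.flux j - b.flux j = real J *\<^sub>R integral ?E (\<lambda>z. A z - B z)"
  proof -
    have "a.flux j = real J *\<^sub>R integral ?E A" "b.flux j = real J *\<^sub>R integral ?E B"
      by (simp_all add: a.flux_def b.flux_def A_def[abs_def] B_def[abs_def])
    then show ?thesis by (simp add: HK_integral_diff[OF cA cB] scaleR_diff_right)
  qed
  ultimately show ?thesis by (simp add: oh_def h_def power_divide)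
qed

text \<open>Only the mean of |d - e| over each element enters, and Cauchy-Schwarz turns its squares
  into an L2 norm. Nothing stronger is available, because \<open>x_tt\<close> is only square
  integrable in space.\<close>

theorem flux_increment_n2:
  assumes od2: "(\<Sum>j<J. (od j)^2) \<le> L^2 / real J"
  shows "n2 J (\<lambda>j. a.flux j - b.flux j) \<le> 192 * K ^ 6 * (2 * L^2 + (l2_norm (\<lambda>z. d z - e z))^2) / real J ^ 4"
proof -
  define I where "I j = real J * integral (element J j) (\<lambda>z. norm (d z - e z))" for j
  define W where "W j = integral (element J j) (\<lambda>z. (norm (d z - e z))^2)" for j
  have K6: "0 \<le> K ^ 6" using a.K by simp
  have "(norm (a.flux j - b.flux j))^2 \<le> 192 * K ^ 6 * (L^2 / real J ^ 4 + (od j)^2 / (real J)^2 + real J * W j / real J ^ 4)" if j: "j < J" for j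
  proof -
    have "(norm (a.flux j - b.flux j))^2 \<le> (8 * K ^ 3 * (L / (real J)^2 + od j / real J + I j / (real J)^2))^2"
      using flux_increment[OF j] by (intro power_mono) (auto simp: I_def)
    also have "\<dots> = 64 * K ^ 6 * (L / (real J)^2 + od j / real J + I j / (real J)^2)^2"
      by (simp add: power_mult_distrib flip: power_mult)
    also have "\<dots> \<le> 64 * K ^ 6 * (3 * ((L / (real J)^2)^2 + (od j / real J)^2 + (I j / (real J)^2)^2))"
      using K6 by (intro mult_left_mono sum3_sq) auto
    also have "\<dots> = 192 * K ^ 6 * (L^2 / real J ^ 4 + (od j)^2 / (real J)^2 + (I j)^2 / real J ^ 4)"
      by (simp add: power_divide flip: power_mult)
    also have "\<dots> \<le> 192 * K ^ 6 * (L^2 / real J ^ 4 + (od j)^2 / (real J)^2 + real J * W j / real J ^ 4)"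
    proof (intro mult_left_mono add_left_mono divide_right_mono)
      show "(I j)^2 \<le> real J * W j"
        unfolding I_def W_def by (rule element_Cauchy_Schwarz[OF a.J]) (intro continuous_intros a.continuity b.continuity)
    qed (use K6 in auto)
    finally show ?thesis .
  qed
  then have "(\<Sum>j<J. (norm (a.flux j - b.flux j))^2) \<le> (\<Sum>j<J. 192 * K ^ 6 * (L^2 / real J ^ 4 + (od j)^2 / (real J)^2 + real J * W j / real J ^ 4))"
    by (intro sum_mono) auto
  also have "\<dots> = 192 * K ^ 6 * (real J * (L^2 / real J ^ 4) + (\<Sum>j<J. (od j)^2) / (real J)^2 + real J * (\<Sum>j<J. W j) / real J ^ 4)"
    by (simp add: sum.distrib flip: sum_distrib_left sum_divide_distrib)
  also have "(\<Sum>j<J. W j) = (l2_norm (\<lambda>z. d z - e z))^2"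
    unfolding W_def by (rule l2_norm_elements[symmetric, OF a.J]) (intro continuous_intros a.continuity b.continuity)
  also have "192 * K ^ 6 * (real J * (L^2 / real J ^ 4) + (\<Sum>j<J. (od j)^2) / (real J)^2 + real J * (l2_norm (\<lambda>z. d z - e z))^2 / real J ^ 4)
    \<le> 192 * K ^ 6 * (real J * (L^2 / real J ^ 4) + (L^2 / real J) / (real J)^2 + real J * (l2_norm (\<lambda>z. d z - e z))^2 / real J ^ 4)"
    using od2 K6 by (intro mult_left_mono add_mono divide_right_mono order_refl) auto
  also have "\<dots> = real J * (192 * K ^ 6 * (2 * L^2 + (l2_norm (\<lambda>z. d z - e z))^2) / real J ^ 4)"
    using a.J0 by (simp add: field_simps power2_eq_square power4_eq_xxxx)
  finally show ?thesis using a.J0 by (simp add: n2_def field_simps)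
qed

end

subsection \<open>Error analysis along a regular solution\<close>

text \<open>The supremum is attained for a continuous function; the points of attainment are the
  pairs to which \<open>element_oscillation\<close> is applied.\<close>

definition oscillation :: "nat \<Rightarrow> (real \<Rightarrow> 'a::real_normed_vector) \<Rightarrow> nat \<Rightarrow> real" where
  "oscillation J g j = (SUP p\<in>element J j \<times> element J j. norm (g (fst p) - g (snd p)))"

lemma oscillation:
  assumes J: "1 \<le> J" and g: "continuous_on UNIV g"
  shows "s \<in> element J j \<Longrightarrow> t \<in> element J j \<Longrightarrow> norm (g s - g t) \<le> oscillation J g j"
    and "\<exists>a\<in>element J j. \<exists>b\<in>element J j. oscillation J g j = norm (g a - g b)"
proof -
  let ?S = "element J j \<times> element J j"
  let ?f = "\<lambda>p. norm (g (fst p) - g (snd p))"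
  have "node J j \<in> element J j" using J by (simp add: node_def divide_right_mono)
  then have ne: "?S \<noteq> {}" by blast
  have c: "compact ?S" by (intro compact_Times compact_Icc)
  have "continuous_on ?S ?f"
    by (intro continuous_intros continuous_on_compose2[OF g]) auto
  from continuous_attains_sup[OF c ne this] obtain p where p: "p \<in> ?S" "\<And>q. q \<in> ?S \<Longrightarrow> ?f q \<le> ?f p" by blast
  have e: "oscillation J g j = ?f p"
    unfolding oscillation_def by (rule cSup_eq_maximum) (use p in auto)
  then show "\<exists>a\<in>element J j. \<exists>b\<in>element J j. oscillation J g j = norm (g a - g b)"
    using p(1) unfolding e by (intro bexI[of _ "fst p"] bexI[of _ "snd p"]) auto
  assume "s \<in> element J j" "t \<in> element J j"
  then show "norm (g s - g t) \<le> oscillation J g j" using p(2)[of "(s, t)"] e by simp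
qed

lemma plin_diff: "plin J U z - plin J V z = plin J (\<lambda>j. U j - V j) z"
  by (simp add: plin_def Let_def scaleR_diff_right)

lemma plin_scale: "c *\<^sub>R plin J U z = plin J (\<lambda>j. c *\<^sub>R U j) z"
  by (simp add: plin_def Let_def scaleR_add_right scaleR_diff_right mult.commute)

lemma dplin_diff: "dplin J U z - dplin J V z = dplin J (\<lambda>j. U j - V j) z"
  by (simp add: dplin_def slope_def scaleR_diff_right)

lemma dplin_L2:
  fixes H :: "nat \<Rightarrow> 'a::euclidean_space"
  assumes J: "1 \<le> J"
  shows "dplin J H \<in> L2_space" "(l2_norm (dplin J H))^2 = s2 J H"
proof -
  have m: "dplin J H \<in> borel_measurable I_measure"
    by (rule borel_measurable_integrable, rule piecewise_integral(1)[OF J, of "\<lambda>j _. slope J H j"]) (auto simp: dplin_open)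
  note i = piecewise_integral[OF J, of "\<lambda>j _. (norm (slope J H j))^2" "\<lambda>z. (norm (dplin J H z))^2"]
  show "dplin J H \<in> L2_space"
    using i(1) m periodic_plin(2) by (auto simp: L2_space_def dplin_open)
  have nn: "node J j \<le> node J (Suc j)" for j using J by (simp add: node_def divide_right_mono)
  have "integral (element J j) (\<lambda>_. (norm (slope J H j))^2) = (norm (slope J H j))^2 / real J" for j
    using nn element_width[OF J, of j] by simp
  then show "(l2_norm (dplin J H))^2 = s2 J H"
    using i(2) unfolding l2_norm_power2 l2_inner_def
    by (simp add: dplin_open s2_def n2_def sum_divide_distrib power2_norm_eq_inner)
qed

text \<open>G1 and G2 are measurable majorants of the H2 norm of \<open>x_t\<close> and the L2 norm
  of \<open>x_tt\<close>; all regularity in time is used through their integrals over steps.\<close>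

locale regular_bounds = regular_solution T x x_t x_tt
  for T and x x_t x_tt :: "real \<Rightarrow> real \<Rightarrow> real^2" +
  fixes B :: real and G1 G2 :: "real \<Rightarrow> real"
  assumes B: "\<And>t. t \<in> {0..T} \<Longrightarrow> regular_curve B (x t)"
    and G1: "G1 \<in> borel_measurable (time_measure T)" "integrable (time_measure T) (\<lambda>t. (G1 t)^2)"
      "AE r in time_measure T. x_t r \<in> H2_space \<and> h2_norm (x_t r) \<le> G1 r"
    and G2: "G2 \<in> borel_measurable (time_measure T)" "integrable (time_measure T) (\<lambda>t. (G2 t)^2)"
      "AE r in time_measure T. x_tt r \<in> L2_space \<and> l2_norm (x_tt r) \<le> G2 r"
begin

text \<open>The bound for \<open>x_t\<close> in \<open>weak_form_defect\<close>; it also dominates 2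
  B, which bounds the curve, its derivative and the second differences of the interpolant.\<close>

definition "K = 3 * B ^ 5"

text \<open>Half of the lower bound 1/B is left to the interpolant, which makes 2 c, and half of
  that to the discrete solution.\<close>

definition "c = 1 / (4 * B)"

definition "\<Gamma>1 = (\<integral>r. (G1 r)^2 \<partial>time_measure T)"

definition "\<Gamma>2 = (\<integral>r. (G2 r)^2 \<partial>time_measure T)"

definition "Ca = 5832 * K ^ 6 * (K^2 * T + 4 * \<Gamma>1) + 3 * K ^ 6 * \<Gamma>2 + 450 * K ^ 8 * (T + 4 * \<Gamma>1)"

definition "Ck = 192 * K ^ 6 * (4 * K^2 * T + 16 * \<Gamma>1 + 24 * \<Gamma>2)"

text \<open>The three summands serve the flux itself, the sum of \<open>\<alpha>\<close> and the sum
  of \<open>\<kappa>\<close>, since a single S has to dominate all of them.\<close>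

definition "Cs = 36 * K ^ 8 + Ca + Ck"

text \<open>Nonnegativity of C6 is a result inside \<open>scheme_error\<close>; the absolute value
  provides it before that locale is instantiated.\<close>

definition "Z = \<bar>scheme_error.C6 T K c\<bar>"

lemma constants: "1 \<le> B" "1 \<le> K" "2 * B \<le> K" "0 < c" "c \<le> 1" "0 \<le> \<Gamma>1" "0 \<le> \<Gamma>2" "0 \<le> Ca" "0 \<le> Ck" "0 \<le> Cs"
proof -
  show B1: "1 \<le> B" using B[of 0] T by (simp add: regular_curve_def)
  then have "B \<le> B ^ 5" by (rule self_le_power) simp
  then show K: "1 \<le> K" "2 * B \<le> K" using B1 by (simp_all add: K_def)
  show "0 < c" "c \<le> 1" using B1 by (auto simp: c_def divide_le_eq)
  show G: "0 \<le> \<Gamma>1" "0 \<le> \<Gamma>2" by (simp_all add: \<Gamma>1_def \<Gamma>2_def)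
  show "0 \<le> Ca" "0 \<le> Ck" using G K T by (auto simp: Ca_def Ck_def)
  then show "0 \<le> Cs" using K by (simp add: Cs_def)
qed

end

section \<open>The consistency data of a fixed mesh and time step\<close>

locale discretization = regular_bounds T x x_t x_tt B G1 G2
  for T and x x_t x_tt :: "real \<Rightarrow> real \<Rightarrow> real^2" and B G1 G2 +
  fixes J M :: nat
  assumes J: "1 \<le> J" and M: "1 \<le> M"
begin

definition "dt = T / real M"

text \<open>The minimum only serves to have a time in \<open>[0,T]\<close> for every \<open>n\<close>.\<close>

definition "tm n = min (real n * dt) T"

definition "I1 n = (window T G1 (real n * dt) (real (Suc n) * dt))"

definition "I2 n = (window T G2 (real n * dt) (real (Suc n) * dt))"

definition "d m z = (x (tm (Suc m)) z - x (tm m) z) /\<^sub>R dt"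

definition "d' m z = (d_rho (x (tm (Suc m))) z - d_rho (x (tm m)) z) /\<^sub>R dt"

definition "N m = 2 * I1 m / dt"

definition "osc m = oscillation J (d' m)"

definition "Y n j = x (tm n) (node J j)"

text \<open>Step m produces the flux with index \<open>Suc m\<close>: curve at the new level,
  difference quotient of the step leading to it.\<close>

definition "g n = level.flux J (x (tm n)) (d_rho (x (tm n))) (d (n - 1))"

text \<open>Three defects: coefficients taken at the old instead of the new level, difference
  quotient instead of \<open>x_t\<close>, and interpolation in space. Each constant is three times
  the one of its source because the parameter of Young's inequality is split in three.\<close>

definition "\<alpha> m = 5832 * K ^ 6 * (K^2 * dt^2 + 4 * (I1 m)^2) + 3 * K ^ 6 * (I2 m)^2
  + 450 * K ^ 8 * (1 + (N m)^2) / real J ^ 4"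

text \<open>The bound of \<open>flux_increment_n2\<close> with L = K dt + 2 I1 and with the
  increment of the difference quotients from \<open>d_increment\<close>.\<close>

definition "\<kappa> m = 192 * K ^ 6 * (4 * K^2 * dt^2 + 16 * (I1 m)^2 + 8 * ((I2 m)^2 + (I2 (m - 1))^2)) / real J ^ 4"

definition "S = Cs * (1 / real J ^ 4 + dt^2)"

lemma dt: "0 < dt" "real M * dt = T"
  using T M by (simp_all add: dt_def)

lemma tm_range: "tm n \<in> {0..T}"
  using dt T by (auto simp: tm_def)

lemma tm_eq: "n \<le> M \<Longrightarrow> tm n = real n * dt"
proof -
  assume "n \<le> M"
  then have "real n * dt \<le> real M * dt" using dt by (intro mult_right_mono) auto
  then show ?thesis using dt by (simp add: tm_def)
qed

lemma tm_step:
  assumes "m < M"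
  shows "0 \<le> tm m" "tm m < tm (Suc m)" "tm (Suc m) \<le> T" "tm (Suc m) - tm m = dt"
    "{real m * dt<..<real (Suc m) * dt} = {tm m<..<tm (Suc m)}" "tm (Suc m) \<in> {0<..T}"
proof -
  have e: "tm m = real m * dt" "tm (Suc m) = real (Suc m) * dt" using tm_eq[of m] tm_eq[of "Suc m"] assms by (simp_all del: of_nat_Suc)
  show "0 \<le> tm m" "tm (Suc m) \<le> T" using tm_range[of m] tm_range[of "Suc m"] by auto
  show "tm (Suc m) - tm m = dt" unfolding e by (simp add: distrib_right)
  then show "tm m < tm (Suc m)" using dt(1) by linarith
  show "{real m * dt<..<real (Suc m) * dt} = {tm m<..<tm (Suc m)}" unfolding e ..
  show "tm (Suc m) \<in> {0<..T}" using \<open>0 \<le> tm m\<close> \<open>tm m < tm (Suc m)\<close> \<open>tm (Suc m) \<le> T\<close> by auto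
qed

lemma curve:
  "periodic (x (tm n))" "(x (tm n) has_vector_derivative d_rho (x (tm n)) z) (at z)"
  "norm (x (tm n) z) \<le> B" "norm (d_rho (x (tm n)) z) \<le> B" "1 / B \<le> x (tm n) z \<bullet> e1" "1 / B \<le> norm (d_rho (x (tm n)) z)"
  "norm (d_rho (x (tm n)) a - d_rho (x (tm n)) b) \<le> B * \<bar>a - b\<bar>"
  using B[OF tm_range] by (auto simp: regular_curve_def)

lemma curve_continuous: "continuous_on UNIV (x (tm n))" "continuous_on UNIV (\<lambda>z. d_rho (x (tm n)) z)"
proof -
  show "continuous_on UNIV (x (tm n))" by (rule x_continuous_rep[OF tm_range])
  show "continuous_on UNIV (\<lambda>z. d_rho (x (tm n)) z)" by (rule lipschitz_continuous[OF curve(7)])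
qed

lemma d_rho_diff: "d_rho (\<lambda>z. x (tm n) z - x (tm m) z) z = d_rho (x (tm n)) z - d_rho (x (tm m)) z"
  by (intro vector_derivative_at has_vector_derivative_diff curve(2))

lemma d_derivative: "(d m has_vector_derivative d' m z) (at z)"
  unfolding d_def[abs_def] d'_def
  by (intro bounded_linear.has_vector_derivative[OF bounded_linear_scaleR_right] has_vector_derivative_diff curve(2))

lemma d_continuous: "continuous_on UNIV (d m)" "continuous_on UNIV (d' m)" "periodic (d m)"
proof -
  show "continuous_on UNIV (d m)" "continuous_on UNIV (d' m)"
    unfolding d_def[abs_def] d'_def[abs_def] by (intro continuous_intros curve_continuous)+
  show "periodic (d m)" using curve(1)[of m] curve(1)[of "Suc m"] by (simp add: periodic_def d_def)
qed

lemma G_integrable: "integrable (time_measure T) G1" "integrable (time_measure T) G2"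
  using sum_time_integrals(1)[OF G1(1,2) T M] sum_time_integrals(1)[OF G2(1,2) T M] by auto

lemma I_sums: "(\<Sum>n<M. (I1 n)^2) \<le> dt * \<Gamma>1" "(\<Sum>n<M. (I2 n)^2) \<le> dt * \<Gamma>2"
  using sum_time_integrals(2)[OF G1(1,2) T M] sum_time_integrals(2)[OF G2(1,2) T M]
  by (simp_all only: I1_def I2_def dt_def \<Gamma>1_def \<Gamma>2_def)

lemma increments:
  assumes m: "m < M"
  shows "norm (x (tm (Suc m)) z - x (tm m) z) \<le> K * dt"
    "norm (d_rho (x (tm (Suc m))) z - d_rho (x (tm m)) z) \<le> 2 * I1 m" "0 \<le> I1 m" "0 \<le> I2 m"
    "l2_norm (\<lambda>z. d m z - x_t (tm (Suc m)) z) \<le> I2 m" "l2_norm (\<lambda>z. x_t (tm (Suc m)) z - x_t (tm m) z) \<le> I2 m"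
proof -
  note t = tm_step[OF m]
  show "norm (x (tm (Suc m)) z - x (tm m) z) \<le> K * dt"
    using x_increment_bound[OF B t(1-3)] by (simp add: K_def t(4))
  show "norm (d_rho (x (tm (Suc m))) z - d_rho (x (tm m)) z) \<le> 2 * I1 m" "0 \<le> I1 m"
    using x_increment_derivative_bound[OF G_integrable(1) G1(3) t(1-3)] by (simp_all only: I1_def t(5) d_rho_diff)
  show "l2_norm (\<lambda>z. d m z - x_t (tm (Suc m)) z) \<le> I2 m"
    using difference_quotient_defect[OF G_integrable(2) G2(3) t(1-3)] unfolding I2_def t(5) d_def t(4) .
  show "l2_norm (\<lambda>z. x_t (tm (Suc m)) z - x_t (tm m) z) \<le> I2 m" "0 \<le> I2 m"
    using x_t_increment_bound[OF G_integrable(2) G2(3) t(1-3)] unfolding I2_def t(5) by auto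
qed

lemma N_nonneg: "m < M \<Longrightarrow> 0 \<le> N m"
  using increments(3) dt by (simp add: N_def)

lemma osc_sum:
  assumes m: "m < M"
  shows "(\<Sum>j<J. (osc m j)^2) \<le> (N m)^2 / real J"
proof -
  note t = tm_step[OF m]
  obtain a b where ab: "\<And>j. a j \<in> element J j" "\<And>j. b j \<in> element J j" "\<And>j. osc m j = norm (d' m (a j) - d' m (b j))"
  proof -
    have "\<exists>a b. a \<in> element J j \<and> b \<in> element J j \<and> osc m j = norm (d' m a - d' m b)" for j
      using oscillation(2)[OF J d_continuous(2)[of m], of j] unfolding osc_def by blast
    then show ?thesis using that by metis
  qed
  have "(\<Sum>j<J. (norm (d_rho (\<lambda>z. x (tm (Suc m)) z - x (tm m) z) (a j) - d_rho (\<lambda>z. x (tm (Suc m)) z - x (tm m) z) (b j)))^2) \<le> (I1 m)^2 / real J"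
    unfolding I1_def t(5) by (rule element_oscillation[OF G_integrable(1) G1(3) t(1-3) J ab(1,2)])
  moreover have "osc m j = norm (d_rho (\<lambda>z. x (tm (Suc m)) z - x (tm m) z) (a j) - d_rho (\<lambda>z. x (tm (Suc m)) z - x (tm m) z) (b j)) / dt" for j
    unfolding ab(3) d'_def d_rho_diff scaleR_diff_right[symmetric] using dt(1) by (simp add: divide_inverse_commute)
  ultimately have "(\<Sum>j<J. (osc m j)^2) \<le> ((I1 m)^2 / real J) / dt^2"
    by (simp only: power_divide sum_divide_distrib[symmetric]) (rule divide_right_mono, auto)
  also have "\<dots> \<le> (N m)^2 / real J"
    using mult_right_mono[of 1 4 "(I1 m)^2 / (real J * dt^2)"] by (simp add: N_def power_divide power_mult_distrib mult.commute)
  finally show ?thesis .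
qed

lemma level:
  assumes m: "m < M"
  shows "level J K (N m) (osc m) (x (tm (Suc m))) (d_rho (x (tm (Suc m)))) (d m) (d' m)"
proof unfold_locales
  show "1 \<le> J" "1 \<le> K" "0 \<le> N m" using J constants N_nonneg[OF m] by auto
  show "periodic (x (tm (Suc m)))" "periodic (d m)" using curve(1) d_continuous by auto
  show "(x (tm (Suc m)) has_vector_derivative d_rho (x (tm (Suc m))) z) (at z)" for z by (rule curve)
  show "(d m has_vector_derivative d' m z) (at z)" for z by (rule d_derivative)
  show "continuous_on UNIV (\<lambda>z. d_rho (x (tm (Suc m))) z)" "continuous_on UNIV (d' m)" by (rule curve_continuous d_continuous)+
  have BK: "B \<le> K" using constants by simp
  show "norm (x (tm (Suc m)) z) \<le> K" "norm (d_rho (x (tm (Suc m))) z) \<le> K" for z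
    using order_trans[OF curve(3) BK] order_trans[OF curve(4) BK] by auto
  show "norm (d_rho (x (tm (Suc m))) a - d_rho (x (tm (Suc m))) b) \<le> K * \<bar>a - b\<bar>" for a b
    using order_trans[OF curve(7) mult_right_mono[OF BK abs_ge_zero]] .
  show "norm (d m z) \<le> K" for z
    using increments(1)[OF m, of z] dt(1) by (simp add: d_def divide_le_eq flip: divide_inverse_commute)
  show "norm (d' m z) \<le> N m" for z
    using increments(2)[OF m, of z] dt(1) by (simp add: d'_def N_def divide_right_mono flip: divide_inverse_commute)
  show "norm (d' m a - d' m b) \<le> osc m j" if "a \<in> element J j" "b \<in> element J j" for j a b
    unfolding osc_def by (rule oscillation(1)[OF J d_continuous(2) that])
qed

lemma g_bound:
  assumes "1 \<le> n" "n \<le> M"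
  shows "n2 J (g n) \<le> 36 * K ^ 8 / real J ^ 4"
proof -
  obtain m where m: "n = Suc m" "m < M" using assms by (cases n) auto
  have "(norm (g n j))^2 \<le> (6 * K ^ 4 / (real J)^2)^2" for j
    unfolding g_def m(1) diff_Suc_1 by (intro power_mono level.flux_bound[OF level[OF m(2)]]) auto
  then have "(\<Sum>j<J. (norm (g n j))^2) \<le> real (card {..<J}) * (6 * K ^ 4 / (real J)^2)^2"
    by (intro sum_bounded_above) auto
  then have "n2 J (g n) \<le> (6 * K ^ 4 / (real J)^2)^2"
    using J by (simp add: n2_def divide_le_eq mult.commute)
  also have "\<dots> = 36 * K ^ 8 / real J ^ 4" by (simp add: power_divide power_mult_distrib flip: power_mult)
  finally show ?thesis .
qed

lemma d_L2: "d m \<in> L2_space" by (rule L2_space_continuous[OF d_continuous(1,3)])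

text \<open>Neighbouring difference quotients are compared through \<open>x_t\<close> at the two
  times; each of the three differences is bounded by the integral of G2 over one step.\<close>

lemma d_increment:
  assumes n: "1 \<le> n" "n < M"
  shows "(l2_norm (\<lambda>z. d n z - d (n - 1) z))^2 \<le> 8 * ((I2 n)^2 + (I2 (n - 1))^2)"
proof -
  have m: "n - 1 < M" "Suc (n - 1) = n" using n by auto
  note L = x_t_L2[OF tm_range]
  have a: "(\<lambda>z. d n z - x_t (tm (Suc n)) z) \<in> L2_space" "(\<lambda>z. x_t (tm (Suc n)) z - x_t (tm n) z) \<in> L2_space"
    "(\<lambda>z. x_t (tm n) z - d (n - 1) z) \<in> L2_space"
    by (intro L2_space_diff d_L2 L)+
  have "l2_norm (\<lambda>z. d n z - d (n - 1) z) = l2_norm (\<lambda>z. (d n z - x_t (tm (Suc n)) z) + ((x_t (tm (Suc n)) z - x_t (tm n) z) + (x_t (tm n) z - d (n - 1) z)))"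
    by simp
  also have "\<dots> \<le> l2_norm (\<lambda>z. d n z - x_t (tm (Suc n)) z) + (l2_norm (\<lambda>z. x_t (tm (Suc n)) z - x_t (tm n) z) + l2_norm (\<lambda>z. x_t (tm n) z - d (n - 1) z))"
    using l2_norm_triangle[OF a(1) L2_space_add[OF a(2,3)]] l2_norm_triangle[OF a(2,3)] by linarith
  also have "l2_norm (\<lambda>z. x_t (tm n) z - d (n - 1) z) = l2_norm (\<lambda>z. d (n - 1) z - x_t (tm n) z)"
    by (simp add: l2_norm_def l2_inner_def inner_diff algebra_simps)
  also have "l2_norm (\<lambda>z. d n z - x_t (tm (Suc n)) z) + (l2_norm (\<lambda>z. x_t (tm (Suc n)) z - x_t (tm n) z) + l2_norm (\<lambda>z. d (n - 1) z - x_t (tm n) z))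
      \<le> 2 * I2 n + I2 (n - 1)"
    using increments(5,6)[OF n(2)] increments(5)[OF m(1)] unfolding m(2) by linarith
  finally have "(l2_norm (\<lambda>z. d n z - d (n - 1) z))^2 \<le> (2 * I2 n + I2 (n - 1))^2"
    using l2_norm_nonneg by (intro power_mono) auto
  also have "\<dots> \<le> 8 * ((I2 n)^2 + (I2 (n - 1))^2)"
    using sum_squares_bound[of "2 * I2 n" "I2 (n - 1)"] by (simp add: power2_sum power_mult_distrib) (smt (verit) zero_le_power2)
  finally show ?thesis .
qed

lemma g_increment:
  assumes n: "1 \<le> n" "n < M"
  shows "n2 J (\<lambda>j. g (Suc n) j - g n j) \<le> \<kappa> n"
proof -
  define L where "L = K * dt + 2 * I1 n"
  define od where "od j = dt * osc n j" for j
  have m: "n - 1 < M" "Suc (n - 1) = n" using n by auto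
  have pos: "0 \<le> K * dt" "0 \<le> 2 * I1 n" using constants dt increments(3)[OF n(2)] by auto
  have "two_levels J K (N n) (N (n - 1)) (osc n) (osc (n - 1)) (x (tm (Suc n))) (d_rho (x (tm (Suc n)))) (d n) (d' n)
    (x (tm n)) (d_rho (x (tm n))) (d (n - 1)) (d' (n - 1)) L od"
  proof (rule two_levels.intro[OF level[OF n(2)] level[OF m(1), unfolded m(2)]], unfold_locales)
    show "norm (x (tm (Suc n)) z - x (tm n) z) \<le> L" "norm (d_rho (x (tm (Suc n))) z - d_rho (x (tm n)) z) \<le> L" for z
      using increments(1,2)[OF n(2), of z] pos by (simp_all add: L_def)
    show "norm (d_rho (x (tm (Suc n))) s - d_rho (x (tm n)) s - (d_rho (x (tm (Suc n))) t - d_rho (x (tm n)) t)) \<le> od j"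
      if "s \<in> element J j" "t \<in> element J j" for j s t
    proof -
      have "d_rho (x (tm (Suc n))) s - d_rho (x (tm n)) s - (d_rho (x (tm (Suc n))) t - d_rho (x (tm n)) t) = dt *\<^sub>R (d' n s - d' n t)"
        using dt(1) by (simp add: d'_def scaleR_diff_right[symmetric])
      then show ?thesis
        using oscillation(1)[OF J d_continuous(2) that, of n] dt(1) by (simp add: od_def osc_def mult_left_mono)
    qed
  qed
  note two_levels.flux_increment_n2[OF this]
  moreover have "(\<Sum>j<J. (od j)^2) \<le> L^2 / real J"
  proof -
    have "(\<Sum>j<J. (od j)^2) = dt^2 * (\<Sum>j<J. (osc n j)^2)" by (simp add: od_def power_mult_distrib sum_distrib_left)
    also have "\<dots> \<le> dt^2 * ((N n)^2 / real J)" using osc_sum[OF n(2)] by (intro mult_left_mono) auto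
    also have "\<dots> = (2 * I1 n)^2 / real J" using dt(1) by (simp add: N_def power_divide)
    also have "\<dots> \<le> L^2 / real J" using pos by (intro divide_right_mono power_mono) (auto simp: L_def)
    finally show ?thesis .
  qed
  ultimately have "n2 J (\<lambda>j. g (Suc n) j - g n j) \<le> 192 * K ^ 6 * (2 * L^2 + (l2_norm (\<lambda>z. d n z - d (n - 1) z))^2) / real J ^ 4"
    by (simp add: g_def)
  also have "\<dots> \<le> \<kappa> n"
    unfolding \<kappa>_def
  proof (intro divide_right_mono mult_left_mono)
    have "L^2 \<le> 2 * ((K * dt)^2 + (2 * I1 n)^2)"
      using sum_squares_bound[of "K * dt" "2 * I1 n"] by (simp add: L_def power2_sum)
    then show "2 * L^2 + (l2_norm (\<lambda>z. d n z - d (n - 1) z))^2 \<le> 4 * K^2 * dt^2 + 16 * (I1 n)^2 + 8 * ((I2 n)^2 + (I2 (n - 1))^2)"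
      using d_increment[OF n] by (simp add: power_mult_distrib)
  qed (use constants in auto)
  finally show ?thesis .
qed

lemma weak_defect:
  assumes m: "m < M" and H: "cyc J H"
  shows "\<bar>\<integral>z. level.weak_integrand (x (tm (Suc m))) (d_rho (x (tm (Suc m)))) (d m) (plin J H) (dplin J H) z \<partial>I_measure\<bar>
    \<le> (B ^ 3 * I2 m) * sqrt (n2 J H)"
proof -
  obtain L where L: "\<And>j. norm (slope J H j) \<le> L" using cyc_bounded[OF J cyc_slope[OF H]] by blast
  have ae: "AE z in I_measure. ((\<lambda>h. (plin J H z - plin J H (z - h)) /\<^sub>R h) \<longlongrightarrow> dplin J H z) (at_right 0)"
    using AE_open_element[OF J]
  proof eventually_elim
    case (elim z)
    then obtain j where j: "j < J" "z \<in> open_element J j" by blast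
    then show ?case
      using vector_derivative_quotients(2)[OF plin_has_vector_derivative[OF j(1) H j(2)]] dplin_open[OF j, of H] by simp
  qed
  have "\<bar>\<integral>z. level.weak_integrand (x (tm (Suc m))) (d_rho (x (tm (Suc m)))) (d m) (plin J H) (dplin J H) z \<partial>I_measure\<bar>
    \<le> B ^ 3 * l2_norm (\<lambda>z. d m z - x_t (tm (Suc m)) z) * l2_norm (plin J H)"
    unfolding level.weak_integrand_def[OF level[OF m]]
    by (rule weak_form_defect(1)[OF tm_step(6)[OF m] B[OF tm_range] periodic_plin(1) plin_lipschitz[OF J H L] _ ae d_continuous(1,3)])
      (use dplin_L2(1)[OF J, of H] in \<open>simp add: L2_space_def\<close>)
  also have "\<dots> \<le> (B ^ 3 * I2 m) * sqrt (n2 J H)"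
    using constants(1) increments(4,5)[OF m] l2_norm_plin[OF J H] l2_norm_nonneg
    by (intro mult_mono real_le_rsqrt) auto
  finally show ?thesis .
qed

text \<open>The restriction on h makes B h at most 1/(2B), so the slopes of the interpolant keep
  half of the lower bound 1/B of the exact derivative.\<close>

lemma Y_facts:
  assumes h: "1 / real J \<le> 1 / (2 * B^2)"
  shows "cyc J (Y n)" "norm (Y n j) \<le> K" "norm (slope J (Y n) j) \<le> K" "2 * c \<le> Y n j \<bullet> e1"
    "2 * c \<le> norm (slope J (Y n) j)" "norm (slope J (Y n) (Suc j) - slope J (Y n) j) \<le> K / real J"
    "z \<in> element J j \<Longrightarrow> norm (d_rho (x (tm n)) z - slope J (Y n) j) \<le> K / real J"
    "z \<in> element J j \<Longrightarrow> norm (x (tm n) z - aff J (Y n) j z) \<le> K / (real J)^2"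
proof -
  have B1: "1 \<le> B" and BK: "B \<le> K" "2 * B \<le> K" using constants by auto
  show "cyc J (Y n)" unfolding Y_def[abs_def] by (rule cyc_nodes[OF curve(1) J])
  show "norm (Y n j) \<le> K" unfolding Y_def using curve(3) BK(1) by (rule order_trans)
  show "norm (slope J (Y n) j) \<le> K"
    unfolding Y_def[abs_def] using slope_bound[OF J curve(2) curve(4)] BK(1) by (rule order_trans)
  show "2 * c \<le> Y n j \<bullet> e1"
  proof -
    have "2 * c \<le> 1 / B" using B1 by (simp add: c_def divide_simps)
    then show ?thesis using curve(5)[of n "node J j"] by (simp add: Y_def)
  qed
  have o: "norm (d_rho (x (tm n)) a - d_rho (x (tm n)) b) \<le> B / real J" if "a \<in> element J j" "b \<in> element J j" for a b j
  proof -
    have "\<bar>a - b\<bar> \<le> 1 / real J" using that element_width[OF J, of j] by auto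
    then have "B * \<bar>a - b\<bar> \<le> B * (1 / real J)" using B1 by (intro mult_left_mono) auto
    then show ?thesis using curve(7)[of n a b] by simp
  qed
  have i: "norm (d_rho (x (tm n)) z - slope J (Y n) j) \<le> B / real J" "norm (x (tm n) z - aff J (Y n) j z) \<le> B / real J / real J"
    if "z \<in> element J j" for z j
    using interpolation_error[OF J curve(2) o that] unfolding Y_def[abs_def] by auto
  show "norm (d_rho (x (tm n)) z - slope J (Y n) j) \<le> K / real J" if "z \<in> element J j"
    using i(1)[OF that] divide_right_mono[OF BK(1), of "real J"] by linarith
  show "norm (x (tm n) z - aff J (Y n) j z) \<le> K / (real J)^2" if "z \<in> element J j"
    using i(2)[OF that] divide_right_mono[OF BK(1), of "(real J)^2"] by (simp add: power2_eq_square)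
  have nd: "node J j \<in> element J j" "node J (Suc j) \<in> element J j" for j using J by (auto simp: node_def divide_right_mono)
  show "2 * c \<le> norm (slope J (Y n) j)"
  proof -
    have "B * (1 / real J) \<le> B * (1 / (2 * B^2))" using h B1 by (intro mult_left_mono) auto
    then have "B / real J \<le> 1 / (2 * B)" using B1 by (simp add: power2_eq_square)
    moreover have "norm (d_rho (x (tm n)) (node J j)) - norm (slope J (Y n) j) \<le> B / real J"
      using i(1)[OF nd(1)] norm_triangle_ineq2 by (rule order_trans[rotated])
    moreover have "1 / B = 2 * (1 / (2 * B))" "2 * c = 1 / (2 * B)" by (simp_all add: c_def)
    ultimately show ?thesis using curve(6)[of n "node J j"] by linarith
  qed
  have "norm (slope J (Y n) (Suc j) - slope J (Y n) j) \<le> B / real J + B / real J"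
    using norm_triangle_ineq4[of "d_rho (x (tm n)) (node J (Suc j)) - slope J (Y n) j" "d_rho (x (tm n)) (node J (Suc j)) - slope J (Y n) (Suc j)"]
      i(1)[OF nd(2), of j] i(1)[OF nd(1), of "Suc j"] by simp
  also have "\<dots> = 2 * B / real J" by simp
  also have "\<dots> \<le> K / real J" using BK(2) by (rule divide_right_mono) simp
  finally show "norm (slope J (Y n) (Suc j) - slope J (Y n) j) \<le> K / real J" .
qed

text \<open>Three comparisons, each with a third of \<open>\<epsilon>\<close>: the form at level m
  with the form at level \<open>Suc m\<close>, the latter with flux and exact weak form, and the
  weak form with zero, its defect being due to d in place of \<open>x_t\<close>.\<close>

lemma consistent:
  assumes h: "1 / real J \<le> 1 / (2 * B^2)" and m: "m < M" and H: "cyc J H" and e: "0 < \<epsilon>"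
  shows "\<bar>scheme_form J (Y m) (\<lambda>j. (Y (Suc m) j - Y m j) /\<^sub>R dt) (Y (Suc m)) H - (\<Sum>j<J. g (Suc m) j \<bullet> (H (Suc j) - H j))\<bar>
    \<le> \<epsilon> * n2 J H + \<alpha> m / \<epsilon>"
proof -
  define Dn where "Dn j = (Y (Suc m) j - Y m j) /\<^sub>R dt" for j
  note lv = level[OF m]
  have X: "level.X J (x (tm (Suc m))) = Y (Suc m)" "level.Dn J (d m) = Dn"
    by (simp_all add: level.X_def[OF lv] level.Dn_def[OF lv] Y_def Dn_def d_def fun_eq_iff)
  define Q where "Q = (\<integral>z. level.weak_integrand (x (tm (Suc m))) (d_rho (x (tm (Suc m)))) (d m) (plin J H) (dplin J H) z \<partial>I_measure)"
  define F where "F = (\<Sum>j<J. g (Suc m) j \<bullet> (H (Suc j) - H j))"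
  have e3: "0 < \<epsilon> / 3" using e by simp
  have 1: "\<bar>scheme_form J (Y (Suc m)) Dn (Y (Suc m)) H - F - Q\<bar> \<le> \<epsilon> / 3 * n2 J H + (150 * K ^ 8 * (1 + (N m)^2) / real J ^ 4) / (\<epsilon> / 3)"
    using level.consistency[OF lv H e3 osc_sum[OF m]] by (simp only: X Q_def F_def g_def diff_Suc_1)
  define D where "D j = Y m j - Y (Suc m) j" for j
  have DnK: "norm (Dn j) \<le> K" for j
    using increments(1)[OF m, of "node J j"] dt(1) by (simp add: Dn_def Y_def divide_le_eq flip: divide_inverse_commute)
  have 2: "\<bar>scheme_form J (Y m) Dn (Y (Suc m)) H - scheme_form J (Y (Suc m)) Dn (Y (Suc m)) H\<bar>
      \<le> \<epsilon> / 3 * n2 J H + 1944 * K ^ 6 / (\<epsilon> / 3) * (s2 J D + n2 J D)"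
    unfolding D_def
    by (rule form_lipschitz[OF J constants(2) e3]) (use Y_facts[OF h] H DnK in auto)
  have D2: "s2 J D + n2 J D \<le> K^2 * dt^2 + 4 * (I1 m)^2"
  proof -
    have av: "n2 J V \<le> q^2" if "\<And>j. norm (V j) \<le> q" for V :: "nat \<Rightarrow> real^2" and q
    proof -
      have "(\<Sum>j<J. (norm (V j))^2) \<le> real (card {..<J}) * q^2"
        by (intro sum_bounded_above power_mono that) auto
      then show ?thesis using J by (simp add: n2_def divide_le_eq mult.commute)
    qed
    have "n2 J D \<le> (K * dt)^2"
      using increments(1)[OF m] by (intro av) (simp add: D_def Y_def norm_minus_commute)
    moreover have "s2 J D \<le> (2 * I1 m)^2"
      unfolding s2_def
    proof (rule av)
      fix j
      have "norm (slope J (\<lambda>j. x (tm (Suc m)) (node J j) - x (tm m) (node J j)) j) \<le> 2 * I1 m"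
        by (rule slope_bound[OF J has_vector_derivative_diff[OF curve(2) curve(2)] increments(2)[OF m]])
      moreover have "slope J D j = - slope J (\<lambda>j. x (tm (Suc m)) (node J j) - x (tm m) (node J j)) j"
        by (simp add: slope_def D_def Y_def algebra_simps)
      ultimately show "norm (slope J D j) \<le> 2 * I1 m" by simp
    qed
    ultimately show ?thesis by (simp add: power_mult_distrib)
  qed
  have 3: "\<bar>Q\<bar> \<le> \<epsilon> / 3 * n2 J H + (K ^ 6 * (I2 m)^2) / (\<epsilon> / 3)"
  proof -
    have "\<bar>Q\<bar> \<le> (B ^ 3 * I2 m) * sqrt (n2 J H)" unfolding Q_def by (rule weak_defect[OF m H])
    also have "\<dots> \<le> \<epsilon> / 3 * (sqrt (n2 J H))^2 + (B ^ 3 * I2 m)^2 / (4 * (\<epsilon> / 3))" by (rule young[OF e3])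
    also have "(B ^ 3 * I2 m)^2 / (4 * (\<epsilon> / 3)) \<le> (K ^ 6 * (I2 m)^2) / (4 * (\<epsilon> / 3))"
    proof (intro divide_right_mono)
      have "B ^ 6 \<le> K ^ 6" using constants by (intro power_mono) auto
      then show "(B ^ 3 * I2 m)^2 \<le> K ^ 6 * (I2 m)^2" by (simp add: power_mult_distrib mult_right_mono flip: power_mult)
    qed (use e in auto)
    also have "\<dots> \<le> (K ^ 6 * (I2 m)^2) / (\<epsilon> / 3)" using e constants by (intro divide_left_mono) auto
    finally show ?thesis by (simp add: n2_nonneg)
  qed
  have "1944 * K ^ 6 / (\<epsilon> / 3) * (s2 J D + n2 J D) \<le> 1944 * K ^ 6 / (\<epsilon> / 3) * (K^2 * dt^2 + 4 * (I1 m)^2)"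
    using D2 e constants by (intro mult_left_mono) auto
  moreover have "1944 * K ^ 6 / (\<epsilon> / 3) * (K^2 * dt^2 + 4 * (I1 m)^2) + (150 * K ^ 8 * (1 + (N m)^2) / real J ^ 4) / (\<epsilon> / 3)
      + (K ^ 6 * (I2 m)^2) / (\<epsilon> / 3) = \<alpha> m / \<epsilon>"
  proof -
    have t: "a / (\<epsilon> / 3) = 3 * a / \<epsilon>" for a :: real by simp
    have q: "1944 * K ^ 6 / (\<epsilon> / 3) * (K^2 * dt^2 + 4 * (I1 m)^2) = 1944 * K ^ 6 * (K^2 * dt^2 + 4 * (I1 m)^2) / (\<epsilon> / 3)" by simp
    show ?thesis unfolding q unfolding t add_divide_distrib[symmetric] \<alpha>_def by (rule arg_cong[of _ _ "\<lambda>a. a / \<epsilon>"]) simp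
  qed
  ultimately show ?thesis
    using 1 2 3 unfolding F_def[symmetric] Dn_def[abs_def, symmetric] by linarith
qed

text \<open>The bound N contains a division by \<open>dt\<close>, but the squares of I1 sum to
  \<open>dt\<close> times \<open>\<Gamma>1\<close>, so \<open>dt\<close> times the sum of N^2 stays
  bounded; in the terms without h^4 the same sums yield dt^2.\<close>

lemma \<alpha>_sum: "(\<Sum>m<M. dt * \<alpha> m) \<le> S" "0 \<le> \<alpha> m"
proof -
  define h4 where "h4 = 1 / real J ^ 4"
  have h4: "0 \<le> h4" by (simp add: h4_def)
  have K0: "0 \<le> K" using constants by simp
  show "0 \<le> \<alpha> m" using K0 by (simp add: \<alpha>_def)
  have a: "dt * \<alpha> m = 5832 * K ^ 6 * (K^2 * dt^2 * dt + 4 * dt * (I1 m)^2) + 3 * K ^ 6 * dt * (I2 m)^2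
      + 450 * K ^ 8 * h4 * (dt + 4 / dt * (I1 m)^2)" for m
  proof -
    have n: "4 / dt * (I1 m)^2 = dt * (N m)^2"
      using dt(1) by (simp add: N_def power_divide power_mult_distrib power2_eq_square)
    have "\<alpha> m = 5832 * K ^ 6 * (K^2 * dt^2 + 4 * (I1 m)^2) + 3 * K ^ 6 * (I2 m)^2 + 450 * K ^ 8 * h4 * (1 + (N m)^2)"
      by (simp add: \<alpha>_def h4_def)
    then show ?thesis unfolding n by (simp add: algebra_simps)
  qed
  have "(\<Sum>m<M. dt * \<alpha> m) = 5832 * K ^ 6 * (K^2 * dt^2 * T + 4 * dt * (\<Sum>m<M. (I1 m)^2)) + 3 * K ^ 6 * dt * (\<Sum>m<M. (I2 m)^2)
      + 450 * K ^ 8 * h4 * (T + 4 / dt * (\<Sum>m<M. (I1 m)^2))"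
  proof -
    have lin: "(\<Sum>m<n. a * (p + q * u m) + b * v m + e * (t + w * u m)) = a * (real n * p + q * (\<Sum>m<n. u m)) + b * (\<Sum>m<n. v m) + e * (real n * t + w * (\<Sum>m<n. u m))"
      for a p q b e t w :: real and u v :: "nat \<Rightarrow> real" and n
      by (induction n) (simp_all add: algebra_simps)
    have "real M * (K^2 * dt^2 * dt) = K^2 * dt^2 * (real M * dt)" by (simp only: mult_ac)
    then show ?thesis unfolding a lin dt(2) by simp
  qed
  also have "\<dots> \<le> 5832 * K ^ 6 * (K^2 * dt^2 * T + 4 * dt * (dt * \<Gamma>1)) + 3 * K ^ 6 * dt * (dt * \<Gamma>2)
      + 450 * K ^ 8 * h4 * (T + 4 / dt * (dt * \<Gamma>1))"
    using I_sums dt(1) K0 h4 by (intro add_mono mult_left_mono order_refl) auto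
  also have "\<dots> = (5832 * K ^ 6 * (K^2 * T + 4 * \<Gamma>1) + 3 * K ^ 6 * \<Gamma>2) * dt^2 + 450 * K ^ 8 * (T + 4 * \<Gamma>1) * h4"
    using dt(1) by (simp add: power2_eq_square algebra_simps)
  also have "\<dots> \<le> Ca * dt^2 + Ca * h4"
    using constants K0 h4 T by (intro add_mono mult_right_mono) (auto simp: Ca_def)
  also have "\<dots> \<le> S"
  proof -
    have "Ca * (h4 + dt^2) \<le> Cs * (h4 + dt^2)" using constants K0 h4 by (intro mult_right_mono) (auto simp: Cs_def)
    then show ?thesis by (simp add: S_def h4_def distrib_left)
  qed
  finally show "(\<Sum>m<M. dt * \<alpha> m) \<le> S" .
qed

text \<open>All terms carry h^4, and the division by \<open>dt\<close> is compensated by the factor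
  \<open>dt\<close> in the sums of the squared step integrals.\<close>

lemma \<kappa>_sum: "(\<Sum>m<M. \<kappa> m / dt) \<le> S" "0 \<le> \<kappa> m"
proof -
  define h4 where "h4 = 1 / real J ^ 4"
  have h4: "0 \<le> h4" by (simp add: h4_def)
  have K0: "0 \<le> K" using constants by simp
  show "0 \<le> \<kappa> m" using K0 by (simp add: \<kappa>_def)
  \<comment> \<open>In the shifted sum the index 0 - 1 = 0 counts the first term twice, hence the
    factor 2 and the coefficient 24 = 8 * 3 in \<open>Ck\<close>.\<close>
  have pre: "(\<Sum>m<M. (I2 (m - 1))^2) \<le> 2 * (\<Sum>m<M. (I2 m)^2)"
  proof -
    obtain q where q: "M = Suc q" using M by (cases M) auto
    have "(\<Sum>m<Suc q. f (m - 1)) = f 0 + (\<Sum>m<q. f m)" for f :: "nat \<Rightarrow> real"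
      by (subst sum.lessThan_Suc_shift) simp
    from this[of "\<lambda>m. (I2 m)^2", folded q] have "(\<Sum>m<M. (I2 (m - 1))^2) = (I2 0)^2 + (\<Sum>m<q. (I2 m)^2)" .
    moreover have "(I2 0)^2 \<le> (\<Sum>m<M. (I2 m)^2)" using M by (intro member_le_sum) auto
    moreover have "(\<Sum>m<q. (I2 m)^2) \<le> (\<Sum>m<M. (I2 m)^2)" using q by (intro sum_mono2) auto
    ultimately show ?thesis by simp
  qed
  have k: "\<kappa> m / dt = 192 * K ^ 6 * h4 * (4 * K^2 * dt + 16 / dt * (I1 m)^2 + 8 / dt * ((I2 m)^2 + (I2 (m - 1))^2))" for m
  proof -
    have "(4 * K^2 * dt^2 + 16 * a + 8 * b) / dt = 4 * K^2 * dt + 16 / dt * a + 8 / dt * b" for a b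
      using dt(1) by (simp add: field_simps power2_eq_square)
    moreover have "\<kappa> m / dt = 192 * K ^ 6 * h4 * ((4 * K^2 * dt^2 + 16 * (I1 m)^2 + 8 * ((I2 m)^2 + (I2 (m - 1))^2)) / dt)"
      by (simp add: \<kappa>_def h4_def)
    ultimately show ?thesis by presburger
  qed
  have "(\<Sum>m<M. \<kappa> m / dt) = 192 * K ^ 6 * h4 * (4 * K^2 * T + 16 / dt * (\<Sum>m<M. (I1 m)^2) + 8 / dt * ((\<Sum>m<M. (I2 m)^2) + (\<Sum>m<M. (I2 (m - 1))^2)))"
  proof -
    have lin: "(\<Sum>m<n. a * (p + q * u m + b * (v m + w m))) = a * (real n * p + q * (\<Sum>m<n. u m) + b * ((\<Sum>m<n. v m) + (\<Sum>m<n. w m)))"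
      for a p q b :: real and u v w :: "nat \<Rightarrow> real" and n
      by (induction n) (simp_all add: algebra_simps)
    have "real M * (4 * K^2 * dt) = 4 * K^2 * (real M * dt)" by (simp only: mult_ac)
    then show ?thesis unfolding k lin dt(2) by simp
  qed
  also have "\<dots> \<le> 192 * K ^ 6 * h4 * (4 * K^2 * T + 16 / dt * (dt * \<Gamma>1) + 8 / dt * (dt * \<Gamma>2 + 2 * (dt * \<Gamma>2)))"
    using I_sums pre dt(1) K0 h4 by (intro mult_left_mono add_mono order_refl) auto
  also have "\<dots> = Ck * h4" using dt(1) by (simp add: Ck_def algebra_simps)
  also have "\<dots> \<le> Cs * h4" using constants K0 h4 by (intro mult_right_mono) (auto simp: Cs_def)
  also have "\<dots> \<le> S" using constants by (simp add: S_def h4_def distrib_left)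
  finally show "(\<Sum>m<M. \<kappa> m / dt) \<le> S" .
qed

section \<open>Existence, uniqueness and errors of the discrete solution\<close>

definition "nodal_solution k U \<longleftrightarrow> U 0 = Y 0 \<and> (\<forall>n\<le>k. cyc J (U n)) \<and>
  (\<forall>m<k. \<forall>H. cyc J H \<longrightarrow> scheme_form J (U m) (\<lambda>j. (U (Suc m) j - U m j) /\<^sub>R dt) (U (Suc m)) H = 0)"

lemma scheme_error:
  assumes h: "1 / real J \<le> 1 / (2 * B^2)" and k: "k \<le> M" and U: "nodal_solution k U"
  shows "scheme_error J k dt T K c S Y U g \<alpha> \<kappa>"
proof (rule scheme_error.intro)
  note Y = Y_facts[OF h]
  have "real k * dt \<le> real M * dt" using k dt(1) by (intro mult_right_mono) auto
  then show "real k * dt \<le> T" using dt(2) by simp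
  show "1 \<le> J" "0 < dt" "1 \<le> K" "0 < c" "c \<le> 1" using J dt constants by auto
  show S: "0 \<le> S" using constants by (simp add: S_def)
  show "cyc J (Y n)" for n by (rule Y)
  show "cyc J (U n)" if "n \<le> k" for n using U that by (simp add: nodal_solution_def)
  show "norm (Y n j) \<le> K" "norm (slope J (Y n) j) \<le> K" "2 * c \<le> Y n j \<bullet> e1" "2 * c \<le> norm (slope J (Y n) j)"
    "norm (slope J (Y n) (Suc j) - slope J (Y n) j) \<le> K / real J" for n j by (rule Y)+
  show "norm (Y (Suc n) j - Y n j) \<le> K * dt" if "n < k" for n j
    unfolding Y_def by (rule increments(1)) (use that k in simp)
  show "scheme_form J (U m) (\<lambda>j. (U (Suc m) j - U m j) /\<^sub>R dt) (U (Suc m)) H = 0" if "m < k" "cyc J H" for m H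
    using U that by (simp add: nodal_solution_def)
  show "U 0 j = Y 0 j" for j using U by (simp add: nodal_solution_def)
  show "\<bar>scheme_form J (Y m) (\<lambda>j. (Y (Suc m) j - Y m j) /\<^sub>R dt) (Y (Suc m)) H - (\<Sum>j<J. g (Suc m) j \<bullet> (H (Suc j) - H j))\<bar>
        \<le> \<epsilon> * n2 J H + \<alpha> m / \<epsilon>" if "m < k" "cyc J H" "0 < \<epsilon>" for m H \<epsilon>
    by (rule consistent[OF h _ that(2,3)]) (use that k in simp)
  show "n2 J (g n) \<le> S" if "1 \<le> n" "n \<le> k" for n
  proof -
    have "n2 J (g n) \<le> 36 * K ^ 8 * (1 / real J ^ 4)" using g_bound[of n] that k by simp
    also have "\<dots> \<le> Cs * (1 / real J ^ 4)" using constants by (intro mult_right_mono) (auto simp: Cs_def)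
    also have "\<dots> \<le> S" using constants by (simp add: S_def distrib_left)
    finally show ?thesis .
  qed
  show "n2 J (\<lambda>j. g (Suc n) j - g n j) \<le> \<kappa> n" if "1 \<le> n" "n < k" for n
    by (rule g_increment) (use that k in auto)
  show "0 \<le> \<alpha> m" "0 \<le> \<kappa> m" for m by (rule \<alpha>_sum \<kappa>_sum)+
  show "(\<Sum>m<k. dt * \<alpha> m) \<le> S"
    using k dt(1) \<alpha>_sum(2) by (intro order_trans[OF sum_mono2[of "{..<M}"] \<alpha>_sum(1)]) auto
  show "(\<Sum>m<k. \<kappa> m / dt) \<le> S"
    using k dt(1) \<kappa>_sum(2) by (intro order_trans[OF sum_mono2[of "{..<M}"] \<kappa>_sum(1)]) auto
qed

lemma nodal_step:
  assumes h: "1 / real J \<le> 1 / (2 * B^2)" and small: "real J * (Z * S) \<le> c^2" and k: "k \<le> M" and U: "nodal_solution k U"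
  shows "c \<le> U k j \<bullet> e1" "c \<le> norm (slope J (U k) j)"
    "s2 J (\<lambda>j. Y k j - U k j) \<le> Z * S" "n2 J (\<lambda>j. Y k j - U k j) \<le> Z * S"
    "(\<Sum>m<k. dt * n2 J (\<lambda>j. ((Y (Suc m) j - U (Suc m) j) - (Y m j - U m j)) /\<^sub>R dt)) \<le> Z * S"
proof -
  note se = scheme_error[OF h k U]
  have S0: "0 \<le> S" using constants by (simp add: S_def)
  have ZS: "scheme_error.C6 T K c * S \<le> Z * S" using S0 by (intro mult_right_mono) (auto simp: Z_def)
  then have sm: "real J * (scheme_error.C6 T K c * S) \<le> c^2"
    using small mult_left_mono[OF ZS, of "real J"] by simp
  note st = scheme_error.stability[OF se sm order_refl]
  show "c \<le> U k j \<bullet> e1" "c \<le> norm (slope J (U k) j)"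
    using scheme_error.goodD(3,4)[OF se st(1) order_refl] by auto
  show "s2 J (\<lambda>j. Y k j - U k j) \<le> Z * S" "n2 J (\<lambda>j. Y k j - U k j) \<le> Z * S"
    "(\<Sum>m<k. dt * n2 J (\<lambda>j. ((Y (Suc m) j - U (Suc m) j) - (Y m j - U m j)) /\<^sub>R dt)) \<le> Z * S"
    using st(2-4) ZS by (simp_all only: diff_Suc_1)
qed

lemma nodal_restrict: "nodal_solution k U \<Longrightarrow> n \<le> k \<Longrightarrow> nodal_solution n U"
  by (simp add: nodal_solution_def)

text \<open>Existence and stability advance together: stability of the k steps already constructed
  keeps the coefficients above c, which makes the next linear system coercive.\<close>

lemma nodal_exists:
  assumes h: "1 / real J \<le> 1 / (2 * B^2)" and small: "real J * (Z * S) \<le> c^2"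
  shows "k \<le> M \<Longrightarrow> \<exists>U. nodal_solution k U"
proof (induction k)
  case 0
  have "nodal_solution 0 Y" using Y_facts(1)[OF h] by (simp add: nodal_solution_def)
  then show ?case by blast
next
  case (Suc k)
  then have k: "k \<le> M" by simp
  from Suc.IH[OF k] obtain U where U: "nodal_solution k U" by blast
  have "cyc J (U k)" using U by (simp add: nodal_solution_def)
  from step_solvable[OF J dt(1) constants(4) this nodal_step(1,2)[OF h small k U]]
  obtain V where V: "cyc J V" "\<And>H. cyc J H \<Longrightarrow> scheme_form J (U k) (\<lambda>j. (V j - U k j) /\<^sub>R dt) V H = 0" by blast
  have "nodal_solution (Suc k) (U(Suc k := V))"
    using U V by (auto simp: nodal_solution_def le_Suc_eq less_Suc_eq)
  then show ?case by blast
qed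

lemma solution_iff_nodal:
  assumes X: "\<And>n. n \<le> M \<Longrightarrow> X n = plin J (U n)" and cyc: "\<And>n. n \<le> M \<Longrightarrow> cyc J (U n)" and m: "m < M"
  shows "(\<forall>\<eta>\<in>Vh_vec J. l2_inner (\<lambda>z. (X m z \<bullet> e1) *\<^sub>R D_t (T / real M) X (m + 1) z) (\<lambda>z. (norm (d_rho (X m) z))^2 *\<^sub>R \<eta> z)
        + l2_inner (\<lambda>z. (X m z \<bullet> e1) *\<^sub>R d_rho (X (m + 1)) z) (d_rho \<eta>)
        + l2_inner (\<lambda>z. \<eta> z \<bullet> e1) (\<lambda>z. (norm (d_rho (X m) z))^2) = 0)
    \<longleftrightarrow> (\<forall>H. cyc J H \<longrightarrow> scheme_form J (U m) (\<lambda>j. (U (Suc m) j - U m j) /\<^sub>R dt) (U (Suc m)) H = 0)"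
    (is "(\<forall>\<eta>\<in>Vh_vec J. ?F \<eta> = 0) \<longleftrightarrow> _")
proof -
  have e: "?F (plin J H) = scheme_form J (U m) (\<lambda>j. (U (Suc m) j - U m j) /\<^sub>R dt) (U (Suc m)) H" if "cyc J H" for H
    unfolding dt_def by (rule scheme_eq_form[OF J cyc cyc that X]) (use m X in auto)
  show ?thesis
  proof (intro iffI allI impI ballI)
    fix H :: "nat \<Rightarrow> real^2" assume a: "\<forall>\<eta>\<in>Vh_vec J. ?F \<eta> = 0" and H: "cyc J H"
    from bspec[OF a plin_in_Vh_vec[OF J H]] show "scheme_form J (U m) (\<lambda>j. (U (Suc m) j - U m j) /\<^sub>R dt) (U (Suc m)) H = 0"
      unfolding e[OF H] .
  next
    fix \<eta> assume a: "\<forall>H. cyc J H \<longrightarrow> scheme_form J (U m) (\<lambda>j. (U (Suc m) j - U m j) /\<^sub>R dt) (U (Suc m)) H = 0" and \<eta>: "\<eta> \<in> Vh_vec J"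
    note n = Vh_vec_eq_plin[OF J \<eta>]
    show "?F \<eta> = 0" using e[OF n(3)] a n(3) unfolding n(1)[symmetric] by simp
  qed
qed

lemma initial: "interp_vec J (x 0) = plin J (Y 0)"
proof -
  have "tm 0 = 0" using T by (simp add: tm_def)
  then show ?thesis using interp_vec_eq_plin[OF J x_periodic[of 0]] T unfolding Y_def[abs_def] by simp
qed

lemma solution_exists:
  assumes U: "nodal_solution M U"
  shows "scheme_solution J M T (x 0) (\<lambda>n. plin J (U n))"
  unfolding scheme_solution_def
proof (intro conjI allI impI)
  have c: "cyc J (U n)" if "n \<le> M" for n using U that by (simp add: nodal_solution_def)
  show "plin J (U 0) = interp_vec J (x 0)" using U by (simp add: initial nodal_solution_def)
  show "plin J (U m) \<in> Vh_vec J" if "m \<le> M" for m by (rule plin_in_Vh_vec[OF J c[OF that]])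
  fix m assume m: "m < M"
  show "\<forall>\<eta>\<in>Vh_vec J. l2_inner (\<lambda>z. (plin J (U m) z \<bullet> e1) *\<^sub>R D_t (T / real M) (\<lambda>n. plin J (U n)) (m + 1) z)
        (\<lambda>z. (norm (d_rho (plin J (U m)) z))^2 *\<^sub>R \<eta> z)
        + l2_inner (\<lambda>z. (plin J (U m) z \<bullet> e1) *\<^sub>R d_rho (plin J (U (m + 1))) z) (d_rho \<eta>)
        + l2_inner (\<lambda>z. \<eta> z \<bullet> e1) (\<lambda>z. (norm (d_rho (plin J (U m)) z))^2) = 0"
    using solution_iff_nodal[of "\<lambda>n. plin J (U n)" U m, OF refl c m] U m by (simp add: nodal_solution_def)
qed

text \<open>Only the constructed solution is known to have controlled coefficients. Another solution
  agrees with it at level n by induction, hence both solve the same coercive system for level n +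
  1.\<close>

lemma solution_unique:
  assumes h: "1 / real J \<le> 1 / (2 * B^2)" and small: "real J * (Z * S) \<le> c^2" and U: "nodal_solution M U"
    and W: "scheme_solution J M T (x 0) W"
  shows "n \<le> M \<Longrightarrow> W n = plin J (U n)"
proof (induction n)
  case 0
  then show ?case using W U by (simp add: scheme_solution_def nodal_solution_def initial)
next
  case (Suc n)
  then have n: "n < M" "n \<le> M" by auto
  define V where "V m = (\<lambda>j. W m (node J j))" for m
  have V: "W m = plin J (V m)" "cyc J (V m)" if "m \<le> M" for m
    using Vh_vec_eq_plin[OF J, of "W m"] W that by (auto simp: scheme_solution_def V_def)
  have c: "cyc J (U m)" if "m \<le> M" for m using U that by (simp add: nodal_solution_def)
  have "V n j = U n j" for j
  proof -
    have e: "W n = plin J (U n)" using Suc.IH n by simp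
    have "plin J (U n) (node J j) = U n j" if "j \<le> J" for j by (rule plin_node[OF that J c[OF n(2)]])
    then have "V n j = U n j" if "j < J" for j using that by (simp add: V_def e)
    then show ?thesis
      using cyc_hat_expansion[OF J V(2)[OF n(2)], of j] cyc_hat_expansion[OF J c[OF n(2)], of j] by simp
  qed
  then have VUn: "V n = U n" by blast
  have "scheme_form J (U n) (\<lambda>j. (V (Suc n) j - U n j) /\<^sub>R dt) (V (Suc n)) H = 0" if "cyc J H" for H
    using solution_iff_nodal[of W V n, OF V n(1)] W n(1) that unfolding VUn by (simp add: scheme_solution_def)
  moreover have "scheme_form J (U n) (\<lambda>j. (U (Suc n) j - U n j) /\<^sub>R dt) (U (Suc n)) H = 0" if "cyc J H" for H
    using U n(1) that by (simp add: nodal_solution_def)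
  ultimately have "V (Suc n) j = U (Suc n) j" for j
    by (rule step_unique[OF J dt(1) constants(4) V(2)[OF Suc.prems] c[OF Suc.prems] nodal_step(1,2)[OF h small n(2) nodal_restrict[OF U n(2)]]])
  then have "V (Suc n) = U (Suc n)" by blast
  then show ?case using V(1)[OF Suc.prems] by simp
qed

lemma interpolant_error:
  assumes h: "1 / real J \<le> 1 / (2 * B^2)"
  shows "AE z in I_measure. norm (x (tm n) z - plin J (Y n) z) \<le> K / (real J)^2"
    "AE z in I_measure. norm (d_rho (x (tm n)) z - dplin J (Y n) z) \<le> K / real J"
proof -
  note Y = Y_facts[OF h]
  show "AE z in I_measure. norm (x (tm n) z - plin J (Y n) z) \<le> K / (real J)^2"
    using AE_open_element[OF J]
  proof eventually_elim
    case (elim z)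
    then obtain j where j: "j < J" "z \<in> open_element J j" by blast
    then have "z \<in> element J j" by auto
    then show ?case using Y(8)[of z j n] plin_element[OF j(1) Y(1), of z n] by (simp add: aff_def)
  qed
  show "AE z in I_measure. norm (d_rho (x (tm n)) z - dplin J (Y n) z) \<le> K / real J"
    using AE_open_element[OF J]
  proof eventually_elim
    case (elim z)
    then obtain j where j: "j < J" "z \<in> open_element J j" by blast
    then have "z \<in> element J j" by auto
    then show ?case using Y(7)[of z j n] dplin_open[OF j, of "Y n"] by simp
  qed
qed

lemma error_L2:
  assumes h: "1 / real J \<le> 1 / (2 * B^2)" and small: "real J * (Z * S) \<le> c^2" and U: "nodal_solution M U" and n: "n \<le> M"
  shows "(l2_norm (\<lambda>z. x (tm n) z - plin J (U n) z))^2 \<le> 2 * K^2 / real J ^ 4 + 2 * (Z * S)"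
proof -
  have cU: "cyc J (U n)" and cY: "cyc J (Y n)" using U n Y_facts(1)[OF h] by (auto simp: nodal_solution_def)
  have cE: "cyc J (\<lambda>j. Y n j - U n j)" using cU cY by (simp add: cyc_def)
  have pl: "plin J V \<in> L2_space" if "cyc J V" for V :: "nat \<Rightarrow> real^2"
    by (rule L2_space_continuous[OF plin_continuous[OF J that] periodic_plin(1)])
  have a: "(\<lambda>z. x (tm n) z - plin J (Y n) z) \<in> L2_space" by (intro L2_space_diff x_L2[OF tm_range] pl[OF cY])
  have "l2_norm (\<lambda>z. x (tm n) z - plin J (U n) z)
    = l2_norm (\<lambda>z. (x (tm n) z - plin J (Y n) z) + plin J (\<lambda>j. Y n j - U n j) z)"
    by (simp add: plin_diff[symmetric])
  also have "\<dots> \<le> l2_norm (\<lambda>z. x (tm n) z - plin J (Y n) z) + l2_norm (plin J (\<lambda>j. Y n j - U n j))"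
    by (rule l2_norm_triangle[OF a pl[OF cE]])
  also have "l2_norm (\<lambda>z. x (tm n) z - plin J (Y n) z) \<le> K / (real J)^2"
    by (rule l2_norm_le_AE[OF interpolant_error(1)[OF h] _ a]) (use constants in simp)
  finally have "(l2_norm (\<lambda>z. x (tm n) z - plin J (U n) z))^2 \<le> (K / (real J)^2 + l2_norm (plin J (\<lambda>j. Y n j - U n j)))^2"
    by (intro power_mono l2_norm_nonneg) auto
  also have "\<dots> \<le> 2 * (K / (real J)^2)^2 + 2 * (l2_norm (plin J (\<lambda>j. Y n j - U n j)))^2" by (rule sum2_sq)
  also have "\<dots> \<le> 2 * (K / (real J)^2)^2 + 2 * (Z * S)"
    using l2_norm_plin[OF J cE] nodal_step(4)[OF h small n nodal_restrict[OF U n]] by simp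
  finally show ?thesis by (simp add: power_divide flip: power_mult)
qed

text \<open>\<open>h1_seminorm\<close> refers to an unspecified representative of the weak
  derivative. The error is Lipschitz and differentiable inside the elements, which identifies the
  representative almost everywhere. The term h^2 is the interpolation error; the nodal error
  contributes only h^4 + dt^2.\<close>

lemma error_H1:
  assumes h: "1 / real J \<le> 1 / (2 * B^2)" and small: "real J * (Z * S) \<le> c^2" and U: "nodal_solution M U" and n: "n \<le> M"
  shows "(h1_seminorm (\<lambda>z. x (tm n) z - plin J (U n) z))^2 \<le> 2 * K^2 / (real J)^2 + 2 * (Z * S)"
proof -
  let ?f = "\<lambda>z. x (tm n) z - plin J (U n) z"
  let ?f' = "\<lambda>z. d_rho (x (tm n)) z - dplin J (U n) z"
  have cU: "cyc J (U n)" and cY: "cyc J (Y n)" using U n Y_facts(1)[OF h] by (auto simp: nodal_solution_def)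
  obtain L where L: "\<And>j. norm (slope J (U n) j) \<le> L" using cyc_bounded[OF J cyc_slope[OF cU]] by blast
  have xd: "(\<lambda>z. d_rho (x (tm n)) z) \<in> L2_space"
    by (rule L2_space_continuous[OF curve_continuous(2) periodic_d_rho[OF curve(1,2)]])
  have f': "?f' \<in> L2_space" by (intro L2_space_diff xd dplin_L2[OF J])
  have ae: "AE z in I_measure. ((\<lambda>h. (?f (z + h) - ?f z) /\<^sub>R h) \<longlongrightarrow> ?f' z) (at_right 0)"
    using AE_open_element[OF J]
  proof eventually_elim
    case (elim z)
    then obtain j where j: "j < J" "z \<in> open_element J j" by blast
    then have "(?f has_vector_derivative ?f' z) (at z)"
      unfolding dplin_open[OF j] by (intro has_vector_derivative_diff curve(2) plin_has_vector_derivative[OF j(1) cU])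
    then show ?case by (rule vector_derivative_quotients(1))
  qed
  have "has_weak_deriv ?f ?f'"
  proof (rule has_weak_deriv_lipschitz[OF _ _ _ _ ae])
    show "periodic ?f" using curve(1)[of n] periodic_plin(1)[of J "U n"] by (simp add: periodic_def)
    show "periodic ?f'" "?f' \<in> borel_measurable I_measure" using f' by (auto simp: L2_space_def)
    fix a b :: real
    have "norm (?f a - ?f b) \<le> norm (x (tm n) a - x (tm n) b) + norm (plin J (U n) a - plin J (U n) b)"
      using norm_triangle_ineq4[of "x (tm n) a - x (tm n) b" "plin J (U n) a - plin J (U n) b"] by (simp add: algebra_simps)
    also have "\<dots> \<le> B * \<bar>a - b\<bar> + L * \<bar>a - b\<bar>"
      by (intro add_mono C1_lipschitz[OF curve(2) curve(4)] plin_lipschitz[OF J cU L])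
    finally show "norm (?f a - ?f b) \<le> (B + L) * \<bar>a - b\<bar>" by (simp add: distrib_right)
  qed
  then have w: "AE z in I_measure. weak_deriv ?f z = ?f' z" and wd: "has_weak_deriv ?f (weak_deriv ?f)"
    by (rule weak_deriv_AE_eq, rule has_weak_deriv_weak_deriv)
  have "h1_seminorm ?f = l2_norm ?f'"
    unfolding h1_seminorm_def
    by (rule l2_norm_AE_cong[OF w]) (use wd f' in \<open>auto simp: has_weak_deriv_def L2_space_def\<close>)
  also have "\<dots> = l2_norm (\<lambda>z. (d_rho (x (tm n)) z - dplin J (Y n) z) + dplin J (\<lambda>j. Y n j - U n j) z)"
    by (simp add: dplin_diff[symmetric])
  also have "\<dots> \<le> l2_norm (\<lambda>z. d_rho (x (tm n)) z - dplin J (Y n) z) + l2_norm (dplin J (\<lambda>j. Y n j - U n j))"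
    by (intro l2_norm_triangle L2_space_diff xd dplin_L2[OF J])
  also have "l2_norm (\<lambda>z. d_rho (x (tm n)) z - dplin J (Y n) z) \<le> K / real J"
    by (intro l2_norm_le_AE[OF interpolant_error(2)[OF h]] L2_space_diff xd dplin_L2[OF J]) (use constants in simp)
  finally have "(h1_seminorm ?f)^2 \<le> (K / real J + l2_norm (dplin J (\<lambda>j. Y n j - U n j)))^2"
    by (intro power_mono) (auto simp: h1_seminorm_def l2_norm_nonneg)
  also have "\<dots> \<le> 2 * (K / real J)^2 + 2 * (l2_norm (dplin J (\<lambda>j. Y n j - U n j)))^2" by (rule sum2_sq)
  also have "\<dots> \<le> 2 * (K / real J)^2 + 2 * (Z * S)"
    using dplin_L2(2)[OF J, of "\<lambda>j. Y n j - U n j"] nodal_step(3)[OF h small n nodal_restrict[OF U n]] by simp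
  finally show ?thesis by (simp add: power_divide)
qed

lemma d_interpolation:
  assumes m: "m < M"
  shows "(l2_norm (\<lambda>z. d m z - plin J (\<lambda>j. (Y (Suc m) j - Y m j) /\<^sub>R dt) z))^2 \<le> (N m)^2 / real J ^ 4"
proof -
  define V where "V j = (Y (Suc m) j - Y m j) /\<^sub>R dt" for j
  have Vd: "V = (\<lambda>j. d m (node J j))" by (simp add: fun_eq_iff V_def Y_def d_def)
  have cV: "cyc J V" unfolding Vd by (rule cyc_nodes[OF d_continuous(3) J])
  have c: "continuous_on UNIV (\<lambda>z. d m z - plin J V z)"
    by (intro continuous_intros d_continuous plin_continuous[OF J cV])
  have b: "norm (integral (element J j) (\<lambda>z. (norm (d m z - plin J V z))^2)) \<le> (osc m j / real J)^2 / real J" if j: "j < J" for j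
  proof (rule element_integral_bound[OF J])
    show "continuous_on (element J j) (\<lambda>z. (norm (d m z - plin J V z))^2)"
      by (intro continuous_intros continuous_on_subset[OF c]) auto
    fix z assume z: "z \<in> element J j"
    have "norm (d m z - plin J V z) \<le> osc m j / real J"
    proof -
      have o: "\<And>a b. a \<in> element J j \<Longrightarrow> b \<in> element J j \<Longrightarrow> norm (d' m a - d' m b) \<le> osc m j"
        unfolding osc_def by (rule oscillation(1)[OF J d_continuous(2)])
      show ?thesis
        using interpolation_error(2)[OF J d_derivative o z] unfolding plin_element[OF j cV z] by (simp add: Vd aff_def)
    qed
    then show "norm ((norm (d m z - plin J V z))^2) \<le> (osc m j / real J)^2" by (simp add: power_mono)
  qed
  have "(l2_norm (\<lambda>z. d m z - plin J V z))^2 \<le> (\<Sum>j<J. (osc m j / real J)^2 / real J)"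
    unfolding l2_norm_elements[OF J c] using b by (intro sum_mono) (auto simp: abs_le_iff)
  also have "\<dots> = (\<Sum>j<J. (osc m j)^2) / real J ^ 3"
    by (simp add: sum_divide_distrib power_divide power2_eq_square power3_eq_cube)
  also have "\<dots> \<le> ((N m)^2 / real J) / real J ^ 3" using osc_sum[OF m] by (intro divide_right_mono) auto
  finally show ?thesis unfolding V_def[abs_def] by (simp add: power_Suc[symmetric] del: power_Suc) (simp add: mult.commute power_Suc2[symmetric] del: power_Suc2)?
qed

text \<open>Three parts: \<open>x_t\<close> minus the difference quotient of the exact solution, the
  interpolation error of that quotient, and the quotient of the nodal error.\<close>

lemma error_velocity:
  assumes h: "1 / real J \<le> 1 / (2 * B^2)" and small: "real J * (Z * S) \<le> c^2" and U: "nodal_solution M U"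
  shows "dt * (\<Sum>m<M. (l2_norm (\<lambda>z. x_t (tm (Suc m)) z - D_t dt (\<lambda>n. plin J (U n)) (m + 1) z))^2)
    \<le> 3 * (dt^2 * \<Gamma>2 + 4 * \<Gamma>1 / real J ^ 4 + Z * S)"
proof -
  define D where "D m j = ((Y (Suc m) j - U (Suc m) j) - (Y m j - U m j)) /\<^sub>R dt" for m j
  have one: "(l2_norm (\<lambda>z. x_t (tm (Suc m)) z - D_t dt (\<lambda>n. plin J (U n)) (m + 1) z))^2
      \<le> 3 * ((I2 m)^2 + (N m)^2 / real J ^ 4 + n2 J (D m))" if m: "m < M" for m
  proof -
    define V where "V j = (Y (Suc m) j - Y m j) /\<^sub>R dt" for j
    have cyc: "cyc J (U m)" "cyc J (U (Suc m))" "cyc J (Y m)" "cyc J (Y (Suc m))"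
      using U m Y_facts(1)[OF h] by (auto simp: nodal_solution_def)
    then have cV: "cyc J V" "cyc J (D m)" by (simp_all add: cyc_def V_def D_def)
    have pl: "plin J V \<in> L2_space" if "cyc J V" for V :: "nat \<Rightarrow> real^2"
      by (rule L2_space_continuous[OF plin_continuous[OF J that] periodic_plin(1)])
    have e: "x_t (tm (Suc m)) z - D_t dt (\<lambda>n. plin J (U n)) (m + 1) z
      = (x_t (tm (Suc m)) z - d m z) + ((d m z - plin J V z) + plin J (D m) z)" for z
    proof -
      have "D_t dt (\<lambda>n. plin J (U n)) (m + 1) z = plin J (\<lambda>j. (U (Suc m) j - U m j) /\<^sub>R dt) z"
        by (simp add: D_t_def plin_diff plin_scale)
      moreover have "plin J (D m) z = plin J V z - plin J (\<lambda>j. (U (Suc m) j - U m j) /\<^sub>R dt) z"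
        unfolding plin_diff by (rule arg_cong[of _ _ "\<lambda>V. plin J V z"]) (simp add: fun_eq_iff D_def V_def algebra_simps)
      ultimately show ?thesis by simp
    qed
    have a: "(\<lambda>z. x_t (tm (Suc m)) z - d m z) \<in> L2_space" "(\<lambda>z. d m z - plin J V z) \<in> L2_space"
      by (intro L2_space_diff x_t_L2[OF tm_range] d_L2 pl[OF cV(1)])+
    define u v w where "u = l2_norm (\<lambda>z. x_t (tm (Suc m)) z - d m z)" and "v = l2_norm (\<lambda>z. d m z - plin J V z)" and "w = l2_norm (plin J (D m))"
    have "l2_norm (\<lambda>z. x_t (tm (Suc m)) z - D_t dt (\<lambda>n. plin J (U n)) (m + 1) z) \<le> u + (v + w)"
      unfolding e u_def v_def w_def
      using l2_norm_triangle[OF a(1) L2_space_add[OF a(2) pl[OF cV(2)]]] l2_norm_triangle[OF a(2) pl[OF cV(2)]] by linarith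
    then have "(l2_norm (\<lambda>z. x_t (tm (Suc m)) z - D_t dt (\<lambda>n. plin J (U n)) (m + 1) z))^2 \<le> (u + (v + w))^2"
      by (intro power_mono l2_norm_nonneg) auto
    also have "\<dots> \<le> 3 * (u^2 + v^2 + w^2)"
      using sum3_sq[of u v w] by (simp add: add.assoc)
    also have "u^2 \<le> (I2 m)^2"
    proof -
      have "u = l2_norm (\<lambda>z. d m z - x_t (tm (Suc m)) z)"
        by (simp add: u_def l2_norm_def l2_inner_def inner_diff algebra_simps)
      then show ?thesis using increments(5)[OF m] by (simp add: power_mono l2_norm_nonneg)
    qed
    also have "v^2 \<le> (N m)^2 / real J ^ 4" unfolding v_def V_def[abs_def] by (rule d_interpolation[OF m])
    also have "w^2 \<le> n2 J (D m)" unfolding w_def by (rule l2_norm_plin[OF J cV(2)])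
    finally show ?thesis by simp
  qed
  have "dt * (\<Sum>m<M. (l2_norm (\<lambda>z. x_t (tm (Suc m)) z - D_t dt (\<lambda>n. plin J (U n)) (m + 1) z))^2)
    \<le> dt * (\<Sum>m<M. 3 * ((I2 m)^2 + (N m)^2 / real J ^ 4 + n2 J (D m)))"
    using one dt(1) by (intro mult_left_mono sum_mono) auto
  also have "\<dots> = 3 * (dt * (\<Sum>m<M. (I2 m)^2) + (4 / dt * (\<Sum>m<M. (I1 m)^2)) / real J ^ 4 + (\<Sum>m<M. dt * n2 J (D m)))"
  proof -
    have n: "(N m)^2 = 4 / dt^2 * (I1 m)^2" for m by (simp add: N_def power_divide power_mult_distrib)
    have "(\<Sum>m<k. 3 * (u m + q * v m / t + w m)) = 3 * ((\<Sum>m<k. u m) + q * (\<Sum>m<k. v m) / t + (\<Sum>m<k. w m))"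
      for k q t and u v w :: "nat \<Rightarrow> real"
      by (induction k) (simp_all add: algebra_simps add_divide_distrib)
    from this[of "\<lambda>m. (I2 m)^2" "4 / dt^2" "\<lambda>m. (I1 m)^2" "real J ^ 4" "\<lambda>m. n2 J (D m)" M]
    show ?thesis unfolding n using dt(1) by (simp add: sum_distrib_left[symmetric] distrib_left power2_eq_square)
  qed
  also have "\<dots> \<le> 3 * (dt * (dt * \<Gamma>2) + (4 / dt * (dt * \<Gamma>1)) / real J ^ 4 + Z * S)"
    using I_sums dt(1) nodal_step(5)[OF h small order_refl U]
    by (intro mult_left_mono add_mono divide_right_mono) (auto simp: D_def[abs_def])
  also have "\<dots> = 3 * (dt^2 * \<Gamma>2 + 4 * \<Gamma>1 / real J ^ 4 + Z * S)" using dt(1) by (simp add: power2_eq_square)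
  finally show ?thesis .
qed

end

theorem theorem2p2:
  fixes T :: real
    and x x_t x_tt :: "real \<Rightarrow> real \<Rightarrow> real^2"
  assumes T: "T > 0"
    and x_continuous_rep: "\<And>t. t \<in> {0..T} \<Longrightarrow> continuous_on UNIV (x t)"
    and x_reg: "x \<in> C_time T W2inf_space w2inf_norm"
    and x_t_deriv: "has_weak_time_deriv T x x_t"
    and x_t_reg: "x_t \<in> L2_time T H2_space h2_norm"
    and x_t_continuous_rep: "x_t \<in> C_time T L2_space l2_norm"
    and x_tt_deriv: "has_weak_time_deriv T x_t x_tt"
    and x_tt_reg: "x_tt \<in> L2_time T L2_space l2_norm"
    and range: "\<And>t \<rho>. t \<in> {0..T} \<Longrightarrow> x t \<rho> \<bullet> e1 \<ge> 0"
    and pde: "\<And>t. t \<in> {0<..T} \<Longrightarrow> AE \<rho> in I_measure.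
        ((x t \<rho> \<bullet> e1) * (norm (d_rho (x t) \<rho>))\<^sup>2) *\<^sub>R x_t t \<rho>
        - weak_deriv (\<lambda>\<sigma>. (x t \<sigma> \<bullet> e1) *\<^sub>R d_rho (x t) \<sigma>) \<rho>
        + (norm (d_rho (x t) \<rho>))\<^sup>2 *\<^sub>R e1 = 0"
    and x_rho_pos: "\<And>t \<rho>. t \<in> {0..T} \<Longrightarrow> norm (d_rho (x t) \<rho>) > 0"
    and x_e1_pos: "\<And>t \<rho>. t \<in> {0..T} \<Longrightarrow> x t \<rho> \<bullet> e1 > 0"
  shows "\<exists>h0 \<gamma> C :: real. h0 > 0 \<and> \<gamma> > 0 \<and> C > 0 \<and>
    (\<forall>J M :: nat. \<forall>h dt :: real.
       J \<ge> 3 \<and> M \<ge> 1 \<and> h = 1 / real J \<and> dt = T / real M \<and> h \<le> h0 \<and> dt \<le> \<gamma> * sqrt h \<longrightarrow>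
       (\<exists>X. scheme_solution J M T (x 0) X \<and>
            (\<forall>Y. scheme_solution J M T (x 0) Y \<longrightarrow> (\<forall>m\<le>M. Y m = X m)) \<and>
            (MAX m\<in>{0..M}. (l2_norm (\<lambda>\<rho>. x (real m * dt) \<rho> - X m \<rho>))\<^sup>2)
              + dt * (\<Sum>m<M. (l2_norm (\<lambda>\<rho>. x_t (real (m + 1) * dt) \<rho> - D_t dt X (m + 1) \<rho>))\<^sup>2)
              \<le> C * (h ^ 4 + dt\<^sup>2) \<and>
            (MAX m\<in>{0..M}. (h1_seminorm (\<lambda>\<rho>. x (real m * dt) \<rho> - X m \<rho>))\<^sup>2)
              \<le> C * (h\<^sup>2 + dt\<^sup>2)))"
proof -
  interpret rs: regular_solution T x x_t x_tt
    by unfold_locales (use assms in auto)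
  obtain B where B: "\<And>t. t \<in> {0..T} \<Longrightarrow> regular_curve B (x t)"
    using rs.uniform_regular by blast
  obtain G1 where G1: "G1 \<in> borel_measurable (time_measure T)" "integrable (time_measure T) (\<lambda>t. (G1 t)^2)"
    "AE t in time_measure T. x_t t \<in> H2_space \<and> h2_norm (x_t t) = G1 t"
  proof -
    have "0 \<le> h2_norm f" for f :: "real \<Rightarrow> real^2" by (simp add: h2_norm_def)
    from L2_time_norm_bound[OF x_t_reg this h2_norm_diff_le] show ?thesis using that by blast
  qed
  obtain G2 where G2: "G2 \<in> borel_measurable (time_measure T)" "integrable (time_measure T) (\<lambda>t. (G2 t)^2)"
    "AE t in time_measure T. x_tt t \<in> L2_space \<and> l2_norm (x_tt t) = G2 t"
  proof -
    have "\<bar>l2_norm f - l2_norm g\<bar> \<le> l2_norm (\<lambda>z. f z - g z)" if fg: "f \<in> L2_space" "g \<in> L2_space" for f g :: "real \<Rightarrow> real^2"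
    proof -
      have "l2_norm f \<le> l2_norm (\<lambda>z. f z - g z) + l2_norm g"
        using l2_norm_triangle[OF L2_space_diff[OF fg] fg(2)] by simp
      moreover have "l2_norm g \<le> l2_norm (\<lambda>z. g z - f z) + l2_norm f"
        using l2_norm_triangle[OF L2_space_diff[OF fg(2,1)] fg(1)] by simp
      moreover have "l2_norm (\<lambda>z. g z - f z) = l2_norm (\<lambda>z. f z - g z)"
        by (simp add: l2_norm_def l2_inner_def inner_diff algebra_simps)
      ultimately show ?thesis by linarith
    qed
    from L2_time_norm_bound[OF x_tt_reg l2_norm_nonneg this] show ?thesis using that by blast
  qed
  interpret rb: regular_bounds T x x_t x_tt B G1 G2
    by unfold_locales (use B G1 G2 in \<open>auto elim: eventually_mono\<close>)
  note K = rb.constants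
  define W where "W = rb.Z * rb.Cs"
  have W: "0 \<le> W" using K by (simp add: W_def rb.Z_def)
  \<comment> \<open>The threshold for h and the step constant at once. Once h^4 and dt^2 are at most
    q h, the nodal error bound W (h^4 + dt^2) is at most 2 q W h, and q makes this at most c^2 h; W
    + 1 keeps the quotient defined when W = 0.\<close>
  define q where "q = min 1 ((rb.c)^2 / (2 * (W + 1)))"
  have q: "0 < q" "q \<le> 1" "W * (2 * q) \<le> (rb.c)^2"
  proof -
    show "0 < q" "q \<le> 1" using K W by (simp_all add: q_def)
    have "(W + 1) * (2 * q) \<le> (W + 1) * (2 * ((rb.c)^2 / (2 * (W + 1))))"
      using W by (intro mult_left_mono) (auto simp: q_def)
    also have "\<dots> = (rb.c)^2" using W by (simp add: divide_eq_eq algebra_simps)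
    finally show "W * (2 * q) \<le> (rb.c)^2" using \<open>0 < q\<close> by (simp add: distrib_right)
  qed
  \<comment> \<open>The first entry is for stability, the second for the lower bound on the
    interpolant in \<open>Y_facts\<close>.\<close>
  define h0 where "h0 = min q (1 / (2 * B^2))"
  \<comment> \<open>5 W adds 2 W from the error of the values and 3 W from the error of the
    velocity; the summand 1 makes C positive.\<close>
  define C where "C = 2 * (rb.K)^2 + 5 * W + 3 * rb.\<Gamma>2 + 12 * rb.\<Gamma>1 + 1"
  show ?thesis
  proof (rule exI[of _ h0], rule exI[of _ q], rule exI[of _ C], intro conjI allI impI)
    show "0 < h0" "0 < q" "0 < C" using q K W by (auto simp: h0_def C_def intro: add_nonneg_pos)
    fix J M :: nat and h dt :: real
    assume a: "3 \<le> J \<and> 1 \<le> M \<and> h = 1 / real J \<and> dt = T / real M \<and> h \<le> h0 \<and> dt \<le> q * sqrt h"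
    interpret discretization T x x_t x_tt B G1 G2 J M by unfold_locales (use a in auto)
    have dt_eq: "local.dt = dt" using a by (simp add: dt_def)
    have J0: "0 < real J" using a by simp
    have h: "0 < h" "h \<le> 1" "h \<le> q" "1 / real J \<le> 1 / (2 * B^2)" using a q J0 by (auto simp: h0_def)
    have hJ: "1 / real J ^ n = h ^ n" for n using a by (simp add: power_divide)
    have ZS: "rb.Z * S = W * (h ^ 4 + dt^2)" by (simp add: S_def W_def hJ dt_eq)
    \<comment> \<open>The condition dt \<le> q sqrt h enters here: it gives dt^2 \<le> q h, so the
      factor J of the inverse inequality is cancelled.\<close>
    have small: "real J * (rb.Z * S) \<le> (rb.c)^2"
    proof -
      have "dt^2 \<le> (q * sqrt h)^2" using a dt(1) by (intro power_mono) (auto simp: dt_eq)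
      also have "\<dots> = q * q * h" using h by (simp add: power_mult_distrib power2_eq_square)
      also have "\<dots> \<le> q * 1 * h" using q h by (intro mult_right_mono mult_left_mono) auto
      finally have "dt^2 \<le> q * h" by simp
      moreover have "h ^ 4 \<le> q * h"
      proof -
        have "h ^ 4 = h ^ 3 * h" by (simp add: power3_eq_cube power4_eq_xxxx)
        moreover have "h ^ 3 \<le> h ^ 1" using h by (intro power_decreasing) auto
        ultimately show ?thesis using h by (simp add: mult_right_mono)
      qed
      ultimately have "W * (h ^ 4 + dt^2) \<le> W * (2 * q * h)" using W by (intro mult_left_mono) auto
      also have "\<dots> \<le> (rb.c)^2 * h" using mult_right_mono[OF q(3), of h] h by (simp add: mult.assoc)
      finally have "real J * (rb.Z * S) \<le> real J * ((rb.c)^2 * h)" unfolding ZS by (rule mult_left_mono) simp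
      also have "\<dots> = (rb.c)^2" using a J0 by simp
      finally show ?thesis .
    qed
    obtain U where U: "nodal_solution M U" using nodal_exists[OF h(4) small order_refl] by blast
    define X where "X n = plin J (U n)" for n
    have tm: "real m * dt = tm m" if "m \<le> M" for m using tm_eq[OF that] by (simp add: dt_eq)
    show "\<exists>X. scheme_solution J M T (x 0) X \<and>
            (\<forall>Y. scheme_solution J M T (x 0) Y \<longrightarrow> (\<forall>m\<le>M. Y m = X m)) \<and>
            (MAX m\<in>{0..M}. (l2_norm (\<lambda>z. x (real m * dt) z - X m z))^2)
              + dt * (\<Sum>m<M. (l2_norm (\<lambda>z. x_t (real (m + 1) * dt) z - D_t dt X (m + 1) z))^2)
              \<le> C * (h ^ 4 + dt^2) \<and>
            (MAX m\<in>{0..M}. (h1_seminorm (\<lambda>z. x (real m * dt) z - X m z))^2)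
              \<le> C * (h^2 + dt^2)"
    proof (rule exI[of _ X], intro conjI allI impI)
      show "scheme_solution J M T (x 0) X" unfolding X_def[abs_def] by (rule solution_exists[OF U])
      show "Y m = X m" if "scheme_solution J M T (x 0) Y" "m \<le> M" for Y m
        unfolding X_def by (rule solution_unique[OF h(4) small U that])
      have max1: "(MAX m\<in>{0..M}. (l2_norm (\<lambda>z. x (real m * dt) z - X m z))^2) \<le> 2 * (rb.K)^2 * h ^ 4 + 2 * (W * (h ^ 4 + dt^2))"
      proof (rule Max.boundedI)
        fix y assume "y \<in> (\<lambda>m. (l2_norm (\<lambda>z. x (real m * dt) z - X m z))^2) ` {0..M}"
        then obtain m where m: "m \<le> M" "y = (l2_norm (\<lambda>z. x (tm m) z - X m z))^2" using tm by auto
        then show "y \<le> 2 * (rb.K)^2 * h ^ 4 + 2 * (W * (h ^ 4 + dt^2))"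
          using error_L2[OF h(4) small U m(1)] hJ[of 4] by (simp add: X_def ZS divide_inverse)
      qed auto
      have vel: "dt * (\<Sum>m<M. (l2_norm (\<lambda>z. x_t (real (m + 1) * dt) z - D_t dt X (m + 1) z))^2)
        \<le> 3 * (dt^2 * rb.\<Gamma>2 + 4 * rb.\<Gamma>1 * h ^ 4 + W * (h ^ 4 + dt^2))"
      proof -
        have "(\<Sum>m<M. (l2_norm (\<lambda>z. x_t (real (m + 1) * dt) z - D_t dt X (m + 1) z))^2)
          = (\<Sum>m<M. (l2_norm (\<lambda>z. x_t (tm (Suc m)) z - D_t local.dt (\<lambda>n. plin J (U n)) (m + 1) z))^2)"
          using tm[of "Suc _"] by (intro sum.cong refl) (simp add: X_def[abs_def] dt_eq del: of_nat_Suc)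
        then show ?thesis
          using error_velocity[OF h(4) small U] hJ[of 4] by (simp add: ZS dt_eq divide_inverse)
      qed
      have pos: "0 \<le> h ^ 4" "0 \<le> h^2" "0 \<le> dt^2" by auto
      show "(MAX m\<in>{0..M}. (l2_norm (\<lambda>z. x (real m * dt) z - X m z))^2)
              + dt * (\<Sum>m<M. (l2_norm (\<lambda>z. x_t (real (m + 1) * dt) z - D_t dt X (m + 1) z))^2)
              \<le> C * (h ^ 4 + dt^2)"
      proof -
        have "C * (h ^ 4 + dt^2) - (2 * (rb.K)^2 * h ^ 4 + 2 * (W * (h ^ 4 + dt^2)) + 3 * (dt^2 * rb.\<Gamma>2 + 4 * rb.\<Gamma>1 * h ^ 4 + W * (h ^ 4 + dt^2)))
          = 2 * (rb.K)^2 * dt^2 + 3 * rb.\<Gamma>2 * h ^ 4 + 12 * rb.\<Gamma>1 * dt^2 + (h ^ 4 + dt^2)"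
          by (simp add: C_def algebra_simps)
        moreover have "0 \<le> 2 * (rb.K)^2 * dt^2 + 3 * rb.\<Gamma>2 * h ^ 4 + 12 * rb.\<Gamma>1 * dt^2 + (h ^ 4 + dt^2)"
          using K pos by (intro add_nonneg_nonneg mult_nonneg_nonneg) auto
        ultimately show ?thesis using max1 vel by linarith
      qed
      show "(MAX m\<in>{0..M}. (h1_seminorm (\<lambda>z. x (real m * dt) z - X m z))^2) \<le> C * (h^2 + dt^2)"
      proof (rule Max.boundedI)
        fix y assume "y \<in> (\<lambda>m. (h1_seminorm (\<lambda>z. x (real m * dt) z - X m z))^2) ` {0..M}"
        then obtain m where m: "m \<le> M" "y = (h1_seminorm (\<lambda>z. x (tm m) z - X m z))^2" using tm by auto
        then have "y \<le> 2 * (rb.K)^2 * h^2 + 2 * (W * (h ^ 4 + dt^2))"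
          using error_H1[OF h(4) small U m(1)] hJ[of 2] by (simp add: X_def ZS divide_inverse)
        also have "\<dots> \<le> 2 * (rb.K)^2 * h^2 + 2 * (W * (h^2 + dt^2))"
          using W power_decreasing[of 2 4 h] h by (intro add_left_mono mult_left_mono add_right_mono) auto
        also have "\<dots> \<le> C * (h^2 + dt^2)"
        proof -
          have "C * (h^2 + dt^2) - (2 * (rb.K)^2 * h^2 + 2 * (W * (h^2 + dt^2)))
            = 2 * (rb.K)^2 * dt^2 + (3 * W + 3 * rb.\<Gamma>2 + 12 * rb.\<Gamma>1 + 1) * (h^2 + dt^2)"
            by (simp add: C_def algebra_simps)
          moreover have "0 \<le> 2 * (rb.K)^2 * dt^2 + (3 * W + 3 * rb.\<Gamma>2 + 12 * rb.\<Gamma>1 + 1) * (h^2 + dt^2)"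
            using K W pos by (intro add_nonneg_nonneg mult_nonneg_nonneg) auto
          ultimately show ?thesis by linarith
        qed
        finally show "y \<le> C * (h^2 + dt^2)" .
      qed auto
    qed
  qed
qed

end
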